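(* Let $\mathcal{M}$ be a semifinite von Neumann algebra with faithful normal semifinite trace $\tau_{\mathcal{M}}$ and let $\psi$ be an Orlicz function. Given a closed densely defined operator $a$ affiliated with $\mathcal{M}$, we have $a\in L^\psi(\mathcal{M},\tau_{\mathcal{M}})$ if and only if $a\otimes\varphi_\psi(e^t)$ belongs to $\widetilde{\mathcal{A}}$. Moreover, for any $a\in L^\psi(\mathcal{M},\tau_{\mathcal{M}})$ the Luxemburg norm is given by $$\|a\|_\psi=\mu_1(a\otimes\varphi_\psi(e^t)).$$
   Context: An Orlicz function is a convex function $\psi:[0,\infty)\to[0,\infty]$ with $\psi(0)=0$, $\lim_{u\to\infty}\psi(u)=\infty$, neither identically zero nor infinite valued on all of $(0,\infty)$, and left continuous at $b_\psi=\sup\{u>0:\psi(u)<\infty\}$. Put $\psi^{-1}(t)=\sup\{s:\psi(s)\le t\}$. The fundamental function of $L^\psi(\mathbb{R})$ with the Luxemburg norm is $\varphi_\psi(t)=1/\psi^{-1}(1/t)$ for $t>0$, $\varphi_\psi(0)=0$. The space $L^\psi(\mathcal{M},\tau_{\mathcal{M}})$ consists of the $\tau_{\mathcal{M}}$-measurable operators $a$ affiliated with $\mathcal{M}$ whose generalised singular value function $\mu(a)$ belongs to the classical Orlicz space $L^\psi(0,\infty)$; equivalently, of those $a$ affiliated with $\mathcal{M}$ for which $\tau_{\mathcal{M}}(\psi(\alpha|a|))<\infty$ for some $\alpha>0$ ($\psi(\alpha|a|)$ being an element of the extended positive part of $\mathcal{M}$). Its Luxemburg norm is $\|a\|_\psi=\inf\{\lambda>0:\tau_{\mathcal{M}}(\psi(|a|/\lambda))\le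 1\}$. The crossed product $\mathcal{A}=\mathcal{M}\rtimes\mathbb{R}$ of $\mathcal{M}$ by the modular group of $\tau_{\mathcal{M}}$ is identified (via Fourier transform) with $\mathcal{M}\otimes L^\infty(\mathbb{R})$, with canonical trace $\tau_{\mathcal{A}}=\tau_{\mathcal{M}}\otimes\int_{\mathbb{R}}\cdot\,e^{-t}dt$. $\widetilde{\mathcal{A}}$ is the $*$-algebra of $\tau_{\mathcal{A}}$-measurable operators. $f(e^t)$ denotes multiplication by $t\mapsto f(e^t)$ on $\mathbb{R}$. For $x$ affiliated with $\mathcal{A}$, $\lambda_s(x)=\tau_{\mathcal{A}}(\chi_{(s,\infty)}(|x|))$ and $\mu_t(x)=\inf\{s\ge0:\lambda_s(x)\le t\}$. *)

theory Defs
  imports "HOL-Analysis.Analysis"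
begin

section \<open>Complex Hilbert spaces\<close>

class complex_vector = real_vector +
  fixes scaleC :: "complex \<Rightarrow> 'a \<Rightarrow> 'a" (infixr "*\<^sub>C" 75)
  assumes scaleC_add_right: "c *\<^sub>C (x + y) = c *\<^sub>C x + c *\<^sub>C y"
    and scaleC_add_left: "(c + d) *\<^sub>C x = c *\<^sub>C x + d *\<^sub>C x"
    and scaleC_scaleC: "c *\<^sub>C d *\<^sub>C x = (c * d) *\<^sub>C x"
    and scaleR_scaleC: "r *\<^sub>R x = complex_of_real r *\<^sub>C x"

instantiation prod :: (complex_vector, complex_vector) complex_vector
begin

definition scaleC_prod :: "complex \<Rightarrow> 'a \<times> 'b \<Rightarrow> 'a \<times> 'b" where
  "scaleC_prod c p = (c *\<^sub>C fst p, c *\<^sub>C snd p)"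

instance
  by standard (auto simp: scaleC_prod_def prod_eq_iff scaleC_add_right scaleC_add_left
      scaleC_scaleC scaleR_scaleC)

end

text \<open>The complex inner product is linear in the first variable.  Its real part is the real inner
  product of the library, so norm and topology are those of the complex inner product.\<close>

class chilbert_space = complex_vector + real_inner + complete_space +
  fixes cinner :: "'a \<Rightarrow> 'a \<Rightarrow> complex"
  assumes cinner_commute: "cinner x y = cnj (cinner y x)"
    and cinner_add_left: "cinner (x + y) z = cinner x z + cinner y z"
    and cinner_scaleC_left: "cinner (c *\<^sub>C x) y = c * cinner x y"
    and Re_cinner: "Re (cinner x y) = inner x y"

definition csubspace :: "'a::complex_vector set \<Rightarrow> bool" where
  "csubspace S \<longleftrightarrow> 0 \<in> S \<and> (\<forall>x\<in>S. \<forall>y\<in>S. x + y \<in> S) \<and> (\<forall>c. \<forall>x\<in>S. c *\<^sub>C x \<in> S)"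

definition cspan :: "'a::complex_vector set \<Rightarrow> 'a set" where
  "cspan S = csubspace hull S"


section \<open>Bounded operators and von Neumann algebras\<close>

type_synonym 'h bop = "'h \<Rightarrow>\<^sub>L 'h"

text \<open>The type above contains the bounded \<^emph>\<open>real\<close>-linear maps; \<open>B(H)\<close> is cut out by complex
  homogeneity.\<close>

definition bounded_ops :: "'h::chilbert_space bop set" where
  "bounded_ops = {x. \<forall>c \<xi>. blinfun_apply x (c *\<^sub>C \<xi>) = c *\<^sub>C blinfun_apply x \<xi>}"

definition star :: "'h::chilbert_space bop \<Rightarrow> 'h bop" where
  "star x = (THE y. \<forall>\<xi> \<eta>. cinner (blinfun_apply x \<xi>) \<eta> = cinner \<xi> (blinfun_apply y \<eta>))"

definition pos_op :: "'h::chilbert_space bop \<Rightarrow> bool" where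
  "pos_op x \<longleftrightarrow> x \<in> bounded_ops \<and> (\<forall>\<xi>. cinner (blinfun_apply x \<xi>) \<xi> \<in> \<real>\<^sub>\<ge>\<^sub>0)"

definition op_le :: "'h::chilbert_space bop \<Rightarrow> 'h bop \<Rightarrow> bool" where
  "op_le x y \<longleftrightarrow> pos_op (y - x)"

definition projection :: "'h::chilbert_space bop \<Rightarrow> bool" where
  "projection p \<longleftrightarrow> p \<in> bounded_ops \<and> p o\<^sub>L p = p \<and> star p = p"

definition unitary :: "'h::chilbert_space bop \<Rightarrow> bool" where
  "unitary u \<longleftrightarrow> u \<in> bounded_ops \<and> star u o\<^sub>L u = id_blinfun \<and> u o\<^sub>L star u = id_blinfun"

definition commutant :: "'h::chilbert_space bop set \<Rightarrow> 'h bop set" where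
  "commutant M = {y \<in> bounded_ops. \<forall>x\<in>M. x o\<^sub>L y = y o\<^sub>L x}"

definition von_neumann_algebra :: "'h::chilbert_space bop set \<Rightarrow> bool" where
  "von_neumann_algebra M \<longleftrightarrow>
     M \<subseteq> bounded_ops \<and> (\<forall>x\<in>M. star x \<in> M) \<and> commutant (commutant M) = M"

definition pos_cone :: "'h::chilbert_space bop set \<Rightarrow> 'h bop set" where
  "pos_cone M = {x \<in> M. pos_op x}"


section \<open>Normal weights and traces\<close>

text \<open>Weights are maps on the positive cone; values elsewhere are irrelevant.\<close>

definition weight :: "'h::chilbert_space bop set \<Rightarrow> ('h bop \<Rightarrow> ennreal) \<Rightarrow> bool" where
  "weight M \<omega> \<longleftrightarrow>
     (\<forall>x\<in>pos_cone M. \<forall>y\<in>pos_cone M. \<omega> (x + y) = \<omega> x + \<omega> y) \<and>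
     (\<forall>x\<in>pos_cone M. \<forall>r\<ge>0. \<omega> (r *\<^sub>R x) = ennreal r * \<omega> x)"

text \<open>Normality: the weight preserves least upper bounds of bounded upward directed sets.\<close>

definition normal :: "'h::chilbert_space bop set \<Rightarrow> ('h bop \<Rightarrow> ennreal) \<Rightarrow> bool" where
  "normal M \<omega> \<longleftrightarrow>
     (\<forall>D x. D \<subseteq> pos_cone M \<and> D \<noteq> {} \<and> (\<forall>y\<in>D. \<forall>z\<in>D. \<exists>w\<in>D. op_le y w \<and> op_le z w) \<and>
        x \<in> pos_cone M \<and> (\<forall>y\<in>D. op_le y x) \<and>
        (\<forall>z\<in>pos_cone M. (\<forall>y\<in>D. op_le y z) \<longrightarrow> op_le x z)
      \<longrightarrow> \<omega> x = (SUP y\<in>D. \<omega> y))"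

definition faithful :: "'h::chilbert_space bop set \<Rightarrow> ('h bop \<Rightarrow> ennreal) \<Rightarrow> bool" where
  "faithful M \<omega> \<longleftrightarrow> (\<forall>x\<in>pos_cone M. \<omega> x = 0 \<longrightarrow> x = 0)"

definition semifinite :: "'h::chilbert_space bop set \<Rightarrow> ('h bop \<Rightarrow> ennreal) \<Rightarrow> bool" where
  "semifinite M \<omega> \<longleftrightarrow>
     (\<forall>x\<in>pos_cone M. x \<noteq> 0 \<longrightarrow> (\<exists>y\<in>pos_cone M. y \<noteq> 0 \<and> op_le y x \<and> \<omega> y < \<infinity>))"

definition fns_trace :: "'h::chilbert_space bop set \<Rightarrow> ('h bop \<Rightarrow> ennreal) \<Rightarrow> bool" where
  "fns_trace M \<tau> \<longleftrightarrow> weight M \<tau> \<and> (\<forall>x\<in>M. \<tau> (star x o\<^sub>L x) = \<tau> (x o\<^sub>L star x)) \<and>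
     faithful M \<tau> \<and> normal M \<tau> \<and> semifinite M \<tau>"

text \<open>The positive normal functionals, each represented by its restriction to the positive cone.\<close>

definition predual_pos :: "'h::chilbert_space bop set \<Rightarrow> ('h bop \<Rightarrow> ennreal) set" where
  "predual_pos M = {\<omega>. weight M \<omega> \<and> normal M \<omega> \<and> (\<forall>x\<in>pos_cone M. \<omega> x < \<infinity>)}"


section \<open>Unbounded operators\<close>

text \<open>A (possibly unbounded) operator is identified with its graph.\<close>

type_synonym 'h uop = "('h \<times> 'h) set"

definition closed_densely_defined :: "'h::chilbert_space uop \<Rightarrow> bool" where
  "closed_densely_defined T \<longleftrightarrow>
     csubspace T \<and> single_valued T \<and> closed T \<and> closure (Domain T) = UNIV"

definition adj :: "'h::chilbert_space uop \<Rightarrow> 'h uop" where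
  "adj T = {(\<eta>, \<zeta>). \<forall>(\<xi>, \<theta>)\<in>T. cinner \<theta> \<eta> = cinner \<xi> \<zeta>}"

definition pos_selfadjoint :: "'h::chilbert_space uop \<Rightarrow> bool" where
  "pos_selfadjoint S \<longleftrightarrow>
     closed_densely_defined S \<and> adj S = S \<and> (\<forall>(\<xi>, \<eta>)\<in>S. cinner \<eta> \<xi> \<in> \<real>\<^sub>\<ge>\<^sub>0)"

text \<open>\<open>|T|\<close> is the positive square root of \<open>T\<^sup>*T\<close>; for graphs, \<open>r O s\<close> applies \<open>r\<close> first.\<close>

definition abs_op :: "'h::chilbert_space uop \<Rightarrow> 'h uop" where
  "abs_op T = (THE S. pos_selfadjoint S \<and> S O S = T O adj T)"

definition affiliated :: "'h::chilbert_space bop set \<Rightarrow> 'h uop \<Rightarrow> bool" where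
  "affiliated M T \<longleftrightarrow>
     (\<forall>u\<in>commutant M. unitary u \<longrightarrow>
        (\<forall>(\<xi>, \<eta>)\<in>T. (blinfun_apply u \<xi>, blinfun_apply u \<eta>) \<in> T))"


section \<open>Spectral measures\<close>

definition proj_valued_measure :: "(real set \<Rightarrow> 'h::chilbert_space bop) \<Rightarrow> bool" where
  "proj_valued_measure E \<longleftrightarrow>
     (\<forall>B\<in>sets borel. projection (E B)) \<and> E UNIV = id_blinfun \<and>
     (\<forall>A :: nat \<Rightarrow> real set. range A \<subseteq> sets borel \<longrightarrow> disjoint_family A \<longrightarrow>
        (\<forall>\<xi>. (\<lambda>n. blinfun_apply (E (A n)) \<xi>) sums blinfun_apply (E (\<Union>n. A n)) \<xi>))"

definition vector_measure :: "(real set \<Rightarrow> 'h::chilbert_space bop) \<Rightarrow> 'h \<Rightarrow> real measure" where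
  "vector_measure E \<xi> =
     measure_of UNIV (sets borel) (\<lambda>B. ennreal (Re (cinner (blinfun_apply (E B) \<xi>) \<xi>)))"

text \<open>\<open>S = \<integral> s dE(s)\<close>, in the weak sense.  By polarisation over the domain it is enough to
  prescribe the diagonal values \<open>\<langle>S \<xi>, \<xi>\<rangle>\<close>.\<close>

definition spectral_resolution ::
  "'h::chilbert_space uop \<Rightarrow> (real set \<Rightarrow> 'h bop) \<Rightarrow> bool" where
  "spectral_resolution S E \<longleftrightarrow>
     proj_valued_measure E \<and>
     Domain S = {\<xi>. (\<integral>\<^sup>+ s. ennreal (s\<^sup>2) \<partial>vector_measure E \<xi>) < \<infinity>} \<and>
     (\<forall>(\<xi>, \<eta>)\<in>S. cinner \<eta> \<xi> = complex_of_real (LINT s|vector_measure E \<xi>. s))"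

text \<open>For self-adjoint \<open>S\<close> this is unique on Borel sets, which are the only arguments used;
  \<open>spectral_measure S B\<close> is \<open>\<chi>\<^sub>B(S)\<close>.\<close>

definition spectral_measure :: "'h::chilbert_space uop \<Rightarrow> real set \<Rightarrow> 'h bop" where
  "spectral_measure S = (SOME E. spectral_resolution S E)"


section \<open>Measurable operators and generalised singular values\<close>

definition measurable_ops ::
  "'h::chilbert_space bop set \<Rightarrow> ('h bop \<Rightarrow> ennreal) \<Rightarrow> 'h uop set" where
  "measurable_ops M \<tau> = {T. closed_densely_defined T \<and> affiliated M T \<and>
     (\<forall>\<epsilon>>0. \<exists>p\<in>M. projection p \<and> range (blinfun_apply p) \<subseteq> Domain T \<and>
        \<tau> (id_blinfun - p) \<le> ennreal \<epsilon>)}"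

definition distribution_fun ::
  "('h::chilbert_space bop \<Rightarrow> ennreal) \<Rightarrow> 'h uop \<Rightarrow> real \<Rightarrow> ennreal" where
  "distribution_fun \<tau> T s = \<tau> (spectral_measure (abs_op T) {s<..})"

text \<open>With values in \<open>[0,\<infinity>]\<close>, the infimum of the empty set being \<open>\<infinity>\<close>.\<close>

definition sing_val :: "('h::chilbert_space bop \<Rightarrow> ennreal) \<Rightarrow> real \<Rightarrow> 'h uop \<Rightarrow> ennreal" where
  "sing_val \<tau> t T = Inf (ennreal ` {s. 0 \<le> s \<and> distribution_fun \<tau> T s \<le> ennreal t})"


section \<open>Orlicz functions\<close>

text \<open>Functions on \<open>[0,\<infinity>)\<close> are given on all reals; their values on negative arguments are
  irrelevant.  If \<open>b\<^sub>\<psi> = \<infinity>\<close>, left continuity at \<open>b\<^sub>\<psi>\<close> is subsumed in the limit at infinity.\<close>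

definition orlicz_function :: "(real \<Rightarrow> ennreal) \<Rightarrow> bool" where
  "orlicz_function \<psi> \<longleftrightarrow>
     (\<forall>u\<ge>0. \<forall>v\<ge>0. \<forall>r\<in>{0..1}.
        \<psi> ((1 - r) * u + r * v) \<le> ennreal (1 - r) * \<psi> u + ennreal r * \<psi> v) \<and>
     \<psi> 0 = 0 \<and> (\<psi> \<longlongrightarrow> \<infinity>) at_top \<and>
     (\<exists>u>0. \<psi> u \<noteq> 0) \<and> (\<exists>u>0. \<psi> u < \<infinity>) \<and>
     (bdd_above {u. 0 < u \<and> \<psi> u < \<infinity>} \<longrightarrow>
        (\<psi> \<longlongrightarrow> \<psi> (Sup {u. 0 < u \<and> \<psi> u < \<infinity>})) (at_left (Sup {u. 0 < u \<and> \<psi> u < \<infinity>})))"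

definition orlicz_inverse :: "(real \<Rightarrow> ennreal) \<Rightarrow> real \<Rightarrow> real" where
  "orlicz_inverse \<psi> t = Sup {s. 0 \<le> s \<and> \<psi> s \<le> ennreal t}"

definition fundamental_fun :: "(real \<Rightarrow> ennreal) \<Rightarrow> real \<Rightarrow> real" where
  "fundamental_fun \<psi> t = (if t > 0 then 1 / orlicz_inverse \<psi> (1 / t) else 0)"

definition classical_orlicz :: "(real \<Rightarrow> ennreal) \<Rightarrow> (real \<Rightarrow> real) set" where
  "classical_orlicz \<psi> = {f. f \<in> borel_measurable (restrict_space lborel {0<..}) \<and>
     (\<exists>\<alpha>>0. (\<integral>\<^sup>+ t\<in>{0<..}. \<psi> (\<alpha> * \<bar>f t\<bar>) \<partial>lborel) < \<infinity>)}"


section \<open>Noncommutative Orlicz spaces\<close>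

text \<open>\<open>enn2real\<close> loses nothing here: singular values of measurable operators are finite on
  \<open>(0,\<infinity>)\<close>.\<close>

definition orlicz_space ::
  "'h::chilbert_space bop set \<Rightarrow> ('h bop \<Rightarrow> ennreal) \<Rightarrow> (real \<Rightarrow> ennreal) \<Rightarrow> 'h uop set" where
  "orlicz_space M \<tau> \<psi> =
     {a \<in> measurable_ops M \<tau>. (\<lambda>t. enn2real (sing_val \<tau> t a)) \<in> classical_orlicz \<psi>}"

text \<open>Elements of the extended positive part of \<open>M\<close> are \<open>[0,\<infinity>]\<close>-valued maps on the positive
  normal functionals.  For positive self-adjoint \<open>S\<close> with spectral measure \<open>E\<close> and
  \<open>f : [0,\<infinity>) \<rightarrow> [0,\<infinity>]\<close>, the element \<open>f(S)\<close> is \<open>\<omega> \<mapsto> \<integral> f d(\<omega> \<circ> E)\<close>.\<close>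

definition ext_fun_calc ::
  "(real \<Rightarrow> ennreal) \<Rightarrow> 'h::chilbert_space uop \<Rightarrow> ('h bop \<Rightarrow> ennreal) \<Rightarrow> ennreal" where
  "ext_fun_calc f S \<omega> =
     (\<integral>\<^sup>+ s\<in>{0..}. f s \<partial>measure_of UNIV (sets borel) (\<lambda>B. \<omega> (spectral_measure S B)))"

text \<open>The extension of a normal weight to the extended positive part: every \<open>m\<close> there is the
  limit of an increasing sequence \<open>x\<^sub>n\<close> of bounded positive elements and \<open>\<tau>(m) = lim \<tau>(x\<^sub>n)\<close>,
  which is the supremum of \<open>\<tau>\<close> over all bounded positive \<open>x \<le> m\<close>.\<close>

definition ext_trace ::
  "'h::chilbert_space bop set \<Rightarrow> ('h bop \<Rightarrow> ennreal) \<Rightarrow> (('h bop \<Rightarrow> ennreal) \<Rightarrow> ennreal) \<Rightarrow> ennreal"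
  where
  "ext_trace M \<tau> m = (SUP x\<in>{x \<in> pos_cone M. \<forall>\<omega>\<in>predual_pos M. \<omega> x \<le> m \<omega>}. \<tau> x)"

definition luxemburg_norm ::
  "'h::chilbert_space bop set \<Rightarrow> ('h bop \<Rightarrow> ennreal) \<Rightarrow> (real \<Rightarrow> ennreal) \<Rightarrow> 'h uop \<Rightarrow> ennreal"
  where
  "luxemburg_norm M \<tau> \<psi> a =
     Inf (ennreal ` {l. 0 < l \<and> ext_trace M \<tau> (ext_fun_calc (\<lambda>s. \<psi> (s / l)) (abs_op a)) \<le> 1})"


section \<open>The algebra \<open>M \<otimes> L\<^sup>\<infinity>(\<real>)\<close>\<close>

definition square_integrable :: "(real \<Rightarrow> complex) set" where
  "square_integrable =
     {g. g \<in> borel_measurable lborel \<and> integrable lborel (\<lambda>t. (cmod (g t))\<^sup>2)}"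

text \<open>\<open>T \<xi> g\<close> is the elementary tensor of \<open>\<xi>\<close> with the class of \<open>g\<close>, and the target space is the
  Hilbert space tensor product of \<open>H\<close> and \<open>L\<^sup>2(\<real>)\<close>.  The two conditions determine the pair (target
  space, \<open>T\<close>) up to unique unitary equivalence; bilinearity of \<open>T\<close> and its invariance under
  changes of \<open>g\<close> on null sets follow from the first one.\<close>

definition tensor_with_L2 ::
  "('h::chilbert_space \<Rightarrow> (real \<Rightarrow> complex) \<Rightarrow> 'k::chilbert_space) \<Rightarrow> bool" where
  "tensor_with_L2 T \<longleftrightarrow>
     (\<forall>\<xi> \<eta>. \<forall>f\<in>square_integrable. \<forall>g\<in>square_integrable.
        cinner (T \<xi> f) (T \<eta> g) = cinner \<xi> \<eta> * (LINT t|lborel. f t * cnj (g t))) \<and>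
     closure (cspan {T \<xi> g | \<xi> g. g \<in> square_integrable}) = UNIV"

definition bounded_borel :: "(real \<Rightarrow> complex) set" where
  "bounded_borel = {f. f \<in> borel_measurable borel \<and> bounded (range f)}"

text \<open>The bounded operator \<open>x \<otimes> f\<close>, with \<open>f\<close> acting on \<open>L\<^sup>2(\<real>)\<close> by multiplication.\<close>

definition tensor_op ::
  "('h::chilbert_space \<Rightarrow> (real \<Rightarrow> complex) \<Rightarrow> 'k::chilbert_space) \<Rightarrow>
     'h bop \<Rightarrow> (real \<Rightarrow> complex) \<Rightarrow> 'k bop" where
  "tensor_op T x f = (THE X. X \<in> bounded_ops \<and>
     (\<forall>\<xi>. \<forall>g\<in>square_integrable.
        blinfun_apply X (T \<xi> g) = T (blinfun_apply x \<xi>) (\<lambda>t. f t * g t)))"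

definition tensor_Linf ::
  "('h::chilbert_space \<Rightarrow> (real \<Rightarrow> complex) \<Rightarrow> 'k::chilbert_space) \<Rightarrow> 'h bop set \<Rightarrow> 'k bop set" where
  "tensor_Linf T M = commutant (commutant {tensor_op T x f | x f. x \<in> M \<and> f \<in> bounded_borel})"

text \<open>The trace \<open>\<tau> \<otimes> \<integral> \<cdot> e\<^sup>-\<^sup>t dt\<close>: the unique faithful normal semifinite trace with the product
  values on elementary tensors of positive elements.\<close>

definition tensor_trace ::
  "('h::chilbert_space \<Rightarrow> (real \<Rightarrow> complex) \<Rightarrow> 'k::chilbert_space) \<Rightarrow> 'h bop set \<Rightarrow>
     ('h bop \<Rightarrow> ennreal) \<Rightarrow> ('k bop \<Rightarrow> ennreal) \<Rightarrow> bool" where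
  "tensor_trace T M \<tau> \<tau>' \<longleftrightarrow>
     fns_trace (tensor_Linf T M) \<tau>' \<and>
     (\<forall>x\<in>pos_cone M. \<forall>f :: real \<Rightarrow> real.
        (\<lambda>t. complex_of_real (f t)) \<in> bounded_borel \<and> (\<forall>t. 0 \<le> f t) \<longrightarrow>
        \<tau>' (tensor_op T x (\<lambda>t. complex_of_real (f t))) =
          \<tau> x * (\<integral>\<^sup>+ t. ennreal (f t * exp (- t)) \<partial>lborel))"

text \<open>\<open>a \<otimes> h\<close> for an unbounded operator \<open>a\<close> and multiplication by a function \<open>h\<close> on its maximal
  domain: the closure of the algebraic tensor product of the two operators.\<close>

definition tensor_uop ::
  "('h::chilbert_space \<Rightarrow> (real \<Rightarrow> complex) \<Rightarrow> 'k::chilbert_space) \<Rightarrow>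
     'h uop \<Rightarrow> (real \<Rightarrow> real) \<Rightarrow> 'k uop" where
  "tensor_uop T a h = closure (cspan {(T \<xi> g, T \<eta> (\<lambda>t. complex_of_real (h t) * g t)) | \<xi> \<eta> g.
     (\<xi>, \<eta>) \<in> a \<and> g \<in> square_integrable \<and> (\<lambda>t. complex_of_real (h t) * g t) \<in> square_integrable})"

end

theory Submission
  imports Defs
begin

text \<open>Write \<open>h(t) = \<phi>\<^sub>\<psi>(e\<^sup>t)\<close>, \<open>W = a \<otimes> h\<close> and \<open>d\<^sub>a(x) = \<tau>(\<chi>\<^bsub>(x,\<infinity>)\<^esub>(|a|))\<close>.  Cutting the line into the sets
  where \<open>h\<close> is constant up to a factor \<open>q\<close> and comparing the spectral projections of \<open>|W|\<close> with
  sums of elementary tensors \<open>\<chi>\<^bsub>(x,\<infinity>)\<^esub>(|a|) \<otimes> \<chi>\<^sub>I\<close> gives, as \<open>q \<rightarrow> 1\<close>,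
  \<open>\<lambda>\<^sub>s(W) = \<integral> d\<^sub>a(s/h(t)) e\<^sup>-\<^sup>t dt\<close>.  Since \<open>x > s/h(t)\<close> means \<open>\<psi>(x/s) > e\<^sup>-\<^sup>t\<close>, the layer cake formula turns
  this into \<open>\<lambda>\<^sub>s(W) = \<tau>(\<psi>(|a|/s))\<close> for all \<open>s > 0\<close>.  The norm formula is the case \<open>\<lambda>\<^sub>s(W) \<le> 1\<close>, and both membership
  conditions say that \<open>\<tau>(\<psi>(|a|/s))\<close> is finite for some \<open>s\<close>, because convexity then makes it tend to \<open>0\<close>
  as \<open>s \<rightarrow> \<infinity>\<close>.

  The spectral theory of \<open>|a|\<close> uses only the real Hilbert space structure: it is read off the
  bounded operator \<open>(1 + a\<^sup>*a)\<^sup>-\<^sup>1\<close>, a corner of the projection onto the graph.  Complex linearity is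
  commutation with the multiplication by complex scalars.\<close>

text \<open>The definitions pick |a| by \<open>THE\<close> and its spectral measure by
  \<open>SOME\<close>, so besides existence the uniqueness of both has to be proved, the latter for
  an arbitrary E of which only the domain and the diagonal values are known. No joint functional
  calculus of |a| and h is set up. The spectral projections of |W| are only compared with
  rectangles: a rectangle on which |a| h > s lies below the projection of |W| for (s,\<infinity>),
  one on which |a| h < s is annihilated by it, and the trace property turns annihilation into an
  upper bound. Both comparisons need a strict gap, which the right continuity of the two
  distribution functions absorbs. The trace of \<psi>(|a|/s) is a supremum over bounded x that are
  dominated only as quadratic forms. Such x are compressed by spectral projections p on which \<psi>
  is bounded, and the trace property exchanges p x p for sqrt(x) p sqrt(x), which increases with p.
  The identities hold in [0,\<infinity>], so they are available before either membership condition
  is known.\<close>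

instance chilbert_space \<subseteq> banach ..

section \<open>Real Hilbert spaces\<close>

text \<open>A minimising sequence for the distance is Cauchy by the parallelogram law
  (\<open>key\<close>), and minimality along the lines p + t z forces x - p to be orthogonal to
  S.\<close>

lemma closed_subspace_proj_exists:
  fixes S :: "'a::{real_inner,banach} set"
  assumes "closed S" "subspace S"
  shows "\<exists>p\<in>S. \<forall>y\<in>S. (x - p) \<bullet> y = 0"
proof -
  have ne: "S \<noteq> {}" using assms(2) subspace_0 by blast
  define d where "d = infdist x S"
  have d0: "d \<ge> 0" by (simp add: d_def infdist_nonneg)
  have dle: "d \<le> norm (x - y)" if "y \<in> S" for y
    using infdist_le[OF that, of x] by (simp add: d_def dist_norm)
  have "\<exists>y\<in>S. norm (x - y) < d + 1 / real (Suc n)" for n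
  proof (rule ccontr)
    assume "\<not> ?thesis"
    then have "\<And>y. y \<in> S \<Longrightarrow> d + 1 / real (Suc n) \<le> dist x y" by (force simp: dist_norm not_less)
    then have "d + 1 / real (Suc n) \<le> (INF y\<in>S. dist x y)" by (intro cINF_greatest[OF ne])
    then have "d + 1 / real (Suc n) \<le> d" using ne by (simp add: d_def infdist_def)
    then show False by (simp add: field_simps)
  qed
  then obtain y where yS: "\<And>n. y n \<in> S" and yn: "\<And>n. norm (x - y n) < d + 1 / real (Suc n)" by metis
  have key: "(norm (y n - y m))\<^sup>2 \<le> 2 * ((norm (x - y n))\<^sup>2 - d\<^sup>2) + 2 * ((norm (x - y m))\<^sup>2 - d\<^sup>2)" for n m
  proof -
    have mid: "(1/2) *\<^sub>R (y n + y m) \<in> S" using yS assms(2) by (simp add: subspace_add subspace_scale)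
    have "d\<^sup>2 \<le> (norm (x - (1/2) *\<^sub>R (y n + y m)))\<^sup>2" using dle[OF mid] d0 by (rule power_mono)
    also have "\<dots> = (2 * (norm (x - y n))\<^sup>2 + 2 * (norm (x - y m))\<^sup>2 - (norm (y n - y m))\<^sup>2) / 4"
      unfolding power2_norm_eq_inner by (simp add: inner_diff inner_add inner_commute field_simps)
    finally show ?thesis by simp
  qed
  have lim: "(\<lambda>n. norm (x - y n)) \<longlonglongrightarrow> d"
  proof (rule real_tendsto_sandwich)
    show "\<forall>\<^sub>F n in sequentially. d \<le> norm (x - y n)" using dle yS by simp
    show "\<forall>\<^sub>F n in sequentially. norm (x - y n) \<le> d + 1 / real (Suc n)" using yn by (simp add: less_imp_le)
    show "(\<lambda>n. d + 1 / real (Suc n)) \<longlonglongrightarrow> d" using tendsto_add[OF tendsto_const LIMSEQ_Suc[OF lim_1_over_n]] by auto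
  qed simp
  have lim2: "(\<lambda>n. (norm (x - y n))\<^sup>2 - d\<^sup>2) \<longlonglongrightarrow> 0"
    using tendsto_diff[OF tendsto_power[OF lim, of 2] tendsto_const[of "d\<^sup>2"]] by simp
  have "Cauchy y"
  proof (rule metric_CauchyI)
    fix e :: real assume "e > 0"
    then have "e\<^sup>2 / 4 > 0" by simp
    from order_tendstoD(2)[OF lim2 this] obtain N where N: "\<And>n. n \<ge> N \<Longrightarrow> (norm (x - y n))\<^sup>2 - d\<^sup>2 < e\<^sup>2 / 4"
      by (auto simp: eventually_sequentially)
    show "\<exists>M. \<forall>m\<ge>M. \<forall>n\<ge>M. dist (y m) (y n) < e"
    proof (intro exI allI impI)
      fix m n assume "N \<le> m" "N \<le> n"
      then have "(norm (y m - y n))\<^sup>2 < e\<^sup>2" using key[of m n] N[of m] N[of n] by simp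
      then show "dist (y m) (y n) < e" using \<open>e > 0\<close> by (simp add: dist_norm power2_less_imp_less)
    qed
  qed
  then obtain p where p: "y \<longlonglongrightarrow> p" by (meson Cauchy_convergent convergentD)
  have pS: "p \<in> S" using closed_sequentially[OF assms(1)] yS p by blast
  have nd: "norm (x - p) = d"
    using LIMSEQ_unique[OF tendsto_norm[OF tendsto_diff[OF tendsto_const p]] lim] .
  have "(x - p) \<bullet> z = 0" if z: "z \<in> S" for z
  proof (rule ccontr)
    assume nz: "(x - p) \<bullet> z \<noteq> 0"
    then have z0: "z \<bullet> z > 0" by (metis inner_gt_zero_iff inner_zero_right)
    \<comment> \<open>The minimiser of the quadratic t -> |x - p - t z|^2.\<close>
    define t where "t = ((x - p) \<bullet> z) / (z \<bullet> z)"
    have "p + t *\<^sub>R z \<in> S" using pS z assms(2) by (simp add: subspace_add subspace_scale)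
    then have "(norm (x - p))\<^sup>2 \<le> (norm (x - (p + t *\<^sub>R z)))\<^sup>2" using dle[of "p + t *\<^sub>R z"] nd d0 by (intro power_mono) auto
    also have "\<dots> = (norm ((x - p) - t *\<^sub>R z))\<^sup>2" by (simp add: algebra_simps)
    also have "\<dots> = (norm (x - p))\<^sup>2 - 2 * t * ((x - p) \<bullet> z) + t * t * (z \<bullet> z)"
      unfolding power2_norm_eq_inner by (simp add: inner_diff_left inner_diff_right inner_commute algebra_simps)
    also have "\<dots> = (norm (x - p))\<^sup>2 - ((x - p) \<bullet> z)\<^sup>2 / (z \<bullet> z)"
      using z0 by (simp add: t_def power2_eq_square field_simps)
    finally show False using nz z0 by (simp add: divide_le_0_iff)
  qed
  with pS show ?thesis by blast
qed

lemma blinfun_exists: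
  assumes "\<And>x y. f (x + y) = f x + f y" "\<And>r x. f (r *\<^sub>R x) = r *\<^sub>R f x" "\<And>x. norm (f x) \<le> norm x * K"
  shows "\<exists>F. blinfun_apply F = f"
  using bounded_linear_Blinfun_apply[OF bounded_linear_intro[OF assms]] by blast

text \<open>The component of a vector outside the kernel that is orthogonal to the kernel spans the
  orthogonal complement; the representing vector is a multiple of it.\<close>

lemma riesz_exists:
  fixes f :: "'a::{real_inner,banach} \<Rightarrow> real"
  assumes "bounded_linear f"
  shows "\<exists>z. \<forall>x. f x = x \<bullet> z"
proof (cases "\<forall>x. f x = 0")
  case True then show ?thesis by (intro exI[of _ 0]) simp
next
  case False
  then obtain x where x: "f x \<noteq> 0" by blast
  interpret f: bounded_linear f by fact
  let ?S = "{x. f x = 0}"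
  have "closed ?S" by (intro closed_Collect_eq continuous_intros f.continuous_on)
  moreover have "subspace ?S" by (auto simp: subspace_def f.add f.scaleR f.zero)
  ultimately obtain p where p: "f p = 0" "\<And>y. f y = 0 \<Longrightarrow> (x - p) \<bullet> y = 0"
    using closed_subspace_proj_exists[of ?S x] by blast
  let ?w = "x - p"
  have fw: "f ?w = f x" by (simp add: f.diff p)
  then have w0: "?w \<bullet> ?w \<noteq> 0" using x f.zero by (metis inner_eq_zero_iff)
  have "f y = y \<bullet> ((f x / (?w \<bullet> ?w)) *\<^sub>R ?w)" for y
  proof -
    have "f (y - (f y / f x) *\<^sub>R ?w) = 0" using x by (simp add: f.diff f.scaleR p(1))
    from p(2)[OF this] have "?w \<bullet> y = (f y / f x) * (?w \<bullet> ?w)" by (simp add: inner_diff_right)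
    then show ?thesis using x w0 by (simp add: inner_commute)
  qed
  then show ?thesis by blast
qed

text \<open>Riesz in the second variable. Adjoints (\<open>radj\<close>) and weak operator limits
  are obtained from it.\<close>

lemma form_operator_exists:
  fixes b :: "'a::{real_inner,banach} \<Rightarrow> 'b::{real_inner,banach} \<Rightarrow> real"
  assumes "\<And>x y z. b (x + y) z = b x z + b y z" "\<And>r x y. b (r *\<^sub>R x) y = r * b x y"
    and "\<And>x y z. b x (y + z) = b x y + b x z" "\<And>r x y. b x (r *\<^sub>R y) = r * b x y"
    and "\<And>x y. \<bar>b x y\<bar> \<le> C * norm x * norm y" and "C \<ge> 0"
  shows "\<exists>X::'a \<Rightarrow>\<^sub>L 'b. \<forall>x y. b x y = X x \<bullet> y"
proof -
  have "\<exists>z. \<forall>y. b x y = y \<bullet> z" for x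
    by (rule riesz_exists, rule bounded_linear_intro[where K = "C * norm x"])
       (use assms in \<open>auto simp: mult_ac\<close>)
  then obtain X where X: "\<And>x y. b x y = y \<bullet> X x" by metis
  have "\<exists>F. blinfun_apply F = X"
  proof (rule blinfun_exists[where K = C])
    show "X (x + y) = X x + X y" for x y
      by (rule vector_eq_rdot[THEN iffD1]) (metis X assms(1) inner_add_left inner_commute)
    show "X (r *\<^sub>R x) = r *\<^sub>R X x" for r x
      by (rule vector_eq_rdot[THEN iffD1]) (metis X assms(2) inner_scaleR_left inner_commute)
    show "norm (X x) \<le> norm x * C" for x
    proof (cases "X x = 0")
      case True
      then show ?thesis using \<open>C \<ge> 0\<close> by simp
    next
      case False
      have "norm (X x) * norm (X x) \<le> C * norm x * norm (X x)"
        using assms(5)[of x "X x"] by (simp add: X power2_norm_eq_inner[symmetric] power2_eq_square)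
      then show ?thesis using False by (simp add: mult.commute)
    qed
  qed
  then show ?thesis by (metis X inner_commute)
qed

lemma subspace_closure:
  fixes S :: "'a::real_normed_vector set"
  assumes "subspace S"
  shows "subspace (closure S)"
  unfolding subspace_def
proof (intro conjI ballI allI)
  show "0 \<in> closure S" using assms subspace_0 closure_subset by blast
  fix x assume "x \<in> closure S"
  then obtain f where f: "\<And>n. f n \<in> S" "f \<longlonglongrightarrow> x" by (auto simp: closure_sequential)
  show "c *\<^sub>R x \<in> closure S" for c
    unfolding closure_sequential using f assms
    by (intro exI[of _ "\<lambda>n. c *\<^sub>R f n"]) (auto intro: tendsto_intros subspace_scale)
  fix y assume "y \<in> closure S"
  then obtain g where g: "\<And>n. g n \<in> S" "g \<longlonglongrightarrow> y" by (auto simp: closure_sequential)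
  show "x + y \<in> closure S"
    unfolding closure_sequential using f g assms
    by (intro exI[of _ "\<lambda>n. f n + g n"]) (auto intro: tendsto_intros subspace_add)
qed

text \<open>The main tool for building operators from bounded relations: extend to the closure of
  the domain by continuity, then precompose with the orthogonal projection onto that closure. The
  last two conclusions record the resulting kernel and range.\<close>

lemma bounded_extension:
  fixes G :: "('a::{real_inner,banach} \<times> 'b::{real_inner,banach}) set"
  assumes G: "subspace G" and le: "\<And>x y. (x, y) \<in> G \<Longrightarrow> norm y \<le> c * norm x" and c: "c \<ge> 0"
  shows "\<exists>U::'a \<Rightarrow>\<^sub>L 'b. (\<forall>(x, y)\<in>G. U x = y) \<and> (\<forall>x. norm (U x) \<le> c * norm x) \<and>
           (\<forall>x. (\<forall>(y, z)\<in>G. x \<bullet> y = 0) \<longrightarrow> U x = 0) \<and> (\<forall>x. U x \<in> closure (snd ` G))"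
proof -
  let ?G = "closure G"
  have sG: "subspace ?G" using G by (rule subspace_closure)
  have le': "norm y \<le> c * norm x" if "(x, y) \<in> ?G" for x y
  proof -
    have "closed {p::'a \<times> 'b. norm (snd p) \<le> c * norm (fst p)}" by (intro closed_Collect_le continuous_intros)
    moreover have "G \<subseteq> {p. norm (snd p) \<le> c * norm (fst p)}" using le by auto
    ultimately have "?G \<subseteq> {p. norm (snd p) \<le> c * norm (fst p)}" by (rule closure_minimal[rotated])
    then show ?thesis using that by auto
  qed
  let ?D = "fst ` ?G"
  have sD: "subspace ?D" by (rule linear_subspace_image[OF _ sG]) (simp add: linear_fst)
  have uniq: "y = z" if "(x, y) \<in> ?G" "(x, z) \<in> ?G" for x y z
    using le'[of 0 "y - z"] subspace_diff[OF sG that] by simp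
  \<comment> \<open>The bound makes the second components Cauchy whenever the first ones are, and
    the closed graph contains the limit pair.\<close>
  have "closed ?D"
    unfolding closed_sequential_limits
  proof (intro allI impI, elim conjE)
    fix u l assume u: "\<forall>n. u n \<in> ?D" and l: "u \<longlonglongrightarrow> l"
    then have "\<forall>n. \<exists>z. (u n, z) \<in> ?G" by force
    then obtain v where v: "\<And>n. (u n, v n) \<in> ?G" by metis
    have "Cauchy v"
    proof (rule metric_CauchyI)
      fix e :: real assume "e > 0"
      then have "e / (c + 1) > 0" using c by simp
      from metric_CauchyD[OF LIMSEQ_imp_Cauchy[OF l] this]
      obtain M where M: "\<And>m n. m \<ge> M \<Longrightarrow> n \<ge> M \<Longrightarrow> dist (u m) (u n) < e / (c + 1)"
        by blast
      show "\<exists>M. \<forall>m\<ge>M. \<forall>n\<ge>M. dist (v m) (v n) < e"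
      proof (intro exI allI impI)
        fix m n assume mn: "M \<le> m" "M \<le> n"
        have "norm (v m - v n) \<le> c * norm (u m - u n)"
          using le' subspace_diff[OF sG v[of m] v[of n]] by simp
        also have "\<dots> \<le> c * (e / (c + 1))" using M[OF mn] c by (intro mult_left_mono) (auto simp: dist_norm)
        also have "\<dots> < e" using \<open>e > 0\<close> c by (simp add: field_simps)
        finally show "dist (v m) (v n) < e" by (simp add: dist_norm)
      qed
    qed
    then obtain w where "v \<longlonglongrightarrow> w" by (meson Cauchy_convergent convergentD)
    with l have "(\<lambda>n. (u n, v n)) \<longlonglongrightarrow> (l, w)" by (rule tendsto_Pair)
    then have "(l, w) \<in> ?G" by (rule closed_sequentially[OF closed_closure, rotated]) (rule v)
    then show "l \<in> ?D" by force
  qed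
  from closed_subspace_proj_exists[OF this sD]
  have "\<exists>p. p \<in> ?D \<and> (\<forall>y\<in>?D. (x - p) \<bullet> y = 0)" for x by blast
  then obtain p where p: "\<And>x. p x \<in> ?D" "\<And>x y. y \<in> ?D \<Longrightarrow> (x - p x) \<bullet> y = 0" by metis
  have pu: "p x = q" if "q \<in> ?D" "\<And>y. y \<in> ?D \<Longrightarrow> (x - q) \<bullet> y = 0" for x q
  proof -
    have d: "p x - q \<in> ?D" using p(1) that(1) sD by (rule subspace_diff[rotated])
    have "(p x - q) \<bullet> (p x - q) = (x - q) \<bullet> (p x - q) - (x - p x) \<bullet> (p x - q)"
      by (simp add: inner_diff_left)
    also have "\<dots> = 0" using that(2)[OF d] p(2)[OF d] by simp
    finally show ?thesis by simp
  qed
  have "\<forall>x. \<exists>z. (p x, z) \<in> ?G" using p(1) by force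
  then obtain V where V: "\<And>x. (p x, V x) \<in> ?G" by metis
  have np: "norm (p x) \<le> norm x" for x
  proof -
    have "norm (p x) ^ 2 = x \<bullet> p x" using p(2)[OF p(1), of x x] by (simp add: inner_diff_left power2_norm_eq_inner)
    also have "\<dots> \<le> norm x * norm (p x)" by (rule norm_cauchy_schwarz)
    finally show ?thesis by (cases "p x = 0") (auto simp: power2_eq_square)
  qed
  have nV: "norm (V x) \<le> c * norm x" for x
    using le'[OF V, of x] mult_left_mono[OF np c, of x] by linarith
  have pa: "p (x + y) = p x + p y" for x y
  proof (rule pu)
    show "p x + p y \<in> ?D" using p(1) sD by (simp add: subspace_add)
    fix z assume z: "z \<in> ?D"
    have "(x + y - (p x + p y)) \<bullet> z = (x - p x) \<bullet> z + (y - p y) \<bullet> z"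
      by (simp add: inner_diff_left inner_add_left)
    then show "(x + y - (p x + p y)) \<bullet> z = 0" using p(2)[OF z] by simp
  qed
  have ps: "p (r *\<^sub>R x) = r *\<^sub>R p x" for r x
  proof (rule pu)
    show "r *\<^sub>R p x \<in> ?D" using p(1) sD by (simp add: subspace_scale)
    fix z assume z: "z \<in> ?D"
    show "(r *\<^sub>R x - r *\<^sub>R p x) \<bullet> z = 0" using p(2)[OF z, of x] by (simp flip: scaleR_diff_right)
  qed
  have "\<exists>U. blinfun_apply U = V"
  proof (rule blinfun_exists[where K = c])
    show "V (x + y) = V x + V y" for x y
      using uniq[OF V[of "x + y"], of "V x + V y"] subspace_add[OF sG V[of x] V[of y]] pa by simp
    show "V (r *\<^sub>R x) = r *\<^sub>R V x" for r x
      using uniq[OF V[of "r *\<^sub>R x"], of "r *\<^sub>R V x"] subspace_scale[OF sG V[of x], of r] ps by simp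
  qed (use nV in \<open>simp add: mult.commute\<close>)
  then obtain U where U: "blinfun_apply U = V" by blast
  have "V x = y" if "(x, y) \<in> G" for x y
  proof -
    have *: "(x, y) \<in> ?G" using that closure_subset by blast
    then have "x \<in> ?D" by force
    then have "p x = x" by (intro pu) auto
    then show ?thesis using uniq[OF _ *] V[of x] by simp
  qed
  moreover have "V x = 0" if x: "\<forall>(y, z)\<in>G. x \<bullet> y = 0" for x
  proof -
    have "closed {q::'a \<times> 'b. x \<bullet> fst q = 0}" by (intro closed_Collect_eq continuous_intros)
    moreover have "G \<subseteq> {q. x \<bullet> fst q = 0}" using x by auto
    ultimately have "?G \<subseteq> {q. x \<bullet> fst q = 0}" by (rule closure_minimal[rotated])
    then have "p x = 0" using subspace_0[OF sD] by (intro pu) auto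
    then show ?thesis using le'[OF V, of x] by simp
  qed
  moreover have "V x \<in> closure (snd ` G)" for x
  proof -
    have "snd ` closure G \<subseteq> closure (snd ` G)"
      by (rule image_closure_subset[where S=G]) (auto intro!: continuous_intros closure_subset[THEN subsetD])
    then show ?thesis using V[of x] by force
  qed
  ultimately show ?thesis using nV U by (intro exI[of _ U]) auto
qed

section \<open>Self-adjoint and positive bounded operators\<close>

definition commute :: "('a::real_normed_vector \<Rightarrow>\<^sub>L 'a) \<Rightarrow> ('a \<Rightarrow>\<^sub>L 'a) \<Rightarrow> bool" where
  "commute X Y \<longleftrightarrow> X o\<^sub>L Y = Y o\<^sub>L X"

definition self_adj :: "('a::real_inner \<Rightarrow>\<^sub>L 'a) \<Rightarrow> bool" where
  "self_adj X \<longleftrightarrow> (\<forall>x y. X x \<bullet> y = x \<bullet> X y)"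

text \<open>Symmetry is part of the definition because on a real Hilbert space a nonnegative
  quadratic form does not imply it.\<close>

definition psd :: "('a::real_inner \<Rightarrow>\<^sub>L 'a) \<Rightarrow> bool" where
  "psd X \<longleftrightarrow> self_adj X \<and> (\<forall>x. 0 \<le> X x \<bullet> x)"

definition ortho_proj :: "('a::real_inner \<Rightarrow>\<^sub>L 'a) \<Rightarrow> bool" where
  "ortho_proj P \<longleftrightarrow> self_adj P \<and> (\<forall>x. P (P x) = P x)"

text \<open>The adjoint for the real inner products. It relates two possibly different spaces since
  the parametrisation of a graph maps H into H x H; on complex linear operators it is
  \<open>star\<close> (\<open>star_eq_radj\<close>).\<close>

definition radj :: "('a::real_inner \<Rightarrow>\<^sub>L 'b::real_inner) \<Rightarrow> ('b \<Rightarrow>\<^sub>L 'a)" where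
  "radj X = (SOME Y :: 'b \<Rightarrow>\<^sub>L 'a. \<forall>x y. X x \<bullet> y = x \<bullet> Y y)"

lemma commute_iff: "commute X Y \<longleftrightarrow> (\<forall>x. X (Y x) = Y (X x))"
  unfolding commute_def by (metis blinfun_apply_blinfun_compose blinfun_eqI)

lemma commuteD: "commute X Y \<Longrightarrow> X (Y x) = Y (X x)"
  by (simp add: commute_iff)

lemma commute_sym: "commute X Y \<Longrightarrow> commute Y X"
  by (simp add: commute_def)

lemma self_adjD: "self_adj X \<Longrightarrow> X x \<bullet> y = x \<bullet> X y"
  by (simp add: self_adj_def)

lemma radj: 
  fixes X :: "'a::{real_inner,banach} \<Rightarrow>\<^sub>L 'b::{real_inner,banach}"
  shows "X x \<bullet> y = x \<bullet> radj X y"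
proof -
  have "\<exists>Y::'b \<Rightarrow>\<^sub>L 'a. \<forall>x y. x \<bullet> X y = Y x \<bullet> y"
  proof (rule form_operator_exists[where C = "norm X"])
    show "\<bar>x \<bullet> X y\<bar> \<le> norm X * norm x * norm y" for x y
      by (rule order_trans[OF Cauchy_Schwarz_ineq2])
         (metis norm_blinfun mult.commute mult.left_commute mult_left_mono norm_ge_zero)
  qed (auto simp: inner_add_left inner_add_right blinfun.add_right blinfun.scaleR_right)
  then have "\<exists>Y::'b \<Rightarrow>\<^sub>L 'a. \<forall>x y. X x \<bullet> y = x \<bullet> Y y" by (metis inner_commute)
  then show ?thesis unfolding radj_def by (rule someI2_ex) blast
qed

lemma ortho_projD:
  assumes "ortho_proj P"
  shows "P (P x) = P x" "P x \<bullet> y = x \<bullet> P y" "P x \<bullet> x = norm (P x) ^ 2" "norm (P x) \<le> norm x"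
    "(x - P x) \<bullet> P y = 0" "norm x ^ 2 = norm (P x) ^ 2 + norm (x - P x) ^ 2"
proof -
  show 1: "P (P x) = P x" "P x \<bullet> y = x \<bullet> P y" for x y using assms by (auto simp: ortho_proj_def self_adj_def)
  then show "P x \<bullet> x = norm (P x) ^ 2" by (metis inner_commute power2_norm_eq_inner)
  show 2: "(x - P x) \<bullet> P y = 0" for x y using 1 by (simp add: inner_diff_left)
  have "norm x ^ 2 = norm (P x + (x - P x)) ^ 2" by simp
  also have "\<dots> = norm (P x) ^ 2 + norm (x - P x) ^ 2"
    unfolding power2_norm_eq_inner using 2[of x x] by (simp only: inner_add_left inner_add_right) (simp add: inner_commute)
  finally show 3: "norm x ^ 2 = norm (P x) ^ 2 + norm (x - P x) ^ 2" .
  then have "norm (P x) ^ 2 \<le> norm x ^ 2" by simp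
  then show "norm (P x) \<le> norm x" by (rule power2_le_imp_le) simp
qed

lemma psd_ortho_proj: "ortho_proj P \<Longrightarrow> psd P"
  using ortho_projD(3)[of P] by (auto simp: psd_def ortho_proj_def)

lemma ortho_proj_exists:
  fixes S :: "'a::{real_inner,banach} set"
  assumes "closed S" "subspace S"
  shows "\<exists>P. ortho_proj P \<and> (\<forall>x. P x = x \<longleftrightarrow> x \<in> S) \<and> (\<forall>x. P x \<in> S)"
proof -
  let ?G = "(\<lambda>x. (x, x)) ` S"
  have "subspace ?G" by (rule linear_subspace_image[OF _ assms(2)]) (simp add: linear_iff)
  moreover have "norm y \<le> 1 * norm x" if "(x, y) \<in> ?G" for x y using that by auto
  ultimately obtain U :: "'a \<Rightarrow>\<^sub>L 'a" where U: "\<forall>(x, y)\<in>?G. U x = y"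
    "\<forall>x. (\<forall>(y, z)\<in>?G. x \<bullet> y = 0) \<longrightarrow> U x = 0" "\<forall>x. U x \<in> closure (snd ` ?G)"
    using bounded_extension[of ?G 1] by auto
  have cl: "closure (snd ` ?G) = S" using assms(1) by (simp add: image_image)
  have US: "U x \<in> S" for x using U(3) cl by blast
  have Ux: "x \<in> S \<Longrightarrow> U x = x" for x using U(1) by auto
  have orth: "(x - U x) \<bullet> y = 0" if "y \<in> S" for x y
  proof -
    obtain p where p: "p \<in> S" "\<And>y. y \<in> S \<Longrightarrow> (x - p) \<bullet> y = 0" using closed_subspace_proj_exists[OF assms] by blast
    then have "U (x - p) = 0" using U(2) by auto
    then have "U x = p" using Ux[OF p(1)] by (simp add: blinfun.diff_right)
    then show ?thesis using p that by simp
  qed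
  have "U x \<bullet> y = x \<bullet> U y" for x y
    using orth[OF US, of x y] orth[OF US, of y x] by (simp add: inner_diff_left inner_diff_right inner_commute)
  then have "ortho_proj U" using Ux US by (auto simp: ortho_proj_def self_adj_def)
  moreover have "U x = x \<longleftrightarrow> x \<in> S" for x using Ux US by metis
  ultimately show ?thesis using US by blast
qed

lemma psdD: "psd X \<Longrightarrow> 0 \<le> X x \<bullet> x" "psd X \<Longrightarrow> X x \<bullet> y = x \<bullet> X y"
  by (auto simp: psd_def self_adj_def)

text \<open>The polynomial t -> <X(x + t y), x + t y> is nonnegative, so its discriminant is not
  positive; if its leading coefficient vanishes, it is affine and must be constant.\<close>

lemma psd_cauchy_schwarz:
  assumes "psd X"
  shows "(X x \<bullet> y)\<^sup>2 \<le> (X x \<bullet> x) * (X y \<bullet> y)"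
proof -
  have q: "0 \<le> X x \<bullet> x + 2 * t * (X x \<bullet> y) + t\<^sup>2 * (X y \<bullet> y)" for t
  proof -
    have "0 \<le> X (x + t *\<^sub>R y) \<bullet> (x + t *\<^sub>R y)" using assms psdD by blast
    also have "\<dots> = X x \<bullet> x + 2 * t * (X x \<bullet> y) + t\<^sup>2 * (X y \<bullet> y)"
      using psdD(2)[OF assms, of y x]
      by (simp add: blinfun.add_right blinfun.scaleR_right inner_add_left inner_add_right power2_eq_square
          algebra_simps inner_commute)
    finally show ?thesis .
  qed
  show ?thesis
  proof (cases "X y \<bullet> y = 0")
    case True
    have "X x \<bullet> y = 0"
    proof (rule ccontr)
      assume n: "X x \<bullet> y \<noteq> 0"
      \<comment> \<open>This t would give the affine function the value -1.\<close>
      have "0 \<le> X x \<bullet> x + 2 * (- (X x \<bullet> x + 1) / (2 * (X x \<bullet> y))) * (X x \<bullet> y)"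
        using q[of "- (X x \<bullet> x + 1) / (2 * (X x \<bullet> y))"] True by simp
      also have "\<dots> = -1" using n by (simp add: field_simps)
      finally show False by simp
    qed
    then show ?thesis using True by simp
  next
    case False
    then have pos: "X y \<bullet> y > 0" using psdD(1)[OF assms, of y] by simp
    have "0 \<le> X x \<bullet> x - (X x \<bullet> y)\<^sup>2 / (X y \<bullet> y)"
      using q[of "- (X x \<bullet> y) / (X y \<bullet> y)"] pos by (simp add: power2_eq_square field_simps)
    then show ?thesis using pos by (simp add: field_simps)
  qed
qed

text \<open>Cauchy-Schwarz for the form of X at x and X x, divided by |X x|^2. It converts bounds on
  the quadratic form into bounds on vectors, hence weak into strong convergence for monotone
  families.\<close>

lemma psd_norm_sq_le:
  assumes "psd X" "\<And>x. X x \<bullet> x \<le> c * (norm x)\<^sup>2"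
  shows "(norm (X x))\<^sup>2 \<le> c * (X x \<bullet> x)"
proof (cases "X x = 0")
  case False
  have "(X x \<bullet> X x)\<^sup>2 \<le> (X x \<bullet> x) * (X (X x) \<bullet> X x)" by (rule psd_cauchy_schwarz[OF assms(1)])
  also have "\<dots> \<le> (X x \<bullet> x) * (c * (norm (X x))\<^sup>2)"
    using assms psdD by (intro mult_left_mono) auto
  finally have "(norm (X x))\<^sup>2 * (norm (X x))\<^sup>2 \<le> (c * (X x \<bullet> x)) * (norm (X x))\<^sup>2"
    by (simp only: power2_norm_eq_inner[symmetric] power2_eq_square[of "(norm (X x))\<^sup>2"] mult_ac)
  from mult_right_le_imp_le[OF this] show ?thesis using False by simp
qed simp

lemma inner_blinfun_le:
  fixes X :: "'a::real_inner \<Rightarrow>\<^sub>L 'a"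
  shows "X x \<bullet> x \<le> norm X * (norm x)\<^sup>2"
proof -
  have "X x \<bullet> x \<le> norm (X x) * norm x" by (rule norm_cauchy_schwarz)
  also have "\<dots> \<le> norm X * norm x * norm x" by (intro mult_right_mono norm_blinfun) auto
  finally show ?thesis by (simp add: power2_eq_square)
qed

lemma psd_inner_zero: "psd X \<Longrightarrow> X x \<bullet> x = 0 \<Longrightarrow> X x = 0"
  using psd_norm_sq_le[OF _ inner_blinfun_le, of X x] by simp

lemma psd_norm_le:
  assumes "psd X" "\<And>x. X x \<bullet> x \<le> c * (norm x)\<^sup>2" "c \<ge> 0"
  shows "norm (X x) \<le> c * norm x"
proof (rule power2_le_imp_le)
  have "(norm (X x))\<^sup>2 \<le> c * (X x \<bullet> x)" using psd_norm_sq_le[OF assms(1,2)] .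
  also have "\<dots> \<le> c * (c * (norm x)\<^sup>2)" using assms by (intro mult_left_mono)
  finally show "(norm (X x))\<^sup>2 \<le> (c * norm x)\<^sup>2" by (simp add: power2_eq_square mult_ac)
qed (use assms in simp)

lemma self_adj_polar:
  "self_adj X \<Longrightarrow> X x \<bullet> y = (X (x + y) \<bullet> (x + y) - X (x - y) \<bullet> (x - y)) / 4"
  using self_adjD[of X y x]
  by (simp add: blinfun.add_right blinfun.diff_right inner_add_left inner_add_right inner_diff_left
      inner_diff_right inner_commute)

lemma self_adj_eqI:
  assumes "self_adj X" "self_adj Y" "\<And>x. X x \<bullet> x = Y x \<bullet> x"
  shows "X = Y"
proof (rule blinfun_eqI)
  fix x
  have "X x \<bullet> y = Y x \<bullet> y" for y 
    unfolding self_adj_polar[OF assms(1), of x y] self_adj_polar[OF assms(2), of x y] assms(3) ..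
  then show "X x = Y x" by (metis vector_eq_rdot)
qed

text \<open>Polarisation carries convergence of the quadratic forms to the bilinear forms. The limit
  is along an arbitrary filter because normality concerns directed sets, not only sequences.\<close>

lemma monotone_weak_limit:
  fixes X :: "'i \<Rightarrow> 'a::{real_inner,banach} \<Rightarrow>\<^sub>L 'a"
  assumes F: "F \<noteq> bot" and sa: "\<And>i. self_adj (X i)"
    and lim: "\<And>x. ((\<lambda>i. X i x \<bullet> x) \<longlongrightarrow> q x) F" and bd: "\<forall>\<^sub>F i in F. norm (X i) \<le> C"
  shows "\<exists>Y. self_adj Y \<and> (\<forall>x. Y x \<bullet> x = q x) \<and> (\<forall>x y. ((\<lambda>i. X i x \<bullet> y) \<longlongrightarrow> Y x \<bullet> y) F)"
proof -
  define b where "b x y = (q (x + y) - q (x - y)) / 4" for x y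
  have L: "((\<lambda>i. X i x \<bullet> y) \<longlongrightarrow> b x y) F" for x y
  proof -
    have "(\<lambda>i. X i x \<bullet> y) = (\<lambda>i. (X i (x + y) \<bullet> (x + y) - X i (x - y) \<bullet> (x - y)) / 4)"
      by (rule ext) (rule self_adj_polar[OF sa])
    then show ?thesis unfolding b_def by (simp only:) (intro tendsto_intros lim; simp)
  qed
  have "\<exists>i. norm (X i) \<le> C" using eventually_happens[OF bd] F by blast
  then have C0: "C \<ge> 0" by (meson norm_ge_zero order_trans)
  have U: "((\<lambda>i. X i x \<bullet> y) \<longlongrightarrow> l) F \<Longrightarrow> b x y = l" for x y l using tendsto_unique[OF F L] by blast
  have "\<exists>Y::'a \<Rightarrow>\<^sub>L 'a. \<forall>x y. b x y = Y x \<bullet> y"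
  proof (rule form_operator_exists[where C = C])
    show "b (x + y) z = b x z + b y z" for x y z
      by (rule U) (simp add: blinfun.add_right inner_add_left L tendsto_add)
    show "b (r *\<^sub>R x) y = r * b x y" for r x y
      by (rule U) (simp add: blinfun.scaleR_right L tendsto_mult)
    show "b z (x + y) = b z x + b z y" for x y z
      by (rule U) (simp add: inner_add_right L tendsto_add)
    show "b x (r *\<^sub>R y) = r * b x y" for r x y
      by (rule U) (simp add: L tendsto_mult)
    show "\<bar>b x y\<bar> \<le> C * norm x * norm y" for x y
    proof (rule tendsto_upperbound[OF tendsto_rabs[OF L] _ F])
      show "\<forall>\<^sub>F i in F. \<bar>X i x \<bullet> y\<bar> \<le> C * norm x * norm y"
        using bd
      proof eventually_elim
        case (elim i)
        have "\<bar>X i x \<bullet> y\<bar> \<le> norm (X i x) * norm y" by (rule Cauchy_Schwarz_ineq2)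
        also have "\<dots> \<le> (norm (X i) * norm x) * norm y" by (intro mult_right_mono norm_blinfun) auto
        also have "\<dots> \<le> C * norm x * norm y" using elim by (intro mult_right_mono) auto
        finally show ?case .
      qed
    qed
  qed (rule C0)
  then obtain Y :: "'a \<Rightarrow>\<^sub>L 'a" where Y: "\<And>x y. b x y = Y x \<bullet> y" by blast
  have "X i x \<bullet> y = X i y \<bullet> x" for i x y by (metis sa self_adjD inner_commute)
  then have "b x y = b y x" for x y using U[of x y "b y x"] L[of y x] by simp
  then have "self_adj Y" by (simp add: self_adj_def Y[symmetric] inner_commute[of _ "Y _"])
  moreover have "Y x \<bullet> x = q x" for x using U[OF lim, of x] Y by simp
  ultimately show ?thesis using L Y by auto
qed

lemma monotone_strong_limit:
  fixes X :: "'i \<Rightarrow> 'a::{real_inner,banach} \<Rightarrow>\<^sub>L 'a"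
  assumes "\<forall>\<^sub>F i in F. psd (Y - X i)" "\<forall>\<^sub>F i in F. norm (Y - X i) \<le> C"
    and "((\<lambda>i. X i x \<bullet> x) \<longlongrightarrow> Y x \<bullet> x) F"
  shows "((\<lambda>i. X i x) \<longlongrightarrow> Y x) F"
proof -
  have "((\<lambda>i. (norm (Y x - X i x))\<^sup>2) \<longlongrightarrow> 0) F"
  proof (rule tendsto_sandwich[OF _ _ tendsto_const])
    show "((\<lambda>i. C * (Y x \<bullet> x - X i x \<bullet> x)) \<longlongrightarrow> 0) F"
      using tendsto_mult[OF tendsto_const[of C] tendsto_diff[OF tendsto_const[of "Y x \<bullet> x"] assms(3)]] by simp
    show "\<forall>\<^sub>F i in F. (norm (Y x - X i x))\<^sup>2 \<le> C * (Y x \<bullet> x - X i x \<bullet> x)"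
      using assms(1,2)
    proof eventually_elim
      case (elim i)
      have "(norm ((Y - X i) x))\<^sup>2 \<le> norm (Y - X i) * ((Y - X i) x \<bullet> x)"
        using elim(1) inner_blinfun_le by (rule psd_norm_sq_le)
      also have "\<dots> \<le> C * ((Y - X i) x \<bullet> x)" using elim psdD by (intro mult_right_mono) auto
      finally show ?case by (simp add: blinfun.diff_left inner_diff_left)
    qed
  qed simp
  then have "((\<lambda>i. norm (Y x - X i x)) \<longlongrightarrow> 0) F"
    using tendsto_real_sqrt by fastforce
  then have "((\<lambda>i. Y x - X i x) \<longlongrightarrow> 0) F" by (rule tendsto_norm_zero_cancel)
  from tendsto_diff[OF tendsto_const[of "Y x"] this] show ?thesis by simp
qed

text \<open>Monotone convergence of operators. The bound c on the forms is inherited by the limit,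
  whereas C only supplies the uniform norm bound.\<close>

lemma incseq_strong_limit:
  fixes X :: "nat \<Rightarrow> 'a::{real_inner,banach} \<Rightarrow>\<^sub>L 'a"
  assumes sa: "\<And>i. self_adj (X i)" and mono: "\<And>i x. X i x \<bullet> x \<le> X (Suc i) x \<bullet> x"
    and bd: "\<And>i x. X i x \<bullet> x \<le> c * (norm x)\<^sup>2" and nb: "\<And>i. norm (X i) \<le> C"
  shows "\<exists>Y. self_adj Y \<and> (\<forall>x. (\<lambda>i. X i x) \<longlonglongrightarrow> Y x) \<and> (\<forall>i. psd (Y - X i)) \<and>
    (\<forall>x. Y x \<bullet> x \<le> c * (norm x)\<^sup>2)"
proof -
  have mono': "incseq (\<lambda>i. X i x \<bullet> x)" for x using mono by (rule incseq_SucI)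
  have "\<exists>l. (\<lambda>i. X i x \<bullet> x) \<longlonglongrightarrow> l \<and> (\<forall>i. X i x \<bullet> x \<le> l)" for x

  proof -
    have "\<forall>i. X i x \<bullet> x \<le> c * (norm x)\<^sup>2" using bd by blast
    from incseq_convergent[OF mono'[of x] this] show ?thesis by metis
  qed
  then obtain q where q: "\<And>x. (\<lambda>i. X i x \<bullet> x) \<longlonglongrightarrow> q x" "\<And>x i. X i x \<bullet> x \<le> q x" by metis
  obtain Y where Y: "self_adj Y" "\<And>x. Y x \<bullet> x = q x"
    using monotone_weak_limit[of sequentially X q C, OF _ sa q(1)] nb by auto
  have p: "psd (Y - X i)" for i

    unfolding psd_def
  proof
    show "self_adj (Y - X i)" using Y(1) sa[of i]
      by (simp add: self_adj_def blinfun.diff_left inner_diff_left inner_diff_right)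
    show "\<forall>x. 0 \<le> (Y - X i) x \<bullet> x" using q(2) Y(2) by (simp add: blinfun.diff_left inner_diff_left)
  qed
  have "(\<lambda>i. X i x) \<longlonglongrightarrow> Y x" for x
  proof (rule monotone_strong_limit)
    show "\<forall>\<^sub>F i in sequentially. norm (Y - X i) \<le> norm Y + C"
      using nb by (intro always_eventually allI) (metis add_left_mono norm_triangle_ineq4 order_trans)
  qed (use p q Y in auto)
  moreover have "Y x \<bullet> x \<le> c * (norm x)\<^sup>2" for x unfolding Y(2)
    by (rule tendsto_upperbound[OF q(1)]) (use bd in auto)
  ultimately show ?thesis using p Y by blast
qed

section \<open>Square roots of positive operators\<close>

text \<open>Polynomials in C with nonnegative coefficients. They are positive as soon as C is, and
  both the iterates of the square root algorithm and their increments belong to this class, so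
  monotonicity of the algorithm becomes an induction.\<close>

inductive nnpoly :: "('a::real_inner \<Rightarrow>\<^sub>L 'a) \<Rightarrow> ('a \<Rightarrow>\<^sub>L 'a) \<Rightarrow> bool" for C where
  nnpoly_id: "nnpoly C id_blinfun"
| nnpoly_comp: "nnpoly C Y \<Longrightarrow> nnpoly C (C o\<^sub>L Y)"
| nnpoly_add: "nnpoly C Y \<Longrightarrow> nnpoly C Z \<Longrightarrow> nnpoly C (Y + Z)"
| nnpoly_scale: "nnpoly C Y \<Longrightarrow> 0 \<le> r \<Longrightarrow> nnpoly C (r *\<^sub>R Y)"

lemma nnpoly_mult:
  assumes "nnpoly C X" "nnpoly C Y" shows "nnpoly C (X o\<^sub>L Y)"
  using assms(1)
proof induction
  case nnpoly_id
  have "id_blinfun o\<^sub>L Y = Y" by (rule blinfun_eqI) simp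
  then show ?case using assms(2) by simp
next
  case (nnpoly_comp Z)
  have "(C o\<^sub>L Z) o\<^sub>L Y = C o\<^sub>L (Z o\<^sub>L Y)" by (rule blinfun_eqI) simp
  then show ?case using nnpoly_comp by (simp add: nnpoly.nnpoly_comp)
next
  case (nnpoly_add U V)
  have "(U + V) o\<^sub>L Y = (U o\<^sub>L Y) + (V o\<^sub>L Y)" by (rule blinfun_eqI) (simp add: blinfun.add_left)
  then show ?case using nnpoly_add by (simp add: nnpoly.nnpoly_add)
next
  case (nnpoly_scale U r)
  have "(r *\<^sub>R U) o\<^sub>L Y = r *\<^sub>R (U o\<^sub>L Y)" by (rule blinfun_eqI) (simp add: blinfun.scaleR_left)
  then show ?case using nnpoly_scale by (simp add: nnpoly.nnpoly_scale)
qed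

lemma nnpoly_commute:
  fixes Z :: "'a::real_inner \<Rightarrow>\<^sub>L 'a"
  assumes "nnpoly C X" "\<And>x. Z (C x) = C (Z x)" shows "Z (X x) = X (Z x)"
  using assms(1) by (induction arbitrary: x) (auto simp: assms(2) blinfun.bilinear_simps)

text \<open>The second conjunct strengthens the induction: C C Y is Y compressed by C, since <C C Y
  x, x> = <Y C x, C x>, so multiplication by C alternates between the two conjuncts.\<close>

lemma nnpoly_psd:
  assumes "nnpoly C X" "psd C" shows "psd X \<and> psd (C o\<^sub>L X)"
  using assms(1)
proof induction
  case nnpoly_id
  show ?case using assms(2) by (auto simp: psd_def self_adj_def)
next
  case (nnpoly_comp Y)
  have c: "C (Y x) = Y (C x)" for x using nnpoly_commute[OF nnpoly_comp(1), of C] by simp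
  have "C (C (Y x)) \<bullet> x = Y (C x) \<bullet> C x" for x by (metis c assms(2) psdD(2))
  then have "0 \<le> C (C (Y x)) \<bullet> x" for x using nnpoly_comp psdD by metis
  moreover have "C (C (Y x)) \<bullet> y = x \<bullet> C (C (Y y))" for x y
    by (metis c assms(2) psdD(2) nnpoly_comp(2))
  ultimately show ?case using nnpoly_comp by (auto simp: psd_def self_adj_def)
qed (auto simp: psd_def self_adj_def blinfun.bilinear_simps inner_add_left inner_add_right)

text \<open>A fixed point Y of this iteration satisfies (1 - Y)^2 = 1 - C, so 1 - Y is a square root
  of 1 - C.\<close>

primrec sqrt_iter :: "('a::real_inner \<Rightarrow>\<^sub>L 'a) \<Rightarrow> nat \<Rightarrow> ('a \<Rightarrow>\<^sub>L 'a)" where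
  "sqrt_iter C 0 = 0"
| "sqrt_iter C (Suc n) = (1/2) *\<^sub>R (C + (sqrt_iter C n o\<^sub>L sqrt_iter C n))"

lemma nnpoly_sqrt_iter: "nnpoly C (sqrt_iter C n)"
proof (induction n)
  case 0
  show ?case using nnpoly_scale[OF nnpoly_id, of 0 C] by simp
next
  case (Suc n)
  have "C o\<^sub>L id_blinfun = C" by (rule blinfun_eqI) simp
  then have "nnpoly C C" using nnpoly_comp[OF nnpoly_id, of C] by simp
  then show ?case using Suc by (simp add: nnpoly_add nnpoly_mult nnpoly_scale)
qed

lemma sqrt_iter_commute: "sqrt_iter C n (C x) = C (sqrt_iter C n x)"
  using nnpoly_commute[OF nnpoly_sqrt_iter, where Z = C] by simp

text \<open>Consecutive differences factor as half of (a + b)(a - b), because iterates commute; this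
  propagates nonnegative coefficients.\<close>

lemma nnpoly_sqrt_iter_diff: "nnpoly C (sqrt_iter C (Suc n) - sqrt_iter C n)"
proof (induction n)
  case 0
  show ?case using nnpoly_sqrt_iter[of C 1] by simp
next
  case (Suc n)
  let ?a = "sqrt_iter C (Suc n)" and ?b = "sqrt_iter C n"
  have c: "?a (?b x) = ?b (?a x)" for x
    by (rule nnpoly_commute[OF nnpoly_sqrt_iter]) (rule sqrt_iter_commute)
  have "sqrt_iter C (Suc (Suc n)) - ?a = (1/2) *\<^sub>R ((?a + ?b) o\<^sub>L (?a - ?b))"
  proof (rule blinfun_eqI)
    fix x
    have "(sqrt_iter C (Suc (Suc n)) - ?a) x = (1/2) *\<^sub>R (C x + ?a (?a x)) - (1/2) *\<^sub>R (C x + ?b (?b x))"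
      by (simp add: blinfun.bilinear_simps)
    also have "\<dots> = (1/2) *\<^sub>R (?a (?a x) - ?b (?b x))" by (simp add: algebra_simps del: sqrt_iter.simps)
    also have "?a (?a x) - ?b (?b x) = ((?a + ?b) o\<^sub>L (?a - ?b)) x"
      using c[of x] by (simp add: blinfun.bilinear_simps del: sqrt_iter.simps)
    finally show "(sqrt_iter C (Suc (Suc n)) - ?a) x = ((1/2) *\<^sub>R ((?a + ?b) o\<^sub>L (?a - ?b))) x"
      by (simp add: blinfun.scaleR_left del: sqrt_iter.simps)
  qed
  then show ?case using Suc
    by (simp add: nnpoly_scale nnpoly_mult nnpoly_add nnpoly_sqrt_iter del: sqrt_iter.simps)
qed

text \<open>With C = 1 - X the iterates increase and are bounded by 1, so they converge strongly to
  a fixed point Y, and R = 1 - Y. What commutes with X commutes with every iterate and therefore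
  with the limit.\<close>

lemma psd_sqrt_exists_contraction:
  fixes X :: "'a::{real_inner,banach} \<Rightarrow>\<^sub>L 'a"
  assumes X: "psd X" "\<And>x. X x \<bullet> x \<le> (norm x)\<^sup>2"
  shows "\<exists>R. psd R \<and> R o\<^sub>L R = X \<and> (\<forall>Z. commute Z X \<longrightarrow> commute Z R)"
proof -
  define C where "C = id_blinfun - X"
  have Cx: "C x = x - X x" for x by (simp add: C_def blinfun.diff_left)
  have C: "psd C" "\<And>x. C x \<bullet> x \<le> 1 * (norm x)\<^sup>2"
    using X psdD(1)[OF X(1)] psdD(2)[OF X(1)]
    by (auto simp: psd_def self_adj_def Cx inner_diff_left inner_diff_right power2_norm_eq_inner)
  have nC: "norm C \<le> 1" using psd_norm_le[OF C] by (intro norm_blinfun_bound) auto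
  let ?Y = "sqrt_iter C"
  have nY: "norm (?Y n) \<le> 1" for n
  proof (induction n)
    case (Suc n)
    have "norm (C + (?Y n o\<^sub>L ?Y n)) \<le> norm C + norm (?Y n) * norm (?Y n)"
      by (meson norm_triangle_ineq norm_blinfun_compose add_left_mono order_trans)
    also have "\<dots> \<le> 1 + 1 * 1" using Suc nC by (intro add_mono mult_mono) auto
    finally show ?case by simp
  qed simp
  have pY: "psd (?Y n)" "psd (?Y (Suc n) - ?Y n)" for n
    using nnpoly_psd[OF nnpoly_sqrt_iter C(1)] nnpoly_psd[OF nnpoly_sqrt_iter_diff C(1)] by auto
  have le1: "?Y n x \<bullet> x \<le> 1 * (norm x)\<^sup>2" for n x
    by (rule order_trans[OF inner_blinfun_le]) (simp add: nY mult_left_le_one_le)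
  obtain Y where Y: "self_adj Y" "\<And>x. (\<lambda>n. ?Y n x) \<longlonglongrightarrow> Y x" "\<And>n. psd (Y - ?Y n)" "\<And>x. Y x \<bullet> x \<le> 1 * (norm x)\<^sup>2"
  proof -
    have "?Y n x \<bullet> x \<le> ?Y (Suc n) x \<bullet> x" for n x
      using psdD(1)[OF pY(2), of n x] by (simp add: blinfun.diff_left inner_diff_left del: sqrt_iter.simps)
    then show ?thesis using incseq_strong_limit[of ?Y 1 1, OF _ _ le1 nY] pY(1) that by (auto simp: psd_def)
  qed
  have YY: "(\<lambda>n. ?Y n (?Y n x)) \<longlonglongrightarrow> Y (Y x)" for x
  proof -
    have "(\<lambda>n. ?Y n (?Y n x - Y x)) \<longlonglongrightarrow> 0"
    proof (rule Lim_null_comparison)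
      show "\<forall>\<^sub>F n in sequentially. norm (?Y n (?Y n x - Y x)) \<le> norm (?Y n x - Y x)"
      proof (intro always_eventually allI)
        fix n
        have "norm (?Y n (?Y n x - Y x)) \<le> norm (?Y n) * norm (?Y n x - Y x)" by (rule norm_blinfun)
        also have "\<dots> \<le> norm (?Y n x - Y x)" using nY by (simp add: mult_left_le_one_le)
        finally show "norm (?Y n (?Y n x - Y x)) \<le> norm (?Y n x - Y x)" .
      qed
      show "(\<lambda>n. norm (?Y n x - Y x)) \<longlonglongrightarrow> 0" using Y(2)[of x] by (simp add: tendsto_norm_zero LIM_zero)
    qed
    from tendsto_add[OF this Y(2)[of "Y x"]] show ?thesis by (simp add: blinfun.diff_right)
  qed
  have fp: "Y x = (1/2) *\<^sub>R (C x + Y (Y x))" for x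
  proof (rule LIMSEQ_unique[OF LIMSEQ_Suc[OF Y(2)]])
    show "(\<lambda>n. ?Y (Suc n) x) \<longlonglongrightarrow> (1/2) *\<^sub>R (C x + Y (Y x))"
      by (simp add: blinfun.scaleR_left blinfun.add_left) (intro tendsto_intros YY)
  qed
  define R where "R = id_blinfun - Y"
  have Rx: "R x = x - Y x" for x by (simp add: R_def blinfun.diff_left)
  have "psd R" using Y(1,4) 
    by (auto simp: psd_def self_adj_def Rx inner_diff_left inner_diff_right power2_norm_eq_inner)
  moreover have "R o\<^sub>L R = X"
  proof (rule blinfun_eqI)
    fix x
    have "R (R x) = x - 2 *\<^sub>R Y x + Y (Y x)" by (simp add: Rx blinfun.diff_right scaleR_2)
    also have "2 *\<^sub>R Y x = C x + Y (Y x)" by (subst fp) simp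
    finally show "(R o\<^sub>L R) x = X x" by (simp add: Cx)
  qed
  moreover have "commute Z R" if "commute Z X" for Z
  proof -
    have "Z (C x) = C (Z x)" for x using that by (simp add: Cx commute_iff blinfun.diff_right)
    then have "Z (?Y n x) = ?Y n (Z x)" for n x by (rule nnpoly_commute[OF nnpoly_sqrt_iter])
    then have "Z (Y x) = Y (Z x)" for x
      using LIMSEQ_unique[OF blinfun.tendsto[OF tendsto_const Y(2)[of x], of Z] ] Y(2)[of "Z x"] by simp
    then show ?thesis by (simp add: commute_iff Rx blinfun.diff_right)
  qed
  ultimately show ?thesis by blast
qed

lemma psd_sqrt_exists:
  fixes X :: "'a::{real_inner,banach} \<Rightarrow>\<^sub>L 'a"
  assumes X: "psd X"
  shows "\<exists>R. psd R \<and> R o\<^sub>L R = X \<and> (\<forall>Z. commute Z X \<longrightarrow> commute Z R)"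
proof -
  \<comment> \<open>Adding 1 keeps the scaling factor positive when X = 0.\<close>
  define c where "c = norm X + 1"
  have c: "c > 0" by (simp add: c_def add_nonneg_pos)
  define X' where "X' = (1/c) *\<^sub>R X"
  have X'x: "X' x = (1/c) *\<^sub>R X x" for x by (simp add: X'_def blinfun.scaleR_left)
  have "psd X'" using X c by (auto simp: psd_def self_adj_def X'x)
  moreover have "X' x \<bullet> x \<le> (norm x)\<^sup>2" for x
  proof -
    have "X x \<bullet> x \<le> c * (norm x)\<^sup>2" using inner_blinfun_le[of X x] by (simp add: c_def distrib_right add_increasing2)
    then show ?thesis using c by (simp add: X'x field_simps)
  qed
  ultimately obtain R where R: "psd R" "R o\<^sub>L R = X'" "\<And>Z. commute Z X' \<Longrightarrow> commute Z R"
    using psd_sqrt_exists_contraction by blast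
  have RR: "R (R x) = (1/c) *\<^sub>R X x" for x using R(2) X'x by (metis blinfun_apply_blinfun_compose)
  let ?R = "sqrt c *\<^sub>R R"
  have "psd ?R" using R(1) c by (auto simp: psd_def self_adj_def blinfun.scaleR_left)
  moreover have "?R o\<^sub>L ?R = X"
    using c by (intro blinfun_eqI) (simp add: blinfun.scaleR_left blinfun.scaleR_right RR)
  moreover have "commute Z ?R" if "commute Z X" for Z
  proof -
    have "commute Z X'" using that by (simp add: commute_iff X'x blinfun.scaleR_right)
    from R(3)[OF this] show ?thesis by (simp add: commute_iff blinfun.scaleR_left blinfun.scaleR_right)
  qed
  ultimately show ?thesis by blast
qed

definition psd_sqrt :: "('a::{real_inner,banach} \<Rightarrow>\<^sub>L 'a) \<Rightarrow> 'a \<Rightarrow>\<^sub>L 'a" where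
  "psd_sqrt X = (SOME R. psd R \<and> R o\<^sub>L R = X \<and> (\<forall>Z. commute Z X \<longrightarrow> commute Z R))"

lemma psd_sqrt:
  assumes "psd X"
  shows "psd (psd_sqrt X)" "psd_sqrt X (psd_sqrt X x) = X x" "commute Z X \<Longrightarrow> commute Z (psd_sqrt X)"
    "norm (psd_sqrt X x) ^ 2 = X x \<bullet> x"
proof -
  have *: "psd (psd_sqrt X) \<and> psd_sqrt X o\<^sub>L psd_sqrt X = X \<and> (\<forall>Z. commute Z X \<longrightarrow> commute Z (psd_sqrt X))"
    unfolding psd_sqrt_def using psd_sqrt_exists[OF assms] by (rule someI_ex)
  then show 1: "psd (psd_sqrt X)" "psd_sqrt X (psd_sqrt X x) = X x" "commute Z X \<Longrightarrow> commute Z (psd_sqrt X)"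
    by (auto dest: arg_cong[of _ _ "\<lambda>Y. blinfun_apply Y x"])
  show "norm (psd_sqrt X x) ^ 2 = X x \<bullet> x"
    using psdD(2)[OF 1(1), of "psd_sqrt X x" x] 1(2) by (simp add: power2_norm_eq_inner)
qed

text \<open>The root R of X commutes with Y, so <X Y x, x> = <Y R x, R x>.\<close>

lemma psd_commute_mult:
  fixes X :: "'a::{real_inner,banach} \<Rightarrow>\<^sub>L 'a"
  assumes "psd X" "psd Y" "commute X Y"
  shows "psd (X o\<^sub>L Y)"
proof -
  let ?R = "psd_sqrt X"
  have c: "?R (Y x) = Y (?R x)" for x
    using psd_sqrt(3)[OF assms(1) commute_sym[OF assms(3)]] by (simp add: commute_iff)
  have "X (Y x) \<bullet> x = Y (?R x) \<bullet> ?R x" for x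
    by (metis c psd_sqrt(1,2)[OF assms(1)] psdD(2))
  then have "0 \<le> X (Y x) \<bullet> x" for x using assms(2) psdD(1) by metis
  moreover have "X (Y x) \<bullet> y = x \<bullet> X (Y y)" for x y
    by (metis assms commuteD psdD(2))
  ultimately show ?thesis by (simp add: psd_def self_adj_def)
qed

text \<open>P projects onto the kernel of |X| - X, where |X| is the root of X^2. The range of |X| +
  X lies in that kernel, so on the complement X = -|X|; the form is strictly negative there because
  the kernel of X belongs to P.\<close>

lemma spectral_split_exists:
  fixes X :: "'a::{real_inner,banach} \<Rightarrow>\<^sub>L 'a"
  assumes X: "self_adj X"
  shows "\<exists>P. ortho_proj P \<and> (\<forall>Z. commute Z X \<longrightarrow> commute Z P) \<and>
    (\<forall>x. P x = x \<longrightarrow> 0 \<le> X x \<bullet> x) \<and> (\<forall>x. P x = 0 \<longrightarrow> x \<noteq> 0 \<longrightarrow> X x \<bullet> x < 0)"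
proof -
  have XX: "psd (X o\<^sub>L X)"
    using self_adjD[OF X] inner_ge_zero[of "X _"] unfolding psd_def self_adj_def
    by (metis blinfun_apply_blinfun_compose)
  let ?R = "psd_sqrt (X o\<^sub>L X)"
  note R = psd_sqrt(1)[OF XX] psd_sqrt(2)[OF XX, simplified]
  have Rc: "commute Z ?R" if "commute Z X" for Z
    using that by (intro psd_sqrt(3)[OF XX]) (simp add: commute_iff)
  have RX: "?R (X x) = X (?R x)" for x using Rc[of X] by (simp add: commute_iff)
  have nRX: "norm (?R x) = norm (X x)" for x
  proof -
    have "(norm (?R x))\<^sup>2 = X (X x) \<bullet> x" using psd_sqrt(4)[OF XX] by simp
    also have "\<dots> = (norm (X x))\<^sup>2" using self_adjD[OF X, of "X x" x] by (simp add: power2_norm_eq_inner)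
    finally show ?thesis by simp
  qed
  let ?S = "{x. ?R x = X x}"
  have "closed ?S" by (intro closed_Collect_eq continuous_intros)
  moreover have "subspace ?S" by (auto simp: subspace_def blinfun.bilinear_simps)
  ultimately obtain P where P: "ortho_proj P" "\<And>x. P x = x \<longleftrightarrow> ?R x = X x" "\<And>x. ?R (P x) = X (P x)"
    using ortho_proj_exists[of ?S] by auto
  have comm: "commute Z P" if "commute Z X" for Z
  proof -
    \<comment> \<open>The range of P is invariant under Z and under its adjoint, and both
      invariances together give commutation.\<close>
    have "commute (radj Z) X"
      unfolding commute_iff
    proof
      fix x
      have "radj Z (X x) \<bullet> y = X (radj Z x) \<bullet> y" for y
        by (metis X inner_commute radj self_adjD that commuteD)
      then show "radj Z (X x) = X (radj Z x)" by (metis vector_eq_rdot)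
    qed
    note c = commuteD[OF that] commuteD[OF Rc[OF that]] commuteD[OF this] commuteD[OF Rc[OF this]]
    have 1: "P (Z (P x)) = Z (P x)" for x unfolding P(2) by (metis c P(3))
    have 2: "P (radj Z (P x)) = radj Z (P x)" for x unfolding P(2) by (metis c P(3))
    have "P (Z x) \<bullet> y = Z (P x) \<bullet> y" for x y
    proof -
      have "P (Z x) \<bullet> y = x \<bullet> radj Z (P y)" using ortho_projD(2)[OF P(1)] radj by metis
      also have "\<dots> = x \<bullet> P (radj Z (P y))" by (simp add: 2)
      also have "\<dots> = P (Z (P x)) \<bullet> y" using ortho_projD(2)[OF P(1)] radj by metis
      finally show ?thesis by (simp add: 1)
    qed
    then show ?thesis by (metis commute_iff vector_eq_rdot)
  qed
  have neg: "X x \<bullet> x < 0" if x: "P x = 0" "x \<noteq> 0" for x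
  proof -
    have "P (?R y + X y) = ?R y + X y" for y
      unfolding P(2) using R(2)[of y] RX[of y] by (simp add: blinfun.add_right)
    then have "(?R x + X x) \<bullet> y = 0" for y
    proof -
      have "(?R x + X x) \<bullet> y = x \<bullet> (?R y + X y)"
        using psdD(2)[OF R(1)] self_adjD[OF X] by (simp add: inner_add_left inner_add_right)
      also have "\<dots> = P x \<bullet> (?R y + X y)" using ortho_projD(2)[OF P(1)] \<open>P (?R y + X y) = _\<close> by metis
      finally show ?thesis using x by simp
    qed
    from this[of "?R x + X x"] have "?R x + X x = 0" unfolding inner_eq_zero_iff .
    then have e: "?R x = - X x" by (simp add: eq_neg_iff_add_eq_0)
    have "X x \<bullet> x \<le> 0" using psdD(1)[OF R(1), of x] e by simp
    moreover have "X x \<bullet> x \<noteq> 0"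
    proof
      assume "X x \<bullet> x = 0"
      then have "?R x \<bullet> x = 0" using e by simp
      then have "?R x = 0" by (rule psd_inner_zero[OF R(1)])
      then have "P x = x" using e P(2) by simp
      then show False using x by simp
    qed
    ultimately show ?thesis by simp
  qed
  have "0 \<le> X x \<bullet> x" if "P x = x" for x using psdD(1)[OF R(1), of x] that P(2) by simp
  then show ?thesis using P(1) comm neg by blast
qed

lemma dense_inner_zero:
  fixes S :: "'a::real_inner set"
  assumes "closure S = UNIV" "\<And>v. v \<in> S \<Longrightarrow> x \<bullet> v = 0"
  shows "x = 0"
proof -
  have "closure S \<subseteq> {v. x \<bullet> v = 0}"
    by (rule closure_minimal) (use assms in \<open>auto intro!: closed_Collect_eq continuous_intros\<close>)
  then have "x \<bullet> x = 0" using assms(1) by blast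
  then show ?thesis by simp
qed

text \<open>The inverse on the range extends to a bounded U with U A = 1; as A is symmetric, the
  adjoint of U is a right inverse.\<close>

lemma psd_bounded_below_surj:
  fixes A :: "'a::{real_inner,banach} \<Rightarrow>\<^sub>L 'a"
  assumes A: "psd A" and l: "l > 0" "\<And>x. l * (norm x)\<^sup>2 \<le> A x \<bullet> x"
  shows "\<exists>x. A x = y"
proof -
  let ?G = "(\<lambda>x. (A x, x)) ` UNIV"
  have "subspace ?G"
    by (rule linear_subspace_image[OF _ subspace_UNIV]) (simp add: linear_iff blinfun.bilinear_simps)
  moreover have "norm v \<le> (1/l) * norm u" if "(u, v) \<in> ?G" for u v
  proof -
    have u: "u = A v" using that by auto
    have "l * (norm v * norm v) \<le> norm (A v) * norm v"
      using l(2)[of v] norm_cauchy_schwarz[of "A v" v] by (simp add: power2_eq_square)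
    then have "l * norm v \<le> norm (A v)" by (cases "v = 0") (auto simp: mult.assoc[symmetric])
    then show ?thesis using l(1) u by (simp add: field_simps)
  qed
  ultimately obtain U :: "'a \<Rightarrow>\<^sub>L 'a" where U: "\<forall>(x, y)\<in>?G. U x = y"
    using bounded_extension[of ?G "1/l"] l(1) by auto
  have "A (radj U y) \<bullet> z = y \<bullet> z" for z
    using U psdD(2)[OF A, of "radj U y" z] radj[of U "A z" y] by (simp add: inner_commute)
  then have "A (radj U y) = y" using vector_eq_rdot by blast
  then show ?thesis by blast
qed

lemma lim_inverse_Suc: "(\<lambda>n. 1 / real (Suc n)) \<longlonglongrightarrow> 0"
  using LIMSEQ_Suc[OF lim_1_over_n[where 'a = real]] .

text \<open>Apply \<open>incseq_strong_limit\<close> to the negatives, whose forms are bounded above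
  by 0.\<close>

lemma decseq_proj_limit:
  fixes P :: "nat \<Rightarrow> 'a::{real_inner,banach} \<Rightarrow>\<^sub>L 'a"
  assumes P: "\<And>n. ortho_proj (P n)" and dec: "\<And>m n x. m \<le> n \<Longrightarrow> P m (P n x) = P n x"
  shows "\<exists>D :: 'a \<Rightarrow>\<^sub>L 'a. \<forall>x. (\<lambda>n. P n x) \<longlonglongrightarrow> D x"
proof -
  have "norm (P (Suc n) x) \<le> norm (P n x)" for n x
  proof -
    have "P (Suc n) x \<bullet> P (Suc n) x = P (Suc n) x \<bullet> P n x"
      using dec[of n "Suc n" x] ortho_projD(2)[OF P, of n "P (Suc n) x" x] ortho_projD(1,2)[OF P]
      by (metis le_SucI order_refl)
    also have "\<dots> \<le> norm (P (Suc n) x) * norm (P n x)" by (rule norm_cauchy_schwarz)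
    finally have "norm (P (Suc n) x) * norm (P (Suc n) x) \<le> norm (P (Suc n) x) * norm (P n x)"
      by (simp add: power2_norm_eq_inner[symmetric] power2_eq_square)
    then show ?thesis by (cases "P (Suc n) x = 0") auto
  qed
  then have 1: "(- P n) x \<bullet> x \<le> (- P (Suc n)) x \<bullet> x" for n x
    using ortho_projD(3)[OF P] by (simp add: blinfun.minus_left power_mono)
  have 2: "self_adj (- P n)" for n using P[of n] by (simp add: ortho_proj_def self_adj_def blinfun.minus_left)
  have 3: "(- P n) x \<bullet> x \<le> 0 * (norm x)\<^sup>2" for n x
    using ortho_projD(3)[OF P] by (simp add: blinfun.minus_left)
  have 4: "norm (- P n) \<le> 1" for n
    using ortho_projD(4)[OF P] by (intro norm_blinfun_bound) (auto simp: blinfun.minus_left)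
  obtain Y :: "'a \<Rightarrow>\<^sub>L 'a" where "\<And>x. (\<lambda>n. (- P n) x) \<longlonglongrightarrow> Y x"
    using incseq_strong_limit[of "\<lambda>n. - P n", OF 2 1 3 4] by blast
  then have "(\<lambda>n. P n x) \<longlonglongrightarrow> (- Y) x" for x
    using tendsto_minus[of "\<lambda>n. (- P n) x"] by (simp add: blinfun.minus_left)
  then show ?thesis by blast
qed

section \<open>Closed densely defined operators\<close>

locale closed_dense_op =
  fixes T :: "('a::{real_inner,banach} \<times> 'a) set"
  assumes sub: "subspace T" and sv: "single_valued T" and cl: "closed T" and dense: "closure (Domain T) = UNIV"
begin

definition graph_proj :: "('a \<times> 'a) \<Rightarrow>\<^sub>L ('a \<times> 'a)" where
  "graph_proj = (SOME P. ortho_proj P \<and> (\<forall>x. P x = x \<longleftrightarrow> x \<in> T) \<and> (\<forall>x. P x \<in> T))"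

definition res :: "'a \<Rightarrow>\<^sub>L 'a" where
  "res = Blinfun (\<lambda>x. fst (graph_proj (x, 0)))"

text \<open>This is T (1 + T*T)^{-1}: the pair (\<open>res x\<close>, \<open>resT x\<close>) is the
  point of the graph nearest to (x, 0).\<close>

definition resT :: "'a \<Rightarrow>\<^sub>L 'a" where
  "resT = Blinfun (\<lambda>x. snd (graph_proj (x, 0)))"

lemma graph_proj: "ortho_proj graph_proj" "graph_proj x = x \<longleftrightarrow> x \<in> T" "graph_proj x \<in> T"
proof -
  have "ortho_proj graph_proj \<and> (\<forall>x. graph_proj x = x \<longleftrightarrow> x \<in> T) \<and> (\<forall>x. graph_proj x \<in> T)"
    unfolding graph_proj_def by (rule someI_ex) (rule ortho_proj_exists[OF cl sub])
  then show "ortho_proj graph_proj" "graph_proj x = x \<longleftrightarrow> x \<in> T" "graph_proj x \<in> T" by blast+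
qed

lemma res_apply: "res x = fst (graph_proj (x, 0))" "resT x = snd (graph_proj (x, 0))"
proof -
  have "bounded_linear (\<lambda>x::'a. (x, 0::'a))" by (intro bounded_linear_Pair bounded_linear_ident bounded_linear_zero)
  from bounded_linear_compose[OF blinfun.bounded_linear_right this]
  have "bounded_linear (\<lambda>x. graph_proj (x, 0))" .
  then have "bounded_linear (\<lambda>x. fst (graph_proj (x, 0)))" "bounded_linear (\<lambda>x. snd (graph_proj (x, 0)))"
    by (rule bounded_linear_fst_comp bounded_linear_snd_comp)+
  then show "res x = fst (graph_proj (x, 0))" "resT x = snd (graph_proj (x, 0))"
    by (auto simp: res_def resT_def bounded_linear_Blinfun_apply)
qed

lemma res_mem: "(res x, resT x) \<in> T"
  using graph_proj(3)[of "(x, 0)"] by (simp add: res_apply)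

text \<open>The weak form of (1 + T*T) \<open>res\<close> x = x. Together with membership in the
  graph it characterises \<open>res\<close> (\<open>res_unique\<close>).\<close>

lemma res_inner:
  assumes "(v, w) \<in> T" shows "res x \<bullet> v + resT x \<bullet> w = x \<bullet> v"
proof -
  have "graph_proj (x, 0) \<bullet> (v, w) = (x, 0) \<bullet> (v, w)"
    using ortho_projD(2)[OF graph_proj(1), of "(x, 0)" "(v, w)"] graph_proj(2)[of "(v, w)"] assms by simp
  then show ?thesis by (simp add: res_apply inner_prod_def)
qed

lemma zero_image: "(0, y) \<in> T \<Longrightarrow> y = 0"
  using sv subspace_0[OF sub] by (auto simp: single_valued_def zero_prod_def)

lemma unique_image: "(x, y) \<in> T \<Longrightarrow> (x, z) \<in> T \<Longrightarrow> y = z"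
  using sv by (auto simp: single_valued_def)

lemma mem_add: "(x, y) \<in> T \<Longrightarrow> (x', y') \<in> T \<Longrightarrow> (x + x', y + y') \<in> T"
  using subspace_add[OF sub] by fastforce

lemma mem_diff: "(x, y) \<in> T \<Longrightarrow> (x', y') \<in> T \<Longrightarrow> (x - x', y - y') \<in> T"
  using subspace_diff[OF sub] by fastforce

lemma res_unique:
  assumes "(b, c) \<in> T" "\<And>v w. (v, w) \<in> T \<Longrightarrow> b \<bullet> v + c \<bullet> w = x \<bullet> v"
  shows "res x = b"
proof -
  have m: "(res x - b, resT x - c) \<in> T" using mem_diff[OF res_mem assms(1)] .
  have "(res x - b) \<bullet> (res x - b) + (resT x - c) \<bullet> (resT x - c) = 0"
    using res_inner[OF m, of x] assms(2)[OF m] by (simp add: inner_diff_left)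
  then have "(res x - b) \<bullet> (res x - b) = 0"
    by (simp add: add_nonneg_eq_0_iff)
  then show ?thesis by simp
qed

lemma dense_zero: "(\<And>v w. (v, w) \<in> T \<Longrightarrow> x \<bullet> v = 0) \<Longrightarrow> x = 0"
  using dense_inner_zero[OF dense] by blast

lemma res_inj: "res x = 0 \<Longrightarrow> x = 0"
  using res_mem[of x] zero_image res_inner dense_zero by (metis add_0 inner_zero_left)

lemma res_inner_self: "res x \<bullet> y = res x \<bullet> res y + resT x \<bullet> resT y"
  using res_inner[OF res_mem, of y x] by (simp add: inner_commute)

lemma res_psd: "psd res"
proof -
  have "res x \<bullet> y = x \<bullet> res y" for x y
    using res_inner_self[of x y] res_inner_self[of y x] by (simp add: inner_commute)
  moreover have "0 \<le> res x \<bullet> x" for x using res_inner_self[of x x] by simp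
  ultimately show ?thesis by (simp add: psd_def self_adj_def)
qed

lemma res_norm: "norm (res x) \<le> norm x"
proof -
  have "norm (res x) * norm (res x) \<le> res x \<bullet> x"
    using res_inner_self[of x x] by (simp add: power2_norm_eq_inner[symmetric] power2_eq_square)
  also have "\<dots> \<le> norm (res x) * norm x" by (rule norm_cauchy_schwarz)
  finally show ?thesis by (cases "res x = 0") auto
qed

lemma res_le_one: "res x \<bullet> x \<le> (norm x)\<^sup>2"
proof -
  have "res x \<bullet> x \<le> norm (res x) * norm x" by (rule norm_cauchy_schwarz)
  also have "\<dots> \<le> norm x * norm x" by (intro mult_right_mono res_norm) auto
  finally show ?thesis by (simp add: power2_eq_square)
qed

text \<open>P acts on the domain side and P1 on the range side, so that T P = P1 T. Adjointness of
  P1 and Q1 is asked for on the range of T alone, which is what makes the lemma applicable to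
  operators such as \<open>rhat\<close> that are symmetric only there.\<close>

lemma commute_res:
  assumes "\<And>u u'. (u, u') \<in> T \<Longrightarrow> (P u, P1 u') \<in> T" "\<And>u u'. (u, u') \<in> T \<Longrightarrow> (Q u, Q1 u') \<in> T"
    and "\<And>u v. P u \<bullet> v = u \<bullet> Q v"
    and "\<And>u u' v v'. (u, u') \<in> T \<Longrightarrow> (v, v') \<in> T \<Longrightarrow> P1 u' \<bullet> v' = u' \<bullet> Q1 v'"
  shows "res (P x) = P (res x)"
proof (rule res_unique)
  show "(P (res x), P1 (resT x)) \<in> T" using assms(1) res_mem by blast
  fix v w assume vw: "(v, w) \<in> T"
  have "P (res x) \<bullet> v + P1 (resT x) \<bullet> w = res x \<bullet> Q v + resT x \<bullet> Q1 w"
    using assms(3) assms(4)[OF res_mem vw] by simp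
  also have "\<dots> = P x \<bullet> v" using res_inner[OF assms(2)[OF vw]] assms(3) by simp
  finally show "P (res x) \<bullet> v + P1 (resT x) \<bullet> w = P x \<bullet> v" .
qed

definition rt :: "'a \<Rightarrow>\<^sub>L 'a" where "rt = psd_sqrt res"

lemma rt: "psd rt" "rt (rt x) = res x" "norm (rt x) ^ 2 = res x \<bullet> x"
  using psd_sqrt[OF res_psd] by (simp_all add: rt_def)

lemma commute_rt: "commute Z res \<Longrightarrow> commute Z rt"
  using psd_sqrt(3)[OF res_psd] by (simp add: rt_def)

lemma rt_inj: "rt x = 0 \<Longrightarrow> x = 0"
  using rt(2)[of x] res_inj by simp

lemma rt_range_zero: "(\<And>y. x \<bullet> rt y = 0) \<Longrightarrow> x = 0"
  by (metis inner_eq_zero_iff psdD(2) rt(1) rt_inj)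

lemma rt_dense: "closure (range rt) = UNIV"
proof -
  have s: "subspace (closure (range rt))"
    by (intro subspace_closure linear_subspace_image subspace_UNIV) (simp add: linear_iff blinfun.bilinear_simps)
  have "x \<in> closure (range rt)" for x
  proof -
    obtain p where p: "p \<in> closure (range rt)" "\<And>y. y \<in> closure (range rt) \<Longrightarrow> (x - p) \<bullet> y = 0"
      using closed_subspace_proj_exists[OF closed_closure s, of x] by blast
    have "x - p = 0" by (rule rt_range_zero) (rule p(2), rule closure_subset[THEN subsetD], rule rangeI)
    then show ?thesis using p(1) by simp
  qed
  then show ?thesis by blast
qed

text \<open>The graph is the isometric image of the whole space, with first component \<open>(1 + T\<^sup>*T)\<^sup>-\<^sup>1\<^sup>/\<^sup>2\<close>.\<close>

lemma param_exists: "\<exists>V::'a \<Rightarrow>\<^sub>L 'a. T = range (\<lambda>z. (rt z, V z)) \<and> (\<forall>x y. V x \<bullet> V y = (x - res x) \<bullet> y)"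
proof -
  let ?G = "(\<lambda>x. (rt x, res x, resT x)) ` UNIV"
  have G: "subspace ?G"
    by (rule linear_subspace_image[OF _ subspace_UNIV]) (simp add: linear_iff blinfun.bilinear_simps)
  have iso: "norm (res x, resT x) = norm (rt x)" for x
  proof (rule power2_eq_imp_eq)
    show "(norm (res x, resT x))\<^sup>2 = (norm (rt x))\<^sup>2"
      unfolding rt(3) power2_norm_eq_inner[of "(res x, resT x)"] using res_inner_self[of x x] by (simp add: inner_prod_def)
  qed auto
  obtain U :: "'a \<Rightarrow>\<^sub>L ('a \<times> 'a)" where U: "\<forall>(x, y)\<in>?G. U x = y" "\<forall>x. U x \<in> closure (snd ` ?G)"
    using bounded_extension[OF G, of 1] iso by fastforce
  have Ur: "U (rt x) = (res x, resT x)" for x using U(1) by auto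
  have dense_ext: "{x. f x = g x} = UNIV" if "continuous_on UNIV f" "continuous_on UNIV g" "\<And>x. f (rt x) = g (rt x)"
    for f g :: "'a \<Rightarrow> 'c::t2_space"
  proof -
    have "closure (range rt) \<subseteq> {x. f x = g x}"
      by (rule closure_minimal) (use that in \<open>auto intro!: closed_Collect_eq\<close>)
    then show ?thesis using rt_dense by auto
  qed
  have "{x. norm (U x) = norm x} = UNIV"
    by (rule dense_ext) (auto intro!: continuous_intros simp: Ur iso)
  then have nU: "norm (U x) = norm x" for x by blast
  have fU: "{x. fst (U x) = rt x} = UNIV"
    by (rule dense_ext) (auto intro!: continuous_intros simp: Ur rt(2))
  have UU: "radj U (U x) = x" for x
  proof -
    have "radj U o\<^sub>L U = id_blinfun"
    proof (rule self_adj_eqI)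
      show "self_adj (radj U o\<^sub>L U)" by (simp add: self_adj_def) (metis radj inner_commute)
      show "self_adj id_blinfun" by (simp add: self_adj_def)
      show "(radj U o\<^sub>L U) x \<bullet> x = id_blinfun x \<bullet> x" for x
        using nU[of x] radj[of U x "U x"] by (simp add: inner_commute power2_norm_eq_inner[symmetric])
    qed
    then show ?thesis by (metis blinfun_apply_blinfun_compose blinfun_apply_id_blinfun)
  qed
  have UT: "U z \<in> T" for z
  proof -
    have "snd ` ?G \<subseteq> T" using res_mem by auto
    then have "closure (snd ` ?G) \<subseteq> T" using cl by (rule closure_minimal)
    then show ?thesis using U(2) by blast
  qed
  \<comment> \<open>A vector of the graph orthogonal to the range of U is orthogonal to all
    (\<open>res x\<close>, \<open>resT x\<close>), so by \<open>res_inner\<close> its first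
    component vanishes, and with it the second.\<close>
  have TU: "p = U (radj U p)" if p: "p \<in> T" for p
  proof -
    let ?q = "p - U (radj U p)"
    have q: "?q \<in> T" using p UT sub subspace_diff by blast
    have "?q \<bullet> U x = 0" for x
      using radj[of U x ?q] UU by (simp add: blinfun.diff_right inner_commute)
    then have o: "?q \<bullet> (res x, resT x) = 0" for x using Ur by metis
    obtain q1 q2 where q12: "?q = (q1, q2)" by (cases ?q)
    have "x \<bullet> q1 = 0" for x
      using res_inner[of q1 q2 x] q o[of x] unfolding q12 by (simp add: inner_commute)
    then have "q1 = 0" by (metis inner_eq_zero_iff)
    then have "?q = 0" using q zero_image unfolding q12 by (auto simp: zero_prod_def)
    then show ?thesis by simp
  qed
  have sU: "norm (snd (U x)) \<le> norm x" for x
    using norm_snd_le[of "snd (U x)" "fst (U x)"] nU[of x] by simp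
  have "\<exists>V. blinfun_apply V = (\<lambda>x. snd (U x))"
    by (rule blinfun_exists[where K = 1]) (simp_all add: blinfun.bilinear_simps sU)
  then obtain V :: "'a \<Rightarrow>\<^sub>L 'a" where V: "\<And>x. V x = snd (U x)" by metis
  have Ue: "U z = (rt z, V z)" for z using fU V by (auto simp: prod_eq_iff)
  have "T = range (\<lambda>z. (rt z, V z))" using UT TU Ue by (metis (no_types, lifting) image_iff rangeI subsetI subset_antisym image_subset_iff)
  moreover have "V x \<bullet> V y = (x - res x) \<bullet> y" for x y
  proof -
    have "x \<bullet> y = U x \<bullet> U y" using UU[of y] radj[of U x "U y"] by simp
    also have "\<dots> = rt x \<bullet> rt y + V x \<bullet> V y" by (simp add: Ue)
    also have "rt x \<bullet> rt y = res x \<bullet> y" using psdD(2)[OF rt(1), of "rt x" y] rt(2) by simp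
    finally show ?thesis by (simp add: inner_diff_left)
  qed
  ultimately show ?thesis by blast
qed

text \<open>This is T (1 + T*T)^{-1/2}, so that T takes \<open>rt z\<close> to
  \<open>par z\<close>.\<close>

definition par :: "'a \<Rightarrow>\<^sub>L 'a" where
  "par = (SOME V::'a \<Rightarrow>\<^sub>L 'a. T = range (\<lambda>z. (rt z, V z)) \<and> (\<forall>x y. V x \<bullet> V y = (x - res x) \<bullet> y))"

lemma par: "T = range (\<lambda>z. (rt z, par z))" "par x \<bullet> par y = (x - res x) \<bullet> y"
  unfolding par_def using someI_ex[OF param_exists] by blast+

lemma memE:
  assumes "(x, y) \<in> T" obtains z where "x = rt z" "y = par z"
  using assms par(1) by (metis (no_types, lifting) Pair_inject imageE)

lemma par_mem: "(rt z, par z) \<in> T"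
  using par(1) by blast

subsection \<open>The spectral family of the modulus\<close>

text \<open>The projection \<open>\<chi>\<^bsub>[0,s]\<^esub>(|T|)\<close> is the spectral projection of \<open>res = (1 + T\<^sup>*T)\<^sup>-\<^sup>1\<close> for
  \<open>[1/(1 + s\<^sup>2), 1]\<close>, so only bounded operators are needed to construct it.\<close>

definition is_specproj :: "real \<Rightarrow> ('a \<Rightarrow>\<^sub>L 'a) \<Rightarrow> bool" where
  "is_specproj s P \<longleftrightarrow> ortho_proj P \<and> (\<forall>Z. commute Z res \<longrightarrow> commute Z P) \<and>
     (\<forall>x. P x = x \<longrightarrow> (norm x)\<^sup>2 / (1 + s\<^sup>2) \<le> res x \<bullet> x) \<and>
     (\<forall>x. P x = 0 \<longrightarrow> x \<noteq> 0 \<longrightarrow> res x \<bullet> x < (norm x)\<^sup>2 / (1 + s\<^sup>2))"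

definition specfam :: "real \<Rightarrow> 'a \<Rightarrow>\<^sub>L 'a" where
  "specfam s = (if s < 0 then 0 else Eps (is_specproj s))"

lemma specfam_neg: "s < 0 \<Longrightarrow> specfam s = 0"
  by (simp add: specfam_def)

lemma specfam_aux:
  assumes "0 \<le> s"
  shows "ortho_proj (specfam s)" "commute Z res \<Longrightarrow> commute Z (specfam s)"
    "specfam s x = x \<Longrightarrow> (norm x)\<^sup>2 / (1 + s\<^sup>2) \<le> res x \<bullet> x"
    "specfam s x = 0 \<Longrightarrow> x \<noteq> 0 \<Longrightarrow> res x \<bullet> x < (norm x)\<^sup>2 / (1 + s\<^sup>2)"
proof -
  let ?l = "1 / (1 + s\<^sup>2)"
  let ?X = "res - ?l *\<^sub>R id_blinfun"
  have Xx: "?X x = res x - ?l *\<^sub>R x" for x by (simp add: blinfun.bilinear_simps)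
  have "self_adj ?X"
    unfolding self_adj_def Xx using psdD(2)[OF res_psd] by (simp add: inner_diff_left inner_diff_right)
  from spectral_split_exists[OF this] obtain P where P: "ortho_proj P"
    "\<forall>Z. commute Z ?X \<longrightarrow> commute Z P" "\<forall>x. P x = x \<longrightarrow> 0 \<le> ?X x \<bullet> x"
    "\<forall>x. P x = 0 \<longrightarrow> x \<noteq> 0 \<longrightarrow> ?X x \<bullet> x < 0" by (elim exE conjE)
  have c: "commute Z ?X" if "commute Z res" for Z
    using that unfolding commute_iff Xx by (simp add: blinfun.bilinear_simps)
  have i: "?X x \<bullet> x = res x \<bullet> x - (norm x)\<^sup>2 / (1 + s\<^sup>2)" for x
    by (simp add: Xx inner_diff_left power2_norm_eq_inner)
  have "is_specproj s P" unfolding is_specproj_def using P c by (simp add: i)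
  then have "is_specproj s (specfam s)" using assms by (simp add: specfam_def someI)
  then show "ortho_proj (specfam s)" "commute Z res \<Longrightarrow> commute Z (specfam s)"
    "specfam s x = x \<Longrightarrow> (norm x)\<^sup>2 / (1 + s\<^sup>2) \<le> res x \<bullet> x"
    "specfam s x = 0 \<Longrightarrow> x \<noteq> 0 \<Longrightarrow> res x \<bullet> x < (norm x)\<^sup>2 / (1 + s\<^sup>2)"
    by (simp_all add: is_specproj_def)
qed

lemma specfam_proj: "ortho_proj (specfam s)"
  by (cases "s < 0") (simp add: specfam_neg ortho_proj_def self_adj_def, simp add: specfam_aux(1))

lemma specfam_commute: "commute Z res \<Longrightarrow> commute Z (specfam s)"
  by (cases "s < 0") (simp add: specfam_neg commute_iff, simp add: specfam_aux(2))

lemma specfam_comm_res: "specfam s (res x) = res (specfam s x)"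
  using specfam_commute[of res s] by (simp add: commute_iff)

lemma specfam_comm: "specfam s (specfam t x) = specfam t (specfam s x)"
  using specfam_commute[of "specfam s" t] specfam_comm_res[of s] by (simp add: commute_iff)

text \<open>A nonzero vector in the range for s but annihilated for t would have a form value of
  \<open>res\<close> both at least 1/(1 + s^2) and less than 1/(1 + t^2) times its squared
  norm.\<close>

lemma specfam_mono:
  assumes "s \<le> t" shows "specfam t (specfam s x) = specfam s x"
proof (cases "s < 0")
  case False
  let ?y = "specfam s x - specfam t (specfam s x)"
  have 1: "specfam s ?y = ?y"
    using ortho_projD(1)[OF specfam_proj] specfam_comm by (simp add: blinfun.diff_right)
  have 2: "specfam t ?y = 0"
    using ortho_projD(1)[OF specfam_proj] by (simp add: blinfun.diff_right)
  have "?y = 0"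
  proof (rule ccontr)
    assume "?y \<noteq> 0"
    then have "res ?y \<bullet> ?y < (norm ?y)\<^sup>2 / (1 + t\<^sup>2)" using specfam_aux(4)[OF _ 2] False assms by simp
    also have "\<dots> \<le> (norm ?y)\<^sup>2 / (1 + s\<^sup>2)"
      using False assms by (intro divide_left_mono add_left_mono power_mono mult_pos_pos add_pos_nonneg) auto
    also have "\<dots> \<le> res ?y \<bullet> ?y" using specfam_aux(3)[OF _ 1] False by simp
    finally show False by simp
  qed
  then show ?thesis by simp
qed (simp add: specfam_neg)

text \<open>On the range of the projection \<open>res\<close> is bounded below, hence surjective, so
  x = \<open>res z\<close> lies in the domain with image \<open>resT z\<close>. The norm bound comes
  from |resT z|^2 = <res z, z> - |res z|^2 and from res^2 >= res/(1 + s^2) on this range.\<close>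

lemma specfam_in_domain:
  assumes s: "0 \<le> s" and x: "specfam s x = x"
  shows "\<exists>y. (x, y) \<in> T \<and> norm y \<le> s * norm x"
proof -
  let ?G = "specfam s"
  let ?l = "1 / (1 + s\<^sup>2)"
  note G = specfam_proj[of s]
  have l: "?l > 0" "?l \<le> 1" by (auto simp: add_pos_nonneg)
  have below: "?l * (norm (?G z))\<^sup>2 \<le> res (?G z) \<bullet> ?G z" for z
    using specfam_aux(3)[OF s ortho_projD(1)[OF G], of z] by simp
  \<comment> \<open>Equal to \<open>res\<close> on the range of the projection and to 1 on its
    complement, which makes it bounded below on the whole space.\<close>
  define A where "A = (res o\<^sub>L ?G) + (id_blinfun - ?G)"
  have Ax: "A z = res (?G z) + (z - ?G z)" for z by (simp add: A_def blinfun.bilinear_simps)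
  have rG: "res (?G z) \<bullet> w = res (?G z) \<bullet> ?G w" for z w
    using ortho_projD[OF G] specfam_comm_res by metis
  have A1: "A z \<bullet> z = res (?G z) \<bullet> ?G z + (norm (z - ?G z))\<^sup>2" for z
    using rG ortho_projD(5)[OF G, of z z] by (simp add: Ax inner_add_left power2_norm_eq_inner inner_diff_right)
  have A2: "?l * (norm z)\<^sup>2 \<le> A z \<bullet> z" for z
  proof -
    have "?l * (norm (z - ?G z))\<^sup>2 \<le> 1 * (norm (z - ?G z))\<^sup>2" using l(2) by (intro mult_right_mono) auto
    then show ?thesis using below[of z] unfolding A1 ortho_projD(6)[OF G, of z] distrib_left by linarith
  qed
  have "psd A" unfolding psd_def
  proof
    show "self_adj A" unfolding self_adj_def Ax
      using ortho_projD(2)[OF G] psdD(2)[OF res_psd] specfam_comm_res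
      by (simp add: inner_add_left inner_add_right inner_diff_left inner_diff_right)
    show "\<forall>x. 0 \<le> A x \<bullet> x" using A1 psdD(1)[OF res_psd] by simp
  qed
  from psd_bounded_below_surj[OF this l(1) A2, of x] obtain w where w: "A w = x" by blast
  let ?z = "?G w"
  have Gz: "?G ?z = ?z" using ortho_projD(1)[OF G] .
  have xz: "x = res ?z"
  proof -
    have "x = ?G (A w)" using x w by simp
    also have "\<dots> = res ?z" using Gz specfam_comm_res by (simp add: Ax blinfun.bilinear_simps)
    finally show ?thesis .
  qed
  have "(res - ?l *\<^sub>R id_blinfun) v = res v - ?l *\<^sub>R v" for v by (simp add: blinfun.bilinear_simps)
  note X = this
  \<comment> \<open>The compression of \<open>res\<close> - l; it is positive and commutes with
    \<open>res\<close>, so the product with \<open>res\<close> is positive too. This is res^2 >= l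
    res on the range.\<close>
  let ?X = "?G o\<^sub>L ((res - ?l *\<^sub>R id_blinfun) o\<^sub>L ?G)"
  have Xv: "?X v = res (?G v) - ?l *\<^sub>R ?G v" for v
    using ortho_projD(1)[OF G] specfam_comm_res by (simp add: X blinfun.bilinear_simps)
  have "psd ?X" unfolding psd_def
  proof
    show "self_adj ?X" unfolding self_adj_def Xv
      using ortho_projD(2)[OF G] psdD(2)[OF res_psd] specfam_comm_res by (simp add: inner_diff_left inner_diff_right)
    show "\<forall>v. 0 \<le> ?X v \<bullet> v" unfolding Xv using below rG ortho_projD(3)[OF G] by (simp add: inner_diff_left)
  qed
  moreover have "commute res ?X" unfolding commute_iff Xv using specfam_comm_res by (simp add: blinfun.bilinear_simps)
  ultimately have "psd (res o\<^sub>L ?X)" using res_psd psd_commute_mult by blast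
  from psdD(1)[OF this, of ?z] have "0 \<le> res (res ?z) \<bullet> ?z - ?l * (res ?z \<bullet> ?z)"
    using Xv[of ?z] Gz by (simp add: blinfun.bilinear_simps inner_diff_left)
  then have "?l * (res ?z \<bullet> ?z) \<le> (norm x)\<^sup>2"
    using psdD(2)[OF res_psd, of "res ?z" ?z] xz by (simp add: power2_norm_eq_inner)
  then have 1: "res ?z \<bullet> ?z \<le> (1 + s\<^sup>2) * (norm x)\<^sup>2" using l(1)
    by (simp add: divide_le_eq mult.commute add_pos_nonneg split: if_splits)
  have "(norm (resT ?z))\<^sup>2 \<le> (s * norm x)\<^sup>2"
  proof -
    have "(norm (resT ?z))\<^sup>2 = res ?z \<bullet> ?z - (norm x)\<^sup>2"
      unfolding xz using res_inner_self[of ?z ?z] by (simp only: power2_norm_eq_inner)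
    then show ?thesis using 1 unfolding power_mult_distrib distrib_right by linarith
  qed
  then have "norm (resT ?z) \<le> s * norm x" by (rule power2_le_imp_le) (use s in simp)
  then show ?thesis using res_mem[of ?z] xz by auto
qed

text \<open>Two Cauchy-Schwarz inequalities, b^2 <= c n for \<open>res x\<close> against x and (n -
  b)^2 <= (b - c)|y|^2 for \<open>resT x\<close> against y, combine to n (n - b) <= b |y|^2 by
  elimination of c; then b (1 + s^2) < n gives the claim.\<close>

lemma specfam_compl_gt:
  assumes s: "0 \<le> s" and xy: "(x, y) \<in> T" and x: "specfam s x = 0" "x \<noteq> 0"
  shows "s * norm x < norm y"
proof -
  define n b c where "n = (norm x)\<^sup>2" and "b = res x \<bullet> x" and "c = (norm (res x))\<^sup>2"
  have n: "n > 0" using x by (simp add: n_def)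
  have b: "0 \<le> b" "b < n / (1 + s\<^sup>2)"
    using specfam_aux(4)[OF s x] psdD(1)[OF res_psd] by (auto simp: b_def n_def)
  have "n / (1 + s\<^sup>2) \<le> n / 1" using n by (intro divide_left_mono) (auto simp: add_pos_nonneg)
  then have bn: "b < n" using b by simp
  have e: "resT x \<bullet> y = n - b" using res_inner[OF xy, of x] by (simp add: n_def b_def power2_norm_eq_inner)
  have f: "(norm (resT x))\<^sup>2 = b - c"
    using res_inner_self[of x x] by (simp add: b_def c_def power2_norm_eq_inner)
  have "b\<^sup>2 \<le> c * n" using Cauchy_Schwarz_ineq[of "res x" x] by (simp add: b_def c_def n_def power2_norm_eq_inner)
  then have g: "n * (b - c) \<le> b * (n - b)" by (simp add: algebra_simps power2_eq_square)
  have "(n - b)\<^sup>2 \<le> (b - c) * (norm y)\<^sup>2"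
    using Cauchy_Schwarz_ineq[of "resT x" y] e f by (simp add: power2_norm_eq_inner)
  then have "n * (n - b)\<^sup>2 \<le> (n * (b - c)) * (norm y)\<^sup>2" using n by (simp add: mult.assoc)
  also have "\<dots> \<le> b * (n - b) * (norm y)\<^sup>2" using g by (intro mult_right_mono) auto
  finally have "(n - b) * (n * (n - b)) \<le> (n - b) * (b * (norm y)\<^sup>2)"
    by (simp add: power2_eq_square mult_ac)
  then have h: "n * (n - b) \<le> b * (norm y)\<^sup>2" using bn by simp
  then have b0: "b > 0" using b(1) mult_pos_pos[OF n n] by (cases "b = 0") auto
  have "b * (1 + s\<^sup>2) < n" using b(2) by (simp add: field_simps add_pos_nonneg)
  then have "n * (b * s\<^sup>2) < n * (n - b)" using n by (intro mult_strict_left_mono) (simp_all add: algebra_simps)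
  then have "b * (n * s\<^sup>2) < b * (norm y)\<^sup>2" using h by (simp add: mult_ac)
  then have "(s * norm x)\<^sup>2 < (norm y)\<^sup>2" using b0 by (simp add: n_def power_mult_distrib mult.commute)
  then show ?thesis by (rule power2_less_imp_less) simp
qed

text \<open>The projections between s and s + 1/(n+1) decrease to a limit. A nonzero vector fixed by
  all of them satisfies the lower bound on \<open>res\<close> for every n, hence for s, against the
  strict upper bound outside the range for s.\<close>

lemma specfam_right_cont: "(\<lambda>n. specfam (s + 1 / real (Suc n)) x) \<longlonglongrightarrow> specfam s x"
proof (cases "s < 0")
  case True
  have "(\<lambda>n. s + 1 / real (Suc n)) \<longlonglongrightarrow> s + 0"
    by (intro tendsto_intros lim_inverse_Suc)
  then have "\<forall>\<^sub>F n in sequentially. s + 1 / real (Suc n) < 0" using True order_tendstoD(2) by fastforce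
  then have "\<forall>\<^sub>F n in sequentially. specfam (s + 1 / real (Suc n)) x = specfam s x"
    by eventually_elim (simp add: specfam_neg True)
  then show ?thesis by (rule tendsto_eventually)
next
  case False
  let ?s = "\<lambda>n. s + 1 / real (Suc n)"
  let ?P = "\<lambda>n. specfam (?s n) - specfam s"
  have s0: "0 \<le> ?s n" "s \<le> ?s n" for n using False by auto
  have anti: "?s n \<le> ?s m" if "m \<le> n" for m n using that by (simp add: frac_le)
  note idem = ortho_projD(1)[OF specfam_proj]
  have m1: "specfam (?s n) (specfam s x) = specfam s x" "specfam s (specfam (?s n) x) = specfam s x" for n x
    using specfam_mono[OF s0(2)] specfam_comm by auto
  have P: "ortho_proj (?P n)" for n
    unfolding ortho_proj_def self_adj_def
    using ortho_projD(1,2)[OF specfam_proj] m1[of n] by (simp add: blinfun.bilinear_simps inner_diff_left inner_diff_right)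
  have dec: "?P m (?P n x) = ?P n x" if "m \<le> n" for m n x
    using specfam_mono[OF anti[OF that], of x] m1 idem by (simp add: blinfun.bilinear_simps)
  obtain D :: "'a \<Rightarrow>\<^sub>L 'a" where D: "\<And>x. (\<lambda>n. ?P n x) \<longlonglongrightarrow> D x" using decseq_proj_limit[of ?P, OF P dec] by blast
  have "D x = 0"
  proof (rule ccontr)
    assume nz: "D x \<noteq> 0"
    have Dm: "?P m (D x) = D x" for m
    proof (rule LIMSEQ_unique)
      show "(\<lambda>n. ?P m (?P n x)) \<longlonglongrightarrow> ?P m (D x)" by (intro blinfun.tendsto tendsto_const D)
      show "(\<lambda>n. ?P m (?P n x)) \<longlonglongrightarrow> D x"
        by (rule Lim_transform_eventually[OF D[of x]])
           (use dec in \<open>auto intro!: eventually_sequentiallyI[of m]\<close>)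
    qed
    have y0: "specfam s (D x) = 0"
    proof -
      have "specfam s (?P 0 (D x)) = 0" unfolding blinfun.diff_left blinfun.diff_right m1 idem by simp
      then show ?thesis using Dm[of 0] by simp
    qed
    have ym: "specfam (?s m) (D x) = D x" for m using Dm[of m] y0 by (simp add: blinfun.diff_left)
    have lim: "(\<lambda>n. (norm (D x))\<^sup>2 / (1 + (?s n)\<^sup>2)) \<longlonglongrightarrow> (norm (D x))\<^sup>2 / (1 + (s + 0)\<^sup>2)"
      by (intro tendsto_intros lim_inverse_Suc) (use add_pos_nonneg[of 1 "s\<^sup>2"] in simp)
    have "(norm (D x))\<^sup>2 / (1 + (s + 0)\<^sup>2) \<le> res (D x) \<bullet> D x"
      by (rule LIMSEQ_le_const2[OF lim]) (use specfam_aux(3)[OF s0(1) ym] in blast)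
    then show False using specfam_aux(4)[OF _ y0 nz] False by simp
  qed
  then have "(\<lambda>n. ?P n x + specfam s x) \<longlonglongrightarrow> 0 + specfam s x"
    using D[of x] by (intro tendsto_intros) simp
  then show ?thesis by (simp add: blinfun.diff_left)
qed

text \<open>A nonzero vector annihilated by all projections would have form value at most 0 under
  the injective positive operator \<open>res\<close>.\<close>

lemma specfam_at_top: "(\<lambda>n. specfam (real n) x) \<longlonglongrightarrow> x"
proof -
  let ?P = "\<lambda>n. id_blinfun - specfam (real n)"
  note idem = ortho_projD(1)[OF specfam_proj]
  have P: "ortho_proj (?P n)" for n
    unfolding ortho_proj_def self_adj_def
    using ortho_projD(1,2)[OF specfam_proj] by (simp add: blinfun.bilinear_simps inner_diff_left inner_diff_right)
  have dec: "?P m (?P n x) = ?P n x" if "m \<le> n" for m n x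
  proof -
    have "specfam (real m) (specfam (real n) x) = specfam (real m) x"
      using specfam_mono[of "real m" "real n" x] specfam_comm that by simp
    then show ?thesis by (simp add: blinfun.bilinear_simps)
  qed
  obtain D :: "'a \<Rightarrow>\<^sub>L 'a" where D: "\<And>x. (\<lambda>n. ?P n x) \<longlonglongrightarrow> D x" using decseq_proj_limit[of ?P, OF P dec] by blast
  have "D x = 0"
  proof (rule ccontr)
    assume nz: "D x \<noteq> 0"
    have y: "specfam (real m) (D x) = 0" for m
    proof -
      have "?P m (D x) = D x"
      proof (rule LIMSEQ_unique)
        show "(\<lambda>n. ?P m (?P n x)) \<longlonglongrightarrow> ?P m (D x)" by (intro blinfun.tendsto tendsto_const D)
        show "(\<lambda>n. ?P m (?P n x)) \<longlonglongrightarrow> D x"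
          by (rule Lim_transform_eventually[OF D[of x]])
             (use dec in \<open>auto intro!: eventually_sequentiallyI[of m]\<close>)
      qed
      then show ?thesis by (simp add: blinfun.diff_left)
    qed
    have lim: "(\<lambda>n. (norm (D x))\<^sup>2 / (1 + (real n)\<^sup>2)) \<longlonglongrightarrow> 0"
      by (intro tendsto_divide_0[OF tendsto_const] filterlim_at_top_imp_at_infinity
          filterlim_tendsto_add_at_top[OF tendsto_const] filterlim_pow_at_top filterlim_real_sequentially) simp
    have "res (D x) \<bullet> D x \<le> 0"
      by (rule LIMSEQ_le_const[OF lim]) (use specfam_aux(4)[OF _ y nz] in \<open>auto intro: less_imp_le\<close>)
    then have "res (D x) \<bullet> D x = 0" using psdD(1)[OF res_psd, of "D x"] by simp
    then show False using psd_inner_zero[OF res_psd] res_inj nz by blast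
  qed
  then have "(\<lambda>n. x - ?P n x) \<longlonglongrightarrow> x - 0"
    using D[of x] by (intro tendsto_intros) simp
  then show ?thesis by (simp add: blinfun.diff_left)
qed

end

section \<open>Projection-valued measures\<close>

lemma ortho_proj_zero_mult:
  assumes "ortho_proj P" "ortho_proj Q" "\<And>x. P (Q x) = 0" shows "Q (P x) = 0"
proof -
  have "Q (P x) \<bullet> Q (P x) = P x \<bullet> Q (P x)" using ortho_projD(1,2)[OF assms(2)] by metis
  also have "\<dots> = 0" using ortho_projD(2)[OF assms(1)] assms(3) by (metis inner_zero_right)
  finally show ?thesis by simp
qed

lemma ortho_proj_sum:
  assumes "finite I" "\<And>i. i \<in> I \<Longrightarrow> ortho_proj (P i)"
    and "\<And>i j x. i \<in> I \<Longrightarrow> j \<in> I \<Longrightarrow> i \<noteq> j \<Longrightarrow> P i (P j x) = 0"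
  shows "ortho_proj (\<Sum>i\<in>I. P i)"
  using assms
proof (induction I rule: finite_induct)
  case empty
  then show ?case by (simp add: ortho_proj_def self_adj_def)
next
  case (insert i I)
  define S where "S = (\<Sum>i\<in>I. P i)"
  have S: "ortho_proj S" unfolding S_def using insert by auto
  have 1: "P i (S x) = 0" for x
    using insert by (simp add: S_def blinfun.sum_left blinfun.sum_right) (metis (mono_tags, lifting) sum.neutral)
  have Pi: "ortho_proj (P i)" using insert by blast
  have 2: "S (P i x) = 0" for x
    using ortho_proj_zero_mult[OF Pi S 1] .
  have "ortho_proj (P i + S)"
    unfolding ortho_proj_def self_adj_def
    using ortho_projD(1,2)[OF Pi] ortho_projD(1,2)[OF S] 1 2
    by (simp add: blinfun.bilinear_simps inner_add_left inner_add_right)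
  then show ?case using insert by (simp add: S_def)
qed

lemma proj_suminf_exists:
  fixes P :: "nat \<Rightarrow> 'a::{real_inner,banach} \<Rightarrow>\<^sub>L 'a"
  assumes P: "\<And>i. ortho_proj (P i)" and orth: "\<And>i j x. i \<noteq> j \<Longrightarrow> P i (P j x) = 0"
  shows "\<exists>Y. ortho_proj Y \<and> (\<forall>x. (\<lambda>i. P i x) sums Y x) \<and>
    (\<forall>Z. (\<forall>i. commute Z (P i)) \<longrightarrow> commute Z Y)"
proof -
  let ?S = "\<lambda>n. \<Sum>i<n. P i"
  have S: "ortho_proj (?S n)" for n using P orth by (intro ortho_proj_sum) auto
  have 1: "self_adj (?S n)" for n using S by (auto simp: ortho_proj_def)
  have 2: "?S n x \<bullet> x \<le> ?S (Suc n) x \<bullet> x" for n x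
    using psdD(1)[OF psd_ortho_proj[OF P], of n x] by (simp add: blinfun.bilinear_simps inner_add_left)
  have 3: "?S n x \<bullet> x \<le> 1 * (norm x)\<^sup>2" for n x
    using ortho_projD(3,4)[OF S, of n x] by (simp add: power_mono)
  have 4: "norm (?S n) \<le> 1" for n using ortho_projD(4)[OF S] by (intro norm_blinfun_bound) auto
  obtain Y where Y: "self_adj Y" "\<And>x. (\<lambda>n. ?S n x) \<longlonglongrightarrow> Y x"
    using incseq_strong_limit[of ?S, OF 1 2 3 4] by blast
  have sums: "(\<lambda>i. P i x) sums Y x" for x using Y(2)[of x] by (simp add: sums_def blinfun.sum_left)
  have PY: "P i (Y x) = P i x" for i x
  proof (rule LIMSEQ_unique)
    show "(\<lambda>n. P i (?S n x)) \<longlonglongrightarrow> P i (Y x)" by (intro blinfun.tendsto tendsto_const Y)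
    have "P i (?S n x) = P i x" if "n > i" for n
    proof -
      have "P i (?S n x) = (\<Sum>j<n. P i (P j x))" by (simp add: blinfun.sum_left blinfun.sum_right)
      also have "\<dots> = (\<Sum>j<n. if j = i then P i x else 0)"
        using orth ortho_projD(1)[OF P] by (intro sum.cong) auto
      finally show ?thesis using that by simp
    qed
    then show "(\<lambda>n. P i (?S n x)) \<longlonglongrightarrow> P i x"
      by (intro tendsto_eventually eventually_sequentiallyI[of "Suc i"]) auto
  qed
  have "Y (Y x) = Y x" for x
    using sums_unique2[OF sums[of "Y x"]] sums[of x] by (simp add: PY)
  then have "ortho_proj Y" using Y(1) by (simp add: ortho_proj_def)
  moreover have "commute Z Y" if "\<forall>i. commute Z (P i)" for Z
    unfolding commute_iff
  proof
    fix x
    have "(\<lambda>i. Z (P i x)) sums Z (Y x)" using bounded_linear.sums[OF blinfun.bounded_linear_right sums] .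
    moreover have "(\<lambda>i. Z (P i x)) = (\<lambda>i. P i (Z x))" using that by (auto simp: commute_iff)
    ultimately show "Z (Y x) = Y (Z x)" using sums_unique2 sums[of "Z x"] by metis
  qed
  ultimately show ?thesis using sums by blast
qed

text \<open>The part of \<open>proj_valued_measure\<close> that involves the real structure only;
  \<open>proj_valued_measure_iff\<close> adds complex linearity of the values.\<close>

locale pvm =
  fixes E :: "real set \<Rightarrow> 'a::{real_inner,banach} \<Rightarrow>\<^sub>L 'a"
  assumes proj: "A \<in> sets borel \<Longrightarrow> ortho_proj (E A)"
    and total: "E UNIV = id_blinfun"
    and countably_add: "range F \<subseteq> sets borel \<Longrightarrow> disjoint_family F \<Longrightarrow> (\<lambda>n::nat. E (F n) x) sums E (\<Union>n. F n) x"
begin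

definition vm :: "'a \<Rightarrow> real measure" where
  "vm x = measure_of UNIV (sets borel) (\<lambda>B. ennreal (E B x \<bullet> x))"

lemma empty [simp]: "E {} = 0"
proof (rule blinfun_eqI)
  fix x
  have "(\<lambda>n::nat. E {} x) sums E {} x" using countably_add[of "\<lambda>_. {}" x] by (simp add: disjoint_family_on_def)
  then have "(\<lambda>n::nat. E {} x) \<longlonglongrightarrow> 0" by (intro summable_LIMSEQ_zero sums_summable)
  then have "E {} x = 0" by (simp add: LIMSEQ_const_iff)
  then show "E {} x = (0 :: 'a \<Rightarrow>\<^sub>L 'a) x" by simp
qed

lemma E_nonneg: "A \<in> sets borel \<Longrightarrow> 0 \<le> E A x \<bullet> x"
  using ortho_projD(3)[OF proj] by simp

lemma sets_vm [simp, measurable_cong]: "sets (vm x) = sets borel"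
  by (simp add: vm_def sets.sigma_sets_eq[of borel, simplified])

lemma space_vm [simp]: "space (vm x) = UNIV"
  by (simp add: vm_def space_measure_of_conv)

lemma emeasure_vm: "A \<in> sets borel \<Longrightarrow> emeasure (vm x) A = ennreal (E A x \<bullet> x)"
  unfolding vm_def
proof (rule emeasure_measure_of_sigma)
  show "sigma_algebra UNIV (sets borel)" by (metis sets.sigma_algebra_axioms space_borel)
  show "positive (sets borel) (\<lambda>B. ennreal (E B x \<bullet> x))" by (simp add: positive_def)
  show "countably_additive (sets borel) (\<lambda>B. ennreal (E B x \<bullet> x))"
  proof (rule countably_additiveI)
    fix A :: "nat \<Rightarrow> real set" assume A: "range A \<subseteq> sets borel" "disjoint_family A"
    have "(\<lambda>n. E (A n) x \<bullet> x) sums (E (\<Union>n. A n) x \<bullet> x)"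
      using bounded_linear.sums[OF bounded_linear_inner_left countably_add[OF A]] .
    then show "(\<Sum>n. ennreal (E (A n) x \<bullet> x)) = ennreal (E (\<Union>n. A n) x \<bullet> x)"
      using A E_nonneg by (intro suminf_ennreal_eq) auto
  qed
qed

lemma emeasure_vm_norm: "A \<in> sets borel \<Longrightarrow> emeasure (vm x) A = ennreal ((norm (E A x))\<^sup>2)"
  using emeasure_vm ortho_projD(3)[OF proj] by simp

lemma emeasure_vm_UNIV: "emeasure (vm x) UNIV = ennreal ((norm x)\<^sup>2)"
  using emeasure_vm_norm[of UNIV x] by (simp add: total)

lemma finite_measure_vm: "finite_measure (vm x)"
  by (rule finite_measureI) (simp add: emeasure_vm_UNIV)

lemma union:
  assumes "A \<in> sets borel" "B \<in> sets borel" "A \<inter> B = {}"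
  shows "E (A \<union> B) x = E A x + E B x"
proof -
  have "(\<lambda>n. E (binaryset A B n) x) sums E (\<Union>n. binaryset A B n) x"
    using assms by (intro countably_add) (auto simp: range_binaryset_eq disjoint_family_on_def binaryset_def)
  moreover have "(\<lambda>n. E (binaryset A B n) x) sums (E A x + E B x)"
    using binaryset_sums[of "\<lambda>A. E A x" A B] by simp
  ultimately show ?thesis using sums_unique2 by (metis UN_binaryset_eq)
qed

text \<open>Multiplicativity follows from additivity: E B = E A + E (B - A) is a contraction, so E
  (B - A) has to vanish on the range of E A.\<close>

lemma mono:
  assumes "A \<in> sets borel" "B \<in> sets borel" "A \<subseteq> B"
  shows "E A (E B x) = E A x" "E B (E A x) = E A x"
proof -
  have B: "E B x = E A x + E (B - A) x" for x using union[of A "B - A" x] assms by (simp add: Un_absorb1)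
  have "norm (E (B - A) (E A x)) ^ 2 = 0" for x
  proof -
    have "E B (E A x) \<bullet> E A x \<le> E A x \<bullet> E A x"
      using ortho_projD(3,4)[OF proj[OF assms(2)], of "E A x"] by (simp add: power2_norm_eq_inner[symmetric] power_mono)
    moreover have "E B (E A x) \<bullet> E A x = E A x \<bullet> E A x + E (B - A) (E A x) \<bullet> E A x"
      unfolding B[of "E A x"] using ortho_projD(1)[OF proj[OF assms(1)]] by (simp add: inner_add_left)
    moreover have "E (B - A) (E A x) \<bullet> E A x = norm (E (B - A) (E A x)) ^ 2"
      using ortho_projD(3)[OF proj] assms by blast
    ultimately show ?thesis by (smt (verit) zero_le_power2)
  qed
  then have 0: "E (B - A) (E A x) = 0" for x by simp
  then show "E B (E A x) = E A x" unfolding B[of "E A x"] using ortho_projD(1)[OF proj[OF assms(1)]] by simp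
  have "E A (E (B - A) x) = 0" for x
    using ortho_proj_zero_mult[OF proj proj 0] assms by blast
  then show "E A (E B x) = E A x" unfolding B[of x] using ortho_projD(1)[OF proj[OF assms(1)]] by (simp add: blinfun.add_right)
qed

lemma disjoint_zero:
  assumes "A \<in> sets borel" "B \<in> sets borel" "A \<inter> B = {}" shows "E A (E B x) = 0"
  using mono(1)[of A "A \<union> B" x] union[of A B x] assms ortho_projD(1)[OF proj[OF assms(1)]]
  by (simp add: blinfun.add_right)

lemma inter:
  assumes "A \<in> sets borel" "B \<in> sets borel" shows "E (A \<inter> B) x = E A (E B x)"
proof -
  have "E B x = E (A \<inter> B) x + E (B - A) x"
  proof -
    have "A \<inter> B \<union> (B - A) = B" "A \<inter> B \<inter> (B - A) = {}" by blast+
    then show ?thesis using union[of "A \<inter> B" "B - A" x] assms by simp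
  qed
  then show ?thesis using mono(2)[of "A \<inter> B" A x] disjoint_zero[of A "B - A" x] assms
    by (auto simp: blinfun.add_right)
qed

lemma compl: "A \<in> sets borel \<Longrightarrow> E (- A) x = x - E A x"
  using union[of A "- A" x] by (simp add: total algebra_simps)

lemma E_comm: "A \<in> sets borel \<Longrightarrow> B \<in> sets borel \<Longrightarrow> E A (E B x) = E B (E A x)"
  by (metis inter Int_commute)

lemma incseq_lim:
  assumes "range A \<subseteq> sets borel" "incseq A"
  shows "(\<lambda>n. E (A n) x) \<longlonglongrightarrow> E (\<Union>n. A n) x"
proof -
  have d: "range (disjointed A) \<subseteq> sets borel" using assms(1) by (rule sets.range_disjointed_sets)
  have "(\<Sum>i<Suc n. E (disjointed A i) x) = E (A n) x" for n
  proof (induction n)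
    case 0 show ?case by (simp add: disjointed_def)
  next
    case (Suc n)
    have "disjointed A (Suc n) = A (Suc n) - A n" using disjointed_mono[OF assms(2)] by simp
    moreover have "E (A n \<union> (A (Suc n) - A n)) x = E (A n) x + E (A (Suc n) - A n) x"
      using assms(1) by (intro union) auto
    moreover have "A n \<union> (A (Suc n) - A n) = A (Suc n)" using incseqD[OF assms(2), of n "Suc n"] by auto
    ultimately show ?case using Suc by simp
  qed
  moreover have "(\<lambda>i. E (disjointed A i) x) sums E (\<Union>n. disjointed A n) x"
    using d by (intro countably_add disjoint_family_disjointed)
  ultimately show ?thesis
    using LIMSEQ_Suc by (fastforce simp: sums_def UN_disjointed_eq)
qed

lemma emeasure_vm_E: "A \<in> sets borel \<Longrightarrow> B \<in> sets borel \<Longrightarrow> emeasure (vm (E A x)) B = emeasure (vm x) (A \<inter> B)"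
  by (metis emeasure_vm_norm inter E_comm sets.Int)

lemma vm_E: "A \<in> sets borel \<Longrightarrow> vm (E A x) = density (vm x) (indicator A)"
proof (rule measure_eqI)
  fix B assume A: "A \<in> sets borel" and "B \<in> sets (vm (E A x))"
  then have B: "B \<in> sets borel" by simp
  have "emeasure (density (vm x) (indicator A)) B = (\<integral>\<^sup>+y. indicator A y * indicator B y \<partial>vm x)"
    using A B by (simp add: emeasure_density)
  also have "\<dots> = (\<integral>\<^sup>+y. indicator (A \<inter> B) y \<partial>vm x)" by (intro nn_integral_cong) (simp split: split_indicator)
  also have "\<dots> = emeasure (vm x) (A \<inter> B)" using A B by simp
  finally show "emeasure (vm (E A x)) B = emeasure (density (vm x) (indicator A)) B"
    using A B by (simp add: emeasure_vm_E)
qed simp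

lemma polar: "A \<in> sets borel \<Longrightarrow> E A (x + y) \<bullet> (x + y) - E A (x - y) \<bullet> (x - y) = 4 * (E A x \<bullet> y)"
  using self_adj_polar[of "E A" x y] proj by (simp add: ortho_proj_def)

end

text \<open>For each x the function s -> |G s x|^2 is a distribution function and defines a
  Stieltjes measure. The sets on which all these measures come from one projection contain the
  half-lines and are closed under complements and disjoint unions, so they include all Borel
  sets.\<close>

lemma pvm_from_family:
  fixes G :: "real \<Rightarrow> 'a::{real_inner,banach} \<Rightarrow>\<^sub>L 'a"
  assumes G: "\<And>s. ortho_proj (G s)" and mono: "\<And>s t x. s \<le> t \<Longrightarrow> G t (G s x) = G s x"
    and right: "\<And>s x. (\<lambda>n. G (s + 1 / real (Suc n)) x) \<longlonglongrightarrow> G s x"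
    and top: "\<And>x. (\<lambda>n. G (real n) x) \<longlonglongrightarrow> x" and neg: "\<And>s. s < 0 \<Longrightarrow> G s = 0"
  shows "\<exists>E. pvm E \<and> (\<forall>s. E {..s} = G s) \<and>
    (\<forall>Z. (\<forall>s. commute Z (G s)) \<longrightarrow> (\<forall>A\<in>sets borel. commute Z (E A)))"
proof -
  define F where "F x s = (norm (G s x))\<^sup>2" for x s
  have F: "F x s = G s x \<bullet> x" for x s using ortho_projD(3)[OF G] by (simp add: F_def)
  have Fmono: "F x s \<le> F x t" if "s \<le> t" for x s t
  proof -
    have "G s (G t x) = G s x"
    proof -
      have "G s (G t x) \<bullet> y = G s x \<bullet> y" for y
        using ortho_projD(2)[OF G, of s "G t x" y] ortho_projD(2)[OF G, of t x "G s y"]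
          ortho_projD(2)[OF G, of s x y] mono[OF that, of y] by simp
      then show ?thesis by (metis vector_eq_rdot)
    qed
    then have "norm (G s x) \<le> norm (G t x)" using ortho_projD(4)[OF G, of s "G t x"] by simp
    then show ?thesis by (simp add: F_def power_mono)
  qed
  have Fright: "continuous (at_right a) (F x)" for a x
  proof (subst continuous_at_right_real_increasing, rule Fmono, assumption, intro allI impI)
    fix e :: real assume "e > 0"
    have "(\<lambda>n. F x (a + 1 / real (Suc n)) - F x a) \<longlonglongrightarrow> F x a - F x a"
      unfolding F_def by (intro tendsto_intros right)
    then have "\<forall>\<^sub>F n in sequentially. F x (a + 1 / real (Suc n)) - F x a < e"
      using \<open>e > 0\<close> by (intro order_tendstoD(2)) auto
    then obtain n where "F x (a + 1 / real (Suc n)) - F x a < e" by (auto simp: eventually_sequentially)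
    then show "\<exists>d>0. F x (a + d) - F x a < e" by (intro exI[of _ "1 / real (Suc n)"]) auto
  qed
  define M where "M x = interval_measure (F x)" for x
  have setsM [simp, measurable_cong]: "sets (M x) = sets borel" and spaceM [simp]: "space (M x) = UNIV" for x
    by (auto simp: M_def)
  have MIic: "emeasure (M x) {..s} = ennreal (F x s)" for x s
  proof -
    \<comment> \<open>The left end point is negative, where G and hence the distribution function
      vanish.\<close>
    have Ioc: "emeasure (M x) {- real n - 1<..s} = ennreal (F x s)" for n
    proof (cases "- real n - 1 \<le> s")
      case True
      have "F x (- real n - 1) = 0" unfolding F by (subst neg) auto
      then show ?thesis unfolding M_def using emeasure_interval_measure_Ioc[OF True Fmono Fright] by simp
    next
      case False
      then have "F x s = 0" unfolding F by (subst neg) auto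
      then show ?thesis using False by simp
    qed
    have "(\<Union>n. {- real n - 1<..s}) = {..s}"
    proof (intro equalityI subsetI)
      fix y assume "y \<in> {..s}"
      moreover obtain n where "- y < real n" using reals_Archimedean2 by blast
      ultimately show "y \<in> (\<Union>n. {- real n - 1<..s})" by (intro UN_I[of n]) auto
    qed auto
    moreover have "emeasure (M x) (\<Union>n. {- real n - 1<..s}) = (SUP n. emeasure (M x) {- real n - 1<..s})"
      by (rule SUP_emeasure_incseq[symmetric]) (auto simp: incseq_def)
    ultimately show ?thesis by (simp add: Ioc)
  qed
  have MU: "emeasure (M x) UNIV = ennreal ((norm x)\<^sup>2)" for x
  proof -
    have "(\<Union>n. {..real n}) = UNIV" using real_arch_simple by auto
    moreover have "emeasure (M x) (\<Union>n. {..real n}) = (SUP n. emeasure (M x) {..real n})"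
      by (rule SUP_emeasure_incseq[symmetric]) (auto simp: incseq_def)
    moreover have "(SUP n. ennreal (F x (real n))) = ennreal ((norm x)\<^sup>2)"
    proof (rule LIMSEQ_unique[OF LIMSEQ_SUP])
      show "incseq (\<lambda>n. ennreal (F x (real n)))" by (auto simp: incseq_def intro!: ennreal_leI Fmono)
      show "(\<lambda>n. ennreal (F x (real n))) \<longlonglongrightarrow> ennreal ((norm x)\<^sup>2)"
        unfolding F_def by (intro tendsto_ennrealI tendsto_intros top)
    qed
    ultimately show ?thesis by (simp add: MIic)
  qed
  let ?Q = "\<lambda>A P. ortho_proj P \<and> (\<forall>x. emeasure (M x) A = ennreal (P x \<bullet> x)) \<and>
      (\<forall>Z. (\<forall>s. commute Z (G s)) \<longrightarrow> commute Z P)"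
  have uniq: "P = P'" if "?Q A P" "?Q A P'" for A P P'
  proof (rule self_adj_eqI)
    show "self_adj P" "self_adj P'" using that by (auto simp: ortho_proj_def)
    fix x
    have "ennreal (P x \<bullet> x) = ennreal (P' x \<bullet> x)" using that by metis
    then show "P x \<bullet> x = P' x \<bullet> x" using psdD(1)[OF psd_ortho_proj] that by (metis ennreal_inj)
  qed
  have sumQ: "\<exists>P'. ?Q (\<Union>i. A i) P' \<and> (\<forall>x. (\<lambda>i. P i x) sums P' x)"
    if "range A \<subseteq> sets borel" "disjoint_family A" "\<And>i. ?Q (A i) (P i)" for A P
  proof -
    have P: "ortho_proj (P i)" for i using that(3) by blast
    have "P i (P j x) = 0" if "i \<noteq> j" for i j x
    proof -
      \<comment> \<open>The measure of P j x has total mass |P j x|^2 and A j carries all of it, so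
        nothing is left for the disjoint set A i.\<close>
      have "emeasure (M (P j x)) (A i \<union> A j) = emeasure (M (P j x)) (A i) + emeasure (M (P j x)) (A j)"
        using \<open>range A \<subseteq> _\<close> \<open>disjoint_family A\<close> \<open>i \<noteq> j\<close>
        by (intro plus_emeasure[symmetric]) (auto simp: disjoint_family_on_def)
      also have "\<dots> = ennreal ((norm (P i (P j x)))\<^sup>2) + ennreal ((norm (P j x))\<^sup>2)"
        using \<open>\<And>i. ?Q (A i) (P i)\<close> ortho_projD(1,3)[OF P] by simp
      finally have "ennreal ((norm (P i (P j x)))\<^sup>2) + ennreal ((norm (P j x))\<^sup>2) \<le> ennreal ((norm (P j x))\<^sup>2)"
        using emeasure_space[of "M (P j x)" "A i \<union> A j"] MU[of "P j x"] by simp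
      then show ?thesis by (simp add: ennreal_plus[symmetric] del: ennreal_plus)
    qed
    from proj_suminf_exists[of P, OF P this] obtain Y where Y: "ortho_proj Y" "\<And>x. (\<lambda>i. P i x) sums Y x"
      "\<And>Z. (\<forall>i. commute Z (P i)) \<Longrightarrow> commute Z Y" by blast
    have "emeasure (M x) (\<Union>i. A i) = ennreal (Y x \<bullet> x)" for x
    proof -
      have "(\<lambda>i. P i x \<bullet> x) sums (Y x \<bullet> x)" by (rule bounded_linear.sums[OF bounded_linear_inner_left Y(2)])
      then have "(\<Sum>i. ennreal (P i x \<bullet> x)) = ennreal (Y x \<bullet> x)"
        using psdD(1)[OF psd_ortho_proj[OF P]] by (intro suminf_ennreal_eq)
      moreover have "emeasure (M x) (A i) = ennreal (P i x \<bullet> x)" for i using that(3) by blast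
      ultimately show ?thesis using suminf_emeasure[of A "M x"] that by simp
    qed
    then have "?Q (\<Union>i. A i) Y" using Y that(3) by blast
    then show ?thesis using Y(2) by blast
  qed
  have ex: "\<exists>P. ?Q A P" if "A \<in> sets borel" for A
  proof -
    have "Int_stable (range (\<lambda>a. {..a::real}))" by (auto simp: Int_stable_def)
    moreover have "range (\<lambda>a. {..a::real}) \<subseteq> Pow UNIV" by simp
    moreover have "A \<in> sigma_sets UNIV (range (\<lambda>a. {..a::real}))"
      using that by (subst (asm) borel_eq_atMost) simp
    ultimately show ?thesis
    proof (induction rule: sigma_sets_induct_disjoint)
      case (basic A)
      then obtain s where "A = {..s}" by blast
      then show ?case using G F MIic by (intro exI[of _ "G s"]) auto
    next
      case empty
      show ?case by (intro exI[of _ 0]) (auto simp: ortho_proj_def self_adj_def commute_iff)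
    next
      case (compl A)
      then obtain P where P: "?Q A P" by blast
      have A: "A \<in> sets borel" using compl by (subst borel_eq_atMost) simp
      let ?P = "id_blinfun - P"
      have 1: "ortho_proj ?P" using P ortho_projD(1,2)[of P]
        by (simp add: ortho_proj_def[of ?P] self_adj_def blinfun.bilinear_simps inner_diff_left inner_diff_right)
      have 2: "emeasure (M x) (UNIV - A) = ennreal (?P x \<bullet> x)" for x
      proof -
        have "emeasure (M x) (UNIV - A) = ennreal ((norm x)\<^sup>2) - ennreal (P x \<bullet> x)"
          using emeasure_compl[of A "M x"] A P MU by simp
        moreover have "0 \<le> P x \<bullet> x" using P psdD(1)[OF psd_ortho_proj] by blast
        ultimately show ?thesis
          by (simp add: ennreal_minus blinfun.bilinear_simps inner_diff_left power2_norm_eq_inner)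
      qed
      have 3: "commute Z ?P" if "\<forall>s. commute Z (G s)" for Z
        using P that unfolding commute_iff by (simp add: blinfun.bilinear_simps)
      show ?case using 1 2 3 by blast
    next
      case (union A)
      have "A i \<in> sets borel" for i using union by (subst borel_eq_atMost) auto
      moreover obtain P where "\<And>i. ?Q (A i) (P i)" using union by metis
      ultimately show ?case using sumQ[of A P] union by blast
    qed
  qed
  define E where "E A = (SOME P. ?Q A P)" for A
  have E: "?Q A (E A)" if "A \<in> sets borel" for A unfolding E_def using someI_ex[OF ex[OF that]] .
  have "pvm E"
  proof
    show "ortho_proj (E A)" if "A \<in> sets borel" for A using E[OF that] by blast
    show "E UNIV = id_blinfun"
      by (rule uniq[OF E]) (auto simp: MU ortho_proj_def self_adj_def commute_iff power2_norm_eq_inner)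
    fix A :: "nat \<Rightarrow> real set" and x assume A: "range A \<subseteq> sets borel" "disjoint_family A"
    then obtain P' where P': "?Q (\<Union>i. A i) P'" "\<And>x. (\<lambda>i. E (A i) x) sums P' x"
      using sumQ[of A "\<lambda>i. E (A i)"] E by blast
    moreover have "P' = E (\<Union>i. A i)" by (rule uniq[OF P'(1) E]) (use A in auto)
    ultimately show "(\<lambda>n. E (A n) x) sums E (\<Union>n. A n) x" by simp
  qed
  moreover have "E {..s} = G s" for s
    by (rule uniq[OF E]) (use G F MIic in auto)
  moreover have "commute Z (E A)" if "\<forall>s. commute Z (G s)" "A \<in> sets borel" for Z A using E that by blast
  ultimately show ?thesis by blast
qed

section \<open>Geometric partition of the positive half-line\<close>

text \<open>All integer exponents occur, since neither |T| nor h need be bounded above or away from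
  0; \<open>int_decode\<close> lists them over the naturals so that countable additivity
  applies.\<close>

definition cell :: "real \<Rightarrow> nat \<Rightarrow> real set" where
  "cell q n = {q powr (of_int (int_decode n)) <.. q powr (of_int (int_decode n) + 1)}"

lemma cell_iff:
  assumes "q > 1"
  shows "x \<in> cell q n \<longleftrightarrow> x > 0 \<and> int_decode n = \<lceil>log q x\<rceil> - 1"
proof (cases "x > 0")
  case True
  have "x \<in> cell q n \<longleftrightarrow> of_int (int_decode n) < log q x \<and> log q x \<le> of_int (int_decode n) + 1"
    using True assms by (simp add: cell_def less_log_iff log_le_iff)
  also have "\<dots> \<longleftrightarrow> int_decode n = \<lceil>log q x\<rceil> - 1" by linarith
  finally show ?thesis using True by simp
next
  case False
  have "0 < q powr (of_int (int_decode n))" using assms by simp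
  then show ?thesis using False by (auto simp: cell_def simp del: powr_gt_zero)
qed

lemma cell_disjoint: "q > 1 \<Longrightarrow> disjoint_family (cell q)"
  using injD[OF inj_int_decode[of UNIV]] by (auto simp: disjoint_family_on_def cell_iff)

lemma cell_Union: "q > 1 \<Longrightarrow> (\<Union>n. cell q n) = {0<..}"
  by (auto simp: cell_iff) (metis int_encode_inverse)

lemma cell_borel [measurable]: "cell q n \<in> sets borel"
  by (simp add: cell_def)

lemma cell_Iic: "cell q n \<subseteq> {..q powr (of_int (int_decode n) + 1)}"
  by (auto simp: cell_def)

lemma cell_Ioi: "cell q n \<subseteq> {q powr (of_int (int_decode n)) <..}"
  by (auto simp: cell_def)

text \<open>Q n stands for an operator quantity confined to the n-th cell. It is caught between the
  same multiples of the cell measure as the integral, so the totals agree up to the factor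
  r.\<close>

lemma cell_integral:
  assumes q: "q > 1" and sets: "sets \<mu> = sets borel" and f: "f \<in> borel_measurable borel"
    and fc: "\<And>n s. s \<in> cell q n \<Longrightarrow> c n \<le> f s \<and> f s \<le> r * c n"
    and Q: "\<And>n. c n * emeasure \<mu> (cell q n) \<le> Q n" "\<And>n. Q n \<le> r * c n * emeasure \<mu> (cell q n)"
  shows "(\<integral>\<^sup>+s\<in>{0<..}. f s \<partial>\<mu>) \<le> r * (\<Sum>n. Q n)" "(\<Sum>n. Q n) \<le> r * (\<integral>\<^sup>+s\<in>{0<..}. f s \<partial>\<mu>)"
proof -
  have fm: "f \<in> borel_measurable \<mu>" using f sets by (simp cong: measurable_cong_sets)
  have cm: "cell q n \<in> sets \<mu>" for n using sets by simp
  let ?a = "\<lambda>n. \<integral>\<^sup>+s\<in>cell q n. f s \<partial>\<mu>"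
  have sum: "(\<integral>\<^sup>+s\<in>{0<..}. f s \<partial>\<mu>) = (\<Sum>n. ?a n)"
    unfolding cell_Union[OF q, symmetric]
    using fm cm cell_disjoint[OF q] by (intro nn_integral_disjoint_family) auto
  have lo: "c n * emeasure \<mu> (cell q n) \<le> ?a n" for n
  proof -
    have "c n * emeasure \<mu> (cell q n) = (\<integral>\<^sup>+s. c n * indicator (cell q n) s \<partial>\<mu>)"
      using cm by (simp add: nn_integral_cmult_indicator)
    also have "\<dots> \<le> ?a n" by (intro nn_integral_mono) (auto simp: fc split: split_indicator)
    finally show ?thesis .
  qed
  have hi: "?a n \<le> r * c n * emeasure \<mu> (cell q n)" for n
  proof -
    have "?a n \<le> (\<integral>\<^sup>+s. r * c n * indicator (cell q n) s \<partial>\<mu>)"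
      by (intro nn_integral_mono) (auto simp: fc split: split_indicator)
    then show ?thesis using cm by (simp add: nn_integral_cmult_indicator)
  qed
  have "?a n \<le> r * Q n" for n
    using order_trans[OF hi[of n]] mult_left_mono[OF Q(1)[of n] zero_le, of r] by (simp add: mult_ac)
  then show "(\<integral>\<^sup>+s\<in>{0<..}. f s \<partial>\<mu>) \<le> r * (\<Sum>n. Q n)"
    unfolding sum ennreal_suminf_cmult[symmetric] by (intro suminf_le) auto
  have "Q n \<le> r * ?a n" for n
    using order_trans[OF Q(2)[of n]] mult_left_mono[OF lo[of n] zero_le, of r] by (simp add: mult_ac)
  then show "(\<Sum>n. Q n) \<le> r * (\<integral>\<^sup>+s\<in>{0<..}. f s \<partial>\<mu>)"
    unfolding sum ennreal_suminf_cmult[symmetric] by (intro suminf_le) auto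
qed

text \<open>Lets q tend to 1 in the comparisons over cells, both of which lose q^2.\<close>

lemma ennreal_le_scaled_limit:
  fixes a b :: ennreal
  assumes "\<And>q. q > 1 \<Longrightarrow> a \<le> ennreal (q\<^sup>2) * b"
  shows "a \<le> b"
proof (cases "b = top")
  case False
  show ?thesis
  proof (rule LIMSEQ_le_const)
    have 1: "(\<lambda>n. (1 + 1 / real (Suc n))\<^sup>2) \<longlonglongrightarrow> (1 + 0)\<^sup>2"
      by (intro tendsto_intros lim_inverse_Suc)
    have "(\<lambda>n. b * ennreal ((1 + 1 / real (Suc n))\<^sup>2)) \<longlonglongrightarrow> b * ennreal ((1 + 0)\<^sup>2)"
      using False by (intro ennreal_tendsto_cmult tendsto_ennrealI 1) (simp add: less_top)
    then show "(\<lambda>n. ennreal ((1 + 1 / real (Suc n))\<^sup>2) * b) \<longlonglongrightarrow> b" by (simp add: mult.commute)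
    show "\<exists>N. \<forall>n\<ge>N. a \<le> ennreal ((1 + 1 / real (Suc n))\<^sup>2) * b" using assms by simp
  qed
qed simp

text \<open>With y = A x - B x, (A + B) y = 0, and positivity forces A y = B y = 0; symmetry then
  gives |y|^2 = 0.\<close>

lemma psd_roots_eq:
  assumes "psd A" "psd B" "commute A B" "\<And>x. A (A x) = B (B x)"
  shows "A = B"
proof (rule blinfun_eqI)
  fix x
  let ?y = "A x - B x"
  have AB: "A (B x) = B (A x)" for x using assms(3) by (rule commuteD)
  have "A ?y + B ?y = 0" using assms(4) AB by (simp add: blinfun.diff_right)
  then have "A ?y \<bullet> ?y + B ?y \<bullet> ?y = 0" by (metis inner_add_left inner_zero_left)
  then have "A ?y \<bullet> ?y = 0" "B ?y \<bullet> ?y = 0"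
    using psdD(1)[OF assms(1), of ?y] psdD(1)[OF assms(2), of ?y] by linarith+
  then have "A ?y = 0" "B ?y = 0" using psd_inner_zero assms by blast+
  then have "?y \<bullet> ?y = 0"
    using psdD(2)[OF assms(1), of x ?y] psdD(2)[OF assms(2), of x ?y] unfolding inner_diff_left[of _ _ ?y] by simp
  then show "A x = B x" by simp
qed

lemma self_adj_inj_dense:
  fixes A :: "'a::{real_inner,banach} \<Rightarrow>\<^sub>L 'a"
  assumes "self_adj A" "\<And>x. A x = 0 \<Longrightarrow> x = 0"
  shows "closure (range A) = UNIV"
proof -
  have s: "subspace (closure (range A))"
    by (intro subspace_closure linear_subspace_image subspace_UNIV) (simp add: linear_iff blinfun.bilinear_simps)
  have "x \<in> closure (range A)" for x
  proof -
    obtain p where p: "p \<in> closure (range A)" "\<And>y. y \<in> closure (range A) \<Longrightarrow> (x - p) \<bullet> y = 0"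
      using closed_subspace_proj_exists[OF closed_closure s, of x] by blast
    have "(x - p) \<bullet> A (A (x - p)) = 0" by (rule p(2)) (rule closure_subset[THEN subsetD], rule rangeI)
    then have "A (x - p) = 0" using self_adjD[OF assms(1), of "x - p" "A (x - p)"] by simp
    then have "x - p = 0" by (rule assms(2))
    then show ?thesis using p(1) by simp
  qed
  then show ?thesis by blast
qed

lemma orthogonal_increments_convergent:
  fixes y :: "nat \<Rightarrow> 'a::{real_inner,banach}"
  assumes inc: "\<And>m n. m \<le> n \<Longrightarrow> (norm (y n - y m))\<^sup>2 = (norm (y n))\<^sup>2 - (norm (y m))\<^sup>2"
    and bd: "\<And>n. (norm (y n))\<^sup>2 \<le> C"
  shows "convergent y"
proof -
  let ?u = "\<lambda>n. (norm (y n))\<^sup>2"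
  have "?u m \<le> ?u n" if "m \<le> n" for m n using inc[OF that] zero_le_power2[of "norm (y n - y m)"] by linarith
  then have "incseq ?u" by (simp add: incseq_def)
  then obtain l where "?u \<longlonglongrightarrow> l" using incseq_convergent[of ?u C] bd by metis
  then have Cu: "Cauchy ?u" by (rule LIMSEQ_imp_Cauchy)
  have "Cauchy y"
  proof (rule metric_CauchyI)
    fix e :: real assume "e > 0"
    then have "e\<^sup>2 > 0" by simp
    from metric_CauchyD[OF Cu this] obtain N where N: "\<And>m n. m \<ge> N \<Longrightarrow> n \<ge> N \<Longrightarrow> \<bar>?u m - ?u n\<bar> < e\<^sup>2"
      by (auto simp: dist_real_def)
    have le: "norm (y n - y m) < e" if "N \<le> m" "m \<le> n" for m n
    proof (rule power2_less_imp_less)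
      show "(norm (y n - y m))\<^sup>2 < e\<^sup>2" using inc[OF that(2)] N[of n m] that by linarith
    qed (use \<open>e > 0\<close> in simp)
    show "\<exists>M. \<forall>m\<ge>M. \<forall>n\<ge>M. dist (y m) (y n) < e"
    proof (intro exI allI impI)
      fix m n assume "N \<le> m" "N \<le> n"
      then show "dist (y m) (y n) < e"
        using le[of m n] le[of n m] by (cases "m \<le> n") (auto simp: dist_norm norm_minus_commute)
    qed
  qed
  then show ?thesis by (rule Cauchy_convergent)
qed

context closed_dense_op
begin

section \<open>The modulus and its spectral measure\<close>

definition spec :: "real set \<Rightarrow> 'a \<Rightarrow>\<^sub>L 'a" where
  "spec = (SOME E. pvm E \<and> (\<forall>s. E {..s} = specfam s) \<and>
    (\<forall>Z. (\<forall>s. commute Z (specfam s)) \<longrightarrow> (\<forall>A\<in>sets borel. commute Z (E A))))"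

lemma spec_ex: "pvm spec \<and> (\<forall>s. spec {..s} = specfam s) \<and>
    (\<forall>Z. (\<forall>s. commute Z (specfam s)) \<longrightarrow> (\<forall>A\<in>sets borel. commute Z (spec A)))"
  using someI_ex[OF pvm_from_family[of specfam, OF specfam_proj specfam_mono specfam_right_cont specfam_at_top specfam_neg]]
  unfolding spec_def[symmetric] .

sublocale spec: pvm spec using spec_ex by blast

lemma spec_Iic: "spec {..s} = specfam s" using spec_ex by blast

lemma spec_commute: "commute Z res \<Longrightarrow> A \<in> sets borel \<Longrightarrow> commute Z (spec A)"
  using spec_ex specfam_commute by blast

lemma spec_res: "A \<in> sets borel \<Longrightarrow> spec A (res x) = res (spec A x)"
  using spec_commute[of res A] by (simp add: commute_iff)

lemma spec_rt: "A \<in> sets borel \<Longrightarrow> spec A (rt x) = rt (spec A x)"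
  using commute_rt[of "spec A"] spec_res by (simp add: commute_iff)

lemma spec_mem: "A \<in> sets borel \<Longrightarrow> (spec A (rt z), par (spec A z)) \<in> T"
  using par_mem[of "spec A z"] spec_rt by simp

lemma spec_Iio: "spec {..<0} = 0"
proof (rule blinfun_eqI)
  fix x
  have "(\<Union>n. {..- (1 / real (Suc n))}) = {..<0}"
  proof (intro equalityI subsetI)
    fix y :: real assume "y \<in> {..<0}"
    then obtain n where "1 / real (Suc n) < - y" using reals_Archimedean[of "- y"] by (auto simp: inverse_eq_divide)
    then show "y \<in> (\<Union>n. {..- (1 / real (Suc n))})" by (intro UN_I[of n]) auto
  next
    fix y :: real assume "y \<in> (\<Union>n. {..- (1 / real (Suc n))})"
    then obtain n where "y \<le> - (1 / real (Suc n))" by auto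
    moreover have "- (1 / real (Suc n)) < 0" by simp
    ultimately show "y \<in> {..<0}" using lessThan_iff by (blast intro: le_less_trans)
  qed
  moreover have inc: "incseq (\<lambda>n. {..- (1 / real (Suc n))})" by (rule incseq_SucI) (simp add: frac_le)
  have "(\<lambda>n. spec {..- (1 / real (Suc n))} x) \<longlonglongrightarrow> spec (\<Union>n. {..- (1 / real (Suc n))}) x"
    by (rule spec.incseq_lim[OF _ inc]) auto
  ultimately have "(\<lambda>n. spec {..- (1 / real (Suc n))} x) \<longlonglongrightarrow> spec {..<0} x" by (simp only:)
  moreover have "spec {..- (1 / real (Suc n))} x = 0" for n
    unfolding spec_Iic by (subst specfam_neg) auto
  ultimately show "spec {..<0} x = (0 :: 'a \<Rightarrow>\<^sub>L 'a) x" by (simp add: LIMSEQ_const_iff)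
qed

lemma spec_in_domain:
  assumes "0 \<le> s" "spec {..s} x = x"
  shows "\<exists>z. x = rt z \<and> norm (par z) \<le> s * norm x"
  using specfam_in_domain[OF assms(1)] assms(2) memE unfolding spec_Iic by metis

lemma par_norm_eq: "(norm (par z))\<^sup>2 = (z - res z) \<bullet> z"
  by (simp add: power2_norm_eq_inner par(2))

lemma par_spec_inner:
  assumes "A \<in> sets borel" shows "par (spec A z) \<bullet> par w = par z \<bullet> par (spec A w)"
  using ortho_projD(2)[OF spec.proj[OF assms], of "res z" w] ortho_projD(2)[OF spec.proj[OF assms], of z w]
    spec_res[OF assms, of z] by (simp add: par(2) inner_diff_left)

lemma par_spec_norm:
  assumes "A \<in> sets borel" shows "norm (par (spec A z)) \<le> norm (par z)"
proof -
  have "par (spec A z) \<bullet> par (spec A z) = par z \<bullet> par (spec A z)"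
    using par_spec_inner[OF assms, of z "spec A z"] ortho_projD(1)[OF spec.proj[OF assms]] by simp
  also have "\<dots> \<le> norm (par z) * norm (par (spec A z))" by (rule norm_cauchy_schwarz)
  finally have "norm (par (spec A z)) * norm (par (spec A z)) \<le> norm (par z) * norm (par (spec A z))"
    by (simp only: power2_norm_eq_inner[symmetric] power2_eq_square)
  then show ?thesis by (cases "par (spec A z) = 0") auto
qed

lemma spec_Ioi_bound_rt:
  assumes "0 \<le> s" shows "s * norm (spec {s<..} (rt z)) \<le> norm (par z)"
proof (cases "spec {s<..} (rt z) = 0")
  case False
  have "specfam s (spec {s<..} (rt z)) = 0"
    unfolding spec_Iic[symmetric] by (rule spec.disjoint_zero) auto
  then have "s * norm (spec {s<..} (rt z)) < norm (par (spec {s<..} z))"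
    using specfam_compl_gt[OF assms spec_mem] False by simp
  then show ?thesis using par_spec_norm[of "{s<..}" z] by simp
qed simp

lemma spec_Ioi_bound:
  assumes "0 \<le> s" "(x, y) \<in> T" shows "s * norm (spec {s<..} x) \<le> norm y"
  using assms spec_Ioi_bound_rt by (metis memE)

definition sq :: "'a \<Rightarrow>\<^sub>L 'a" where "sq = psd_sqrt (id_blinfun - res)"

text \<open>The operators \<open>sq\<close> and \<open>rt\<close> are \<open>|T| (1 + |T|\<^sup>2)\<^sup>-\<^sup>1\<^sup>/\<^sup>2\<close> and \<open>(1 + |T|\<^sup>2)\<^sup>-\<^sup>1\<^sup>/\<^sup>2\<close>, which makes this the
  graph of \<open>|T|\<close>.\<close>

definition modl :: "('a \<times> 'a) set" where "modl = {(x, y). sq x = rt y}"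

lemma sq: "psd sq" "sq (sq x) = x - res x" "commute Z res \<Longrightarrow> commute Z sq" "norm (sq z) = norm (par z)"
proof -
  have p: "psd (id_blinfun - res)"
    using psdD(2)[OF res_psd] res_le_one
    by (auto simp: psd_def self_adj_def blinfun.bilinear_simps inner_diff_left inner_diff_right power2_norm_eq_inner)
  show "psd sq" "sq (sq x) = x - res x" using psd_sqrt(1,2)[OF p] by (simp_all add: sq_def blinfun.bilinear_simps)
  show "commute Z res \<Longrightarrow> commute Z sq"
    unfolding sq_def by (rule psd_sqrt(3)[OF p]) (simp add: commute_iff blinfun.bilinear_simps)
  have "(norm (sq z))\<^sup>2 = (norm (par z))\<^sup>2"
    using psd_sqrt(4)[OF p, of z] by (simp add: sq_def par_norm_eq blinfun.bilinear_simps)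
  then show "norm (sq z) = norm (par z)" by simp
qed

lemma sq_rt: "sq (rt x) = rt (sq x)"
  using commute_rt[OF commute_sym[OF sq(3)[of res]]] by (simp add: commute_iff)

lemma spec_sq: "A \<in> sets borel \<Longrightarrow> spec A (sq x) = sq (spec A x)"
  using sq(3)[of "spec A"] spec_res by (simp add: commute_iff)

lemma modl_param: "(x, y) \<in> modl \<longleftrightarrow> (\<exists>z. x = rt z \<and> y = sq z)"
proof
  assume "(x, y) \<in> modl"
  then have e: "sq x = rt y" by (simp add: modl_def)
  \<comment> \<open>As \<open>rt\<close>^2 + \<open>sq\<close>^2 = 1, this vector recovers both
    coordinates, like cosine and sine.\<close>
  let ?z = "rt x + sq y"
  have "rt (sq y) = sq (sq x)" by (simp add: e sq_rt)
  then have "rt ?z = x" using rt(2)[of x] sq(2)[of x] by (simp add: blinfun.add_right)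
  moreover have "sq ?z = y" using sq_rt[of x] e rt(2)[of y] sq(2)[of y] by (simp add: blinfun.add_right)
  ultimately show "\<exists>z. x = rt z \<and> y = sq z" by metis
qed (auto simp: modl_def sq_rt)

lemma modl_closed_dense: "closed_dense_op modl"
proof
  show "subspace modl" by (auto simp: subspace_def modl_def blinfun.bilinear_simps zero_prod_def)
  show "single_valued modl"
  proof (rule single_valuedI)
    fix x y z assume "(x, y) \<in> modl" "(x, z) \<in> modl"
    then have "rt (y - z) = 0" by (simp add: modl_def blinfun.diff_right)
    then show "y = z" using rt_inj by fastforce
  qed
  have "modl = {p. sq (fst p) = rt (snd p)}" by (auto simp: modl_def)
  then show "closed modl" by (simp only:) (intro closed_Collect_eq continuous_intros)
  have "range rt \<subseteq> Domain modl" using modl_param by blast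
  then show "closure (Domain modl) = UNIV" using rt_dense closure_mono by blast
qed

lemma modl_self_adj: "{(x, y). \<forall>(v, w)\<in>modl. w \<bullet> x = v \<bullet> y} = modl"
proof (intro equalityI subsetI)
  fix p assume "p \<in> {(x, y). \<forall>(v, w)\<in>modl. w \<bullet> x = v \<bullet> y}"
  moreover obtain x y where p0: "p = (x, y)" by (cases p)
  ultimately have p: "p = (x, y)" "\<And>v w. (v, w) \<in> modl \<Longrightarrow> w \<bullet> x = v \<bullet> y" by auto
  have "z \<bullet> sq x = z \<bullet> rt y" for z
    using p(2)[of "rt z" "sq z"] modl_param psdD(2)[OF sq(1), of z x] psdD(2)[OF rt(1), of z y] by auto
  then have "sq x = rt y" by (metis vector_eq_ldot)
  then show "p \<in> modl" by (simp add: p modl_def)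
next
  fix p assume "p \<in> modl"
  then obtain x y where p: "p = (x, y)" "sq x = rt y" by (auto simp: modl_def)
  have "w \<bullet> x = v \<bullet> y" if vw: "(v, w) \<in> modl" for v w
  proof -
    obtain z where z: "v = rt z" "w = sq z" using vw modl_param by blast
    show ?thesis using psdD(2)[OF sq(1), of z x] psdD(2)[OF rt(1), of z y] p(2) z by simp
  qed
  then show "p \<in> {(x, y). \<forall>(v, w)\<in>modl. w \<bullet> x = v \<bullet> y}" using p by auto
qed

lemma modl_sym: "(x, y) \<in> modl \<Longrightarrow> (v, w) \<in> modl \<Longrightarrow> w \<bullet> x = v \<bullet> y"
  using modl_self_adj by blast

lemma rt_sq_psd: "psd (rt o\<^sub>L sq)"
  by (intro psd_commute_mult rt(1) sq(1)) (simp add: commute_iff sq_rt)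

lemma modl_pos: "(x, y) \<in> modl \<Longrightarrow> 0 \<le> y \<bullet> x"
  using psdD(1)[OF rt_sq_psd] psdD(2)[OF rt(1)] by (auto simp: modl_param)

text \<open>The left side says y = T*T x in terms of the real inner product. So T*T is determined by
  \<open>res\<close>, which is all that the modulus has to match.\<close>

lemma adj_comp_iff:
  "(\<exists>w. (x, w) \<in> T \<and> (\<forall>(v, v')\<in>T. v' \<bullet> w = v \<bullet> y)) \<longleftrightarrow> res (x + y) = x"
proof
  assume "\<exists>w. (x, w) \<in> T \<and> (\<forall>(v, v')\<in>T. v' \<bullet> w = v \<bullet> y)"
  then obtain w where w: "(x, w) \<in> T" "\<And>v v'. (v, v') \<in> T \<Longrightarrow> v' \<bullet> w = v \<bullet> y" by blast
  show "res (x + y) = x"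
    by (rule res_unique[OF w(1)]) (simp add: inner_add_left w(2) inner_commute[of w] inner_commute[of y])
next
  assume r: "res (x + y) = x"
  have "v' \<bullet> resT (x + y) = v \<bullet> y" if "(v, v') \<in> T" for v v'
    using res_inner[OF that, of "x + y"] r by (simp add: inner_add_left inner_add_right inner_commute)
  moreover have "(x, resT (x + y)) \<in> T" using res_mem[of "x + y"] r by simp
  ultimately show "\<exists>w. (x, w) \<in> T \<and> (\<forall>(v, v')\<in>T. v' \<bullet> w = v \<bullet> y)" by blast
qed

lemma modl_comp_iff: "(x, y) \<in> modl O modl \<longleftrightarrow> res (x + y) = x"
proof
  assume "(x, y) \<in> modl O modl"
  then obtain w where w: "(x, w) \<in> modl" "sq w = rt y" by (auto simp: modl_def)
  obtain z where z: "x = rt z" "w = sq z" using w(1) modl_param by blast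
  have "z = rt (x + y)" using w(2) z sq(2)[of z] rt(2)[of z] by (simp add: blinfun.add_right algebra_simps)
  then show "res (x + y) = x" using z(1) rt(2)[of "x + y"] by simp
next
  assume r: "res (x + y) = x"
  define z where "z = rt (x + y)"
  have x: "rt z = x" using r rt(2) by (simp add: z_def)
  have "res z = rt x" using rt(2)[of z] x by simp
  then have "sq (sq z) = z - rt x" using sq(2)[of z] by simp
  also have "\<dots> = rt y" by (simp add: z_def blinfun.add_right)
  finally have "sq (sq z) = rt y" .
  then have "(sq z, y) \<in> modl" by (simp add: modl_def)
  moreover have "(x, sq z) \<in> modl" using x modl_param by blast
  ultimately show "(x, y) \<in> modl O modl" by blast
qed

text \<open>S*S = T*T gives S the same \<open>res\<close> and \<open>rt\<close>. Its
  \<open>par\<close> commutes with \<open>res\<close>, is symmetric and positive because S is, and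
  has square 1 - \<open>res\<close>, so it equals \<open>sq\<close> by uniqueness of commuting
  positive roots.\<close>

lemma modl_unique:
  assumes S: "closed_dense_op S" and sa: "{(x, y). \<forall>(v, w)\<in>S. w \<bullet> x = v \<bullet> y} = S"
    and pos: "\<And>x y. (x, y) \<in> S \<Longrightarrow> 0 \<le> y \<bullet> x"
    and comp: "\<And>x y. (x, y) \<in> S O S \<longleftrightarrow> res (x + y) = x"
  shows "S = modl"
proof -
  interpret S: closed_dense_op S by fact
  have adjS: "(\<forall>(v, v')\<in>S. v' \<bullet> w = v \<bullet> y) \<longleftrightarrow> (w, y) \<in> S" for w y using sa by blast
  have SS: "(x, y) \<in> S O S \<longleftrightarrow> S.res (x + y) = x" for x y
    using S.adj_comp_iff[of x y] unfolding adjS by blast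
  have res: "S.res = res"
  proof (rule blinfun_eqI)
    fix x
    have "(res x, x - res x) \<in> S O S" unfolding comp by simp
    then show "S.res x = res x" unfolding SS by simp
  qed
  have rtS: "S.rt = rt" by (simp add: S.rt_def rt_def res)
  let ?V = "S.par"
  have mem: "(rt z, ?V z) \<in> S" for z using S.par_mem rtS by simp
  \<comment> \<open>S commutes with (1 + S^2)^{-1}: both sides turn out to be the value of S at
    \<open>rt (res z)\<close>.\<close>
  have cV: "commute ?V res"
    unfolding commute_iff
  proof
    fix z
    have "(res (rt z), rt z - res (rt z)) \<in> S O S" unfolding comp by simp
    then obtain w where w: "(res (rt z), w) \<in> S" "(w, rt z - res (rt z)) \<in> S" by blast
    have "(rt z - res (rt z), ?V z - w) \<in> S" using S.mem_diff[OF mem w(1)] .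
    then have "(w, ?V z - w) \<in> S O S" using w(2) by blast
    then have "res (?V z) = w" unfolding comp by simp
    moreover have "res (rt z) = rt (res z)" by (metis rt(2))
    ultimately have "(rt (res z), res (?V z)) \<in> S" using w(1) by simp
    then show "?V (res z) = res (?V z)" using S.unique_image mem by blast
  qed
  have Vrt: "?V (rt z) = rt (?V z)" for z using commute_rt[OF cV] by (simp add: commute_iff)
  have saV: "self_adj ?V"
    unfolding self_adj_def
  proof (intro allI)
    fix x y
    have "{x. ?V x \<bullet> y = x \<bullet> ?V y} = UNIV"
    proof -
      have "?V (rt z) \<bullet> y = rt z \<bullet> ?V y" for z
      proof -
        have "(rt y, ?V y) \<in> {(x, y). \<forall>(v, w)\<in>S. w \<bullet> x = v \<bullet> y}" unfolding sa by (rule mem)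
        then have "?V z \<bullet> rt y = rt z \<bullet> ?V y" using mem[of z] by blast
        then show ?thesis using psdD(2)[OF rt(1), of "?V z" y] Vrt by simp
      qed
      then have "closure (range rt) \<subseteq> {x. ?V x \<bullet> y = x \<bullet> ?V y}"
        by (intro closure_minimal closed_Collect_eq continuous_intros) auto
      then show ?thesis using rt_dense by blast
    qed
    then show "?V x \<bullet> y = x \<bullet> ?V y" by blast
  qed
  have psdV: "psd ?V"
  proof -
    \<comment> \<open>Positivity of S only says <V z, rt z> >= 0. Splitting \<open>rt\<close> into
      two commuting roots turns this into <V v, v> >= 0 for v in the dense range of the
      root.\<close>
    let ?r = "psd_sqrt rt"
    note r = psd_sqrt[OF rt(1)]
    have cr: "?V (?r x) = ?r (?V x)" for x using r(3)[of ?V] Vrt by (simp add: commute_iff)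
    have "0 \<le> ?V (?r z) \<bullet> ?r z" for z
    proof -
      have "?V (?r z) \<bullet> ?r z = ?V z \<bullet> rt z"
        using psdD(2)[OF r(1), of "?V z" "?r z"] cr r(2) by simp
      then show ?thesis using pos[OF mem] by simp
    qed
    moreover have "closure (range ?r) = UNIV"
    proof (rule self_adj_inj_dense)
      show "self_adj ?r" using r(1) by (simp add: psd_def)
      show "x = 0" if "?r x = 0" for x using r(2)[of x] that rt_inj by simp
    qed
    moreover have "closure (range ?r) \<subseteq> {x. 0 \<le> ?V x \<bullet> x}"
      using calculation(1) by (intro closure_minimal closed_Collect_le continuous_intros) auto
    ultimately show ?thesis using saV by (auto simp: psd_def)
  qed
  have VV: "?V (?V x) = x - res x" for x
  proof -
    have "?V (?V x) \<bullet> y = (x - res x) \<bullet> y" for y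
      using self_adjD[OF saV, of "?V x" y] S.par(2)[of x y] res by simp
    then show ?thesis by (metis vector_eq_rdot)
  qed
  have "?V = sq"
    by (rule psd_roots_eq[OF psdV sq(1) sq(3)[OF cV]]) (simp add: VV sq(2))
  then show ?thesis using S.par(1) rtS modl_param by auto
qed

subsection \<open>Spectral resolution\<close>

lemma spec_modl: "(x, y) \<in> modl \<Longrightarrow> A \<in> sets borel \<Longrightarrow> (spec A x, spec A y) \<in> modl"
  by (auto simp: modl_param spec_rt spec_sq)

lemma modl_upper:
  assumes "(x, y) \<in> modl" "0 \<le> s" "spec {..s} x = x" shows "norm y \<le> s * norm x"
proof -
  obtain z where z: "x = rt z" "norm (par z) \<le> s * norm x" using spec_in_domain[OF assms(2,3)] by blast
  obtain w where w: "x = rt w" "y = sq w" using assms(1) modl_param by blast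
  have "w = z" using rt_inj[of "w - z"] z w by (simp add: blinfun.diff_right)
  then show ?thesis using z w sq(4) by simp
qed

lemma modl_lower:
  assumes "(x, y) \<in> modl" "0 \<le> s" "spec {s<..} x = x" shows "s * norm x \<le> norm y"
proof -
  obtain z where "x = rt z" "y = sq z" using assms(1) modl_param by blast
  then show ?thesis using spec_Ioi_bound_rt[OF assms(2), of z] assms(3) sq(4)[of z] by simp
qed

text \<open>The inequality |T|^2 <= s |T| below the level s. It is Cauchy-Schwarz for the positive
  form of \<open>rt o\<^sub>L sq\<close>, combined with the fact that y = |T| x lies below the level
  s as well.\<close>

lemma modl_inner_lower:
  assumes xy: "(x, y) \<in> modl" and s: "0 \<le> s" and x: "spec {..s} x = x"
  shows "(norm y)\<^sup>2 \<le> s * (y \<bullet> x)"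
proof (cases "y = 0")
  case False
  have Iic: "{..s} \<in> sets borel" by simp
  have y: "spec {..s} y = y"
    using spec_modl[OF xy Iic] x xy closed_dense_op.unique_image[OF modl_closed_dense] by metis
  obtain z where z: "x = rt z" "y = sq z" using xy modl_param by blast
  obtain w where w: "y = rt w" "norm (par w) \<le> s * norm y" using spec_in_domain[OF s y] by blast
  have M: "(rt o\<^sub>L sq) u \<bullet> v = sq u \<bullet> rt v" for u v using psdD(2)[OF rt(1), of "sq u" v] by simp
  have "(norm y)\<^sup>2 * (norm y)\<^sup>2 = (sq z \<bullet> rt w)\<^sup>2"
    unfolding power2_norm_eq_inner z(2)[symmetric] w(1)[symmetric] by (simp only: power2_eq_square)
  also have "\<dots> \<le> (sq z \<bullet> rt z) * (sq w \<bullet> rt w)"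
    using psd_cauchy_schwarz[OF rt_sq_psd, of z w] unfolding M .
  also have "\<dots> \<le> (y \<bullet> x) * (s * norm y * norm y)"
  proof (intro mult_mono)
    have "sq w \<bullet> rt w \<le> norm (sq w) * norm (rt w)" by (rule norm_cauchy_schwarz)
    also have "\<dots> \<le> s * norm y * norm y" using w sq(4) s by (intro mult_mono) auto
    finally show "sq w \<bullet> rt w \<le> s * norm y * norm y" .
    show "0 \<le> y \<bullet> x" using modl_pos xy by blast
    show "0 \<le> sq w \<bullet> rt w" using modl_pos modl_param by blast
  qed (use z in simp)
  finally have "(norm y)\<^sup>2 * (norm y)\<^sup>2 \<le> (s * (y \<bullet> x)) * (norm y)\<^sup>2" by (simp only: power2_eq_square mult_ac)
  from mult_right_le_imp_le[OF this] show ?thesis using False by simp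
qed (use modl_pos[OF xy] s in simp)

lemma spec_Ioi_modl:
  assumes "(x, y) \<in> modl" shows "spec {0<..} y = y"
proof -
  have B: "{0<..} \<in> sets (borel :: real measure)" "{..0} \<in> sets (borel :: real measure)" by auto
  have "(spec {..0} x, spec {..0} y) \<in> modl" using spec_modl[OF assms B(2)] .
  then have "norm (spec {..0} y) \<le> 0 * norm (spec {..0} x)"
    by (rule modl_upper) (simp_all add: ortho_projD(1)[OF spec.proj[OF B(2)]])
  moreover have "- {..0} = {0::real<..}" by auto
  ultimately show ?thesis using spec.compl[OF B(2), of y] by simp
qed

lemma spec_cells:
  assumes q: "q > 1" and xy: "(x, y) \<in> modl"
  shows "(\<lambda>n. spec (cell q n) y \<bullet> u) sums (y \<bullet> u)"
proof -
  have "(\<lambda>n. spec (cell q n) y) sums spec (\<Union>n. cell q n) y"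
    by (rule spec.countably_add) (auto simp: cell_disjoint[OF q])
  then have "(\<lambda>n. spec (cell q n) y) sums y" using spec_Ioi_modl[OF xy] by (simp add: cell_Union[OF q])
  then show ?thesis by (rule bounded_linear.sums[OF bounded_linear_inner_left])
qed

text \<open>The division by q in the last bound is the price of c^2 |x|^2 <= |y|^2 <= q c <y, x> on
  the cell.\<close>

lemma cell_bounds:
  assumes "(x, y) \<in> modl" and c: "c = q powr (of_int (int_decode n))" and q: "q > 1"
  shows "c * norm (spec (cell q n) x) \<le> norm (spec (cell q n) y)"
    "norm (spec (cell q n) y) \<le> q * c * norm (spec (cell q n) x)"
    "c / q * (norm (spec (cell q n) x))\<^sup>2 \<le> spec (cell q n) y \<bullet> spec (cell q n) x"
proof -
  let ?C = "cell q n"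
  let ?x = "spec ?C x" and ?y = "spec ?C y"
  have c0: "c > 0" and qc: "q powr (of_int (int_decode n) + 1) = q * c" using q by (auto simp: c powr_add)
  have m: "(?x, ?y) \<in> modl" using spec_modl assms(1) by simp
  have 1: "spec {..q * c} ?x = ?x" using spec.mono(2)[of ?C "{..q * c}" x] cell_Iic[of q n] qc by simp
  have 2: "spec {c<..} ?x = ?x" using spec.mono(2)[of ?C "{c<..}" x] cell_Ioi[of q n] c by simp
  show lo: "c * norm ?x \<le> norm ?y" using modl_lower[OF m _ 2] c0 by simp
  show "norm ?y \<le> q * c * norm ?x" using modl_upper[OF m _ 1] c0 q by simp
  have "c\<^sup>2 * (norm ?x)\<^sup>2 \<le> (norm ?y)\<^sup>2" using power_mono[OF lo, of 2] c0 by (simp add: power_mult_distrib)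
  also have "\<dots> \<le> q * c * (?y \<bullet> ?x)" using modl_inner_lower[OF m _ 1] c0 q by simp
  finally have "c * (c * (norm ?x)\<^sup>2) \<le> c * (q * (?y \<bullet> ?x))" by (simp add: power2_eq_square mult_ac)
  then have "c * (norm ?x)\<^sup>2 \<le> q * (?y \<bullet> ?x)" using c0 by simp
  then show "c / q * (norm ?x)\<^sup>2 \<le> ?y \<bullet> ?x" using q by (simp add: field_simps)
qed

lemma AE_spec_nonneg: "AE s in spec.vm x. 0 \<le> s"
proof -
  have "{..<0} \<in> null_sets (spec.vm x)" by (auto simp: null_sets_def spec.emeasure_vm spec_Iio)
  then show ?thesis by (rule AE_I'[where N = "{..<0}"]) auto
qed

text \<open>On each cell s^2 and |T|^2 equal the same constant up to the factor q^2, so both sides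
  agree up to q^2 for every q > 1.\<close>

lemma nn_integral_sq_modl:
  assumes xy: "(x, y) \<in> modl"
  shows "(\<integral>\<^sup>+s. ennreal (s\<^sup>2) \<partial>spec.vm x) = ennreal ((norm y)\<^sup>2)"
proof -
  have pos: "(\<integral>\<^sup>+s. ennreal (s\<^sup>2) \<partial>spec.vm x) = (\<integral>\<^sup>+s\<in>{0<..}. ennreal (s\<^sup>2) \<partial>spec.vm x)"
    using AE_spec_nonneg[of x] by (intro nn_integral_cong_AE) (auto split: split_indicator)
  have key: "(\<integral>\<^sup>+s\<in>{0<..}. ennreal (s\<^sup>2) \<partial>spec.vm x) \<le> ennreal (q\<^sup>2) * ennreal ((norm y)\<^sup>2) \<and>
    ennreal ((norm y)\<^sup>2) \<le> ennreal (q\<^sup>2) * (\<integral>\<^sup>+s\<in>{0<..}. ennreal (s\<^sup>2) \<partial>spec.vm x)" if q: "q > 1" for q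
  proof -
    let ?c = "\<lambda>n. q powr (of_int (int_decode n))"
    let ?Q = "\<lambda>n. ennreal ((norm (spec (cell q n) y))\<^sup>2)"
    have "(norm (spec (cell q n) y))\<^sup>2 = spec (cell q n) y \<bullet> y" for n
      using ortho_projD(3)[OF spec.proj[of "cell q n"]] by simp
    then have "(\<lambda>n. (norm (spec (cell q n) y))\<^sup>2) sums ((norm y)\<^sup>2)"
      using spec_cells[OF q xy, of y] by (simp add: power2_norm_eq_inner)
    then have sQ: "(\<Sum>n. ?Q n) = ennreal ((norm y)\<^sup>2)" by (intro suminf_ennreal_eq) auto
    have b1: "ennreal ((?c n)\<^sup>2) \<le> ennreal (s\<^sup>2) \<and> ennreal (s\<^sup>2) \<le> ennreal (q\<^sup>2) * ennreal ((?c n)\<^sup>2)" if "s \<in> cell q n" for n s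
    proof -
      have s: "?c n \<le> s" "s \<le> q * ?c n" using that q by (auto simp: cell_def powr_add mult.commute)
      have "s\<^sup>2 \<le> (q * ?c n)\<^sup>2" using s q by (intro power_mono order_trans[OF powr_ge_zero s(1)]) auto
      then show ?thesis using s power_mono[OF s(1), of 2]
        by (simp add: ennreal_mult'[symmetric] power_mult_distrib ennreal_leI)
    qed
    have b2: "ennreal ((?c n)\<^sup>2) * emeasure (spec.vm x) (cell q n) \<le> ?Q n" for n
      using power_mono[OF cell_bounds(1)[OF xy refl q, of n], of 2]
      by (simp add: spec.emeasure_vm_norm ennreal_mult'[symmetric] power_mult_distrib ennreal_leI)
    have b3: "?Q n \<le> ennreal (q\<^sup>2) * ennreal ((?c n)\<^sup>2) * emeasure (spec.vm x) (cell q n)" for n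
      using power_mono[OF cell_bounds(2)[OF xy refl q, of n], of 2]
      by (simp add: spec.emeasure_vm_norm ennreal_mult'[symmetric] power_mult_distrib ennreal_leI)
    show ?thesis
      using cell_integral[OF q spec.sets_vm _ b1 b2 b3] unfolding sQ by auto
  qed
  show ?thesis unfolding pos
  proof (rule antisym)
    show "(\<integral>\<^sup>+s\<in>{0<..}. ennreal (s\<^sup>2) \<partial>spec.vm x) \<le> ennreal ((norm y)\<^sup>2)" by (rule ennreal_le_scaled_limit) (rule key[THEN conjunct1])
    show "ennreal ((norm y)\<^sup>2) \<le> (\<integral>\<^sup>+s\<in>{0<..}. ennreal (s\<^sup>2) \<partial>spec.vm x)" by (rule ennreal_le_scaled_limit) (rule key[THEN conjunct2])
  qed
qed

lemma nn_integral_id_modl: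
  assumes xy: "(x, y) \<in> modl"
  shows "(\<integral>\<^sup>+s. ennreal s \<partial>spec.vm x) = ennreal (y \<bullet> x)"
proof -
  have pos: "(\<integral>\<^sup>+s. ennreal s \<partial>spec.vm x) = (\<integral>\<^sup>+s\<in>{0<..}. ennreal s \<partial>spec.vm x)"
    by (intro nn_integral_cong) (auto split: split_indicator simp: ennreal_neg)
  have key: "(\<integral>\<^sup>+s\<in>{0<..}. ennreal s \<partial>spec.vm x) \<le> ennreal (q\<^sup>2) * ennreal (y \<bullet> x) \<and>
    ennreal (y \<bullet> x) \<le> ennreal (q\<^sup>2) * (\<integral>\<^sup>+s\<in>{0<..}. ennreal s \<partial>spec.vm x)" if q: "q > 1" for q
  proof -
    let ?c = "\<lambda>n. q powr (of_int (int_decode n))"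
    let ?Q = "\<lambda>n. ennreal (spec (cell q n) y \<bullet> spec (cell q n) x)"
    have e: "spec (cell q n) y \<bullet> spec (cell q n) x = spec (cell q n) y \<bullet> x" for n
      using ortho_projD(1,2)[OF spec.proj[of "cell q n"]] by (metis cell_borel)
    have Qpos: "0 \<le> spec (cell q n) y \<bullet> spec (cell q n) x" for n
      using modl_pos spec_modl[OF xy] by simp
    have sQ: "(\<Sum>n. ?Q n) = ennreal (y \<bullet> x)"
      using spec_cells[OF q xy, of x] Qpos unfolding e by (intro suminf_ennreal_eq) auto
    have q2: "q\<^sup>2 * (?c n / q) = q * ?c n" for n using q by (simp add: power2_eq_square)
    have q3: "ennreal (q\<^sup>2) * ennreal (?c n / q) = ennreal (q * ?c n)" for n
      using q by (subst ennreal_mult'[symmetric]) (simp_all add: power2_eq_square)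
    have b1: "ennreal (?c n / q) \<le> ennreal s \<and> ennreal s \<le> ennreal (q\<^sup>2) * ennreal (?c n / q)" if "s \<in> cell q n" for n s
    proof -
      have s: "?c n \<le> s" "s \<le> q * ?c n" using that q by (auto simp: cell_def powr_add mult.commute)
      have "?c n / q \<le> ?c n / 1" using q by (intro divide_left_mono) auto
      then show ?thesis using s q unfolding q3 by (simp add: ennreal_leI)
    qed
    have b2: "ennreal (?c n / q) * emeasure (spec.vm x) (cell q n) \<le> ?Q n" for n
      using cell_bounds(3)[OF xy refl q, of n] q
      by (simp add: spec.emeasure_vm_norm ennreal_mult'[symmetric] ennreal_leI)
    have b3: "?Q n \<le> ennreal (q\<^sup>2) * ennreal (?c n / q) * emeasure (spec.vm x) (cell q n)" for n
    proof -
      have "spec (cell q n) y \<bullet> spec (cell q n) x \<le> norm (spec (cell q n) y) * norm (spec (cell q n) x)"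
        by (rule norm_cauchy_schwarz)
      also have "\<dots> \<le> q * ?c n * norm (spec (cell q n) x) * norm (spec (cell q n) x)"
        by (intro mult_right_mono cell_bounds(2)[OF xy refl q]) auto
      finally have "spec (cell q n) y \<bullet> spec (cell q n) x \<le> q\<^sup>2 * (?c n / q) * (norm (spec (cell q n) x))\<^sup>2"
        unfolding q2 by (simp add: power2_eq_square mult.assoc)
      moreover have "ennreal (q\<^sup>2) * ennreal (?c n / q) * emeasure (spec.vm x) (cell q n) =
         ennreal (q\<^sup>2 * (?c n / q) * (norm (spec (cell q n) x))\<^sup>2)"
        using q by (simp add: spec.emeasure_vm_norm ennreal_mult'[symmetric])
      ultimately show ?thesis by (simp only: ennreal_leI)
    qed
    show ?thesis
      using cell_integral[OF q spec.sets_vm _ b1 b2 b3] unfolding sQ by auto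
  qed
  show ?thesis unfolding pos
  proof (rule antisym)
    show "(\<integral>\<^sup>+s\<in>{0<..}. ennreal s \<partial>spec.vm x) \<le> ennreal (y \<bullet> x)" by (rule ennreal_le_scaled_limit) (rule key[THEN conjunct1])
    show "ennreal (y \<bullet> x) \<le> (\<integral>\<^sup>+s\<in>{0<..}. ennreal s \<partial>spec.vm x)" by (rule ennreal_le_scaled_limit) (rule key[THEN conjunct2])
  qed
qed

text \<open>For a finite second moment the truncations of x have images with orthogonal increments
  and bounded norms. These converge, and closedness of the graph puts x into the domain.\<close>

lemma domain_modl_iff: "x \<in> Domain modl \<longleftrightarrow> (\<integral>\<^sup>+s. ennreal (s\<^sup>2) \<partial>spec.vm x) < \<infinity>"
proof
  assume fin: "(\<integral>\<^sup>+s. ennreal (s\<^sup>2) \<partial>spec.vm x) < \<infinity>"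
  interpret M: closed_dense_op modl by (rule modl_closed_dense)
  let ?e = "\<lambda>n. spec {..real n}"
  have B: "{..real n} \<in> sets borel" for n by simp
  have "\<exists>z. ?e n x = rt z" for n using spec_in_domain[of "real n" "?e n x"] ortho_projD(1)[OF spec.proj[OF B]] by auto
  then obtain z where z: "\<And>n. ?e n x = rt (z n)" by metis
  define y where "y n = sq (z n)" for n
  have m: "(?e n x, y n) \<in> modl" for n using modl_param z y_def by auto
  have ey: "?e k (y n) = y k" if "k \<le> n" for k n
  proof -
    have "?e k (?e n x) = ?e k x" using that by (intro spec.mono) auto
    moreover have "(?e k (?e n x), ?e k (y n)) \<in> modl" by (rule spec_modl[OF m B])
    ultimately have "(?e k x, ?e k (y n)) \<in> modl" by simp
    then show ?thesis using m[of k] by (rule M.unique_image)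
  qed
  define C where "C = enn2real (\<integral>\<^sup>+s. ennreal (s\<^sup>2) \<partial>spec.vm x)"
  have bd: "(norm (y n))\<^sup>2 \<le> C" for n
  proof -
    have "ennreal ((norm (y n))\<^sup>2) = (\<integral>\<^sup>+s. indicator {..real n} s * ennreal (s\<^sup>2) \<partial>spec.vm x)"
      unfolding nn_integral_sq_modl[OF m, symmetric] spec.vm_E[OF B] by (subst nn_integral_density) auto
    also have "\<dots> \<le> (\<integral>\<^sup>+s. ennreal (s\<^sup>2) \<partial>spec.vm x)" by (intro nn_integral_mono) (auto split: split_indicator)
    also have "\<dots> = ennreal C" using fin unfolding C_def by (simp add: ennreal_enn2real)
    finally show ?thesis using ennreal_le_iff[of C] by (simp add: C_def)
  qed
  have "convergent y"
  proof (rule orthogonal_increments_convergent[OF _ bd])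
    fix k n :: nat assume "k \<le> n"
    have "(norm (y n))\<^sup>2 = (norm (?e k (y n)))\<^sup>2 + (norm (y n - ?e k (y n)))\<^sup>2"
      by (rule ortho_projD(6)[OF spec.proj[OF B]])
    then show "(norm (y n - y k))\<^sup>2 = (norm (y n))\<^sup>2 - (norm (y k))\<^sup>2"
      using ey[OF \<open>k \<le> n\<close>] by simp
  qed
  then obtain l where l: "y \<longlonglongrightarrow> l" by (auto simp: convergent_def)
  have "(\<lambda>n. ?e n x) \<longlonglongrightarrow> x" using specfam_at_top[of x] by (simp add: spec_Iic)
  with l have "(\<lambda>n. (?e n x, y n)) \<longlonglongrightarrow> (x, l)" by (intro tendsto_Pair)
  then have "(x, l) \<in> modl" using closed_sequentially[OF M.cl, of "\<lambda>n. (?e n x, y n)"] m by blast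
  then show "x \<in> Domain modl" by blast
qed (auto simp: nn_integral_sq_modl)

lemma integral_id_modl:
  assumes xy: "(x, y) \<in> modl"
  shows "integrable (spec.vm x) (\<lambda>s. s)" "(LINT s|spec.vm x. s) = y \<bullet> x"
proof -
  have 1: "(\<integral>\<^sup>+s. ennreal s \<partial>spec.vm x) = ennreal (y \<bullet> x)" by (rule nn_integral_id_modl[OF xy])
  show "integrable (spec.vm x) (\<lambda>s. s)"
    by (rule integrableI_nonneg) (use AE_spec_nonneg 1 in auto)
  show "(LINT s|spec.vm x. s) = y \<bullet> x"
    using modl_pos[OF xy] by (subst integral_eq_nn_integral) (use AE_spec_nonneg 1 in auto)
qed

end

section \<open>Uniqueness of the spectral measure of the modulus\<close>

context closed_dense_op
begin

lemma modl_res: "closed_dense_op.res modl = res"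
proof -
  interpret M: closed_dense_op modl by (rule modl_closed_dense)
  show ?thesis
  proof (rule blinfun_eqI)
    fix x
    show "M.res x = res x"
    proof (rule M.res_unique)
      show "(res x, sq (rt x)) \<in> modl" using modl_param rt(2) by metis
      fix v w assume "(v, w) \<in> modl"
      then obtain z where z: "v = rt z" "w = sq z" using modl_param by blast
      have "sq (rt x) \<bullet> w = sq (sq (rt x)) \<bullet> z" using psdD(2)[OF sq(1), of "sq (rt x)" z] z by simp
      also have "\<dots> = rt x \<bullet> z - res (rt x) \<bullet> z" by (simp add: sq(2) inner_diff_left)
      also have "rt x \<bullet> z = x \<bullet> v" using psdD(2)[OF rt(1), of x z] z by simp
      also have "res (rt x) \<bullet> z = res x \<bullet> v"
        using psdD(2)[OF rt(1), of "res x" z] z rt(2)[of "rt x"] rt(2)[of x] by simp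
      finally show "res x \<bullet> v + sq (rt x) \<bullet> w = x \<bullet> v" by simp
    qed
  qed
qed

text \<open>The content of \<open>spectral_resolution\<close> for the modulus, in terms of the real
  inner product.\<close>

definition resolves :: "(real set \<Rightarrow> 'a \<Rightarrow>\<^sub>L 'a) \<Rightarrow> bool" where
  "resolves E \<longleftrightarrow> pvm E \<and> (\<forall>x. x \<in> Domain modl \<longleftrightarrow> (\<integral>\<^sup>+s. ennreal (s\<^sup>2) \<partial>pvm.vm E x) < \<infinity>) \<and>
     (\<forall>(x, y)\<in>modl. (LINT s|pvm.vm E x. s) = y \<bullet> x)"

lemma resolves_spec: "resolves spec"
  unfolding resolves_def using spec.pvm_axioms domain_modl_iff integral_id_modl(2) by auto

lemma resolves_integral:
  assumes "resolves E" "(x, y) \<in> modl"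
  shows "integrable (pvm.vm E x) (\<lambda>s. s)" "(LINT s|pvm.vm E x. s) = y \<bullet> x"
proof -
  interpret pvm E using assms(1) by (simp add: resolves_def)
  interpret finite_measure "vm x" by (rule finite_measure_vm)
  show "(LINT s|vm x. s) = y \<bullet> x" using assms by (auto simp: resolves_def)
  have "(\<integral>\<^sup>+s. ennreal (s\<^sup>2) \<partial>vm x) < \<infinity>" using assms by (auto simp: resolves_def)
  then have "integrable (vm x) (\<lambda>s. s\<^sup>2)" by (intro integrableI_nonneg) auto
  then have "integrable (vm x) (\<lambda>s. 1 + s\<^sup>2)" by simp
  then show "integrable (vm x) (\<lambda>s. s)"
  proof (rule Bochner_Integration.integrable_bound)
    have "\<bar>s\<bar> \<le> 1 + s\<^sup>2" for s :: real using sum_power2_ge_zero[of "\<bar>s\<bar> - 1" 0] by (simp add: power2_diff)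
    then show "AE s in vm x. norm s \<le> norm (1 + s\<^sup>2)" by auto
  qed simp
qed

text \<open>Only diagonal values of |T| are known through E. For u in the range of E B and w in that
  of the complement, u + w and u - w have the same diagonal measure, so polarisation gives <|T| u,
  w> = 0. Hence |T| preserves the ranges of E.\<close>

lemma resolves_commute:
  assumes E: "resolves E" and A: "A \<in> sets borel" shows "commute (E A) res"
proof -
  interpret M: closed_dense_op modl by (rule modl_closed_dense)
  interpret E: pvm E using E by (simp add: resolves_def)
  have dom: "E B x \<in> Domain modl" if "x \<in> Domain modl" "B \<in> sets borel" for x B
  proof -
    have "(\<integral>\<^sup>+s. ennreal (s\<^sup>2) \<partial>E.vm (E B x)) = (\<integral>\<^sup>+s. indicator B s * ennreal (s\<^sup>2) \<partial>E.vm x)"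
      using that by (simp add: E.vm_E nn_integral_density)
    also have "\<dots> \<le> (\<integral>\<^sup>+s. ennreal (s\<^sup>2) \<partial>E.vm x)" by (intro nn_integral_mono) (auto split: split_indicator)
    also have "\<dots> < \<infinity>" using that(1) E by (auto simp: resolves_def)
    finally show ?thesis using E by (auto simp: resolves_def)
  qed
  have inv: "E B a = a" if B: "B \<in> sets borel" and xa: "(E B x, a) \<in> modl" for B x a
  proof -
    have "(a - E B a) \<bullet> y = 0" if y: "(y, y') \<in> modl" for y y'
    proof -
      have cB: "- B \<in> sets borel" using B by auto
      obtain b where b: "(E (- B) y, b) \<in> modl" using dom[OF _ cB] y by blast
      let ?u = "E B x" and ?w = "E (- B) y"
      have z: "E C ?u \<bullet> ?w = 0" if "C \<in> sets borel" for C
      proof -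
        have "E C ?u \<bullet> ?w = E (- B) (E B (E C x)) \<bullet> y"
          using E.E_comm[OF that B, of x] ortho_projD(2)[OF E.proj[OF cB], of "E B (E C x)" y] by simp
        also have "E (- B) (E B (E C x)) = 0" by (rule E.disjoint_zero) (use B cB in auto)
        finally show ?thesis by simp
      qed
      have "E.vm (?u + ?w) = E.vm (?u - ?w)"
      proof (rule measure_eqI)
        fix C assume "C \<in> sets (E.vm (?u + ?w))"
        then have C: "C \<in> sets borel" by simp
        have "E C (?u + ?w) \<bullet> (?u + ?w) = E C (?u - ?w) \<bullet> (?u - ?w)"
          using E.polar[OF C, of ?u ?w] z[OF C] by linarith
        then show "emeasure (E.vm (?u + ?w)) C = emeasure (E.vm (?u - ?w)) C" using C by (simp add: E.emeasure_vm)
      qed simp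
      then have "(a + b) \<bullet> (?u + ?w) = (a - b) \<bullet> (?u - ?w)"
        using resolves_integral(2)[OF E M.mem_add[OF xa b]] resolves_integral(2)[OF E M.mem_diff[OF xa b]] by simp
      then have "a \<bullet> ?w + b \<bullet> ?u = 0" by (simp add: inner_add_left inner_add_right inner_diff_left inner_diff_right)
      moreover have "b \<bullet> ?u = ?w \<bullet> a" using modl_sym[OF xa b] .
      ultimately have "a \<bullet> ?w = 0" by (simp add: inner_commute)
      then show ?thesis using E.compl[OF B, of y] ortho_projD(2)[OF E.proj[OF B], of a y]
        by (simp add: inner_diff_left inner_diff_right)
    qed
    from M.dense_zero[OF this] have "a - E B a = 0" .
    then show ?thesis by simp
  qed
  have cA: "- A \<in> sets borel" using A by auto
  have mem: "(E A x, E A y) \<in> modl" if xy: "(x, y) \<in> modl" for x y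
  proof -
    obtain a where a: "(E A x, a) \<in> modl" using dom[OF _ A] xy by blast
    obtain b where b: "(E (- A) x, b) \<in> modl" using dom[OF _ cA] xy by blast
    have "(x, a + b) \<in> modl" using M.mem_add[OF a b] E.compl[OF A, of x] by simp
    then have "y = a + b" using xy M.unique_image by blast
    moreover have "E A b = 0" using inv[OF cA b] E.compl[OF A, of b] by (simp add: algebra_simps)
    ultimately show ?thesis using inv[OF A a] a by (simp add: blinfun.add_right)
  qed
  have "M.res (E A x) = E A (M.res x)" for x
    by (rule M.commute_res[of "E A" "E A" "E A" "E A"]) (use mem ortho_projD(2)[OF E.proj[OF A]] in auto)
  then show ?thesis by (simp add: modl_res commute_iff)
qed

text \<open>The diagonal value <|T| x, x> is at most s |x|^2 when computed with E, and with F it is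
  larger unless x = 0.\<close>

lemma resolves_half_lines:
  assumes E: "resolves E" and F: "resolves F" and xy: "(x, y) \<in> modl"
    and x: "E {..s} x = x" "F {s<..} x = x"
  shows "x = 0"
proof -
  interpret E: pvm E using E by (simp add: resolves_def)
  interpret F: pvm F using F by (simp add: resolves_def)
  interpret fE: finite_measure "E.vm x" by (rule E.finite_measure_vm)
  interpret fF: finite_measure "F.vm x" by (rule F.finite_measure_vm)
  note iE = resolves_integral[OF E xy] and iF = resolves_integral[OF F xy]
  have mE: "measure (E.vm x) UNIV = (norm x)\<^sup>2" and mF: "measure (F.vm x) UNIV = (norm x)\<^sup>2"
    by (simp_all add: measure_def E.emeasure_vm_UNIV F.emeasure_vm_UNIV)
  have "E {s<..} (E {..s} x) = 0" by (rule E.disjoint_zero) auto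
  then have "E {s<..} x = 0" using x(1) by simp
  then have "{s<..} \<in> null_sets (E.vm x)" by (simp add: null_sets_def E.emeasure_vm)
  then have aE: "AE t in E.vm x. t \<le> s" by (rule AE_I'[where N = "{s<..}"]) auto
  have "F {..s} (F {s<..} x) = 0" by (rule F.disjoint_zero) auto
  then have "F {..s} x = 0" using x(2) by simp
  then have "{..s} \<in> null_sets (F.vm x)" by (simp add: null_sets_def F.emeasure_vm)
  then have aF: "AE t in F.vm x. s < t" by (rule AE_I'[where N = "{..s}"]) auto
  have "(LINT t|E.vm x. t) \<le> (LINT t|E.vm x. s)"
    by (rule integral_mono_AE) (use iE aE in auto)
  then have le: "y \<bullet> x \<le> s * (norm x)\<^sup>2" using iE mE by (simp add: mult.commute)
  have int: "integrable (F.vm x) (\<lambda>t. t - s)" using iF by simp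
  have val: "(LINT t|F.vm x. t - s) = y \<bullet> x - s * (norm x)\<^sup>2" using iF mF by (simp add: mult.commute)
  have ge: "0 \<le> (LINT t|F.vm x. t - s)" by (rule integral_nonneg_AE) (use aF in auto)
  then have "(LINT t|F.vm x. t - s) = 0" using val le by linarith
  moreover have "AE t in F.vm x. 0 \<le> t - s" using aF by eventually_elim simp
  ultimately have "AE t in F.vm x. t - s = 0"
    using integral_nonneg_eq_0_iff_AE[OF int] by blast
  with aF have "AE t in F.vm x. False" by eventually_elim simp
  then have "emeasure (F.vm x) UNIV = 0" using AE_iff_measurable[of UNIV "F.vm x" "\<lambda>_. False"] by simp
  then show ?thesis by (simp add: F.emeasure_vm_UNIV)
qed

lemma resolves_unique:
  assumes E: "resolves E" and A: "A \<in> sets borel" shows "E A = spec A"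
proof -
  interpret E: pvm E using E by (simp add: resolves_def)
  have B: "{..s} \<in> sets borel" "{s<..} \<in> sets borel" for s :: real by auto
  have c: "spec C (E D x) = E D (spec C x)" if "C \<in> sets borel" "D \<in> sets borel" for C D x
    using spec_commute[OF resolves_commute[OF E that(2)] that(1)] by (simp add: commute_iff)
  have r: "E D (res x) = res (E D x)" if "D \<in> sets borel" for D x
    using resolves_commute[OF E that] by (simp add: commute_iff)
  have dom: "\<exists>y. (res x, y) \<in> modl" for x using modl_param rt(2) by metis
  have z: "E {..s} (spec {s<..} x) = 0" for s x
  proof -
    \<comment> \<open>\<open>res\<close> moves this vector into the domain of |T|, commutes with
      both projections and is injective, so it suffices that the image vanishes.\<close>
    let ?w = "E {..s} (spec {s<..} x)"
    have 1: "E {..s} (res ?w) = res ?w" using r[OF B(1)] ortho_projD(1)[OF E.proj[OF B(1)]] by simp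
    have 2: "spec {s<..} (res ?w) = res ?w"
      using spec_res[OF B(2)] c[OF B(2) B(1)] ortho_projD(1)[OF spec.proj[OF B(2)]] by simp
    obtain y where "(res ?w, y) \<in> modl" using dom by blast
    from resolves_half_lines[OF E resolves_spec this 1 2] show ?thesis by (rule res_inj)
  qed
  have z': "E {s<..} (spec {..s} x) = 0" for s x
  proof -
    let ?w = "E {s<..} (spec {..s} x)"
    have 1: "E {s<..} (res ?w) = res ?w" using r[OF B(2)] ortho_projD(1)[OF E.proj[OF B(2)]] by simp
    have 2: "spec {..s} (res ?w) = res ?w"
      using spec_res[OF B(1)] c[OF B(1) B(2)] ortho_projD(1)[OF spec.proj[OF B(1)]] by simp
    obtain y where "(res ?w, y) \<in> modl" using dom by blast
    from resolves_half_lines[OF resolves_spec E this 2 1] show ?thesis by (rule res_inj)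
  qed
  have cmp: "- {..s} = {s<..}" for s :: real by auto
  have eq: "E {s<..} x = spec {s<..} x" for s x
  proof -
    have "E {s<..} x = E {s<..} (spec {..s} x) + E {s<..} (spec {s<..} x)"
      using spec.compl[OF B(1), of s x] unfolding cmp by (simp add: blinfun.bilinear_simps)
    also have "\<dots> = E {s<..} (spec {s<..} x)" by (simp add: z')
    also have "\<dots> = spec {s<..} x"
      using E.compl[OF B(1), of s "spec {s<..} x"] z unfolding cmp by simp
    finally show ?thesis .
  qed
  have "E.vm x = spec.vm x" for x
    by (rule measure_eqI_lessThan) (simp_all add: E.emeasure_vm spec.emeasure_vm eq)
  then have "emeasure (E.vm x) A = emeasure (spec.vm x) A" for x by simp
  then have "ennreal (E A x \<bullet> x) = ennreal (spec A x \<bullet> x)" for x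
    using A by (simp add: E.emeasure_vm spec.emeasure_vm)
  then have "E A x \<bullet> x = spec A x \<bullet> x" for x
    using E.E_nonneg[OF A, of x] spec.E_nonneg[OF A, of x] by (metis ennreal_inj)
  then show ?thesis
    using E.proj[OF A] spec.proj[OF A] by (intro self_adj_eqI) (auto simp: ortho_proj_def)
qed

end

section \<open>Complex Hilbert spaces\<close>

lemma cinner_simps:
  fixes x y z :: "'a::chilbert_space"
  shows "cinner x (y + z) = cinner x y + cinner x z" "cinner x (c *\<^sub>C y) = cnj c * cinner x y"
    "cinner 0 x = 0" "cinner x 0 = 0"
proof -
  show 1: "cinner x (y + z) = cinner x y + cinner x z"
    using cinner_commute[of x "y + z"] cinner_commute[of x y] cinner_commute[of x z] by (simp add: cinner_add_left)
  show 2: "cinner x (c *\<^sub>C y) = cnj c * cinner x y"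
    using cinner_commute[of x "c *\<^sub>C y"] cinner_commute[of x y] by (simp add: cinner_scaleC_left)
  show "cinner 0 x = 0" using cinner_add_left[of 0 0 x] by simp
  then show "cinner x 0 = 0" using cinner_commute[of x 0] by simp
qed

lemma cinner_eq: "cinner x y = Complex (x \<bullet> y) (x \<bullet> (\<i> *\<^sub>C y))"
proof (rule complex_eqI)
  show "Im (cinner x y) = Im (Complex (x \<bullet> y) (x \<bullet> (\<i> *\<^sub>C y)))"
    using Re_cinner[of x "\<i> *\<^sub>C y"] by (simp add: cinner_simps)
qed (simp add: Re_cinner)

lemma Im_cinner: "Im (cinner x y) = - ((\<i> *\<^sub>C x) \<bullet> y)"
  using Re_cinner[of "\<i> *\<^sub>C x" y] by (simp add: cinner_scaleC_left)

lemma inner_scaleC: "(c *\<^sub>C x) \<bullet> y = x \<bullet> (cnj c *\<^sub>C (y :: 'a::chilbert_space))"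
  using Re_cinner[of "c *\<^sub>C x" y] Re_cinner[of x "cnj c *\<^sub>C y"] by (simp add: cinner_scaleC_left cinner_simps)

lemma norm_scaleC: "norm (c *\<^sub>C (x :: 'a::chilbert_space)) = cmod c * norm x"
proof (rule power2_eq_imp_eq)
  have "(norm (c *\<^sub>C x))\<^sup>2 = x \<bullet> ((cnj c * c) *\<^sub>C x)"
    by (simp add: power2_norm_eq_inner inner_scaleC scaleC_scaleC)
  also have "(cnj c * c) *\<^sub>C x = (cmod c)\<^sup>2 *\<^sub>R x"
    by (simp only: scaleR_scaleC complex_norm_square mult.commute)
  finally show "(norm (c *\<^sub>C x))\<^sup>2 = (cmod c * norm x)\<^sup>2" by (simp add: power2_norm_eq_inner power_mult_distrib)
qed auto

lemma csubspace_imp_subspace: "csubspace S \<Longrightarrow> subspace S"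
  by (auto simp: csubspace_def subspace_def scaleR_scaleC)

lemma csubspace_pairD: "csubspace T \<Longrightarrow> (x, y) \<in> T \<Longrightarrow> (c *\<^sub>C x, c *\<^sub>C y) \<in> T"
  unfolding csubspace_def scaleC_prod_def by (metis fst_conv snd_conv)

lemma closed_densely_defined_iff: "closed_densely_defined T \<longleftrightarrow> csubspace T \<and> closed_dense_op T"
  by (auto simp: closed_densely_defined_def closed_dense_op_def csubspace_imp_subspace)

definition cmul :: "complex \<Rightarrow> 'a::chilbert_space \<Rightarrow>\<^sub>L 'a" where
  "cmul c = Blinfun (\<lambda>x. c *\<^sub>C x)"

lemma scaleC_scaleR: "c *\<^sub>C (r *\<^sub>R x) = r *\<^sub>R (c *\<^sub>C x)"
  by (simp add: scaleR_scaleC scaleC_scaleC mult.commute)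

lemma cmul_apply [simp]: "cmul c x = c *\<^sub>C (x :: 'a::chilbert_space)"
proof -
  have "\<exists>F. blinfun_apply F = (\<lambda>x::'a. c *\<^sub>C x)"
    by (rule blinfun_exists[where K = "cmod c"]) (auto simp: scaleC_add_right norm_scaleC mult.commute scaleC_scaleR)
  then obtain F where "blinfun_apply F = (\<lambda>x::'a. c *\<^sub>C x)" by blast
  then show ?thesis unfolding cmul_def by (metis blinfun_apply_inverse)
qed

lemma bounded_ops_iff: "X \<in> bounded_ops \<longleftrightarrow> (\<forall>c. commute X (cmul c))"
  by (auto simp: bounded_ops_def commute_iff)

lemma bounded_opsD: "X \<in> bounded_ops \<Longrightarrow> X (c *\<^sub>C x) = c *\<^sub>C X x"
  by (simp add: bounded_ops_def)

lemma radj_bounded_ops: "X \<in> bounded_ops \<Longrightarrow> radj X \<in> bounded_ops"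
proof -
  assume X: "X \<in> bounded_ops"
  have "y \<bullet> radj X (c *\<^sub>C x) = y \<bullet> (c *\<^sub>C radj X x)" for c x y
  proof -
    have "y \<bullet> radj X (c *\<^sub>C x) = (cnj c *\<^sub>C X y) \<bullet> x" by (simp add: radj[symmetric] inner_scaleC)
    also have "\<dots> = X (cnj c *\<^sub>C y) \<bullet> x" using X by (simp add: bounded_opsD)
    also have "\<dots> = y \<bullet> (c *\<^sub>C radj X x)" by (simp add: radj inner_scaleC)
    finally show ?thesis .
  qed
  then show ?thesis unfolding bounded_ops_def using vector_eq_ldot by blast
qed

lemma star_eq_radj:
  fixes X :: "'a::chilbert_space \<Rightarrow>\<^sub>L 'a"
  assumes "X \<in> bounded_ops" shows "star X = radj X"
  unfolding star_def
proof (rule the_equality)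
  show "\<forall>x y. cinner (X x) y = cinner x (radj X y)"
    unfolding cinner_eq using bounded_opsD[OF radj_bounded_ops[OF assms]] by (simp add: radj)
  fix Y :: "'a \<Rightarrow>\<^sub>L 'a" assume Y: "\<forall>x y. cinner (X x) y = cinner x (Y y)"
  show "Y = radj X"
  proof (rule blinfun_eqI)
    fix y
    have "x \<bullet> Y y = x \<bullet> radj X y" for x using Y radj[of X x y] by (metis Re_cinner)
    then show "Y y = radj X y" using vector_eq_ldot by blast
  qed
qed

lemma radj_eqI:
  fixes X :: "'a::{real_inner,banach} \<Rightarrow>\<^sub>L 'b::{real_inner,banach}" and Y :: "'b \<Rightarrow>\<^sub>L 'a"
  assumes "\<And>x y. X x \<bullet> y = x \<bullet> Y y" shows "radj X = Y"
proof (rule blinfun_eqI)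
  fix y
  have "x \<bullet> radj X y = x \<bullet> Y y" for x using assms radj[of X x y] by simp
  then show "radj X y = Y y" using vector_eq_ldot by blast
qed

lemma self_adj_iff_radj: "self_adj X \<longleftrightarrow> radj X = (X :: 'a::{real_inner,banach} \<Rightarrow>\<^sub>L 'a)"
  unfolding self_adj_def using radj_eqI[of X X] radj by metis

lemma radj_radj: "radj (radj X) = (X :: 'a::{real_inner,banach} \<Rightarrow>\<^sub>L 'b::{real_inner,banach})"
  by (rule radj_eqI) (metis radj inner_commute)

lemma radj_compose:
  fixes X :: "'b::{real_inner,banach} \<Rightarrow>\<^sub>L 'c::{real_inner,banach}" and Y :: "'a::{real_inner,banach} \<Rightarrow>\<^sub>L 'b"
  shows "radj (X o\<^sub>L Y) = radj Y o\<^sub>L radj X"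
  by (rule radj_eqI) (simp add: radj)

lemma projection_iff: "projection p \<longleftrightarrow> p \<in> bounded_ops \<and> ortho_proj p"
proof (cases "p \<in> bounded_ops")
  case True
  have "p o\<^sub>L p = p \<longleftrightarrow> (\<forall>x. p (p x) = p x)" by (metis blinfun_apply_blinfun_compose blinfun_eqI)
  then show ?thesis using True star_eq_radj[OF True] by (auto simp: projection_def ortho_proj_def self_adj_iff_radj)
qed (simp add: projection_def)

lemma cinner_real_iff:
  fixes X :: "'a::chilbert_space \<Rightarrow>\<^sub>L 'a"
  assumes "X \<in> bounded_ops" shows "(\<forall>x. Im (cinner (X x) x) = 0) \<longleftrightarrow> self_adj X"
proof
  assume im: "\<forall>x. Im (cinner (X x) x) = 0"
  show "self_adj X"
    unfolding self_adj_def
  proof (intro allI)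
    fix x y
    have z: "X u \<bullet> (\<i> *\<^sub>C u) = 0" for u using im by (simp add: cinner_eq)
    \<comment> \<open>Vanishing of <X u, i u> at u = x, w and x + w yields the mixed relation, and i
      w = y.\<close>
    define w :: 'a where "w = (- \<i>) *\<^sub>C y"
    have iw: "\<i> *\<^sub>C w = y" by (simp add: w_def scaleC_scaleC) (metis scaleR_scaleC of_real_1 scaleR_one)
    have "X x \<bullet> (\<i> *\<^sub>C w) + X w \<bullet> (\<i> *\<^sub>C x) = 0"
      using z[of "x + w"] z[of x] z[of w]
      by (simp add: blinfun.add_right scaleC_add_right inner_add_left inner_add_right)
    moreover have "X w \<bullet> (\<i> *\<^sub>C x) = - (X (\<i> *\<^sub>C w) \<bullet> x)"
    proof -
      have "X (\<i> *\<^sub>C w) \<bullet> x = X w \<bullet> ((- \<i>) *\<^sub>C x)" by (simp add: bounded_opsD[OF assms] inner_scaleC)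
      also have "(- \<i>) *\<^sub>C x = - (\<i> *\<^sub>C x)"
        using scaleC_add_left[of "- \<i>" \<i> x] scaleR_scaleC[of 0 x] by (simp add: eq_neg_iff_add_eq_0)
      finally show ?thesis by simp
    qed
    ultimately show "X x \<bullet> y = x \<bullet> X y" unfolding iw by (simp add: inner_commute)
  qed
next
  assume sa: "self_adj X"
  show "\<forall>x. Im (cinner (X x) x) = 0"
  proof
    fix x
    have "(\<i> *\<^sub>C X x) \<bullet> x = X x \<bullet> ((- \<i>) *\<^sub>C x)" by (simp add: inner_scaleC)
    also have "\<dots> = x \<bullet> X ((- \<i>) *\<^sub>C x)" using sa by (rule self_adjD)
    also have "\<dots> = (\<i> *\<^sub>C x) \<bullet> X x" by (simp add: bounded_opsD[OF assms] inner_scaleC)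
    also have "\<dots> = X (\<i> *\<^sub>C x) \<bullet> x" using self_adjD[OF sa, of "\<i> *\<^sub>C x" x] by simp
    finally have "(\<i> *\<^sub>C X x) \<bullet> x = X (\<i> *\<^sub>C x) \<bullet> x" .
    moreover have "X x \<bullet> ((- \<i>) *\<^sub>C x) = - (X x \<bullet> (\<i> *\<^sub>C x))"
    proof -
      have "(- \<i>) *\<^sub>C x = - (\<i> *\<^sub>C x)"
        using scaleC_add_left[of "- \<i>" \<i> x] scaleR_scaleC[of 0 x] by (simp add: eq_neg_iff_add_eq_0)
      then show ?thesis by simp
    qed
    moreover have "X x \<bullet> (\<i> *\<^sub>C x) = x \<bullet> (\<i> *\<^sub>C X x)"
      using self_adjD[OF sa, of x "\<i> *\<^sub>C x"] by (simp add: bounded_opsD[OF assms])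
    ultimately show "Im (cinner (X x) x) = 0"
      using \<open>(\<i> *\<^sub>C X x) \<bullet> x = X x \<bullet> ((- \<i>) *\<^sub>C x)\<close> by (simp add: Im_cinner inner_commute)
  qed
qed

lemma pos_op_iff: "pos_op X \<longleftrightarrow> X \<in> bounded_ops \<and> psd X"
proof (cases "X \<in> bounded_ops")
  case True
  have "pos_op X \<longleftrightarrow> (\<forall>x. 0 \<le> X x \<bullet> x) \<and> (\<forall>x. Im (cinner (X x) x) = 0)"
    using True by (auto simp: pos_op_def complex_nonneg_Reals_iff Re_cinner)
  then show ?thesis using True by (auto simp: psd_def cinner_real_iff[OF True])
qed (simp add: pos_op_def)

lemma adj_eq:
  assumes "csubspace T" shows "adj T = {(x, y). \<forall>(v, w)\<in>T. w \<bullet> x = v \<bullet> y}"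
proof (intro equalityI subsetI)
  fix p assume "p \<in> adj T"
  then show "p \<in> {(x, y). \<forall>(v, w)\<in>T. w \<bullet> x = v \<bullet> y}"
    unfolding adj_def by (auto simp flip: Re_cinner)
next
  fix p assume p: "p \<in> {(x, y). \<forall>(v, w)\<in>T. w \<bullet> x = v \<bullet> y}"
  obtain x y where xy: "p = (x, y)" by (cases p)
  have "cinner w x = cinner v y" if "(v, w) \<in> T" for v w
  proof (rule complex_eqI)
    have "(\<i> *\<^sub>C v, \<i> *\<^sub>C w) \<in> T" using csubspace_pairD[OF assms that] .
    then show "Im (cinner w x) = Im (cinner v y)" using p xy by (auto simp: Im_cinner)
    show "Re (cinner w x) = Re (cinner v y)" using p xy that by (auto simp: Re_cinner)
  qed
  then show "p \<in> adj T" by (auto simp: adj_def xy)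
qed

lemma vector_measure_eq: "pvm E \<Longrightarrow> vector_measure E x = pvm.vm E x"
  by (simp add: vector_measure_def pvm.vm_def Re_cinner)

lemma proj_valued_measure_iff:
  "proj_valued_measure E \<longleftrightarrow> pvm E \<and> (\<forall>B\<in>sets borel. E B \<in> bounded_ops)"
  unfolding proj_valued_measure_def pvm_def by (auto simp: projection_iff)

lemma res_bounded_ops:
  assumes "closed_densely_defined T" shows "closed_dense_op.res T \<in> bounded_ops"
proof -
  have cs: "csubspace T" and "closed_dense_op T" using assms by (auto simp: closed_densely_defined_iff)
  interpret closed_dense_op T by fact
  have "res (cmul c x) = cmul c (res x)" for c x
    by (rule commute_res[of "cmul c" "cmul c" "cmul (cnj c)" "cmul (cnj c)"])
      (auto simp: csubspace_pairD[OF cs] inner_scaleC)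
  then show ?thesis by (simp add: bounded_ops_def)
qed

lemma spec_bounded_ops:
  assumes "closed_densely_defined T" "A \<in> sets borel" shows "closed_dense_op.spec T A \<in> bounded_ops"
proof -
  interpret closed_dense_op T using assms(1) by (simp add: closed_densely_defined_iff)
  have "commute (cmul c) res" for c using res_bounded_ops[OF assms(1)] by (auto simp: bounded_ops_iff intro: commute_sym)
  from spec_commute[OF this assms(2)] show ?thesis by (auto simp: bounded_ops_iff intro: commute_sym)
qed

text \<open>Discharges the description operator in \<open>abs_op\<close>: the modulus is complex
  linear because \<open>rt\<close> and \<open>sq\<close> commute with scalars, and
  \<open>modl_unique\<close> excludes competitors.\<close>

lemma abs_op_eq_modl:
  assumes T: "closed_densely_defined T" shows "abs_op T = closed_dense_op.modl T" "pos_selfadjoint (abs_op T)"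
proof -
  have cs: "csubspace T" and "closed_dense_op T" using T by (auto simp: closed_densely_defined_iff)
  interpret closed_dense_op T by fact
  have c: "commute (cmul c) res" for c using res_bounded_ops[OF T] by (auto simp: bounded_ops_iff intro: commute_sym)
  have sqc: "sq (c *\<^sub>C x) = c *\<^sub>C sq x" for c x using commuteD[OF sq(3)[OF c], of c x] by simp
  have rtc: "rt (c *\<^sub>C x) = c *\<^sub>C rt x" for c x using commuteD[OF commute_rt[OF c], of c x] by simp
  have csm: "csubspace modl"
    by (auto simp: csubspace_def modl_def blinfun.add_right zero_prod_def scaleC_prod_def sqc rtc)
  have comp: "T O adj T = {(x, y). res (x + y) = x}"
    unfolding adj_eq[OF cs] using adj_comp_iff by (auto simp: relcomp_unfold)
  have "cinner y x \<in> \<real>\<^sub>\<ge>\<^sub>0" if "(x, y) \<in> modl" for x y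
  proof -
    have "(\<i> *\<^sub>C y) \<bullet> x = (\<i> *\<^sub>C x) \<bullet> y" using modl_sym[OF that csubspace_pairD[OF csm that]] .
    moreover have "(\<i> *\<^sub>C x) \<bullet> y = x \<bullet> ((- \<i>) *\<^sub>C y)" by (simp add: inner_scaleC)
    moreover have "(- \<i>) *\<^sub>C y = - (\<i> *\<^sub>C y)"
      using scaleC_add_left[of "- \<i>" \<i> y] scaleR_scaleC[of 0 y] by (simp add: eq_neg_iff_add_eq_0)
    ultimately have "Im (cinner y x) = 0" by (simp add: Im_cinner inner_commute)
    then show ?thesis using modl_pos[OF that] by (simp add: complex_nonneg_Reals_iff Re_cinner)
  qed
  then have ps: "pos_selfadjoint modl"
    unfolding pos_selfadjoint_def
    using csm modl_closed_dense adj_eq[OF csm] modl_self_adj by (auto simp: closed_densely_defined_iff)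
  have "abs_op T = modl"
    unfolding abs_op_def
  proof (rule the_equality)
    show "pos_selfadjoint modl \<and> modl O modl = T O adj T"
      using ps comp modl_comp_iff by (auto simp del: relcomp.simps)
    fix S assume S: "pos_selfadjoint S \<and> S O S = T O adj T"
    then have csS: "csubspace S" "closed_dense_op S" "adj S = S"
      by (auto simp: pos_selfadjoint_def closed_densely_defined_iff)
    show "S = modl"
    proof (rule modl_unique[OF csS(2)])
      show "{(x, y). \<forall>(v, w)\<in>S. w \<bullet> x = v \<bullet> y} = S" using adj_eq[OF csS(1)] csS(3) by simp
      show "0 \<le> y \<bullet> x" if "(x, y) \<in> S" for x y
        using S that by (auto simp: pos_selfadjoint_def complex_nonneg_Reals_iff Re_cinner)
      show "(x, y) \<in> S O S \<longleftrightarrow> res (x + y) = x" for x y using S comp by auto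
    qed
  qed
  then show "abs_op T = modl" "pos_selfadjoint (abs_op T)" using ps by auto
qed

lemma spectral_resolution_modl_iff:
  assumes T: "closed_densely_defined T"
  shows "spectral_resolution (closed_dense_op.modl T) E \<longleftrightarrow>
    closed_dense_op.resolves T E \<and> (\<forall>B\<in>sets borel. E B \<in> bounded_ops)"
proof -
  interpret closed_dense_op T using T by (simp add: closed_densely_defined_iff)
  have "pos_selfadjoint modl" using abs_op_eq_modl[OF T] by simp
  then have "cinner y x = complex_of_real (y \<bullet> x)" if "(x, y) \<in> modl" for x y
    using that by (fastforce simp: pos_selfadjoint_def complex_nonneg_Reals_iff Re_cinner complex_eq_iff)
  then have "(\<forall>(x, y)\<in>modl. cinner y x = complex_of_real I) = (\<forall>(x, y)\<in>modl. I = y \<bullet> x)" for I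
    by auto
  have "(\<forall>(x, y)\<in>modl. cinner y x = complex_of_real (f x)) = (\<forall>(x, y)\<in>modl. f x = y \<bullet> x)" for f
  proof -
    have "cinner y x = complex_of_real (f x) \<longleftrightarrow> f x = y \<bullet> x" if "(x, y) \<in> modl" for x y
      using \<open>\<And>x y. (x, y) \<in> modl \<Longrightarrow> cinner y x = complex_of_real (y \<bullet> x)\<close>[OF that] by auto
    then show ?thesis by blast
  qed
  then show ?thesis
    unfolding spectral_resolution_def resolves_def proj_valued_measure_iff
    using vector_measure_eq[of E] by auto
qed

text \<open>The choice in \<open>spectral_measure\<close> is harmless, since every resolution agrees
  with \<open>spec\<close> on Borel sets.\<close>

lemma spectral_measure_abs_op:
  assumes T: "closed_densely_defined T" and A: "A \<in> sets borel"
  shows "spectral_measure (abs_op T) A = closed_dense_op.spec T A"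
proof -
  interpret closed_dense_op T using T by (simp add: closed_densely_defined_iff)
  have "spectral_resolution modl spec"
    unfolding spectral_resolution_modl_iff[OF T] using resolves_spec spec_bounded_ops[OF T] by blast
  then have "spectral_resolution modl (spectral_measure modl)" 
    unfolding spectral_measure_def by (rule someI[of "spectral_resolution modl" spec])
  then have "resolves (spectral_measure modl)" unfolding spectral_resolution_modl_iff[OF T] by blast
  from resolves_unique[OF this A] show ?thesis unfolding abs_op_eq_modl[OF T] .
qed

section \<open>Von Neumann algebras and normal weights\<close>

lemma commutant_iff: "X \<in> commutant S \<longleftrightarrow> X \<in> bounded_ops \<and> (\<forall>Y\<in>S. commute X Y)"
  by (auto simp: commutant_def commute_def)

lemma scaleC_zero_right: "c *\<^sub>C (0::'a::chilbert_space) = 0"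
  using norm_scaleC[of c "0::'a"] by simp

lemma scaleC_diff_right: "c *\<^sub>C (x - y) = c *\<^sub>C x - c *\<^sub>C (y::'a::chilbert_space)"
  using scaleC_add_right[of c "x - y" y] by (simp add: algebra_simps)

lemma bounded_ops_closed:
  shows "id_blinfun \<in> bounded_ops" "0 \<in> bounded_ops"
    and "X \<in> bounded_ops \<Longrightarrow> Y \<in> bounded_ops \<Longrightarrow> X + Y \<in> bounded_ops"
    and "X \<in> bounded_ops \<Longrightarrow> Y \<in> bounded_ops \<Longrightarrow> X - Y \<in> bounded_ops"
    and "X \<in> bounded_ops \<Longrightarrow> r *\<^sub>R X \<in> bounded_ops"
    and "X \<in> bounded_ops \<Longrightarrow> Y \<in> bounded_ops \<Longrightarrow> X o\<^sub>L Y \<in> bounded_ops"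
  by (auto simp: bounded_ops_def blinfun.bilinear_simps scaleC_zero_right scaleC_diff_right
      scaleC_add_right scaleC_scaleR)

text \<open>Multiplication by a non-real scalar commutes only with complex linear operators, hence
  the smaller set in the last clause.\<close>

lemma commutant_closed:
  shows "id_blinfun \<in> commutant S" "0 \<in> commutant S"
    and "X \<in> commutant S \<Longrightarrow> Y \<in> commutant S \<Longrightarrow> X + Y \<in> commutant S"
    and "X \<in> commutant S \<Longrightarrow> Y \<in> commutant S \<Longrightarrow> X - Y \<in> commutant S"
    and "X \<in> commutant S \<Longrightarrow> r *\<^sub>R X \<in> commutant S"
    and "X \<in> commutant S \<Longrightarrow> Y \<in> commutant S \<Longrightarrow> X o\<^sub>L Y \<in> commutant S"
    and "psd X \<Longrightarrow> X \<in> commutant S \<Longrightarrow> psd_sqrt X \<in> commutant S"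
    and "X \<in> commutant S \<Longrightarrow> (cmul c o\<^sub>L X) \<in> commutant {Y. Y \<in> S \<and> Y \<in> bounded_ops}"
proof -
  show "id_blinfun \<in> commutant S" "0 \<in> commutant S"
    and "X \<in> commutant S \<Longrightarrow> Y \<in> commutant S \<Longrightarrow> X + Y \<in> commutant S"
    and "X \<in> commutant S \<Longrightarrow> Y \<in> commutant S \<Longrightarrow> X - Y \<in> commutant S"
    and "X \<in> commutant S \<Longrightarrow> r *\<^sub>R X \<in> commutant S"
    and "X \<in> commutant S \<Longrightarrow> Y \<in> commutant S \<Longrightarrow> X o\<^sub>L Y \<in> commutant S"
    by (auto simp: commutant_iff bounded_ops_closed commute_iff blinfun.bilinear_simps)
  show "psd X \<Longrightarrow> X \<in> commutant S \<Longrightarrow> psd_sqrt X \<in> commutant S"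
    by (auto simp: commutant_iff bounded_ops_iff intro!: commute_sym[OF psd_sqrt(3)] dest: commute_sym)
  show "X \<in> commutant S \<Longrightarrow> (cmul c o\<^sub>L X) \<in> commutant {Y. Y \<in> S \<and> Y \<in> bounded_ops}"
    by (auto simp: commutant_iff commute_iff bounded_ops_def scaleC_scaleC mult.commute)
qed

lemma commutant_limit:
  fixes X :: "nat \<Rightarrow> 'h::chilbert_space \<Rightarrow>\<^sub>L 'h" and Y :: "'h \<Rightarrow>\<^sub>L 'h"
  assumes "\<And>n. X n \<in> commutant S" "\<And>x. (\<lambda>n. X n x) \<longlonglongrightarrow> Y x" shows "Y \<in> commutant S"
proof -
  have c: "commute Y Z" if "\<And>n. commute (X n) Z" for Z
    unfolding commute_iff
  proof
    fix x
    have "(\<lambda>n. Z (X n x)) \<longlonglongrightarrow> Z (Y x)" by (intro blinfun.tendsto tendsto_const assms(2))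
    moreover have "(\<lambda>n. Z (X n x)) = (\<lambda>n. X n (Z x))" using that by (auto simp: commute_iff)
    ultimately show "Y (Z x) = Z (Y x)" using LIMSEQ_unique[OF assms(2)[of "Z x"]] by simp
  qed
  show ?thesis using assms(1) c unfolding commutant_iff bounded_ops_iff by blast
qed

lemma commute_radj:
  fixes X Y :: "'h::{real_inner,banach} \<Rightarrow>\<^sub>L 'h"
  shows "commute X Y \<Longrightarrow> commute (radj X) (radj Y)"
  unfolding commute_def by (metis radj_compose)

lemma commutant_radj:
  assumes "\<And>Y. Y \<in> S \<Longrightarrow> radj Y \<in> S" "X \<in> commutant S" shows "radj X \<in> commutant S"
  unfolding commutant_iff
proof (intro conjI ballI)
  show "radj X \<in> bounded_ops" using assms radj_bounded_ops by (auto simp: commutant_iff)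
  fix Y assume "Y \<in> S"
  then have "commute X (radj Y)" using assms by (auto simp: commutant_iff)
  from commute_radj[OF this] show "commute (radj X) Y" by (simp add: radj_radj)
qed

text \<open>Take u = h + i sqrt(1 - h^2). Affiliation speaks of unitaries only, so commutation has
  to be passed from these to the whole commutant.\<close>

lemma self_adj_unitary_dilation:
  fixes h :: "'h::chilbert_space \<Rightarrow>\<^sub>L 'h"
  assumes h: "self_adj h" "h \<in> commutant S" and S: "S \<subseteq> bounded_ops" and n: "norm h \<le> 1"
  shows "\<exists>u\<in>commutant S. unitary u \<and> unitary (radj u) \<and> radj u \<in> commutant S \<and> h = (1/2) *\<^sub>R (u + radj u)"
proof -
  have hb: "h \<in> bounded_ops" using h by (simp add: commutant_iff)
  let ?X = "id_blinfun - (h o\<^sub>L h)"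
  have le: "x \<bullet> h (h x) \<le> x \<bullet> x" for x
  proof -
    have "norm (h x) \<le> norm x"
      using norm_blinfun[of h x] mult_right_mono[OF n norm_ge_zero[of x]] by simp
    then have "(norm (h x))\<^sup>2 \<le> (norm x)\<^sup>2" by (rule power_mono) simp
    then show ?thesis using self_adjD[OF h(1), of x "h x"] by (simp add: power2_norm_eq_inner)
  qed
  have sah: "h (h x) \<bullet> y = x \<bullet> h (h y)" for x y using self_adjD[OF h(1)] by metis
  have Xx: "?X x = x - h (h x)" for x by (simp add: blinfun.diff_left)
  have X: "psd ?X"
    unfolding psd_def self_adj_def Xx inner_diff_left inner_diff_right using le sah
    by (simp add: inner_commute[of "h (h _)"])
  let ?w = "psd_sqrt ?X"
  have Xc: "?X \<in> commutant S"
    by (rule commutant_closed(4)[OF commutant_closed(1) commutant_closed(6)[OF h(2) h(2)]])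
  have w: "psd ?w" "?w \<in> commutant S" "\<And>x. ?w (?w x) = x - h (h x)"
    using psd_sqrt(1,2)[OF X] commutant_closed(7)[OF X Xc] by (auto simp: blinfun.bilinear_simps)
  have wb: "?w \<in> bounded_ops" using w by (simp add: commutant_iff)
  have hw: "h (?w x) = ?w (h x)" for x
    using psd_sqrt(3)[OF X, of h] by (simp add: commute_iff blinfun.bilinear_simps)
  have mi: "(- \<i>) *\<^sub>C (x::'h) = - (\<i> *\<^sub>C x)" for x
    using scaleC_add_left[of "- \<i>" \<i> x] scaleR_scaleC[of 0 x] by (simp add: eq_neg_iff_add_eq_0)
  have ii: "\<i> *\<^sub>C \<i> *\<^sub>C (x::'h) = - x" for x
    using scaleR_scaleC[of "-1" x] by (simp add: scaleC_scaleC)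
  let ?iw = "cmul \<i> o\<^sub>L ?w"
  have SS: "{Y. Y \<in> S \<and> Y \<in> bounded_ops} = S" using S by auto
  have iw: "?iw \<in> commutant S" using commutant_closed(8)[OF w(2), of \<i>] unfolding SS .
  define u where "u = h + ?iw"
  define v where "v = h - ?iw"
  have ux: "u x = h x + \<i> *\<^sub>C ?w x" and vx: "v x = h x - \<i> *\<^sub>C ?w x" for x by (auto simp: u_def v_def blinfun.bilinear_simps)
  have uv: "u \<in> commutant S" "v \<in> commutant S" 
    unfolding u_def v_def by (rule commutant_closed(3,4)[OF h(2) iw])+
  have rad: "radj u = v"
  proof (rule radj_eqI)
    fix x y
    have "(\<i> *\<^sub>C ?w x) \<bullet> y = - (x \<bullet> (\<i> *\<^sub>C ?w y))"
      using psdD(2)[OF w(1), of x "(- \<i>) *\<^sub>C y"] bounded_opsD[OF wb, of "- \<i>" y] by (simp add: inner_scaleC mi)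
    then show "u x \<bullet> y = x \<bullet> v y" using self_adjD[OF h(1), of x y]
      by (simp add: ux vx inner_add_left inner_diff_right)
  qed
  have un: "u (v x) = x" "v (u x) = x" for x
    using w(3)[of x] hw[of x] ii bounded_opsD[OF wb] bounded_opsD[OF hb]
    by (simp_all add: ux vx blinfun.bilinear_simps algebra_simps)
  have b: "u \<in> bounded_ops" "v \<in> bounded_ops" using uv by (auto simp: commutant_iff)
  have "unitary u" "unitary v"
    using b un rad radj_radj[of u] by (auto simp: unitary_def star_eq_radj intro!: blinfun_eqI)
  moreover have "h = (1/2) *\<^sub>R (u + v)" by (rule blinfun_eqI) (simp add: blinfun.bilinear_simps ux vx scaleR_2[symmetric])
  ultimately show ?thesis using uv rad by auto
qed

definition vector_state :: "'a::chilbert_space \<Rightarrow> 'a bop \<Rightarrow> ennreal" where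
  "vector_state \<xi> X = ennreal (X \<xi> \<bullet> \<xi>)"

locale vna =
  fixes M :: "'h::chilbert_space bop set"
  assumes vna: "von_neumann_algebra M"
begin

lemma M_bounded: "X \<in> M \<Longrightarrow> X \<in> bounded_ops"
  using vna by (auto simp: von_neumann_algebra_def)

lemma M_radj: "X \<in> M \<Longrightarrow> radj X \<in> M"
  using vna M_bounded star_eq_radj unfolding von_neumann_algebra_def by metis

lemma M_eq: "commutant (commutant M) = M"
  using vna by (auto simp: von_neumann_algebra_def)

lemmas M_closed = commutant_closed(1-7)[where S = "commutant M", unfolded M_eq]
lemmas M_limit = commutant_limit[where S = "commutant M", unfolded M_eq]

lemma comm_radj: "X \<in> commutant M \<Longrightarrow> radj X \<in> commutant M"
  by (rule commutant_radj) (rule M_radj)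

lemma M_sum: "(\<And>i. i \<in> I \<Longrightarrow> X i \<in> M) \<Longrightarrow> (\<Sum>i\<in>I. X i) \<in> M"
  by (induction I rule: infinite_finite_induct) (auto simp: M_closed)

text \<open>Every y in the commutant is a combination of the self-adjoint operators
  \<open>y + radj y\<close> and i (\<open>y - radj y\<close>), and each of these is a multiple of a
  sum of two unitaries. The bicommutant then contains X.\<close>

lemma mem_if_commutes_unitaries:
  assumes X: "X \<in> bounded_ops" "\<And>u. u \<in> commutant M \<Longrightarrow> unitary u \<Longrightarrow> commute X u"
  shows "X \<in> M"
proof -
  have MS: "M \<subseteq> bounded_ops" using M_bounded by blast
  have sa: "commute X h" if h: "self_adj h" "h \<in> commutant M" for h
  proof -
    define c where "c = norm h + 1"
    have c: "c > 0" by (simp add: c_def add_nonneg_pos)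
    let ?h = "(1/c) *\<^sub>R h"
    have "self_adj ?h" using h by (simp add: self_adj_def blinfun.bilinear_simps)
    moreover have "?h \<in> commutant M" by (rule commutant_closed(5)[OF h(2)])
    moreover have "norm ?h \<le> 1" using c by (simp add: c_def field_simps)
    ultimately obtain u where u: "u \<in> commutant M" "unitary u" "unitary (radj u)" "radj u \<in> commutant M"
      "?h = (1/2) *\<^sub>R (u + radj u)" using self_adj_unitary_dilation[of ?h M] MS by blast
    have "commute X u" "commute X (radj u)" using u X by auto
    then have "commute X ?h" unfolding u(5) by (simp add: commute_iff blinfun.bilinear_simps)
    then show ?thesis using c by (simp add: commute_iff blinfun.bilinear_simps)
  qed
  have "commute X y" if y: "y \<in> commutant M" for y
  proof -
    have ry: "radj y \<in> commutant M" using comm_radj[OF y] .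
    let ?h = "y + radj y" and ?k = "cmul \<i> o\<^sub>L (y - radj y)"
    have MM: "{Y. Y \<in> M \<and> Y \<in> bounded_ops} = M" using MS by auto
    have yb: "y - radj y \<in> bounded_ops" using y ry bounded_ops_closed by (auto simp: commutant_iff)
    have h: "self_adj ?h" by (simp add: self_adj_def blinfun.bilinear_simps inner_add_left inner_add_right radj)
        (metis inner_commute radj add.commute)
    have k: "self_adj ?k"
      unfolding self_adj_def
    proof (intro allI)
      fix a b
      have mi: "(- \<i>) *\<^sub>C (x::'h) = - (\<i> *\<^sub>C x)" for x
        using scaleC_add_left[of "- \<i>" \<i> x] scaleR_scaleC[of 0 x] by (simp add: eq_neg_iff_add_eq_0)
      have "?k a \<bullet> b = (y - radj y) a \<bullet> (- (\<i> *\<^sub>C b))" by (simp add: inner_scaleC mi)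
      also have "\<dots> = a \<bullet> (y - radj y) (\<i> *\<^sub>C b)"
        using radj[of y a "\<i> *\<^sub>C b"] radj[of "radj y" a "\<i> *\<^sub>C b"]
        by (simp add: blinfun.bilinear_simps inner_diff_left inner_diff_right radj_radj)
      finally show "?k a \<bullet> b = a \<bullet> ?k b" using bounded_opsD[OF yb] by simp
    qed
    have hc: "commute X ?h" by (rule sa[OF h commutant_closed(3)[OF y ry]])
    have "?k \<in> commutant M"
      using commutant_closed(8)[OF commutant_closed(4)[OF y ry], of \<i>] unfolding MM .
    from sa[OF k this] have kc: "commute X ?k" .
    have "X (y x) = y (X x)" for x
    proof -
      have "\<i> *\<^sub>C X ((y - radj y) x) = \<i> *\<^sub>C (y - radj y) (X x)"
        using commuteD[OF kc, of x] bounded_opsD[OF X(1)] by simp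
      then have "(- \<i>) *\<^sub>C \<i> *\<^sub>C X ((y - radj y) x) = (- \<i>) *\<^sub>C \<i> *\<^sub>C (y - radj y) (X x)" by simp
      then have "X ((y - radj y) x) = (y - radj y) (X x)"
        using scaleR_scaleC[of 1 "X ((y - radj y) x)"] scaleR_scaleC[of 1 "(y - radj y) (X x)"] by (simp add: scaleC_scaleC)
      moreover have "X ((y + radj y) x) = (y + radj y) (X x)" using commuteD[OF hc] .
      ultimately have "X ((y - radj y) x) + X ((y + radj y) x) = (y - radj y) (X x) + (y + radj y) (X x)" by simp
      then have "2 *\<^sub>R X (y x) = 2 *\<^sub>R y (X x)" by (simp add: blinfun.bilinear_simps scaleR_2)
      then show ?thesis by simp
    qed
    then show ?thesis by (simp add: commute_iff)
  qed
  then show ?thesis using X(1) M_eq by (auto simp: commutant_iff)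
qed

lemma unitary_radj: "unitary u \<Longrightarrow> unitary (radj u)" "unitary u \<Longrightarrow> radj u (u x) = x"
  unfolding unitary_def using star_eq_radj radj_bounded_ops radj_radj
  by (metis, metis blinfun_apply_blinfun_compose blinfun_apply_id_blinfun)

lemma affiliatedD:
  "affiliated M T \<Longrightarrow> u \<in> commutant M \<Longrightarrow> unitary u \<Longrightarrow> (x, y) \<in> T \<Longrightarrow> (u x, u y) \<in> T"
  by (auto simp: affiliated_def)

lemma affiliated_spec:
  assumes T: "closed_densely_defined T" "affiliated M T" and A: "A \<in> sets borel"
  shows "closed_dense_op.spec T A \<in> M"
proof -
  interpret closed_dense_op T using T by (simp add: closed_densely_defined_iff)
  show ?thesis
  proof (rule mem_if_commutes_unitaries)
    show "spec A \<in> bounded_ops" using spec_bounded_ops T A by blast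
    fix u assume u: "u \<in> commutant M" "unitary u"
    have r: "radj u \<in> commutant M" "unitary (radj u)" using comm_radj unitary_radj u by auto
    have "res (u x) = u (res x)" for x
      by (rule commute_res[of u u "radj u" "radj u"]) (use affiliatedD[OF T(2)] u r radj in auto)
    then have "commute u res" by (simp add: commute_iff)
    from spec_commute[OF this A] show "commute (spec A) u" by (rule commute_sym)
  qed
qed

lemma pos_cone_iff: "X \<in> pos_cone M \<longleftrightarrow> X \<in> M \<and> psd X"
  using M_bounded by (auto simp: pos_cone_def pos_op_iff)

lemma op_le_iff: "X \<in> M \<Longrightarrow> Y \<in> M \<Longrightarrow> op_le X Y \<longleftrightarrow> psd (Y - X)"
  by (simp add: op_le_def pos_op_iff bounded_ops_closed(4) M_bounded)

definition nweight :: "('h bop \<Rightarrow> ennreal) \<Rightarrow> bool" where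
  "nweight \<omega> \<longleftrightarrow> weight M \<omega> \<and> normal M \<omega>"

lemma psd_simps:
  "psd (0 :: 'h bop)" "psd X \<Longrightarrow> psd Y \<Longrightarrow> psd (X + Y)" "psd X \<Longrightarrow> 0 \<le> r \<Longrightarrow> psd (r *\<^sub>R X)"
  for X Y :: "'h bop"
  by (auto simp: psd_def self_adj_def blinfun.bilinear_simps inner_add_left inner_add_right)

lemma nweight_add:
  "nweight \<omega> \<Longrightarrow> X \<in> M \<Longrightarrow> psd X \<Longrightarrow> Y \<in> M \<Longrightarrow> psd Y \<Longrightarrow> \<omega> (X + Y) = \<omega> X + \<omega> Y"
  by (auto simp: nweight_def weight_def pos_cone_iff)

lemma nweight_scale:
  "nweight \<omega> \<Longrightarrow> X \<in> M \<Longrightarrow> psd X \<Longrightarrow> 0 \<le> r \<Longrightarrow> \<omega> (r *\<^sub>R X) = ennreal r * \<omega> X"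
  by (auto simp: nweight_def weight_def pos_cone_iff)

lemma nweight_zero: "nweight \<omega> \<Longrightarrow> \<omega> 0 = 0"
  using nweight_scale[of \<omega> 0 0] psd_simps(1) M_closed(2) by simp

lemma nweight_mono:
  assumes "nweight \<omega>" "X \<in> M" "psd X" "Y \<in> M" "psd (Y - X)" shows "\<omega> X \<le> \<omega> Y"
proof -
  have "\<omega> (X + (Y - X)) = \<omega> X + \<omega> (Y - X)" using assms M_closed by (intro nweight_add) auto
  then show ?thesis by simp
qed

lemma nweight_sum:
  assumes "nweight \<omega>" "finite I" "\<And>i. i \<in> I \<Longrightarrow> X i \<in> M \<and> psd (X i)"
  shows "psd (\<Sum>i\<in>I. X i)" "\<omega> (\<Sum>i\<in>I. X i) = (\<Sum>i\<in>I. \<omega> (X i))"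
proof -
  have "psd (\<Sum>i\<in>I. X i) \<and> \<omega> (\<Sum>i\<in>I. X i) = (\<Sum>i\<in>I. \<omega> (X i))"
    using assms(2,3)
  proof (induction I rule: finite_induct)
    case (insert i I)
    then show ?case using M_sum[of I X] by (auto simp: psd_simps nweight_add[OF assms(1)])
  qed (simp add: psd_simps nweight_zero[OF assms(1)])
  then show "psd (\<Sum>i\<in>I. X i)" "\<omega> (\<Sum>i\<in>I. X i) = (\<Sum>i\<in>I. \<omega> (X i))" by auto
qed

lemma psd_limit:
  fixes X :: "nat \<Rightarrow> 'h bop" and Y :: "'h bop"
  assumes "\<And>n. psd (X n)" "\<And>x. (\<lambda>n. X n x) \<longlonglongrightarrow> Y x" shows "psd Y"
  unfolding psd_def self_adj_def
proof (intro conjI allI)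
  fix x y
  have "(\<lambda>n. X n x \<bullet> y) \<longlonglongrightarrow> Y x \<bullet> y" "(\<lambda>n. x \<bullet> X n y) \<longlonglongrightarrow> x \<bullet> Y y"
    by (intro tendsto_inner assms tendsto_const)+
  moreover have "(\<lambda>n. X n x \<bullet> y) = (\<lambda>n. x \<bullet> X n y)" using psdD(2)[OF assms(1)] by auto
  ultimately show "Y x \<bullet> y = x \<bullet> Y y" using LIMSEQ_unique by metis
  have "(\<lambda>n. X n x \<bullet> x) \<longlonglongrightarrow> Y x \<bullet> x" by (intro tendsto_inner assms tendsto_const)
  then show "0 \<le> Y x \<bullet> x" by (rule LIMSEQ_le_const) (use psdD(1)[OF assms(1)] in auto)
qed

text \<open>The range of an increasing sequence is directed and its strong limit is its least upper
  bound, so normality applies.\<close>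

lemma nweight_SUP:
  fixes X :: "nat \<Rightarrow> 'h bop" and Y :: "'h bop"
  assumes w: "nweight \<omega>" and X: "\<And>n. X n \<in> M" "\<And>n. psd (X n)" "\<And>n. psd (X (Suc n) - X n)"
    and lim: "\<And>x. (\<lambda>n. X n x) \<longlonglongrightarrow> Y x"
  shows "Y \<in> M" "psd Y" "\<omega> Y = (SUP n. \<omega> (X n))" "psd (Y - X n)"
proof -
  show Y: "Y \<in> M" using M_limit[OF X(1) lim] .
  show pY: "psd Y" using psd_limit[OF X(2) lim] .
  have mono: "psd (X n - X m)" if "m \<le> n" for m n
    using that
  proof (induction n rule: dec_induct)
    case (step n)
    have "X (Suc n) - X m = (X (Suc n) - X n) + (X n - X m)" by simp
    then show ?case using step X(3)[of n] psd_simps(2) by metis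
  qed (simp add: psd_simps)
  have le: "psd (Y - X m)" for m
  proof (rule psd_limit)
    show "psd (X (m + n) - X m)" for n using mono by simp
    have L: "(\<lambda>n. X (m + n) x) \<longlonglongrightarrow> Y x" for x using LIMSEQ_ignore_initial_segment[OF lim[of x], of m] by (simp add: add.commute)
    show "(\<lambda>n. (X (m + n) - X m) x) \<longlonglongrightarrow> (Y - X m) x" for x
      unfolding blinfun.diff_left by (intro tendsto_diff tendsto_const L)
  qed
  then show "psd (Y - X n)" .
  have least: "psd (Z - Y)" if Z: "\<And>n. psd (Z - X n)" for Z
  proof (rule psd_limit[OF Z])
    show "(\<lambda>n. (Z - X n) x) \<longlonglongrightarrow> (Z - Y) x" for x
      unfolding blinfun.diff_left by (intro tendsto_diff tendsto_const lim)
  qed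
  have N: "normal M \<omega>" using w by (simp add: nweight_def)
  have "\<omega> Y = (SUP y\<in>range X. \<omega> y)"
  proof (rule N[unfolded normal_def, THEN spec[of _ "range X"], THEN spec[of _ Y], THEN mp], intro conjI)
    show "range X \<subseteq> pos_cone M" using X by (auto simp: pos_cone_iff)
    show "\<forall>y\<in>range X. \<forall>z\<in>range X. \<exists>w\<in>range X. op_le y w \<and> op_le z w"
    proof (intro ballI)
      fix y z assume "y \<in> range X" "z \<in> range X"
      then obtain i j where "y = X i" "z = X j" by blast
      then show "\<exists>w\<in>range X. op_le y w \<and> op_le z w"
        using mono[of i "max i j"] mono[of j "max i j"] X(1) by (intro bexI[of _ "X (max i j)"]) (auto simp: op_le_iff)
    qed
    show "Y \<in> pos_cone M" using Y pY by (simp add: pos_cone_iff)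
    show "\<forall>y\<in>range X. op_le y Y" using X Y le by (auto simp: op_le_iff)
    show "\<forall>z\<in>pos_cone M. (\<forall>y\<in>range X. op_le y z) \<longrightarrow> op_le Y z"
      using X Y least by (auto simp: op_le_iff pos_cone_iff)
  qed simp
  then show "\<omega> Y = (SUP n. \<omega> (X n))" by (simp add: image_image)
qed

text \<open>A least upper bound in \<open>M\<close> of a bounded directed set is its weak limit, so vector states are normal.\<close>

lemma nweight_vector_state: "nweight (vector_state \<xi>)"
  unfolding nweight_def
proof
  show "weight M (vector_state \<xi>)"
    by (auto simp: vector_state_def weight_def pos_cone_iff blinfun.bilinear_simps inner_add_left ennreal_mult psdD(1))
  show "normal M (vector_state \<xi>)"
    unfolding normal_def vector_state_def
  proof (intro allI impI, elim conjE)
    fix D x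
    assume D: "D \<subseteq> pos_cone M" "D \<noteq> {}" and dir: "\<forall>y\<in>D. \<forall>z\<in>D. \<exists>w\<in>D. op_le y w \<and> op_le z w"
      and x: "x \<in> pos_cone M" and ub: "\<forall>y\<in>D. op_le y x"
      and least: "\<forall>z\<in>pos_cone M. (\<forall>y\<in>D. op_le y z) \<longrightarrow> op_le x z"
    have DM: "y \<in> M" "psd y" if "y \<in> D" for y using D that by (auto simp: pos_cone_iff)
    have xM: "x \<in> M" "psd x" using x by (auto simp: pos_cone_iff)
    have dle: "op_le y z \<longleftrightarrow> psd (z - y)" if "y \<in> D" "z \<in> D" for y z using DM that op_le_iff by blast
    have mono: "y v \<bullet> v \<le> z v \<bullet> v" if "psd (z - y)" for y z :: "'h bop" and v
      using psdD(1)[OF that, of v] by (simp add: blinfun.bilinear_simps inner_diff_left)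
    have yx: "y v \<bullet> v \<le> x v \<bullet> v" if "y \<in> D" for y v using mono ub that DM xM op_le_iff by blast
    \<comment> \<open>The filter of tails of the directed set D, which makes its weak limit a limit
      along a filter.\<close>
    define F where "F = (INF y\<in>D. principal {z\<in>D. op_le y z})"
    have ev: "eventually P F \<longleftrightarrow> (\<exists>y\<in>D. \<forall>z\<in>D. op_le y z \<longrightarrow> P z)" for P
      unfolding F_def
    proof (subst eventually_INF_base)
      fix y z assume yz: "y \<in> D" "z \<in> D"
      then obtain w where w: "w \<in> D" "op_le y w" "op_le z w" using dir by blast
      have "op_le y u \<and> op_le z u" if "u \<in> D" "op_le w u" for u
      proof -
        have "psd ((u - w) + (w - y))" "psd ((u - w) + (w - z))" using that w yz dle psd_simps(2) by blast+
        then show ?thesis using that w yz dle by simp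
      qed
      then show "\<exists>w\<in>D. principal {u \<in> D. op_le w u} \<le> inf (principal {u \<in> D. op_le y u}) (principal {u \<in> D. op_le z u})"
        using w(1) by (intro bexI[of _ w]) auto
    qed (use D in \<open>auto simp: eventually_principal\<close>)
    have refl: "op_le y y" if "y \<in> D" for y using dle[OF that that] by (simp add: psd_simps)
    have Fb: "F \<noteq> bot"
    proof
      assume "F = bot"
      then have "eventually (\<lambda>_. False) F" by simp
      then show False unfolding ev using refl by blast
    qed
    have evD: "\<forall>\<^sub>F y in F. y \<in> D" unfolding ev using D by blast
    \<comment> \<open>The value 0 off D makes X self-adjoint at every index, as the limit lemma
      demands; along F only D matters.\<close>
    define X where "X y = (if y \<in> D then y else 0)" for y
    define q where "q v = (SUP y\<in>D. blinfun_apply y v \<bullet> v)" for v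
    have bdd: "bdd_above ((\<lambda>y. blinfun_apply y v \<bullet> v) ` D)" for v using yx by (intro bdd_aboveI2)
    have "((\<lambda>y. X y v \<bullet> v) \<longlongrightarrow> q v) F" for v
    proof (rule order_tendstoI)
      fix a assume "a < q v"
      then obtain y where y: "y \<in> D" "a < y v \<bullet> v" unfolding q_def using less_cSUP_iff[OF D(2) bdd] by blast
      have "a < X z v \<bullet> v" if "z \<in> D" "op_le y z" for z
        using y that mono[of z y v] dle[of y z] by (simp add: X_def)
      then show "\<forall>\<^sub>F y in F. a < X y v \<bullet> v" unfolding ev using y(1) by blast
    next
      fix a assume "q v < a"
      then have "X z v \<bullet> v < a" if "z \<in> D" for z
        using cSUP_upper[OF that bdd, of v] that by (simp add: X_def q_def)
      then show "\<forall>\<^sub>F y in F. X y v \<bullet> v < a" using evD by (auto elim: eventually_mono)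
    qed
    moreover have "self_adj (X y)" for y using DM by (auto simp: X_def psd_def self_adj_def)
    moreover have "\<forall>\<^sub>F y in F. norm (X y) \<le> norm x"
      using evD
    proof eventually_elim
      case (elim y)
      have "y v \<bullet> v \<le> norm x * (norm v)\<^sup>2" for v using yx[OF elim, of v] inner_blinfun_le[of x v] by linarith
      then have "norm (y v) \<le> norm x * norm v" for v using DM(2)[OF elim] by (intro psd_norm_le) auto
      then show ?case using elim by (simp add: X_def norm_blinfun_bound)
    qed
    ultimately obtain Y where Y: "self_adj Y" "\<And>v. Y v \<bullet> v = q v"
      "\<And>v w. ((\<lambda>y. X y v \<bullet> w) \<longlongrightarrow> Y v \<bullet> w) F"
      using monotone_weak_limit[OF Fb, of X q "norm x"] by blast
    have comm: "commute Y Z" if Z: "\<And>y. y \<in> D \<Longrightarrow> commute y Z" for Z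
      unfolding commute_iff
    proof
      fix v
      have "Y (Z v) \<bullet> w = Z (Y v) \<bullet> w" for w
      proof (rule tendsto_unique[OF Fb Y(3)])
        have "((\<lambda>y. X y v \<bullet> radj Z w) \<longlongrightarrow> Y v \<bullet> radj Z w) F" by (rule Y(3))
        moreover have "\<forall>\<^sub>F y in F. X y v \<bullet> radj Z w = X y (Z v) \<bullet> w"
          using evD by eventually_elim (use Z in \<open>auto simp: X_def commute_iff radj[symmetric]\<close>)
        ultimately show "((\<lambda>y. X y (Z v) \<bullet> w) \<longlongrightarrow> Z (Y v) \<bullet> w) F"
          by (simp add: radj tendsto_cong)
      qed
      then show "Y (Z v) = Z (Y v)" using vector_eq_rdot by blast
    qed
    have "Y \<in> commutant (commutant M)"
      unfolding commutant_iff[of Y] bounded_ops_iff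
    proof (intro conjI allI ballI)
      show "commute Y (cmul c)" for c by (rule comm) (use DM M_bounded bounded_ops_iff in blast)
      show "commute Y Z" if "Z \<in> commutant M" for Z
        by (rule comm) (use DM that in \<open>auto simp: commutant_iff intro: commute_sym\<close>)
    qed
    then have YM: "Y \<in> M" by (simp add: M_eq)
    have Yge: "psd (Y - y)" if y: "y \<in> D" for y
      unfolding psd_def
    proof
      show "self_adj (Y - y)" using Y(1) DM(2)[OF y]
        by (simp add: psd_def self_adj_def blinfun.bilinear_simps inner_diff_left inner_diff_right)
      show "\<forall>v. 0 \<le> (Y - y) v \<bullet> v" using cSUP_upper[OF y bdd] Y(2)
        by (simp add: blinfun.bilinear_simps inner_diff_left q_def)
    qed
    obtain y0 where y0: "y0 \<in> D" using D by blast
    have "psd ((Y - y0) + y0)" using Yge[OF y0] DM(2)[OF y0] by (rule psd_simps(2))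
    then have pY: "psd Y" by simp
    have "op_le x Y" using least YM pY Yge DM by (simp add: pos_cone_iff op_le_iff)
    then have "x \<xi> \<bullet> \<xi> \<le> q \<xi>" using mono xM YM op_le_iff Y(2) by metis
    then have "x \<xi> \<bullet> \<xi> = q \<xi>"
      using cSUP_least[OF D(2), of "\<lambda>y. blinfun_apply y \<xi> \<bullet> \<xi>" "x \<xi> \<bullet> \<xi>"] yx unfolding q_def by fastforce
    then show "ennreal (x \<xi> \<bullet> \<xi>) = (SUP y\<in>D. ennreal (blinfun_apply y \<xi> \<bullet> \<xi>))"
    proof -
      have "ennreal (SUP y\<in>D. blinfun_apply y \<xi> \<bullet> \<xi>) = (SUP y\<in>D. ennreal (blinfun_apply y \<xi> \<bullet> \<xi>))"
      proof (rule antisym)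
        show "(SUP y\<in>D. ennreal (blinfun_apply y \<xi> \<bullet> \<xi>)) \<le> ennreal (SUP y\<in>D. blinfun_apply y \<xi> \<bullet> \<xi>)"
          by (intro SUP_least ennreal_leI cSUP_upper bdd)
        have "((\<lambda>y. ennreal (X y \<xi> \<bullet> \<xi>)) \<longlongrightarrow> ennreal (q \<xi>)) F"
          using Y(2,3) by (metis tendsto_ennrealI)
        moreover have "\<forall>\<^sub>F y in F. ennreal (X y \<xi> \<bullet> \<xi>) \<le> (SUP y\<in>D. ennreal (blinfun_apply y \<xi> \<bullet> \<xi>))"
          using evD by eventually_elim (auto simp: X_def intro: SUP_upper)
        ultimately show "ennreal (SUP y\<in>D. blinfun_apply y \<xi> \<bullet> \<xi>) \<le> (SUP y\<in>D. ennreal (blinfun_apply y \<xi> \<bullet> \<xi>))"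
          unfolding q_def using Fb by (intro tendsto_upperbound)
      qed
      then show ?thesis using \<open>x \<xi> \<bullet> \<xi> = q \<xi>\<close> by (simp add: q_def)
    qed
  qed
qed

lemma vector_state_predual: "vector_state \<xi> \<in> predual_pos M"
  using nweight_vector_state by (auto simp: predual_pos_def nweight_def vector_state_def)

end

lemma psd_diffI: "self_adj X \<Longrightarrow> self_adj Y \<Longrightarrow> (\<And>x. X x \<bullet> x \<le> Y x \<bullet> x) \<Longrightarrow> psd (Y - X)"
  unfolding psd_def by (simp add: self_adj_def blinfun.diff_left inner_diff_left inner_diff_right)

lemma psd_imp_self_adj: "psd X \<Longrightarrow> self_adj X"
  by (simp add: psd_def)

text \<open>Banach-Steinhaus by Baire: the open sets U k cannot all be dense, since a point of their
  intersection would have an unbounded orbit.\<close>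

lemma uniform_boundedness:
  fixes Y :: "nat \<Rightarrow> 'a::{real_inner,banach} \<Rightarrow>\<^sub>L 'b::real_normed_vector"
  assumes bd: "\<And>x. \<exists>C. \<forall>n. norm (Y n x) \<le> C"
  shows "\<exists>C\<ge>0. \<forall>n x. norm (Y n x) \<le> C * norm x"
proof -
  define U where "U k = {x. \<exists>n. real k < norm (Y n x)}" for k :: nat
  have oU: "open (U k)" for k
  proof -
    have "U k = (\<Union>n. {x. real k < norm (Y n x)})" by (auto simp: U_def)
    moreover have "open {x. real k < norm (Y n x)}" for n by (intro open_Collect_less continuous_intros)
    ultimately show ?thesis by auto
  qed
  have "\<exists>k. closure (U k) \<noteq> UNIV"
  proof (rule ccontr)
    assume "\<not> ?thesis"
    then have dense: "\<And>k. closure (U k) = UNIV" by blast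
    have "Met_TC.mcomplete TYPE('a)"
      unfolding Met_TC.mcomplete_def using Cauchy_convergent by (auto simp: convergent_def)
    from Met_TC.metric_Baire_category[OF this, of "range U"]
    have "closure (\<Inter>k. U k) = UNIV" using oU dense by auto
    then obtain x where x: "\<And>k. x \<in> U k" using closure_empty by (metis INT_E UNIV_I all_not_in_conv)
    obtain C where C: "\<And>n. norm (Y n x) \<le> C" using bd by blast
    obtain k where "C \<le> real k" using real_arch_simple by blast
    moreover obtain n where "real k < norm (Y n x)" using x[of k] by (auto simp: U_def)
    ultimately show False using C[of n] by linarith
  qed
  then obtain k z where "z \<notin> closure (U k)" by blast
  then have "open (- closure (U k))" "z \<in> - closure (U k)" by auto
  then obtain r where r: "r > 0" "ball z r \<subseteq> - closure (U k)" by (meson openE)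
  have ball: "norm (Y n x) \<le> real k" if "dist z x < r" for n x
  proof -
    have "x \<notin> U k" using r that closure_subset by (auto simp: subset_iff)
    then show ?thesis by (auto simp: U_def not_less)
  qed
  \<comment> \<open>A step of length r/2 inside the ball changes the value by at most 2 k, which
    scales to 4 k / r.\<close>
  let ?C = "4 * real k / r"
  have "norm (Y n x) \<le> ?C * norm x" for n x
  proof (cases "x = 0")
    case False
    define t where "t = r / (2 * norm x)"
    have t: "t > 0" using r False by (simp add: t_def)
    have "norm (t *\<^sub>R x) = r / 2" using False r by (simp add: t_def)
    then have "norm (Y n (z + t *\<^sub>R x)) \<le> real k" using r by (intro ball) (simp add: dist_norm)
    moreover have "norm (Y n z) \<le> real k" using r by (intro ball) simp
    moreover have "Y n (t *\<^sub>R x) = Y n (z + t *\<^sub>R x) - Y n z" by (simp add: blinfun.add_right)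
    ultimately have "norm (Y n (t *\<^sub>R x)) \<le> 2 * real k"
      using norm_triangle_ineq4[of "Y n (z + t *\<^sub>R x)" "Y n z"] by simp
    then have "t * norm (Y n x) \<le> 2 * real k" using t by (simp add: blinfun.scaleR_right)
    then show ?thesis using r False by (simp add: t_def field_simps)
  qed simp
  then show ?thesis using r by (intro exI[of _ ?C]) auto
qed

section \<open>Bounded truncations of a closed operator\<close>

context closed_dense_op
begin

text \<open>X is T times the spectral projection of |T| for [0, s], an everywhere defined
  operator.\<close>

lemma trunc_exists:
  assumes "0 \<le> s"
  shows "\<exists>X :: 'a \<Rightarrow>\<^sub>L 'a. (\<forall>x. (spec {..s} x, X x) \<in> T) \<and> (\<forall>x. norm (X x) \<le> s * norm x)"
proof -
  let ?e = "spec {..s}"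
  have e: "ortho_proj ?e" using spec.proj by simp
  have "\<exists>y. (?e x, y) \<in> T \<and> norm y \<le> s * norm (?e x)" for x
    using spec_in_domain[OF assms, of "?e x"] ortho_projD(1)[OF e, of x] par_mem by metis
  then obtain f where f: "\<And>x. (?e x, f x) \<in> T" "\<And>x. norm (f x) \<le> s * norm (?e x)" by metis
  have le: "norm (f x) \<le> s * norm x" for x
    using f(2)[of x] mult_left_mono[OF ortho_projD(4)[OF e] assms, of x] by linarith
  have "\<exists>F. blinfun_apply F = f"
  proof (rule blinfun_exists[where K = s])
    show "f (x + y) = f x + f y" for x y
      by (rule unique_image[OF f(1)]) (simp add: blinfun.add_right mem_add f(1))
    show "f (r *\<^sub>R x) = r *\<^sub>R f x" for r x
      by (rule unique_image[OF f(1)]) (use subspace_scale[OF sub f(1)[of x], of r] in \<open>simp add: blinfun.scaleR_right\<close>)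
  qed (use le in \<open>simp add: mult.commute\<close>)
  then show ?thesis using f(1) le by metis
qed

text \<open>In effect T p is bounded. Its truncations are pointwise bounded by the value of T at p
  x, uniform boundedness gives C, and the Chebyshev estimate \<open>spec_Ioi_bound\<close> passes to
  the limit.\<close>

lemma bounded_trunc_imp:
  fixes p :: "'a \<Rightarrow>\<^sub>L 'a"
  assumes p: "\<And>x. p x \<in> Domain T"
  shows "\<exists>C\<ge>0. \<forall>s>0. \<forall>x. s * norm (spec {s<..} (p x)) \<le> C * norm x"
proof -
  have "\<forall>n. \<exists>X :: 'a \<Rightarrow>\<^sub>L 'a. \<forall>x. (spec {..real n} x, X x) \<in> T" using trunc_exists by (meson of_nat_0_le_iff)
  then obtain X :: "nat \<Rightarrow> 'a \<Rightarrow>\<^sub>L 'a" where X: "\<And>n x. (spec {..real n} x, X n x) \<in> T" by metis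
  have "\<exists>C. \<forall>n. norm ((X n o\<^sub>L p) x) \<le> C" for x
  proof -
    obtain y where "(p x, y) \<in> T" using p[of x] by blast
    then obtain z where z: "p x = rt z" "y = par z" by (rule memE)
    have "norm (X n (p x)) \<le> norm (par z)" for n
    proof -
      have "X n (p x) = par (spec {..real n} z)"
        using unique_image[OF X[of n "p x"]] spec_mem[of "{..real n}" z] z by simp
      then show ?thesis using par_spec_norm[of "{..real n}" z] by simp
    qed
    then show ?thesis by auto
  qed
  from uniform_boundedness[OF this] obtain C where C: "C \<ge> 0" "\<And>n x. norm (X n (p x)) \<le> C * norm x" by auto
  have "s * norm (spec {s<..} (p x)) \<le> C * norm x" if "s > 0" for s x
  proof (rule LIMSEQ_le_const2)
    have "(\<lambda>n. spec {..real n} (p x)) \<longlonglongrightarrow> p x" using specfam_at_top[of "p x"] by (simp add: spec_Iic)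
    then show "(\<lambda>n. s * norm (spec {s<..} (spec {..real n} (p x)))) \<longlonglongrightarrow> s * norm (spec {s<..} (p x))"
      by (intro tendsto_mult tendsto_const tendsto_norm blinfun.tendsto[OF tendsto_const])
    show "\<exists>N. \<forall>n\<ge>N. s * norm (spec {s<..} (spec {..real n} (p x))) \<le> C * norm x"
      using spec_Ioi_bound[OF _ X] that C(2) by (meson less_imp_le order_trans)
  qed
  then show ?thesis using C(1) by blast
qed

end

context vna
begin

section \<open>Traces of spectral integrals\<close>

definition wmeas :: "('h bop \<Rightarrow> ennreal) \<Rightarrow> (real set \<Rightarrow> 'h bop) \<Rightarrow> real measure" where
  "wmeas \<omega> E = measure_of UNIV (sets borel) (\<lambda>B. \<omega> (E B))"

lemma sets_wmeas [simp, measurable_cong]: "sets (wmeas \<omega> E) = sets borel"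
  by (simp add: wmeas_def sets.sigma_sets_eq[of borel, simplified])

lemma space_wmeas [simp]: "space (wmeas \<omega> E) = UNIV"
  by (simp add: wmeas_def space_measure_of_conv)

definition pvm_in :: "(real set \<Rightarrow> 'h bop) \<Rightarrow> bool" where
  "pvm_in E \<longleftrightarrow> pvm E \<and> (\<forall>A\<in>sets borel. E A \<in> M)"

lemma emeasure_wmeas:
  assumes E: "pvm_in E" and w: "nweight \<omega>" and A: "A \<in> sets borel"
  shows "emeasure (wmeas \<omega> E) A = \<omega> (E A)"
  unfolding wmeas_def
proof (rule emeasure_measure_of_sigma)
  interpret pvm E using E by (simp add: pvm_in_def)
  have EM: "E B \<in> M" if "B \<in> sets borel" for B using E that by (simp add: pvm_in_def)
  show "sigma_algebra UNIV (sets borel)" by (metis sets.sigma_algebra_axioms space_borel)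
  show "positive (sets borel) (\<lambda>B. \<omega> (E B))" by (simp add: positive_def nweight_zero[OF w])
  show "countably_additive (sets borel) (\<lambda>B. \<omega> (E B))"
  proof (rule countably_additiveI)
    fix F :: "nat \<Rightarrow> real set" assume F: "range F \<subseteq> sets borel" "disjoint_family F"
    have FM: "E (F i) \<in> M \<and> psd (E (F i))" for i using EM F psd_ortho_proj[OF proj] by auto
    let ?X = "\<lambda>n. \<Sum>i<n. E (F i)"
    have "(\<lambda>n. ?X n x) \<longlonglongrightarrow> E (\<Union>i. F i) x" for x
      using countably_add[OF F, of x] by (simp add: sums_def blinfun.sum_left)
    moreover have "?X n \<in> M" for n by (rule M_sum) (rule conjunct1[OF FM])
    moreover have "psd (?X n)" for n by (rule nweight_sum(1)[OF w finite_lessThan]) (rule FM)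
    moreover have "psd (?X (Suc n) - ?X n)" for n using conjunct2[OF FM[of n]] by simp
    ultimately have "\<omega> (E (\<Union>i. F i)) = (SUP n. \<omega> (?X n))"
      using nweight_SUP(3)[OF w, of ?X "E (\<Union>i. F i)"] by presburger
    also have "\<dots> = (\<Sum>i. \<omega> (E (F i)))" 
      using nweight_sum(2)[where X = "\<lambda>i. E (F i)", OF w finite_lessThan FM] by (simp add: suminf_eq_SUP)
    finally show "(\<Sum>i. \<omega> (E (F i))) = \<omega> (E (\<Union>i. F i))" by simp
  qed
qed (rule A)

lemma vm_eq_wmeas: "pvm E \<Longrightarrow> pvm.vm E x = wmeas (vector_state x) E"
  by (simp add: pvm.vm_def wmeas_def vector_state_def)

lemma simple_calc:
  assumes E: "pvm_in E" and g: "simple_function borel g" "\<And>s. g s < (top::ennreal)"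
  shows "\<exists>X\<in>M. psd X \<and> (\<forall>\<omega>. nweight \<omega> \<longrightarrow> \<omega> X = (\<integral>\<^sup>+s. g s \<partial>wmeas \<omega> E))"
proof -
  interpret pvm E using E by (simp add: pvm_in_def)
  have fin: "finite (range g)" and pre: "g -` {y} \<in> sets borel" for y
    using g(1) simple_functionD(2)[OF g(1), of "{y}"] by (auto simp: simple_function_def)
  have EM: "E (g -` {y}) \<in> M" "psd (E (g -` {y}))" for y
    using E pre psd_ortho_proj[OF proj] by (auto simp: pvm_in_def)
  let ?f = "\<lambda>y. enn2real y *\<^sub>R E (g -` {y})"
  have f: "?f y \<in> M \<and> psd (?f y)" for y using EM M_closed psd_simps by simp
  have "\<omega> (\<Sum>y\<in>range g. ?f y) = (\<integral>\<^sup>+s. g s \<partial>wmeas \<omega> E)" if w: "nweight \<omega>" for \<omega>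
  proof -
    have sg: "simple_function (wmeas \<omega> E) g" using fin pre by (simp add: simple_function_def)
    have "\<omega> (\<Sum>y\<in>range g. ?f y) = (\<Sum>y\<in>range g. y * \<omega> (E (g -` {y})))"
      unfolding nweight_sum(2)[OF w fin f]
    proof (rule sum.cong[OF refl])
      fix y assume "y \<in> range g"
      then have "ennreal (enn2real y) = y" using g(2) by (auto simp: ennreal_enn2real)
      then show "\<omega> (?f y) = y * \<omega> (E (g -` {y}))"
        using nweight_scale[OF w EM, of "enn2real y" y] by (simp add: enn2real_nonneg)
    qed
    also have "\<dots> = (\<integral>\<^sup>+s. g s \<partial>wmeas \<omega> E)"
      by (simp add: nn_integral_eq_simple_integral[OF sg] simple_integral_def emeasure_wmeas[OF E w pre])
    finally show ?thesis .
  qed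
  moreover have "(\<Sum>y\<in>range g. ?f y) \<in> M" by (rule M_sum) (use f in blast)
  moreover have "psd (\<Sum>y\<in>range g. ?f y)" using nweight_sum(1)[OF nweight_vector_state fin f] .
  ultimately show ?thesis by blast
qed

text \<open>One X serves all normal weights at once. Vector states therefore compare it with other
  operators while the trace evaluates it as an integral.\<close>

lemma bounded_calc:
  assumes E: "pvm_in E" and f: "f \<in> borel_measurable borel" "\<And>s. f s \<le> ennreal C"
  shows "\<exists>X\<in>M. psd X \<and> (\<forall>\<omega>. nweight \<omega> \<longrightarrow> \<omega> X = (\<integral>\<^sup>+s. f s \<partial>wmeas \<omega> E))"
proof -
  interpret pvm E using E by (simp add: pvm_in_def)
  define c where "c = max 0 C"
  have c: "c \<ge> 0" "ennreal c = ennreal C" by (auto simp: c_def max_def ennreal_neg)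
  from f(1) obtain g where g: "\<And>i. simple_function borel (g i)" "incseq g" "\<And>i s. g i s < top" "\<And>s. (SUP i. g i s) = f s"
    by (rule borel_measurable_implies_simple_function_sequence') blast
  have "\<forall>i. \<exists>X. X \<in> M \<and> psd X \<and> (\<forall>\<omega>. nweight \<omega> \<longrightarrow> \<omega> X = (\<integral>\<^sup>+s. g i s \<partial>wmeas \<omega> E))"
    using simple_calc[OF E g(1,3)] by blast
  then obtain X where X: "\<And>i. X i \<in> M" "\<And>i. psd (X i)"
    "\<And>i \<omega>. nweight \<omega> \<Longrightarrow> \<omega> (X i) = (\<integral>\<^sup>+s. g i s \<partial>wmeas \<omega> E)" by metis
  have gm: "g i \<in> borel_measurable (wmeas \<omega> E)" for i \<omega>
    using borel_measurable_simple_function[OF g(1)] by (simp cong: measurable_cong_sets)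
  have v: "ennreal (X i x \<bullet> x) = (\<integral>\<^sup>+s. g i s \<partial>vm x)" for i x
    using X(3)[OF nweight_vector_state, of x i] vm_eq_wmeas[OF pvm_axioms] by (simp add: vector_state_def)
  have mono: "X i x \<bullet> x \<le> X (Suc i) x \<bullet> x" for i x
  proof -
    have "ennreal (X i x \<bullet> x) \<le> ennreal (X (Suc i) x \<bullet> x)"
      unfolding v using incseq_SucD[OF g(2)] by (intro nn_integral_mono) (auto simp: le_fun_def)
    then show ?thesis using psdD(1)[OF X(2)] by (simp add: ennreal_le_iff)
  qed
  have bd: "X i x \<bullet> x \<le> c * (norm x)\<^sup>2" for i x
  proof -
    have "g i s \<le> ennreal c" for s using g(4)[of s] f(2)[of s] c SUP_upper[of i UNIV "\<lambda>i. g i s"] by simp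
    then have "ennreal (X i x \<bullet> x) \<le> (\<integral>\<^sup>+s. ennreal c \<partial>vm x)" unfolding v by (intro nn_integral_mono)
    also have "\<dots> = ennreal (c * (norm x)\<^sup>2)" using c by (simp add: emeasure_vm_UNIV ennreal_mult)
    finally show ?thesis using c by (simp add: ennreal_le_iff)
  qed
  have nb: "norm (X i) \<le> c" for i
    using psd_norm_le[OF X(2) bd c(1)] c(1) by (intro norm_blinfun_bound) auto
  have sa: "self_adj (X i)" for i using X(2) by (simp add: psd_def)
  obtain Y :: "'h bop" where Y: "\<And>x. (\<lambda>i. X i x) \<longlonglongrightarrow> Y x" using incseq_strong_limit[of X, OF sa mono bd nb] by blast
  have inc: "psd (X (Suc i) - X i)" for i
    by (rule psd_diffI[OF sa sa mono])
  have "\<omega> Y = (\<integral>\<^sup>+s. f s \<partial>wmeas \<omega> E)" if w: "nweight \<omega>" for \<omega>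
    unfolding nweight_SUP(3)[OF w X(1,2) inc Y] X(3)[OF w] g(4)[symmetric]
    by (rule nn_integral_monotone_convergence_SUP[symmetric, OF g(2) gm])
  moreover have "Y \<in> M" "psd Y" using nweight_SUP(1,2)[OF nweight_vector_state X(1,2) inc Y] by auto
  ultimately show ?thesis by blast
qed

end

section \<open>Consequences of the trace property\<close>

locale vna_trace = vna +
  fixes \<tau> :: "'a bop \<Rightarrow> ennreal"
  assumes trace: "fns_trace M \<tau>"
begin

lemma tau: "nweight \<tau>"
  using trace by (auto simp: fns_trace_def nweight_def)

lemma tau_tracial: "X \<in> M \<Longrightarrow> \<tau> (radj X o\<^sub>L X) = \<tau> (X o\<^sub>L radj X)"
  using trace star_eq_radj[OF M_bounded, of X] unfolding fns_trace_def by metis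

lemma tau_faithful: "X \<in> M \<Longrightarrow> psd X \<Longrightarrow> \<tau> X = 0 \<Longrightarrow> X = 0"
  using trace by (auto simp: fns_trace_def faithful_def pos_cone_iff)

lemma proj_radj: "ortho_proj p \<Longrightarrow> radj p = (p :: 'a bop)"
  by (simp add: ortho_proj_def self_adj_iff_radj)

text \<open>The trace property for y = p sqrt(x). The form p x p can be dominated by the functional
  calculus, and the form sqrt(x) p sqrt(x) is monotone in p.\<close>

lemma tau_compress:
  assumes "x \<in> M" "psd x" "p \<in> M" "ortho_proj p"
  shows "\<tau> (p o\<^sub>L x o\<^sub>L p) = \<tau> (psd_sqrt x o\<^sub>L p o\<^sub>L psd_sqrt x)"
    "psd (p o\<^sub>L x o\<^sub>L p)" "psd (psd_sqrt x o\<^sub>L p o\<^sub>L psd_sqrt x)"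
proof -
  let ?r = "psd_sqrt x"
  have r: "psd ?r" "?r \<in> M" "\<And>v. ?r (?r v) = x v" 
    using psd_sqrt(1,2)[OF assms(2)] M_closed(7)[OF assms(2,1)] by auto
  have rr: "radj ?r = ?r" using r(1) by (simp add: psd_def self_adj_iff_radj)
  let ?y = "p o\<^sub>L ?r"
  have ry: "radj ?y = ?r o\<^sub>L p" by (simp add: radj_compose rr proj_radj[OF assms(4)])
  have 1: "radj ?y o\<^sub>L ?y = ?r o\<^sub>L p o\<^sub>L ?r"
    unfolding ry by (rule blinfun_eqI) (simp add: ortho_projD(1)[OF assms(4)])
  have 2: "?y o\<^sub>L radj ?y = p o\<^sub>L x o\<^sub>L p" unfolding ry by (rule blinfun_eqI) (simp add: r(3))
  have "?y \<in> M" by (rule M_closed(6)[OF assms(3) r(2)])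
  from tau_tracial[OF this] show "\<tau> (p o\<^sub>L x o\<^sub>L p) = \<tau> (?r o\<^sub>L p o\<^sub>L ?r)" unfolding 1 2 by simp
  have p: "psd (radj z o\<^sub>L z)" for z :: "'a bop"
    unfolding psd_def self_adj_def by (simp add: radj[symmetric]) (metis inner_commute inner_ge_zero radj)
  from p[of ?y] p[of "radj ?y"] show "psd (p o\<^sub>L x o\<^sub>L p)" "psd (?r o\<^sub>L p o\<^sub>L ?r)"
    unfolding 1 radj_radj 2 by auto
qed

text \<open>The truncations min(f, n) give one inequality. For the other, a bounded x below f(S) is
  compressed by p = E {f <= n}: vector states show p x p <= (f restricted to {f <= n})(S), and the
  trace of x is the supremum of the traces of p x p.\<close>

lemma ext_trace_ext_fun_calc:
  assumes E: "pvm_in E" and S: "\<And>A. A \<in> sets borel \<Longrightarrow> spectral_measure S A = E A"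
    and f: "(\<lambda>s. f s * indicator {0..} s) \<in> borel_measurable borel"
  shows "ext_trace M \<tau> (ext_fun_calc f S) = (\<integral>\<^sup>+s\<in>{0..}. f s \<partial>wmeas \<tau> E)"
proof -
  interpret pvm E using E by (simp add: pvm_in_def)
  let ?g = "\<lambda>s. f s * indicator {0..} s"
  let ?I = "\<lambda>\<omega>. \<integral>\<^sup>+s. ?g s \<partial>wmeas \<omega> E"
  have EM: "E A \<in> M" if "A \<in> sets borel" for A using E that by (simp add: pvm_in_def)
  have efc: "ext_fun_calc f S \<omega> = ?I \<omega>" for \<omega>
  proof -
    have "measure_of UNIV (sets borel) (\<lambda>B. \<omega> (spectral_measure S B)) = wmeas \<omega> E"
      unfolding wmeas_def by (rule measure_of_eq) (auto simp: S sets.sigma_sets_eq[of borel, simplified])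
    then show ?thesis by (simp add: ext_fun_calc_def)
  qed
  have gm: "?g \<in> borel_measurable (wmeas \<omega> E)" for \<omega> using f by (simp cong: measurable_cong_sets)
  have pw: "\<omega> \<in> predual_pos M \<Longrightarrow> nweight \<omega>" for \<omega> by (auto simp: predual_pos_def nweight_def)
  let ?D = "{x \<in> pos_cone M. \<forall>\<omega>\<in>predual_pos M. \<omega> x \<le> ext_fun_calc f S \<omega>}"
  have "?I \<tau> \<le> (SUP x\<in>?D. \<tau> x)"
  proof -
    let ?h = "\<lambda>n s. min (?g s) (ennreal (real n))"
    have inc: "incseq ?h" by (auto simp: incseq_def le_fun_def intro: min.coboundedI2 ennreal_leI)
    have sup: "(SUP n. ?h n s) = ?g s" for s
    proof -
      have "(SUP n. ?h n s) = min (?g s) (SUP n. ennreal (real n))"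
        by (simp add: inf_min[symmetric] inf_SUP)
      then show ?thesis by (simp add: ennreal_SUP_of_nat_eq_top ennreal_of_nat_eq_real_of_nat[symmetric])
    qed
    have hm: "?h n \<in> borel_measurable borel" for n using f by measurable
    have hm': "?h n \<in> borel_measurable (wmeas \<tau> E)" for n using hm by (simp cong: measurable_cong_sets)
    have "?I \<tau> = (\<integral>\<^sup>+s. (SUP n. ?h n s) \<partial>wmeas \<tau> E)" by (simp only: sup)
    also have "\<dots> = (SUP n. \<integral>\<^sup>+s. ?h n s \<partial>wmeas \<tau> E)"
      by (rule nn_integral_monotone_convergence_SUP[OF inc hm'])
    also have "\<dots> \<le> (SUP x\<in>?D. \<tau> x)"
    proof (rule SUP_least)
      fix n :: nat
      obtain X where X: "X \<in> M" "psd X" "\<And>\<omega>. nweight \<omega> \<Longrightarrow> \<omega> X = (\<integral>\<^sup>+s. ?h n s \<partial>wmeas \<omega> E)"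
        using bounded_calc[OF E hm[of n], of "real n"] by auto
      have "\<omega> X \<le> ?I \<omega>" if "nweight \<omega>" for \<omega> unfolding X(3)[OF that] by (intro nn_integral_mono) simp
      then have "X \<in> ?D" using X(1,2) pw efc by (auto simp: pos_cone_iff)
      then show "(\<integral>\<^sup>+s. ?h n s \<partial>wmeas \<tau> E) \<le> (SUP x\<in>?D. \<tau> x)"
        unfolding X(3)[OF tau, symmetric] by (rule SUP_upper)
    qed
    finally show ?thesis .
  qed
  moreover have "\<tau> x \<le> ?I \<tau>" if "x \<in> ?D" for x
  proof (cases "?I \<tau> = \<infinity>")
    case fin: False
    have x: "x \<in> M" "psd x" using that by (auto simp: pos_cone_iff)
    have xI: "ennreal (x v \<bullet> v) \<le> (\<integral>\<^sup>+s. ?g s \<partial>vm v)" for v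
    proof -
      have "vector_state v x \<le> ?I (vector_state v)" using that vector_state_predual[of v] efc by auto
      then show ?thesis by (simp add: vector_state_def vm_eq_wmeas[OF pvm_axioms])
    qed
    let ?A = "\<lambda>n. {s. ?g s \<le> ennreal (real n)}"
    have A: "?A n \<in> sets borel" for n using f by measurable
    have incA: "incseq ?A" by (auto simp: incseq_def intro: order_trans ennreal_leI)
    have UA: "(\<Union>n. ?A n) = - {s. ?g s = \<infinity>}"
    proof (intro equalityI subsetI)
      fix s assume "s \<in> - {s. ?g s = \<infinity>}"
      then have "?g s < top" by (simp add: less_top)
      then obtain n where "?g s \<le> of_nat n" by (meson ennreal_Ex_less_of_nat less_imp_le)
      then show "s \<in> (\<Union>n. ?A n)" by (auto simp: ennreal_of_nat_eq_real_of_nat)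
    qed (auto simp: top_unique)
    have Inf: "{s. ?g s = \<infinity>} \<in> sets borel" using f by measurable
    \<comment> \<open>A finite integral confines f to finite values almost everywhere; by
      faithfulness the spectral projection of {f = infinity} is 0, so the compressing projections
      increase to 1.\<close>
    have "AE s in wmeas \<tau> E. ?g s \<noteq> \<infinity>"
      by (rule nn_integral_PInf_AE[OF gm]) (use fin in simp)
    then have "emeasure (wmeas \<tau> E) {s. ?g s = \<infinity>} = 0"
      using Inf by (subst (asm) AE_iff_measurable[where N = "{s. ?g s = \<infinity>}"]) auto
    then have "E {s. ?g s = \<infinity>} = 0"
      using emeasure_wmeas[OF E tau Inf] tau_faithful EM[OF Inf] psd_ortho_proj[OF proj[OF Inf]] by simp
    then have EU: "E (\<Union>n. ?A n) v = v" for v unfolding UA compl[OF Inf] by simp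
    let ?p = "\<lambda>n. E (?A n)"
    have p: "?p n \<in> M" "ortho_proj (?p n)" for n using EM A proj by auto
    let ?r = "psd_sqrt x"
    have r: "psd ?r" "\<And>v. ?r (?r v) = x v" "?r \<in> M"
      using psd_sqrt(1,2)[OF x(2)] M_closed(7)[OF x(2,1)] by auto
    have lim: "(\<lambda>n. ?p n v) \<longlonglongrightarrow> v" for v using incseq_lim[of ?A v] A incA EU by auto
    have "(\<lambda>n. ?r (?p n (?r v))) \<longlonglongrightarrow> ?r (?r v)" for v by (intro blinfun.tendsto tendsto_const lim)
    then have lim': "(\<lambda>n. (?r o\<^sub>L ?p n o\<^sub>L ?r) v) \<longlonglongrightarrow> x v" for v by (simp add: r(2))
    have inc: "psd ((?r o\<^sub>L ?p (Suc n) o\<^sub>L ?r) - (?r o\<^sub>L ?p n o\<^sub>L ?r))" for n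
    proof -
      let ?B = "?A (Suc n) - ?A n"
      have B: "?B \<in> sets borel" by (rule sets.Diff[OF A A])
      have e: "?A n \<union> ?B = ?A (Suc n)" using incseq_SucD[OF incA, of n] by auto
      have u: "E (?A n \<union> ?B) v = ?p n v + E ?B v" for v by (rule union[OF A B]) blast
      have "?p (Suc n) v = ?p n v + E ?B v" for v using u[of v] unfolding e .
      then have "(?r o\<^sub>L ?p (Suc n) o\<^sub>L ?r) - (?r o\<^sub>L ?p n o\<^sub>L ?r) = ?r o\<^sub>L E ?B o\<^sub>L ?r"
        by (intro blinfun_eqI) (simp add: blinfun.bilinear_simps)
      then show ?thesis using tau_compress(3)[OF x EM[OF B] proj[OF B]] by simp
    qed
    have "\<tau> x = (SUP n. \<tau> (?r o\<^sub>L ?p n o\<^sub>L ?r))"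
      by (rule nweight_SUP(3)[OF tau _ _ inc lim'])
        (rule M_closed(6)[OF M_closed(6)[OF r(3) p(1)] r(3)], rule tau_compress(3)[OF x p])
    also have "\<dots> = (SUP n. \<tau> (?p n o\<^sub>L x o\<^sub>L ?p n))" by (simp add: tau_compress(1)[OF x p])
    also have "\<dots> \<le> ?I \<tau>"
    proof (rule SUP_least)
      fix n :: nat
      let ?k = "\<lambda>s. indicator (?A n) s * ?g s"
      have km: "?k \<in> borel_measurable borel" using f A by measurable
      have "?k s \<le> ennreal (real n)" for s by (simp split: split_indicator)
      from bounded_calc[OF E km this] obtain X where X: "X \<in> M" "psd X"
        "\<And>\<omega>. nweight \<omega> \<Longrightarrow> \<omega> X = (\<integral>\<^sup>+s. ?k s \<partial>wmeas \<omega> E)" by blast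
      let ?q = "?p n o\<^sub>L x o\<^sub>L ?p n"
      have "?q v \<bullet> v \<le> X v \<bullet> v" for v
      proof -
        have "ennreal (?q v \<bullet> v) = ennreal (x (?p n v) \<bullet> ?p n v)" using ortho_projD(2)[OF p(2)] by simp
        also have "\<dots> \<le> (\<integral>\<^sup>+s. ?g s \<partial>vm (?p n v))" by (rule xI)
        also have "\<dots> = (\<integral>\<^sup>+s. ?k s \<partial>vm v)" unfolding vm_E[OF A] using f A by (subst nn_integral_density) auto
        also have "\<dots> = ennreal (X v \<bullet> v)"
          using X(3)[OF nweight_vector_state, of v] by (simp add: vector_state_def vm_eq_wmeas[OF pvm_axioms])
        finally show ?thesis using psdD(1)[OF X(2)] by (simp add: ennreal_le_iff)
      qed
      then have "psd (X - ?q)" by (rule psd_diffI[OF psd_imp_self_adj[OF tau_compress(2)[OF x p]] psd_imp_self_adj[OF X(2)]])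
      then have "\<tau> ?q \<le> \<tau> X" 
        by (intro nweight_mono[OF tau _ _ X(1)] tau_compress(2)[OF x p] M_closed(6) p(1) x(1))
      also have "\<dots> \<le> ?I \<tau>" unfolding X(3)[OF tau] by (intro nn_integral_mono) (auto split: split_indicator)
      finally show "\<tau> ?q \<le> ?I \<tau>" .
    qed
    finally show ?thesis .
  qed simp
  ultimately have "(SUP x\<in>?D. \<tau> x) = ?I \<tau>" by (intro antisym SUP_least) auto
  then show ?thesis by (simp add: ext_trace_def)
qed

lemma spec_pvm_in:
  "closed_densely_defined T \<Longrightarrow> affiliated M T \<Longrightarrow> pvm_in (closed_dense_op.spec T)"
  using affiliated_spec closed_dense_op.spec_ex by (auto simp: pvm_in_def closed_densely_defined_iff)

lemma distribution_fun_eq: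
  assumes "closed_densely_defined T" "affiliated M T"
  shows "distribution_fun \<tau> T s = \<tau> (closed_dense_op.spec T {s<..})"
  by (simp add: distribution_fun_def spectral_measure_abs_op[OF assms(1)])

text \<open>The angle estimate \<open>\<parallel>p e\<parallel> \<le> 1/2\<close> gives \<open>e \<le> 2 e (1 - p) e\<close>, which replaces the comparison
  theory of projections.\<close>

lemma measurable_ops_iff:
  assumes T: "closed_densely_defined T" "affiliated M T"
  shows "T \<in> measurable_ops M \<tau> \<longleftrightarrow> (\<forall>\<epsilon>>0. \<exists>s\<ge>0. distribution_fun \<tau> T s \<le> ennreal \<epsilon>)"
proof -
  interpret closed_dense_op T using T by (simp add: closed_densely_defined_iff)
  have eM: "spec A \<in> M" if "A \<in> sets borel" for A using affiliated_spec[OF T that] .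
  show ?thesis
    unfolding distribution_fun_eq[OF T]
  proof
    assume tm: "T \<in> measurable_ops M \<tau>"
    show "\<forall>\<epsilon>>0. \<exists>s\<ge>0. \<tau> (spec {s<..}) \<le> ennreal \<epsilon>"
    proof (intro allI impI)
      fix \<epsilon> :: real assume "\<epsilon> > 0"
      then have "\<epsilon> / 2 > 0" by simp
      then obtain p where p: "p \<in> M" "projection p" "range p \<subseteq> Domain T" "\<tau> (id_blinfun - p) \<le> ennreal (\<epsilon> / 2)"
        using tm unfolding measurable_ops_def by blast
      have pp: "ortho_proj p" using p(2) by (simp add: projection_iff)
      obtain C where C: "C \<ge> 0" "\<And>s x. s > 0 \<Longrightarrow> s * norm (spec {s<..} (p x)) \<le> C * norm x"
        using bounded_trunc_imp[of p] p(3) by blast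
      \<comment> \<open>Makes C / s at most 1/2, which is the angle bound; adding 1 keeps s
        positive.\<close>
      define s where "s = 2 * C + 1"
      have s: "s > 0" using C by (simp add: s_def)
      let ?e = "spec {s<..}" and ?q = "id_blinfun - p"
      have e: "ortho_proj ?e" "?e \<in> M" using spec.proj eM by auto
      have q: "ortho_proj ?q" using ortho_projD(1,2)[OF pp]
        by (simp add: ortho_proj_def self_adj_def blinfun.bilinear_simps inner_diff_left inner_diff_right)
      have qM: "?q \<in> M" by (rule M_closed(4)[OF M_closed(1) p(1)])
      have half: "norm (?e (p x)) \<le> norm x / 2" for x
      proof -
        have "s * norm (?e (p x)) \<le> (s / 2) * norm x"
          using C(2)[OF s, of x] mult_right_mono[of C "s / 2" "norm x"] by (simp add: s_def)
        then show ?thesis using s by simp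
      qed
      have key: "?e x \<bullet> x \<le> 2 * (?q (?e x) \<bullet> ?e x)" for x
      proof -
        have "(norm (p (?e x)))\<^sup>2 = ?e (p (?e x)) \<bullet> ?e x"
          using ortho_projD(3)[OF pp, of "?e x"] ortho_projD(1,2)[OF e(1)] by metis
        also have "\<dots> \<le> norm (?e (p (?e x))) * norm (?e x)" by (rule norm_cauchy_schwarz)
        also have "\<dots> \<le> norm (?e x) / 2 * norm (?e x)" by (intro mult_right_mono half) auto
        finally have "(norm (p (?e x)))\<^sup>2 \<le> (norm (?e x))\<^sup>2 / 2" by (simp add: power2_eq_square)
        moreover have "?q (?e x) \<bullet> ?e x = (norm (?e x))\<^sup>2 - (norm (p (?e x)))\<^sup>2"
          using ortho_projD(3)[OF pp, of "?e x"] by (simp add: blinfun.diff_left inner_diff_left power2_norm_eq_inner)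
        ultimately show ?thesis using ortho_projD(3)[OF e(1), of x] by simp
      qed
      \<comment> \<open>The trace property for this z exchanges e q e with q e q, and the latter is
        below q. The factor 2 of the angle estimate is paid for by \<epsilon> / 2.\<close>
      let ?z = "?q o\<^sub>L ?e"
      have rz: "radj ?z = ?e o\<^sub>L ?q" by (simp add: radj_compose proj_radj[OF e(1)] proj_radj[OF q])
      have zz: "radj ?z o\<^sub>L ?z = ?e o\<^sub>L ?q o\<^sub>L ?e" "?z o\<^sub>L radj ?z = ?q o\<^sub>L ?e o\<^sub>L ?q"
        unfolding rz by (rule blinfun_eqI; simp add: ortho_projD(1)[OF q] ortho_projD(1)[OF e(1)] del: blinfun.diff_left)+
      have eqe: "psd (?e o\<^sub>L ?q o\<^sub>L ?e)" "psd (?q o\<^sub>L ?e o\<^sub>L ?q)"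
        using tau_compress(2)[OF qM psd_ortho_proj[OF q] e(2,1)] tau_compress(2)[OF e(2) psd_ortho_proj[OF e(1)] qM q] by auto
      have zM: "?z \<in> M" "?e o\<^sub>L ?q o\<^sub>L ?e \<in> M" "?q o\<^sub>L ?e o\<^sub>L ?q \<in> M" 
        by (intro M_closed(6) qM e(2))+
      have "psd (2 *\<^sub>R (?e o\<^sub>L ?q o\<^sub>L ?e) - ?e)"
      proof (rule psd_diffI)
        show "self_adj ?e" using e(1) by (simp add: ortho_proj_def)
        show "self_adj (2 *\<^sub>R (?e o\<^sub>L ?q o\<^sub>L ?e))" using psd_simps(3)[OF eqe(1), of 2] by (simp add: psd_def)
        fix x
        have "(2 *\<^sub>R (?e o\<^sub>L ?q o\<^sub>L ?e)) x \<bullet> x = 2 * (?e (?q (?e x)) \<bullet> x)" by (simp add: blinfun.scaleR_left)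
        also have "?e (?q (?e x)) \<bullet> x = ?q (?e x) \<bullet> ?e x" by (rule ortho_projD(2)[OF e(1)])
        finally show "?e x \<bullet> x \<le> (2 *\<^sub>R (?e o\<^sub>L ?q o\<^sub>L ?e)) x \<bullet> x" using key[of x] by simp
      qed
      then have "\<tau> ?e \<le> \<tau> (2 *\<^sub>R (?e o\<^sub>L ?q o\<^sub>L ?e))"
        by (rule nweight_mono[OF tau e(2) psd_ortho_proj[OF e(1)] M_closed(5)[OF zM(2)]])
      also have "\<dots> = 2 * \<tau> (?q o\<^sub>L ?e o\<^sub>L ?q)"
        using nweight_scale[OF tau zM(2) eqe(1), of 2] tau_tracial[OF zM(1)] unfolding zz by simp
      also have "\<dots> \<le> 2 * \<tau> ?q"
      proof (intro mult_left_mono nweight_mono[OF tau zM(3) eqe(2) qM])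
        have "psd (?q o\<^sub>L (id_blinfun - ?e) o\<^sub>L ?q)"
        proof (rule tau_compress(2)[OF _ _ qM q])
          show "id_blinfun - ?e \<in> M" by (rule M_closed(4)[OF M_closed(1) e(2)])
          have "ortho_proj (id_blinfun - ?e)" using ortho_projD(1,2)[OF e(1)]
            by (simp add: ortho_proj_def self_adj_def blinfun.bilinear_simps inner_diff_left inner_diff_right)
          then show "psd (id_blinfun - ?e)" by (rule psd_ortho_proj)
        qed
        moreover have "?q o\<^sub>L (id_blinfun - ?e) o\<^sub>L ?q = ?q - (?q o\<^sub>L ?e o\<^sub>L ?q)"
        proof (rule blinfun_eqI)
          fix x
          have "?q (?q x - ?e (?q x)) = ?q x - ?q (?e (?q x))"
            unfolding blinfun.diff_right[of ?q] ortho_projD(1)[OF q] ..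
          then show "(?q o\<^sub>L (id_blinfun - ?e) o\<^sub>L ?q) x = (?q - (?q o\<^sub>L ?e o\<^sub>L ?q)) x"
            by (simp add: blinfun.diff_left[of ?q "_ o\<^sub>L _"] blinfun.diff_left[of id_blinfun ?e] del: blinfun.diff_left)
        qed
        ultimately show "psd (?q - (?q o\<^sub>L ?e o\<^sub>L ?q))" by simp
      qed simp
      also have "\<dots> \<le> 2 * ennreal (\<epsilon> / 2)" by (intro mult_left_mono p) simp
      also have "\<dots> = ennreal \<epsilon>" using \<open>\<epsilon> > 0\<close> by (simp add: ennreal_mult'[symmetric] ennreal_numeral[symmetric] del: ennreal_numeral)
      finally show "\<exists>s\<ge>0. \<tau> (spec {s<..}) \<le> ennreal \<epsilon>" using s by (intro exI[of _ s]) simp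
    qed
  next
    assume d: "\<forall>\<epsilon>>0. \<exists>s\<ge>0. \<tau> (spec {s<..}) \<le> ennreal \<epsilon>"
    show "T \<in> measurable_ops M \<tau>"
      unfolding measurable_ops_def mem_Collect_eq
    proof (intro conjI allI impI T)
      fix \<epsilon> :: real assume "\<epsilon> > 0"
      then obtain s where s: "s \<ge> 0" "\<tau> (spec {s<..}) \<le> ennreal \<epsilon>" using d by blast
      have B: "{s<..} \<in> sets borel" "{..s} \<in> sets borel" by auto
      have "- {..s} = {s<..}" by auto
      then have "id_blinfun - spec {..s} = spec {s<..}"
        using spec.compl[OF B(2)] by (intro blinfun_eqI) (simp add: blinfun.diff_left)
      moreover have "range (spec {..s}) \<subseteq> Domain T"
        using trunc_exists[OF s(1)] by blast
      moreover have "projection (spec {..s})" using spec.proj[OF B(2)] eM[OF B(2)] M_bounded by (simp add: projection_iff)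
      ultimately show "\<exists>p\<in>M. projection p \<and> range p \<subseteq> Domain T \<and> \<tau> (id_blinfun - p) \<le> ennreal \<epsilon>"
        using s(2) eM[OF B(2)] by (intro bexI[of _ "spec {..s}"]) auto
    qed
  qed
qed

end

section \<open>Tensor products with \<open>L\<^sup>2(\<real>)\<close>\<close>

lemma csubspace_span:
  fixes S :: "'a::complex_vector set"
  assumes S: "\<And>c x. x \<in> S \<Longrightarrow> c *\<^sub>C x \<in> S"
  shows "csubspace (span S)" "cspan S = span S"
proof -
  have z: "c *\<^sub>C (0::'a) = 0" for c using scaleC_add_right[of c "0::'a" 0] by simp
  have r: "c *\<^sub>C (r *\<^sub>R x) = r *\<^sub>R (c *\<^sub>C (x::'a))" for c r x
    by (simp add: scaleR_scaleC scaleC_scaleC mult.commute)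
  have "c *\<^sub>C x \<in> span S" if "x \<in> span S" for c x
    using that
  proof (induction rule: span_induct_alt)
    case (step r x y)
    then show ?case using S by (simp add: scaleC_add_right r span_add span_scale span_base)
  qed (simp add: z span_zero)
  then show cs: "csubspace (span S)" by (auto simp: csubspace_def span_zero span_add)
  show "cspan S = span S"
  proof
    show "cspan S \<subseteq> span S" unfolding cspan_def by (rule hull_minimal) (use cs span_superset in auto)
    have "subspace (cspan S)"
    proof -
      have "csubspace (cspan S)" unfolding cspan_def by (rule hull_in) (auto simp: csubspace_def)
      then show ?thesis by (auto simp: csubspace_def subspace_def scaleR_scaleC)
    qed
    then show "span S \<subseteq> cspan S" unfolding cspan_def by (intro span_minimal hull_subset) simp
  qed
qed

lemma csubspace_closure:
  fixes S :: "('a::chilbert_space \<times> 'a) set"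
  assumes "csubspace S" shows "csubspace (closure S)"
proof -
  have sub: "subspace S"
  proof -
    have "(r *\<^sub>R p) = complex_of_real r *\<^sub>C p" for r and p :: "'a \<times> 'a"
      by (cases p) (simp add: scaleC_prod_def scaleR_scaleC)
    then show ?thesis using assms by (auto simp: csubspace_def subspace_def)
  qed
  have "c *\<^sub>C p \<in> closure S" if "p \<in> closure S" for c p
  proof -
    obtain f where f: "\<And>n. f n \<in> S" "f \<longlonglongrightarrow> p" using \<open>p \<in> closure S\<close> by (auto simp: closure_sequential)
    have "(\<lambda>n. (cmul c (fst (f n)), cmul c (snd (f n)))) \<longlonglongrightarrow> (cmul c (fst p), cmul c (snd p))"
      by (intro tendsto_intros f blinfun.tendsto)
    then have "(\<lambda>n. c *\<^sub>C f n) \<longlonglongrightarrow> c *\<^sub>C p" by (simp add: scaleC_prod_def)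
    moreover have "\<And>n. c *\<^sub>C f n \<in> S" using f assms by (auto simp: csubspace_def)
    ultimately show ?thesis unfolding closure_sequential by (intro exI[of _ "\<lambda>n. c *\<^sub>C f n"]) auto
  qed
  then show ?thesis using subspace_closure[OF sub] by (auto simp: csubspace_def subspace_def)
qed

text \<open>Homogeneity is checked on the closure of the domain and on its orthogonal complement;
  the complement is invariant under scalars too, and U vanishes there.\<close>

lemma bounded_extension_complex:
  fixes G :: "('a::chilbert_space \<times> 'a) set"
  assumes G: "csubspace G" and le: "\<And>x y. (x, y) \<in> G \<Longrightarrow> norm y \<le> c * norm x" and c: "c \<ge> 0"
  shows "\<exists>U\<in>bounded_ops. (\<forall>(x, y)\<in>G. U x = y) \<and> (\<forall>x. norm (U x) \<le> c * norm x)"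
proof -
  have sub: "subspace G"
  proof -
    have "(r *\<^sub>R p) = complex_of_real r *\<^sub>C p" for r and p :: "'a \<times> 'a"
      by (cases p) (simp add: scaleC_prod_def scaleR_scaleC)
    then show ?thesis using G by (auto simp: csubspace_def subspace_def)
  qed
  from bounded_extension[OF sub le c] obtain U :: "'a \<Rightarrow>\<^sub>L 'a" where
    U0: "\<forall>(x, y)\<in>G. U x = y" "\<forall>x. norm (U x) \<le> c * norm x"
    "\<forall>x. (\<forall>(y, z)\<in>G. x \<bullet> y = 0) \<longrightarrow> U x = 0" by blast
  have U: "\<And>x y. (x, y) \<in> G \<Longrightarrow> U x = y" "\<And>x. norm (U x) \<le> c * norm x"
    "\<And>x. (\<And>y z. (y, z) \<in> G \<Longrightarrow> x \<bullet> y = 0) \<Longrightarrow> U x = 0"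
  proof -
    show "U x = y" if "(x, y) \<in> G" for x y using U0(1) that by auto
    show "norm (U x) \<le> c * norm x" for x using U0(2) by blast
    show "U x = 0" if "\<And>y z. (y, z) \<in> G \<Longrightarrow> x \<bullet> y = 0" for x
    proof -
      have "\<forall>(y, z)\<in>G. x \<bullet> y = 0" using that by auto
      then show ?thesis using U0(3) by blast
    qed
  qed
  let ?D = "closure (fst ` G)"
  have sD: "subspace ?D" by (intro subspace_closure linear_subspace_image[OF _ sub]) (simp add: linear_fst)
  have "U (k *\<^sub>C x) = k *\<^sub>C U x" for k x
  proof -
    obtain p where p: "p \<in> ?D" "\<And>y. y \<in> ?D \<Longrightarrow> (x - p) \<bullet> y = 0"
      using closed_subspace_proj_exists[OF closed_closure sD] by blast
    have inG: "y \<in> ?D" if "(y, z) \<in> G" for y z using that closure_subset[of "fst ` G"] by force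
    have "U (x - p) = 0" by (rule U(3)) (use p(2) inG in blast)
    then have 1: "U x = U p" by (simp add: blinfun.diff_right)
    have "U (k *\<^sub>C (x - p)) = 0"
    proof (rule U(3))
      fix y z assume "(y, z) \<in> G"
      then have "(cnj k *\<^sub>C y, cnj k *\<^sub>C z) \<in> G" by (rule csubspace_pairD[OF G])
      then show "(k *\<^sub>C (x - p)) \<bullet> y = 0" unfolding inner_scaleC using p(2) inG by blast
    qed
    then have 2: "U (k *\<^sub>C x) = U (k *\<^sub>C p)" by (simp add: scaleC_diff_right blinfun.diff_right)
    have "?D \<subseteq> {v. U (cmul k v) = cmul k (U v)}"
    proof (rule closure_minimal)
      show "closed {v. U (cmul k v) = cmul k (U v)}" by (intro closed_Collect_eq continuous_intros)
      show "fst ` G \<subseteq> {v. U (cmul k v) = cmul k (U v)}"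
        using U(1) csubspace_pairD[OF G] by force
    qed
    then have "U (k *\<^sub>C p) = k *\<^sub>C U p" using p(1) by auto
    then show ?thesis using 1 2 by simp
  qed
  then have "U \<in> bounded_ops" by (simp add: bounded_ops_def)
  then show ?thesis using U by blast
qed

lemma cinner_radj:
  assumes "X \<in> bounded_ops" shows "cinner (X x) y = cinner x (radj X y)"
  unfolding cinner_eq by (simp add: radj bounded_opsD[OF radj_bounded_ops[OF assms]])

section \<open>Square integrable functions\<close>

lemma measurable_cnj [measurable]: "cnj \<in> borel_measurable borel"
  by (intro borel_measurable_continuous_onI continuous_intros)

abbreviation "L2 \<equiv> square_integrable"

definition ip :: "(real \<Rightarrow> complex) \<Rightarrow> (real \<Rightarrow> complex) \<Rightarrow> complex" where
  "ip f g = (LINT t|lborel. f t * cnj (g t))"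

lemma L2_meas [measurable_dest]: "f \<in> L2 \<Longrightarrow> f \<in> borel_measurable lborel"
  by (simp add: square_integrable_def)

lemma L2_int: "f \<in> L2 \<Longrightarrow> integrable lborel (\<lambda>t. (cmod (f t))\<^sup>2)"
  by (simp add: square_integrable_def)

lemma L2_bound:
  assumes "g \<in> borel_measurable lborel" "f \<in> L2" "\<And>t. cmod (g t) \<le> C * cmod (f t)"
  shows "g \<in> L2"
proof -
  have "integrable lborel (\<lambda>t. C\<^sup>2 * (cmod (f t))\<^sup>2)" using L2_int[OF assms(2)] by simp
  then have "integrable lborel (\<lambda>t. (cmod (g t))\<^sup>2)"
  proof (rule Bochner_Integration.integrable_bound)
    show "(\<lambda>t. (cmod (g t))\<^sup>2) \<in> borel_measurable lborel" using assms(1) by measurable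
    show "AE t in lborel. norm ((cmod (g t))\<^sup>2) \<le> norm (C\<^sup>2 * (cmod (f t))\<^sup>2)"
      using power_mono[OF assms(3), of _ 2] by (auto simp: power_mult_distrib)
  qed
  then show ?thesis using assms(1) by (simp add: square_integrable_def)
qed

lemma L2_add:
  assumes "f \<in> L2" "g \<in> L2" shows "(\<lambda>t. f t + g t) \<in> L2"
proof -
  have "integrable lborel (\<lambda>t. 2 * (cmod (f t))\<^sup>2 + 2 * (cmod (g t))\<^sup>2)" using assms L2_int by simp
  then have "integrable lborel (\<lambda>t. (cmod (f t + g t))\<^sup>2)"
  proof (rule Bochner_Integration.integrable_bound)
    show "(\<lambda>t. (cmod (f t + g t))\<^sup>2) \<in> borel_measurable lborel" using assms[THEN L2_meas] by measurable
    have "(cmod (a + b))\<^sup>2 \<le> 2 * (cmod a)\<^sup>2 + 2 * (cmod b)\<^sup>2" for a b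
    proof -
      have "(cmod (a + b))\<^sup>2 \<le> (cmod a + cmod b)\<^sup>2" by (intro power_mono norm_triangle_ineq) auto
      also have "\<dots> \<le> 2 * (cmod a)\<^sup>2 + 2 * (cmod b)\<^sup>2"
        using zero_le_power2[of "cmod a - cmod b"] by (simp add: power2_sum power2_diff)
      finally show ?thesis .
    qed
    then show "AE t in lborel. norm ((cmod (f t + g t))\<^sup>2) \<le> norm (2 * (cmod (f t))\<^sup>2 + 2 * (cmod (g t))\<^sup>2)" by auto
  qed
  moreover have "(\<lambda>t. f t + g t) \<in> borel_measurable lborel" using assms[THEN L2_meas] by measurable
  ultimately show ?thesis by (simp add: square_integrable_def)
qed

lemma bounded_borelD:
  assumes "f \<in> bounded_borel" obtains C where "C \<ge> 0" "\<And>t. cmod (f t) \<le> C"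
proof -
  obtain a where a: "\<And>t. cmod (f t) \<le> a" using assms by (auto simp: bounded_borel_def bounded_iff)
  have "0 \<le> a" by (rule order_trans[OF norm_ge_zero a])
  then show ?thesis using that a by blast
qed

lemma bounded_borelI: "f \<in> borel_measurable borel \<Longrightarrow> (\<And>t. cmod (f t) \<le> C) \<Longrightarrow> f \<in> bounded_borel"
  by (auto simp: bounded_borel_def bounded_iff)

lemma L2_mult_le:
  assumes "f \<in> borel_measurable borel" "\<And>t. cmod (f t) \<le> C" "g \<in> L2" shows "(\<lambda>t. f t * g t) \<in> L2"
  by (rule L2_bound[OF _ assms(3), where C = C])
    (use assms(1) L2_meas[OF assms(3)] in measurable, simp add: norm_mult mult_right_mono assms(2))

lemma L2_mult:
  assumes "f \<in> bounded_borel" "g \<in> L2" shows "(\<lambda>t. f t * g t) \<in> L2"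
proof -
  obtain C where "\<And>t. cmod (f t) \<le> C" using assms(1) by (rule bounded_borelD) blast
  then show ?thesis using assms by (intro L2_mult_le) (auto simp: bounded_borel_def)
qed

lemma L2_scale: "g \<in> L2 \<Longrightarrow> (\<lambda>t. c * g t) \<in> L2"
  by (rule L2_mult_le[where C = "cmod c"]) auto

lemma ip_integrable:
  assumes "f \<in> L2" "g \<in> L2" shows "integrable lborel (\<lambda>t. f t * cnj (g t))"
proof (rule Bochner_Integration.integrable_bound[where f = "\<lambda>t. (cmod (f t))\<^sup>2 + (cmod (g t))\<^sup>2"])
  show "integrable lborel (\<lambda>t. (cmod (f t))\<^sup>2 + (cmod (g t))\<^sup>2)" using assms L2_int by simp
  show "(\<lambda>t. f t * cnj (g t)) \<in> borel_measurable lborel" using assms[THEN L2_meas] by measurable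
  have "x * y \<le> x\<^sup>2 + y\<^sup>2" if "0 \<le> x" "0 \<le> y" for x y :: real
    using zero_le_power2[of "x - y"] mult_nonneg_nonneg[OF that] unfolding power2_diff by linarith
  then show "AE t in lborel. norm (f t * cnj (g t)) \<le> norm ((cmod (f t))\<^sup>2 + (cmod (g t))\<^sup>2)"
    by (auto simp: norm_mult)
qed

lemma ip_add_left: "f \<in> L2 \<Longrightarrow> f' \<in> L2 \<Longrightarrow> g \<in> L2 \<Longrightarrow> ip (\<lambda>t. f t + f' t) g = ip f g + ip f' g"
  unfolding ip_def by (simp add: distrib_right ip_integrable)

lemma ip_scale_left: "ip (\<lambda>t. c * f t) g = c * ip f g"
  unfolding ip_def by (simp add: mult.assoc)

lemma ip_self: "f \<in> L2 \<Longrightarrow> ip f f = complex_of_real (LINT t|lborel. (cmod (f t))\<^sup>2)"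
  unfolding ip_def by (simp add: complex_norm_square[symmetric] del: of_real_power)

section \<open>Elementary tensors and bounded tensor operators\<close>

locale l2_tensor =
  fixes T :: "'h::chilbert_space \<Rightarrow> (real \<Rightarrow> complex) \<Rightarrow> 'k::chilbert_space"
  assumes tens: "tensor_with_L2 T"
begin

lemma T_cinner: "f \<in> L2 \<Longrightarrow> g \<in> L2 \<Longrightarrow> cinner (T \<xi> f) (T \<eta> g) = cinner \<xi> \<eta> * ip f g"
  using tens by (auto simp: tensor_with_L2_def ip_def)

lemma T_inner: "f \<in> L2 \<Longrightarrow> g \<in> L2 \<Longrightarrow> T \<xi> f \<bullet> T \<eta> g = Re (cinner \<xi> \<eta> * ip f g)"
  using T_cinner Re_cinner by metis

lemma T_dense0: "closure (cspan {T \<xi> g | \<xi> g. g \<in> L2}) = UNIV"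
  using tens by (simp add: tensor_with_L2_def)

text \<open>Inner products with elementary tensors separate points, so each algebraic law for T
  reduces to one for the two scalar products.\<close>

lemma T_eqI:
  assumes "\<And>\<xi> g. g \<in> L2 \<Longrightarrow> cinner k (T \<xi> g) = cinner k' (T \<xi> g)" shows "k = k'"
proof -
  let ?S = "{v. cinner (k - k') v = 0}"
  have diff: "cinner (k - k') v = cinner k v - cinner k' v" for v
    using cinner_add_left[of "k - k'" k' v] by (simp add: algebra_simps)
  have "csubspace ?S" by (auto simp: csubspace_def cinner_simps)
  then have "cspan {T \<xi> g | \<xi> g. g \<in> L2} \<subseteq> ?S"
    unfolding cspan_def by (intro hull_minimal) (auto simp: diff assms)
  moreover have "?S \<subseteq> {v. (k - k') \<bullet> v = 0}" by (auto simp: Re_cinner[symmetric])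
  moreover have "closed {v. (k - k') \<bullet> v = 0}" by (intro closed_Collect_eq continuous_intros)
  ultimately have "closure (cspan {T \<xi> g | \<xi> g. g \<in> L2}) \<subseteq> {v. (k - k') \<bullet> v = 0}" by (intro closure_minimal) auto
  then have "(k - k') \<bullet> (k - k') = 0" using T_dense0 by blast
  then show ?thesis by simp
qed

lemma T_add_left: "g \<in> L2 \<Longrightarrow> T (\<xi> + \<eta>) g = T \<xi> g + T \<eta> g"
  by (rule T_eqI) (simp add: T_cinner cinner_add_left distrib_right)

lemma T_scale_left: "g \<in> L2 \<Longrightarrow> T (c *\<^sub>C \<xi>) g = c *\<^sub>C T \<xi> g"
  by (rule T_eqI) (simp add: T_cinner cinner_scaleC_left mult.assoc)

lemma T_scale_right: "g \<in> L2 \<Longrightarrow> T \<xi> (\<lambda>t. c * g t) = c *\<^sub>C T \<xi> g"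
  by (rule T_eqI) (simp add: T_cinner cinner_scaleC_left L2_scale ip_scale_left mult.left_commute)

lemma T_add_right: "f \<in> L2 \<Longrightarrow> g \<in> L2 \<Longrightarrow> T \<xi> (\<lambda>t. f t + g t) = T \<xi> f + T \<xi> g"
  by (rule T_eqI) (simp add: T_cinner cinner_add_left L2_add ip_add_left distrib_left)

lemma T_zero: "g \<in> L2 \<Longrightarrow> T 0 g = 0" "T \<xi> (\<lambda>t. 0) = 0"
proof -
  have 0: "(\<lambda>t. 0) \<in> L2" by (simp add: square_integrable_def)
  show "g \<in> L2 \<Longrightarrow> T 0 g = 0" using T_add_left[of g 0 0] by simp
  show "T \<xi> (\<lambda>t. 0) = 0" using T_add_right[OF 0 0, of \<xi>] by simp
qed

lemma T_diff_left: "g \<in> L2 \<Longrightarrow> T (\<xi> - \<eta>) g = T \<xi> g - T \<eta> g"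
  using T_add_left[of g "\<xi> - \<eta>" \<eta>] by (simp add: algebra_simps)

lemma T_diff_right:
  assumes "f \<in> L2" "g \<in> L2" shows "T \<xi> (\<lambda>t. f t - g t) = T \<xi> f - T \<xi> g"
proof -
  have m: "(\<lambda>t. -1 * g t) \<in> L2" by (rule L2_scale[OF assms(2)])
  have "T \<xi> (\<lambda>t. f t + -1 * g t) = T \<xi> f + (-1) *\<^sub>C T \<xi> g"
    unfolding T_add_right[OF assms(1) m] T_scale_right[OF assms(2)] ..
  then show ?thesis using scaleR_scaleC[of "-1" "T \<xi> g"] by simp
qed

lemma T_norm: "g \<in> L2 \<Longrightarrow> (norm (T \<xi> g))\<^sup>2 = (norm \<xi>)\<^sup>2 * (LINT t|lborel. (cmod (g t))\<^sup>2)"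
proof -
  assume g: "g \<in> L2"
  have "(norm (T \<xi> g))\<^sup>2 = Re (cinner \<xi> \<xi> * complex_of_real (LINT t|lborel. (cmod (g t))\<^sup>2))"
    using T_inner[OF g g, of \<xi> \<xi>] by (simp add: power2_norm_eq_inner ip_self[OF g])
  then show ?thesis by (simp add: Re_cinner power2_norm_eq_inner)
qed

lemma T_dense: "closure (span {T \<xi> g | \<xi> g. g \<in> L2}) = UNIV"
proof -
  have "c *\<^sub>C k \<in> {T \<xi> g | \<xi> g. g \<in> L2}" if "k \<in> {T \<xi> g | \<xi> g. g \<in> L2}" for c k
    using that T_scale_left by (auto, metis)
  from csubspace_span(2)[OF this] show ?thesis using T_dense0 by simp
qed

lemma dense_induct:
  assumes "closed S" "subspace S" "\<And>\<xi> g. g \<in> L2 \<Longrightarrow> T \<xi> g \<in> S"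
  shows "k \<in> S"
proof -
  have "span {T \<xi> g | \<xi> g. g \<in> L2} \<subseteq> S" by (rule span_minimal) (use assms in auto)
  then have "closure (span {T \<xi> g | \<xi> g. g \<in> L2}) \<subseteq> S" using assms(1) by (rule closure_minimal)
  then show ?thesis using T_dense by blast
qed

lemma op_eqI:
  fixes X Y :: "'k \<Rightarrow>\<^sub>L 'b::real_normed_vector"
  assumes "\<And>\<xi> g. g \<in> L2 \<Longrightarrow> X (T \<xi> g) = Y (T \<xi> g)" shows "X = Y"
proof (rule blinfun_eqI)
  fix k
  have "k \<in> {k. X k = Y k}"
    by (rule dense_induct) (auto intro!: closed_Collect_eq continuous_intros simp: subspace_def blinfun.bilinear_simps assms)
  then show "X k = Y k" by simp
qed

text \<open>The family w' is a defect that completes w to an exact multiple of the Gram matrix of T.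
  The identity extends bilinearly to spans and bounds |sum w| by c |sum T| for all finite
  combinations, so the assignment is well defined and bounded.\<close>

lemma gram_operator:
  fixes w w' :: "'h \<Rightarrow> (real \<Rightarrow> complex) \<Rightarrow> 'k"
  assumes c: "c \<ge> 0"
    and gram: "\<And>\<xi> \<eta> f g. f \<in> L2 \<Longrightarrow> g \<in> L2 \<Longrightarrow> w \<xi> f \<bullet> w \<eta> g + w' \<xi> f \<bullet> w' \<eta> g = c\<^sup>2 * (T \<xi> f \<bullet> T \<eta> g)"
  shows "\<exists>U :: 'k \<Rightarrow>\<^sub>L 'k. (\<forall>\<xi>. \<forall>g\<in>L2. U (T \<xi> g) = w \<xi> g) \<and> (\<forall>k. norm (U k) \<le> c * norm k)"
proof -
  let ?S = "{(T \<xi> g, w \<xi> g, w' \<xi> g) | \<xi> g. g \<in> L2}"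
  \<comment> \<open>An indefinite form that vanishes on pairs of generators and hence on the
    span.\<close>
  define b :: "'k \<times> 'k \<times> 'k \<Rightarrow> 'k \<times> 'k \<times> 'k \<Rightarrow> real" where
    "b p q = fst (snd p) \<bullet> fst (snd q) + snd (snd p) \<bullet> snd (snd q) - c\<^sup>2 * (fst p \<bullet> fst q)" for p q
  have b: "b p (q + q') = b p q + b p q'" "b p (r *\<^sub>R q) = r * b p q" "b p 0 = 0" "b q p = b p q" for p q q' r
    by (auto simp: b_def inner_add_right algebra_simps inner_commute)
  have b0: "b p q = 0" if "p \<in> ?S" "q \<in> ?S" for p q using that gram by (auto simp: b_def)
  have b1: "b p q = 0" if "p \<in> ?S" "q \<in> span ?S" for p q
  proof -
    have "span ?S \<subseteq> {q. b p q = 0}"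
      by (rule span_minimal) (use b0[OF that(1)] in blast, auto simp: subspace_def b(1-3))
    then show ?thesis using that(2) by blast
  qed
  have b2: "b p q = 0" if "p \<in> span ?S" "q \<in> span ?S" for p q
  proof -
    have "span ?S \<subseteq> {p. b q p = 0}"
    proof (rule span_minimal)
      show "?S \<subseteq> {p. b q p = 0}" using b1[OF _ that(2)] unfolding b(4)[of q] by blast
    qed (auto simp: subspace_def b(1-3))
    then show ?thesis using that(1) b(4)[of q p] by auto
  qed
  let ?G = "(\<lambda>p. (fst p, fst (snd p))) ` span ?S"
  have "subspace ?G" by (rule linear_subspace_image[OF _ subspace_span]) (auto simp: linear_iff)
  moreover have "norm y \<le> c * norm x" if xy: "(x, y) \<in> ?G" for x y
  proof -
    obtain p where p: "p \<in> span ?S" "x = fst p" "y = fst (snd p)" using xy by auto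
    from b2[OF p(1) p(1)] have "(norm y)\<^sup>2 + (norm (snd (snd p)))\<^sup>2 = (c * norm x)\<^sup>2"
      by (simp add: b_def p(2,3) power2_norm_eq_inner power_mult_distrib)
    then have "(norm y)\<^sup>2 \<le> (c * norm x)\<^sup>2" using zero_le_power2[of "norm (snd (snd p))"] by linarith
    then show ?thesis by (rule power2_le_imp_le) (use c in simp)
  qed
  ultimately obtain U :: "'k \<Rightarrow>\<^sub>L 'k" where U: "\<forall>(x, y)\<in>?G. U x = y" "\<forall>x. norm (U x) \<le> c * norm x"
    using bounded_extension[of ?G c] c by blast
  have "U (T \<xi> g) = w \<xi> g" if "g \<in> L2" for \<xi> g
  proof -
    have "(T \<xi> g, w \<xi> g, w' \<xi> g) \<in> span ?S" using that by (intro span_base) auto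
    then have "(T \<xi> g, w \<xi> g) \<in> ?G" by force
    then show ?thesis using U(1) by auto
  qed
  then show ?thesis using U(2) by blast
qed

lemma op_bounded_opsI:
  fixes U :: "'k \<Rightarrow>\<^sub>L 'k"
  assumes "\<And>\<xi> g c. g \<in> L2 \<Longrightarrow> U (T (c *\<^sub>C \<xi>) g) = c *\<^sub>C U (T \<xi> g)"
  shows "U \<in> bounded_ops"
proof -
  have "U o\<^sub>L cmul c = cmul c o\<^sub>L U" for c by (rule op_eqI) (simp add: assms T_scale_left[symmetric])
  then show ?thesis by (auto simp: bounded_ops_iff commute_def)
qed

text \<open>The defect is z = sqrt(|x|^2 - x*x), where x*x is \<open>radj x o\<^sub>L x\<close>; it
  satisfies <x u, x v> + <z u, z v> = |x|^2 <u, v>.\<close>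

lemma tens_left_exists:
  assumes x: "x \<in> bounded_ops"
  shows "\<exists>X\<in>bounded_ops. (\<forall>\<xi>. \<forall>g\<in>L2. X (T \<xi> g) = T (x \<xi>) g) \<and> (\<forall>k. norm (X k) \<le> norm x * norm k)"
proof -
  let ?Z = "(norm x)\<^sup>2 *\<^sub>R id_blinfun - (radj x o\<^sub>L x)"
  have Zv: "?Z v = (norm x)\<^sup>2 *\<^sub>R v - radj x (x v)" for v by (simp add: blinfun.bilinear_simps)
  have "psd ((norm x)\<^sup>2 *\<^sub>R id_blinfun - (radj x o\<^sub>L x))"
  proof (rule psd_diffI)
    show "self_adj (radj x o\<^sub>L x)" unfolding self_adj_iff_radj radj_compose radj_radj ..
    show "self_adj ((norm x)\<^sup>2 *\<^sub>R id_blinfun :: 'h \<Rightarrow>\<^sub>L 'h)" by (simp add: self_adj_def blinfun.scaleR_left)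
    show "(radj x o\<^sub>L x) v \<bullet> v \<le> ((norm x)\<^sup>2 *\<^sub>R id_blinfun) v \<bullet> v" for v
    proof -
      have "(radj x o\<^sub>L x) v \<bullet> v = (norm (x v))\<^sup>2" using radj[of x v "x v"] by (simp add: power2_norm_eq_inner inner_commute)
      also have "\<dots> \<le> (norm x * norm v)\<^sup>2" by (intro power_mono norm_blinfun) auto
      finally show ?thesis by (simp add: blinfun.scaleR_left power_mult_distrib power2_norm_eq_inner)
    qed
  qed
  note z = psd_sqrt[OF this]
  let ?z = "psd_sqrt ?Z"
  have rx: "radj x o\<^sub>L x \<in> bounded_ops" using x by (intro bounded_ops_closed radj_bounded_ops)
  have Zb: "?Z \<in> bounded_ops" by (intro bounded_ops_closed(4,5,1) rx)
  have zb: "?z \<in> bounded_ops"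
    unfolding bounded_ops_iff using Zb z(3) by (auto simp: bounded_ops_iff intro!: commute_sym[OF z(3)] dest: commute_sym)
  have zr: "radj ?z = ?z" using z(1) by (simp add: psd_def self_adj_iff_radj)
  have cin: "cinner (x \<xi>) (x \<eta>) + cinner (?z \<xi>) (?z \<eta>) = complex_of_real ((norm x)\<^sup>2) * cinner \<xi> \<eta>" for \<xi> \<eta>
  proof -
    have "cinner (x \<xi>) (x \<eta>) + cinner (?z \<xi>) (?z \<eta>) = cinner \<xi> (radj x (x \<eta>) + ?Z \<eta>)"
      using cinner_radj[OF x, of \<xi> "x \<eta>"] cinner_radj[OF zb, of \<xi> "?z \<eta>"] z(2)[of \<eta>] by (simp only: zr cinner_simps)
    also have "radj x (x \<eta>) + ?Z \<eta> = complex_of_real ((norm x)\<^sup>2) *\<^sub>C \<eta>" unfolding Zv by (simp add: scaleR_scaleC)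
    finally show ?thesis by (simp add: cinner_simps)
  qed
  obtain U :: "'k \<Rightarrow>\<^sub>L 'k" where U: "\<And>\<xi> g. g \<in> L2 \<Longrightarrow> U (T \<xi> g) = T (x \<xi>) g" "\<And>k. norm (U k) \<le> norm x * norm k"
  proof -
    have "T (x \<xi>) f \<bullet> T (x \<eta>) g + T (?z \<xi>) f \<bullet> T (?z \<eta>) g = (norm x)\<^sup>2 * (T \<xi> f \<bullet> T \<eta> g)"
      if "f \<in> L2" "g \<in> L2" for \<xi> \<eta> f g
    proof -
      have "T (x \<xi>) f \<bullet> T (x \<eta>) g + T (?z \<xi>) f \<bullet> T (?z \<eta>) g
        = Re ((cinner (x \<xi>) (x \<eta>) + cinner (?z \<xi>) (?z \<eta>)) * ip f g)"
        unfolding T_inner[OF that] distrib_right by simp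
      then show ?thesis unfolding cin T_inner[OF that] by (simp add: mult.assoc)
    qed
    from gram_operator[of "norm x" "\<lambda>\<xi>. T (x \<xi>)" "\<lambda>\<xi>. T (?z \<xi>)", OF norm_ge_zero this] show ?thesis using that by blast
  qed
  have "U \<in> bounded_ops" by (rule op_bounded_opsI) (simp add: U(1) bounded_opsD[OF x] T_scale_left[symmetric])
  then show ?thesis using U by blast
qed

lemma tens_right_exists:
  assumes f: "f \<in> borel_measurable borel" "\<And>t. cmod (f t) \<le> C" and C: "C \<ge> 0"
  shows "\<exists>X\<in>bounded_ops. (\<forall>\<xi>. \<forall>g\<in>L2. X (T \<xi> g) = T \<xi> (\<lambda>t. f t * g t)) \<and> (\<forall>k. norm (X k) \<le> C * norm k)"
proof -
  \<comment> \<open>The defect function, with |f|^2 + |k|^2 = C^2.\<close>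
  define k where "k t = complex_of_real (sqrt (C\<^sup>2 - (cmod (f t))\<^sup>2))" for t
  have km: "k \<in> borel_measurable borel" unfolding k_def using f(1) by measurable
  have kn: "(cmod (k t))\<^sup>2 = C\<^sup>2 - (cmod (f t))\<^sup>2" for t
    using power_mono[OF f(2)[of t], of 2] by (simp add: k_def)
  have kb: "cmod (k t) \<le> C" for t
  proof (rule power2_le_imp_le[OF _ C])
    show "(cmod (k t))\<^sup>2 \<le> C\<^sup>2" unfolding kn by simp
  qed
  have fL: "(\<lambda>t. f t * g t) \<in> L2" "(\<lambda>t. k t * g t) \<in> L2" if "g \<in> L2" for g
    using L2_mult_le[OF f(1) f(2) that] L2_mult_le[OF km kb that] by auto
  have ips: "ip (\<lambda>t. f t * g t) (\<lambda>t. f t * g' t) + ip (\<lambda>t. k t * g t) (\<lambda>t. k t * g' t) = complex_of_real (C\<^sup>2) * ip g g'"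
    if g: "g \<in> L2" "g' \<in> L2" for g g'
  proof -
    have "ip (\<lambda>t. f t * g t) (\<lambda>t. f t * g' t) + ip (\<lambda>t. k t * g t) (\<lambda>t. k t * g' t) =
      (LINT t|lborel. f t * g t * cnj (f t * g' t) + k t * g t * cnj (k t * g' t))"
      unfolding ip_def by (intro Bochner_Integration.integral_add[symmetric] ip_integrable fL g)
    also have "\<dots> = (LINT t|lborel. complex_of_real (C\<^sup>2) * (g t * cnj (g' t)))"
    proof (rule Bochner_Integration.integral_cong[OF refl])
      fix t
      have "f t * g t * cnj (f t * g' t) + k t * g t * cnj (k t * g' t) = (f t * cnj (f t) + k t * cnj (k t)) * (g t * cnj (g' t))"
        by (simp add: algebra_simps)
      also have "f t * cnj (f t) + k t * cnj (k t) = complex_of_real ((cmod (f t))\<^sup>2 + (cmod (k t))\<^sup>2)"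
        by (simp only: complex_norm_square of_real_add)
      finally show "f t * g t * cnj (f t * g' t) + k t * g t * cnj (k t * g' t) = complex_of_real (C\<^sup>2) * (g t * cnj (g' t))"
        by (simp add: kn)
    qed
    finally show ?thesis by (simp add: ip_def)
  qed
  obtain U :: "'k \<Rightarrow>\<^sub>L 'k" where U: "\<And>\<xi> g. g \<in> L2 \<Longrightarrow> U (T \<xi> g) = T \<xi> (\<lambda>t. f t * g t)" "\<And>k. norm (U k) \<le> C * norm k"
  proof -
    have "T \<xi> (\<lambda>t. f t * g t) \<bullet> T \<eta> (\<lambda>t. f t * g' t) + T \<xi> (\<lambda>t. k t * g t) \<bullet> T \<eta> (\<lambda>t. k t * g' t)
        = C\<^sup>2 * (T \<xi> g \<bullet> T \<eta> g')" if g: "g \<in> L2" "g' \<in> L2" for \<xi> \<eta> g g'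
    proof -
      have "T \<xi> (\<lambda>t. f t * g t) \<bullet> T \<eta> (\<lambda>t. f t * g' t) + T \<xi> (\<lambda>t. k t * g t) \<bullet> T \<eta> (\<lambda>t. k t * g' t)
        = Re (cinner \<xi> \<eta> * (ip (\<lambda>t. f t * g t) (\<lambda>t. f t * g' t) + ip (\<lambda>t. k t * g t) (\<lambda>t. k t * g' t)))"
        unfolding T_inner[OF fL(1) fL(1), OF g] T_inner[OF fL(2) fL(2), OF g] distrib_left by simp
      also have "\<dots> = C\<^sup>2 * Re (cinner \<xi> \<eta> * ip g g')"
        unfolding ips[OF g] mult.left_commute[of "cinner \<xi> \<eta>"] by simp
      finally show ?thesis unfolding T_inner[OF g] .
    qed
    from gram_operator[of C "\<lambda>\<xi> g. T \<xi> (\<lambda>t. f t * g t)" "\<lambda>\<xi> g. T \<xi> (\<lambda>t. k t * g t)", OF C this] show ?thesis using that by blast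
  qed
  have "U \<in> bounded_ops" by (rule op_bounded_opsI) (simp add: U(1) T_scale_left[symmetric] fL)
  then show ?thesis using U by blast
qed

text \<open>Discharges the description operator by composing the two one-sided operators; values on
  elementary tensors determine a bounded operator.\<close>

lemma tensor_op:
  assumes x: "x \<in> bounded_ops" and f: "f \<in> bounded_borel"
  shows "tensor_op T x f \<in> bounded_ops" "g \<in> L2 \<Longrightarrow> tensor_op T x f (T \<xi> g) = T (x \<xi>) (\<lambda>t. f t * g t)"
    "(\<And>t. cmod (f t) \<le> C) \<Longrightarrow> norm (tensor_op T x f k) \<le> norm x * C * norm k"
proof -
  have fm: "f \<in> borel_measurable borel" using f by (simp add: bounded_borel_def)
  let ?Q = "\<lambda>X. X \<in> bounded_ops \<and> (\<forall>\<xi>. \<forall>g\<in>L2. blinfun_apply X (T \<xi> g) = T (x \<xi>) (\<lambda>t. f t * g t))"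
  have ex: "\<exists>X. ?Q X \<and> (\<forall>k. norm (X k) \<le> norm x * C * norm k)" if fC: "\<And>t. cmod (f t) \<le> C" for C
  proof -
    have C: "C \<ge> 0" using fC[of 0] norm_ge_zero order_trans by blast
    obtain X where X: "X \<in> bounded_ops" "\<And>\<xi> g. g \<in> L2 \<Longrightarrow> X (T \<xi> g) = T (x \<xi>) g" "\<And>k. norm (X k) \<le> norm x * norm k"
      using tens_left_exists[OF x] by blast
    obtain Y where Y: "Y \<in> bounded_ops" "\<And>\<xi> g. g \<in> L2 \<Longrightarrow> Y (T \<xi> g) = T \<xi> (\<lambda>t. f t * g t)" "\<And>k. norm (Y k) \<le> C * norm k"
      using tens_right_exists[OF fm fC C] by blast
    have "norm (X (Y k)) \<le> norm x * C * norm k" for k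
      using order_trans[OF X(3) mult_left_mono[OF Y(3) norm_ge_zero]] by (simp add: mult.assoc)
    then show ?thesis using bounded_ops_closed(6)[OF X(1) Y(1)] X(2) Y(2) L2_mult[OF f]
      by (intro exI[of _ "X o\<^sub>L Y"]) auto
  qed
  have un: "X = X'" if "?Q X" "?Q X'" for X X' by (rule op_eqI) (use that in auto)
  have eq: "tensor_op T x f = X" if "?Q X" for X
    unfolding tensor_op_def by (rule the_equality) (use that un in blast)+
  obtain C0 where C0: "C0 \<ge> 0" "\<And>t. cmod (f t) \<le> C0" using f by (rule bounded_borelD) blast
  from ex[OF C0(2)] obtain X where X: "?Q X" by blast
  have e: "tensor_op T x f = X" by (rule eq) (use X in blast)
  show "tensor_op T x f \<in> bounded_ops" "g \<in> L2 \<Longrightarrow> tensor_op T x f (T \<xi> g) = T (x \<xi>) (\<lambda>t. f t * g t)"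
    unfolding e using X by auto
  assume "\<And>t. cmod (f t) \<le> C"
  from ex[OF this] obtain Y where Y: "?Q Y" "\<And>k. norm (Y k) \<le> norm x * C * norm k" by blast
  have "tensor_op T x f = Y" by (rule eq) (use Y in blast)
  then show "norm (tensor_op T x f k) \<le> norm x * C * norm k" using Y(2) by simp
qed

lemma bounded_borel_cnj: "f \<in> bounded_borel \<Longrightarrow> (\<lambda>t. cnj (f t)) \<in> bounded_borel"
  by (auto simp: bounded_borel_def bounded_iff)

lemma tensor_op_radj:
  assumes x: "x \<in> bounded_ops" and f: "f \<in> bounded_borel"
  shows "radj (tensor_op T x f) = tensor_op T (radj x) (\<lambda>t. cnj (f t))"
proof (rule op_eqI)
  fix \<xi> g assume g: "g \<in> L2"
  note fc = bounded_borel_cnj[OF f]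
  show "radj (tensor_op T x f) (T \<xi> g) = tensor_op T (radj x) (\<lambda>t. cnj (f t)) (T \<xi> g)"
  proof (rule T_eqI)
    fix \<eta> k assume k: "k \<in> L2"
    have "cinner (radj (tensor_op T x f) (T \<xi> g)) (T \<eta> k) = cinner (T \<xi> g) (tensor_op T x f (T \<eta> k))"
      using cinner_radj[OF radj_bounded_ops[OF tensor_op(1)[OF x f]]] by (simp add: radj_radj)
    also have "\<dots> = cinner \<xi> (x \<eta>) * ip g (\<lambda>t. f t * k t)"
      by (simp add: tensor_op(2)[OF x f] k T_cinner g L2_mult[OF f])
    also have "cinner \<xi> (x \<eta>) = cinner (radj x \<xi>) \<eta>"
      using cinner_radj[OF radj_bounded_ops[OF x]] by (simp add: radj_radj)
    also have "ip g (\<lambda>t. f t * k t) = ip (\<lambda>t. cnj (f t) * g t) k" by (simp add: ip_def mult_ac)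
    finally show "cinner (radj (tensor_op T x f) (T \<xi> g)) (T \<eta> k) = cinner (tensor_op T (radj x) (\<lambda>t. cnj (f t)) (T \<xi> g)) (T \<eta> k)"
      by (simp add: tensor_op(2)[OF radj_bounded_ops[OF x] fc] g T_cinner k L2_mult[OF fc])
  qed
qed

lemma commutant_antimono: "A \<subseteq> B \<Longrightarrow> commutant B \<subseteq> commutant A"
  by (auto simp: commutant_def)

lemma subset_double_commutant: "S \<subseteq> bounded_ops \<Longrightarrow> S \<subseteq> commutant (commutant S)"
proof
  fix X assume S: "S \<subseteq> bounded_ops" and X: "X \<in> S"
  show "X \<in> commutant (commutant S)"
    unfolding commutant_iff[of X] using S X by (auto simp: commutant_iff commute_sym)
qed

text \<open>The generators are closed under adjoints, and the third commutant of a set is its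
  first.\<close>

lemma tensor_Linf_vna:
  assumes M: "von_neumann_algebra M"
  shows "von_neumann_algebra (tensor_Linf T M)" "x \<in> M \<Longrightarrow> f \<in> bounded_borel \<Longrightarrow> tensor_op T x f \<in> tensor_Linf T M"
proof -
  interpret vna M by standard (rule M)
  let ?G = "{tensor_op T x f | x f. x \<in> M \<and> f \<in> bounded_borel}"
  let ?N = "tensor_Linf T M"
  have N: "?N = commutant (commutant ?G)" by (simp add: tensor_Linf_def)
  have Gb: "?G \<subseteq> bounded_ops" using tensor_op(1) M_bounded by auto
  have GN: "?G \<subseteq> ?N" unfolding N using Gb by (rule subset_double_commutant)
  then show "x \<in> M \<Longrightarrow> f \<in> bounded_borel \<Longrightarrow> tensor_op T x f \<in> ?N" by blast
  have Gr: "radj Y \<in> ?G" if "Y \<in> ?G" for Y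
    using that tensor_op_radj M_bounded M_radj bounded_borel_cnj by (auto, metis)
  have Nb: "?N \<subseteq> bounded_ops" unfolding N by (auto simp: commutant_def)
  have Nr: "radj Y \<in> ?N" if "Y \<in> ?N" for Y
    using commutant_radj[of "commutant ?G" Y] commutant_radj[OF Gr] that unfolding N by blast
  have "commutant (commutant ?N) = ?N"
  proof
    have "commutant ?G \<subseteq> commutant ?N" unfolding N
      by (rule subset_double_commutant) (auto simp: commutant_def)
    then show "commutant (commutant ?N) \<subseteq> ?N" unfolding N by (rule commutant_antimono)
    show "?N \<subseteq> commutant (commutant ?N)" using Nb by (rule subset_double_commutant)
  qed
  then show "von_neumann_algebra ?N" unfolding von_neumann_algebra_def
    using Nb Nr star_eq_radj by (metis subsetD)
qed

definition cind :: "real set \<Rightarrow> real \<Rightarrow> complex" where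
  "cind I t = complex_of_real (indicator I t)"

lemma cind_borel: "I \<in> sets borel \<Longrightarrow> cind I \<in> bounded_borel"
  by (rule bounded_borelI[where C = 1]) (auto simp: cind_def[abs_def] split: split_indicator)

lemma cind_le: "cmod (cind I t) \<le> 1" by (simp add: cind_def split: split_indicator)

lemma tensor_proj:
  assumes e: "e \<in> bounded_ops" "ortho_proj e" and I: "I \<in> sets borel"
  shows "ortho_proj (tensor_op T e (cind I))"
proof -
  let ?P = "tensor_op T e (cind I)"
  have "radj ?P = ?P" using tensor_op_radj[OF e(1) cind_borel[OF I]] e(2)
    by (simp add: ortho_proj_def self_adj_iff_radj cind_def[abs_def])
  moreover have "?P o\<^sub>L ?P = ?P"
  proof (rule op_eqI)
    fix \<xi> g assume g: "g \<in> L2"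
    have "(\<lambda>t. cind I t * (cind I t * g t)) = (\<lambda>t. cind I t * g t)" by (auto simp: cind_def split: split_indicator)
    then show "(?P o\<^sub>L ?P) (T \<xi> g) = ?P (T \<xi> g)"
      using g by (simp add: tensor_op(2)[OF e(1) cind_borel[OF I]] L2_mult[OF cind_borel[OF I]] ortho_projD(1)[OF e(2)])
  qed
  then have "?P (?P k) = ?P k" for k by (metis blinfun_apply_blinfun_compose)
  ultimately show ?thesis by (simp add: ortho_proj_def self_adj_iff_radj)
qed

lemma strong_limit_dense:
  fixes Z :: "nat \<Rightarrow> 'b::real_normed_vector \<Rightarrow>\<^sub>L 'c::real_normed_vector" and Y :: "'b \<Rightarrow>\<^sub>L 'c"
  assumes bd: "\<And>n k. norm (Z n k) \<le> c * norm k" and lim: "\<And>k. k \<in> S \<Longrightarrow> (\<lambda>n. Z n k) \<longlonglongrightarrow> Y k"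
    and k: "k \<in> closure (span S)"
  shows "(\<lambda>n. Z n k) \<longlonglongrightarrow> Y k"
proof -
  have c: "norm (Z n k) \<le> (\<bar>c\<bar> + 1) * norm k" for n k
  proof -
    have "c * norm k \<le> (\<bar>c\<bar> + 1) * norm k" by (rule mult_right_mono) auto
    then show ?thesis using bd[of n k] by linarith
  qed
  have sp: "(\<lambda>n. Z n v) \<longlonglongrightarrow> Y v" if "v \<in> span S" for v
    using that
  proof (induction rule: span_induct_alt)
    case (step r x y)
    then show ?case by (simp add: blinfun.bilinear_simps tendsto_add tendsto_scaleR lim)
  qed simp
  show ?thesis
  proof (rule metric_LIMSEQ_I)
    fix e :: real assume e: "e > 0"
    define d where "d = e / (3 * (\<bar>c\<bar> + 1 + norm Y))"
    have D: "\<bar>c\<bar> + 1 + norm Y > 0" by (simp add: add_pos_nonneg)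
    have d: "d > 0" using e D by (simp add: d_def)
    obtain v where v: "v \<in> span S" "norm (v - k) < d"
      using k d by (metis closure_approachable dist_norm)
    obtain N where N: "\<And>n. n \<ge> N \<Longrightarrow> norm (Z n v - Y v) < e / 3"
      using metric_LIMSEQ_D[OF sp[OF v(1)], of "e / 3"] e by (auto simp: dist_norm)
    have "dist (Z n k) (Y k) < e" if "n \<ge> N" for n
    proof -
      have "Z n k - Y k = Z n (k - v) + (Z n v - Y v) + Y (v - k)" by (simp add: blinfun.bilinear_simps)
      then have "norm (Z n k - Y k) \<le> norm (Z n (k - v)) + norm (Z n v - Y v) + norm (Y (v - k))"
        using norm_triangle_ineq[of "Z n (k - v) + (Z n v - Y v)" "Y (v - k)"]
          norm_triangle_ineq[of "Z n (k - v)" "Z n v - Y v"] by simp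
      also have "\<dots> \<le> (\<bar>c\<bar> + 1) * norm (v - k) + norm (Z n v - Y v) + norm Y * norm (v - k)"
        using c[of n "k - v"] norm_blinfun[of Y "v - k"] by (simp add: norm_minus_commute)
      also have "\<dots> = (\<bar>c\<bar> + 1 + norm Y) * norm (v - k) + norm (Z n v - Y v)" by (simp add: algebra_simps)
      also have "\<dots> < e / 3 + e / 3"
      proof (rule add_strict_mono)
        have "(\<bar>c\<bar> + 1 + norm Y) * norm (v - k) < (\<bar>c\<bar> + 1 + norm Y) * d" using v D by (intro mult_strict_left_mono)
        also have "\<dots> = e / 3" using D by (simp add: d_def field_simps)
        finally show "(\<bar>c\<bar> + 1 + norm Y) * norm (v - k) < e / 3" .
      qed (rule N[OF that])
      finally show ?thesis using e by (simp add: dist_norm)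
    qed
    then show "\<exists>N. \<forall>n\<ge>N. dist (Z n k) (Y k) < e" by blast
  qed
qed

text \<open>Convergence in both factors at once, in the second by dominated convergence. It gives
  the strong limits of \<open>Pn\<close>, \<open>Qn\<close> and of the rectangles over
  \<open>J\<close>.\<close>

lemma T_tendsto:
  assumes x: "x \<longlonglongrightarrow> \<xi>" and g: "g \<in> L2" and I: "\<And>n. I n \<in> sets borel" "\<And>t. \<forall>\<^sub>F n in sequentially. t \<in> I n"
  shows "(\<lambda>n. T (x n) (\<lambda>t. cind (I n) t * g t)) \<longlonglongrightarrow> T \<xi> g"
proof -
  let ?g = "\<lambda>n t. cind (I n) t * g t"
  have gL: "?g n \<in> L2" for n by (rule L2_mult[OF cind_borel[OF I(1)] g])
  let ?N = "\<lambda>g. LINT t|lborel. (cmod (g t))\<^sup>2"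
  have dL: "(\<lambda>t. ?g n t - g t) \<in> L2" for n
    using L2_add[OF gL L2_scale[OF g, of "-1"]] by simp
  have "(\<lambda>n. ?N (\<lambda>t. ?g n t - g t)) \<longlonglongrightarrow> (LINT t::real|lborel. 0 :: real)"
  proof (rule Bochner_Integration.integral_dominated_convergence[where w = "\<lambda>t. (cmod (g t))\<^sup>2"
        and s = "\<lambda>n t. (cmod (?g n t - g t))\<^sup>2" and f = "\<lambda>t. 0"])
    show "integrable lborel (\<lambda>t. (cmod (g t))\<^sup>2)" by (rule L2_int[OF g])
    show "(\<lambda>t. (cmod (?g n t - g t))\<^sup>2) \<in> borel_measurable lborel" for n using L2_meas[OF dL[of n]] by measurable
    show "AE t in lborel. norm ((cmod (?g n t - g t))\<^sup>2) \<le> (cmod (g t))\<^sup>2" for n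
      by (auto simp: cind_def split: split_indicator)
    show "AE t in lborel. (\<lambda>n. (cmod (?g n t - g t))\<^sup>2) \<longlonglongrightarrow> 0"
    proof (rule AE_I2, rule tendsto_eventually)
      fix t
      show "\<forall>\<^sub>F n in sequentially. (cmod (?g n t - g t))\<^sup>2 = 0"
        using I(2)[of t] by eventually_elim (simp add: cind_def)
    qed
  qed simp
  then have d0: "(\<lambda>n. ?N (\<lambda>t. ?g n t - g t)) \<longlonglongrightarrow> 0" by simp
  have "(\<lambda>n. (norm (T (x n) (?g n) - T \<xi> g))\<^sup>2) \<longlonglongrightarrow> 0"
  proof (rule tendsto_sandwich[OF _ _ tendsto_const])
    show "(\<lambda>n. 2 * ((norm (x n))\<^sup>2 * ?N (\<lambda>t. ?g n t - g t)) + 2 * ((norm (x n - \<xi>))\<^sup>2 * ?N g)) \<longlonglongrightarrow> 0"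
    proof -
      have "(\<lambda>n. x n - \<xi>) \<longlonglongrightarrow> \<xi> - \<xi>" by (intro tendsto_intros x)
      then have "(\<lambda>n. 2 * ((norm (x n))\<^sup>2 * ?N (\<lambda>t. ?g n t - g t)) + 2 * ((norm (x n - \<xi>))\<^sup>2 * ?N g))
         \<longlonglongrightarrow> 2 * ((norm \<xi>)\<^sup>2 * 0) + 2 * ((norm (\<xi> - \<xi>))\<^sup>2 * ?N g)"
        by (intro tendsto_intros x d0)
      then show ?thesis by simp
    qed
    show "\<forall>\<^sub>F n in sequentially. (norm (T (x n) (?g n) - T \<xi> g))\<^sup>2 \<le>
      2 * ((norm (x n))\<^sup>2 * ?N (\<lambda>t. ?g n t - g t)) + 2 * ((norm (x n - \<xi>))\<^sup>2 * ?N g)"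
    proof (intro always_eventually allI)
      fix n
      let ?a = "T (x n) (\<lambda>t. ?g n t - g t)" and ?b = "T (x n - \<xi>) g"
      have "T (x n) (?g n) - T \<xi> g = ?a + ?b" by (simp add: T_diff_right[OF gL g] T_diff_left[OF g])
      then have "norm (T (x n) (?g n) - T \<xi> g) \<le> norm ?a + norm ?b" by (simp only: norm_triangle_ineq)
      then have "(norm (T (x n) (?g n) - T \<xi> g))\<^sup>2 \<le> (norm ?a + norm ?b)\<^sup>2" by (rule power_mono) simp
      also have "\<dots> \<le> 2 * (norm ?a)\<^sup>2 + 2 * (norm ?b)\<^sup>2"
        using zero_le_power2[of "norm ?a - norm ?b"] by (simp add: power2_sum power2_diff)
      finally show "(norm (T (x n) (?g n) - T \<xi> g))\<^sup>2 \<le>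
        2 * ((norm (x n))\<^sup>2 * ?N (\<lambda>t. ?g n t - g t)) + 2 * ((norm (x n - \<xi>))\<^sup>2 * ?N g)"
        unfolding T_norm[OF dL] T_norm[OF g] .
    qed
  qed simp
  then have "(\<lambda>n. norm (T (x n) (?g n) - T \<xi> g)) \<longlonglongrightarrow> 0"
    using tendsto_real_sqrt[of "\<lambda>n. (norm (T (x n) (?g n) - T \<xi> g))\<^sup>2" 0] by simp
  from LIM_zero_cancel[OF tendsto_norm_zero_cancel[OF this]] show ?thesis .
qed

end

text \<open>Inserting a spectral projection of |T| does not increase the norm of the value of T, so
  the relation between old and new values is a contraction and extends to the whole space.\<close>

lemma hat_exists:
  assumes T: "closed_densely_defined T" and B: "B \<in> sets borel"
  shows "\<exists>F\<in>bounded_ops. (\<forall>(x, y)\<in>T. (closed_dense_op.spec T B x, F y) \<in> T) \<and> (\<forall>y. norm (F y) \<le> 1 * norm y)"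
proof -
  have cs: "csubspace T" using T by (simp add: closed_densely_defined_iff)
  interpret closed_dense_op T using T by (simp add: closed_densely_defined_iff)
  let ?e = "spec B"
  have eb: "?e \<in> bounded_ops" using spec_bounded_ops[OF T B] .
  let ?G = "{(y, y'). \<exists>x. (x, y) \<in> T \<and> (?e x, y') \<in> T}"
  have G: "csubspace ?G"
    unfolding csubspace_def
  proof (intro conjI ballI allI)
    have "(0, 0) \<in> T" using subspace_0[OF sub] by (simp add: zero_prod_def)
    then have "(?e 0, 0) \<in> T" by simp
    then have "(0, 0) \<in> ?G" using \<open>(0, 0) \<in> T\<close> by blast
    then show "0 \<in> ?G" by (simp add: zero_prod_def)
  next
    fix p q assume "p \<in> ?G" "q \<in> ?G"
    then obtain y y' x v v' u where *: "p = (y, y')" "(x, y) \<in> T" "(?e x, y') \<in> T" "q = (v, v')" "(u, v) \<in> T" "(?e u, v') \<in> T" by blast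
    have "(x + u, y + v) \<in> T" "(?e (x + u), y' + v') \<in> T"
      using mem_add[OF *(2,5)] mem_add[OF *(3,6)] by (simp_all add: blinfun.add_right)
    then show "p + q \<in> ?G" using * by auto
  next
    fix c p assume "p \<in> ?G"
    then obtain y y' x where *: "p = (y, y')" "(x, y) \<in> T" "(?e x, y') \<in> T" by blast
    have "(c *\<^sub>C x, c *\<^sub>C y) \<in> T" "(?e (c *\<^sub>C x), c *\<^sub>C y') \<in> T"
      using csubspace_pairD[OF cs *(2)] csubspace_pairD[OF cs *(3)] by (simp_all add: bounded_opsD[OF eb])
    then show "c *\<^sub>C p \<in> ?G" using * by (auto simp: scaleC_prod_def)
  qed
  have par_eq: "y' = par (?e z)" if "(?e (rt z), y') \<in> T" for y' z
    using unique_image[OF that spec_mem[OF B]] .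
  have le: "norm y' \<le> 1 * norm y" if yy: "(y, y') \<in> ?G" for y y'
  proof -
    obtain x where x: "(x, y) \<in> T" "(?e x, y') \<in> T" using yy by blast
    obtain z where z: "x = rt z" "y = par z" using x(1) by (rule memE)
    show ?thesis using par_eq[of z y'] x(2) z par_spec_norm[OF B, of z] by simp
  qed
  obtain U where U: "U \<in> bounded_ops" "\<forall>(y, y')\<in>?G. U y = y'" "\<forall>y. norm (U y) \<le> 1 * norm y"
    using bounded_extension_complex[OF G le] by auto
  have "(?e x, U y) \<in> T" if xy: "(x, y) \<in> T" for x y
  proof -
    obtain z where z: "x = rt z" "y = par z" using xy by (rule memE)
    have m: "(?e x, par (?e z)) \<in> T" using spec_mem[OF B, of z] z by simp
    then have "(y, par (?e z)) \<in> ?G" using xy by blast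
    then show ?thesis using U(2) m by auto
  qed
  then show ?thesis using U by blast
qed

text \<open>Above the level s the operator T is bounded below by s. The resulting bounded left
  inverse can be tensored, and so carries lower bounds over to a tensor product.\<close>

lemma left_inverse_exists:
  assumes T: "closed_densely_defined T" and s: "s > 0"
  shows "\<exists>F\<in>bounded_ops. (\<forall>(x, y)\<in>T. F y = closed_dense_op.spec T {s<..} x) \<and> (\<forall>y. norm (F y) \<le> (1 / s) * norm y)"
proof -
  have cs: "csubspace T" using T by (simp add: closed_densely_defined_iff)
  interpret closed_dense_op T using T by (simp add: closed_densely_defined_iff)
  let ?e = "spec {s<..}"
  have eb: "?e \<in> bounded_ops" by (rule spec_bounded_ops[OF T]) simp
  let ?G = "{(y, ?e x) | x y. (x, y) \<in> T}"
  have G: "csubspace ?G"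
    unfolding csubspace_def
  proof (intro conjI ballI allI)
    have "(0, 0) \<in> T" using subspace_0[OF sub] by (simp add: zero_prod_def)
    then have "(0, ?e 0) \<in> ?G" by blast
    then show "0 \<in> ?G" by (simp add: zero_prod_def)
  next
    fix p q assume "p \<in> ?G" "q \<in> ?G"
    then obtain x y u v where *: "p = (y, ?e x)" "(x, y) \<in> T" "q = (v, ?e u)" "(u, v) \<in> T" by blast
    have "(y + v, ?e (x + u)) \<in> ?G" using mem_add[OF *(2,4)] by blast
    then show "p + q \<in> ?G" using * by (simp add: blinfun.add_right)
  next
    fix c p assume "p \<in> ?G"
    then obtain x y where *: "p = (y, ?e x)" "(x, y) \<in> T" by blast
    have "(c *\<^sub>C y, ?e (c *\<^sub>C x)) \<in> ?G" using csubspace_pairD[OF cs *(2)] by blast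
    then show "c *\<^sub>C p \<in> ?G" using * by (simp add: scaleC_prod_def bounded_opsD[OF eb])
  qed
  have le: "norm y' \<le> (1 / s) * norm y" if yy: "(y, y') \<in> ?G" for y y'
  proof -
    obtain x where x: "(x, y) \<in> T" "y' = ?e x" using yy by blast
    show ?thesis using spec_Ioi_bound[OF _ x(1), of s] s x(2) by (simp add: field_simps)
  qed
  obtain U where "U \<in> bounded_ops" "\<forall>(y, y')\<in>?G. U y = y'" "\<forall>y. norm (U y) \<le> (1 / s) * norm y"
    using bounded_extension_complex[OF G le] s by auto
  then show ?thesis by (intro bexI[of _ U]) auto
qed

lemma trunc_bounded_ops:
  assumes T: "closed_densely_defined T" and X: "\<And>x. (closed_dense_op.spec T {..s} x, blinfun_apply X x) \<in> T"
  shows "X \<in> bounded_ops"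
proof -
  have cs: "csubspace T" using T by (simp add: closed_densely_defined_iff)
  interpret closed_dense_op T using T by (simp add: closed_densely_defined_iff)
  have eb: "spec {..s} \<in> bounded_ops" by (rule spec_bounded_ops[OF T]) simp
  have "X (c *\<^sub>C x) = c *\<^sub>C X x" for c x
    using unique_image[OF X[of "c *\<^sub>C x"]] csubspace_pairD[OF cs X[of x], of c] by (simp add: bounded_opsD[OF eb])
  then show ?thesis by (simp add: bounded_ops_def)
qed

lemma (in vna) trunc_mem:
  assumes T: "closed_densely_defined T" "affiliated M T" and X: "\<And>x. (closed_dense_op.spec T {..s} x, blinfun_apply X x) \<in> T"
  shows "X \<in> M"
proof (rule mem_if_commutes_unitaries)
  interpret closed_dense_op T using T by (simp add: closed_densely_defined_iff)
  show "X \<in> bounded_ops" by (rule trunc_bounded_ops[OF T(1) X])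
  fix u assume u: "u \<in> commutant M" "unitary u"
  have eM: "spec {..s} \<in> M" by (rule affiliated_spec[OF T]) simp
  have ue: "u (spec {..s} x) = spec {..s} (u x)" for x using u(1) eM by (auto simp: commutant_iff commute_iff)
  have "X (u x) = u (X x)" for x
    using unique_image[OF X[of "u x"]] affiliatedD[OF T(2) u X[of x]] ue by simp
  then show "commute X u" by (simp add: commute_iff)
qed

section \<open>The operator \<open>a \<otimes> h\<close>\<close>

text \<open>Strict positivity of h makes its geometric levels cover the line and makes 1/h available
  for lower bounds.\<close>

locale tensor_operator = l2_tensor T for T :: "'h::chilbert_space \<Rightarrow> (real \<Rightarrow> complex) \<Rightarrow> 'k::chilbert_space" +
  fixes M :: "'h bop set" and a :: "'h uop" and h :: "real \<Rightarrow> real"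
  assumes M: "von_neumann_algebra M" and a: "closed_densely_defined a" "affiliated M a"
    and h: "h \<in> borel_measurable borel" "\<And>t. h t > 0"
begin

sublocale M: vna M by standard (rule M)
sublocale N: vna "tensor_Linf T M" by standard (rule tensor_Linf_vna(1)[OF M])
sublocale A: closed_dense_op a using a(1) by (simp add: closed_densely_defined_iff)

lemma csa: "csubspace a" using a(1) by (simp add: closed_densely_defined_iff)

definition hm :: "(real \<Rightarrow> complex) \<Rightarrow> real \<Rightarrow> complex" where
  "hm g t = complex_of_real (h t) * g t"

definition gens :: "('k \<times> 'k) set" where
  "gens = {(T \<xi> g, T \<eta> (hm g)) | \<xi> \<eta> g. (\<xi>, \<eta>) \<in> a \<and> g \<in> L2 \<and> hm g \<in> L2}"

definition W :: "'k uop" where "W = tensor_uop T a h"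

lemma W_eq0: "W = closure (cspan gens)"
  unfolding W_def tensor_uop_def gens_def hm_def[abs_def] ..

lemma gens_scale: "p \<in> gens \<Longrightarrow> c *\<^sub>C p \<in> gens"
  unfolding gens_def using csubspace_pairD[OF csa]
  by (auto simp: scaleC_prod_def T_scale_left[symmetric]) blast

lemma W_eq: "W = closure (span gens)"
  unfolding W_eq0 using csubspace_span(2)[OF gens_scale] by simp

lemma csW: "csubspace W"
  unfolding W_eq by (intro csubspace_closure csubspace_span(1) gens_scale)

lemma subW: "subspace W"
  unfolding W_eq by (intro subspace_closure subspace_span)

lemma clW: "closed W" by (simp add: W_eq)

lemma gens_W: "p \<in> gens \<Longrightarrow> p \<in> W"
  unfolding W_eq using closure_subset span_superset by blast

lemma W_induct:
  assumes "closed S" "subspace S" "\<And>\<xi> \<eta> g. (\<xi>, \<eta>) \<in> a \<Longrightarrow> g \<in> L2 \<Longrightarrow> hm g \<in> L2 \<Longrightarrow> (T \<xi> g, T \<eta> (hm g)) \<in> S"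
    and "p \<in> W"
  shows "p \<in> S"
proof -
  have "span gens \<subseteq> S" by (rule span_minimal) (use assms in \<open>auto simp: gens_def\<close>)
  then have "closure (span gens) \<subseteq> S" using assms(1) by (rule closure_minimal)
  then show ?thesis using assms(4) W_eq by blast
qed

lemma hm_mult: "hm (\<lambda>t. f t * g t) = (\<lambda>t. f t * hm g t)"
  by (auto simp: hm_def)

lemma W_map:
  fixes P Q :: "'k \<Rightarrow>\<^sub>L 'k"
  assumes "\<And>\<xi> \<eta> g. (\<xi>, \<eta>) \<in> a \<Longrightarrow> g \<in> L2 \<Longrightarrow> hm g \<in> L2 \<Longrightarrow> (P (T \<xi> g), Q (T \<eta> (hm g))) \<in> W"
    and "(u, u') \<in> W"
  shows "(P u, Q u') \<in> W"
proof -
  let ?f = "\<lambda>p. (P (fst p), Q (snd p))"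
  have "(u, u') \<in> ?f -` W"
  proof (rule W_induct[OF _ _ _ assms(2)])
    show "closed (?f -` W)" by (intro closed_vimage clW continuous_intros)
    show "subspace (?f -` W)"
      unfolding subspace_def
    proof (intro conjI ballI allI)
      show "0 \<in> ?f -` W" using subspace_0[OF subW] by (simp add: zero_prod_def)
      show "x + y \<in> ?f -` W" if "x \<in> ?f -` W" "y \<in> ?f -` W" for x y
        using subspace_add[OF subW, of "?f x" "?f y"] that by (simp add: blinfun.add_right)
      show "c *\<^sub>R x \<in> ?f -` W" if "x \<in> ?f -` W" for x c
        using subspace_scale[OF subW, of "?f x" c] that by (simp add: blinfun.scaleR_right)
    qed
  qed (use assms(1) in simp)
  then show ?thesis by simp
qed

lemma W_eqI:
  fixes P Q :: "'k \<Rightarrow>\<^sub>L 'k"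
  assumes "\<And>\<xi> \<eta> g. (\<xi>, \<eta>) \<in> a \<Longrightarrow> g \<in> L2 \<Longrightarrow> hm g \<in> L2 \<Longrightarrow> P (T \<xi> g) = Q (T \<eta> (hm g))"
    and "(u, u') \<in> W"
  shows "P u = Q u'"
proof -
  have "(u, u') \<in> {p. P (fst p) = Q (snd p)}"
    by (rule W_induct[OF _ _ _ assms(2)])
      (auto intro!: closed_Collect_eq continuous_intros simp: subspace_def blinfun.bilinear_simps assms(1))
  then show ?thesis by simp
qed

text \<open>\<open>hat B\<close> is the counterpart on the range side of \<open>\<chi>\<^sub>B(|a|)\<close>, i.e. \<open>v \<chi>\<^sub>B(|a|) v\<^sup>*\<close> for the polar
  decomposition \<open>a = v |a|\<close>, and \<open>rhat B I\<close> plays this role for \<open>rect B I\<close> and \<open>a \<otimes> h\<close>.\<close>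

definition hat :: "real set \<Rightarrow> 'h bop" where
  "hat B = (SOME F. F \<in> bounded_ops \<and> (\<forall>(x, y)\<in>a. (A.spec B x, F y) \<in> a) \<and> (\<forall>y. norm (F y) \<le> 1 * norm y))"

lemma hat:
  assumes "B \<in> sets borel"
  shows "hat B \<in> bounded_ops" "(x, y) \<in> a \<Longrightarrow> (A.spec B x, hat B y) \<in> a" "norm (hat B) \<le> 1"
proof -
  have *: "hat B \<in> bounded_ops \<and> (\<forall>(x, y)\<in>a. (A.spec B x, hat B y) \<in> a) \<and> (\<forall>y. norm (hat B y) \<le> 1 * norm y)"
    unfolding hat_def by (rule someI_ex) (use hat_exists[OF a(1) assms] in \<open>simp only: Bex_def\<close>)
  then show "hat B \<in> bounded_ops" by (rule conjunct1)
  show "(A.spec B x, hat B y) \<in> a" if "(x, y) \<in> a" using * that by (simp add: Ball_def)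
  show "norm (hat B) \<le> 1" by (rule norm_blinfun_bound) (use * in simp_all)
qed

lemma hat_par: "B \<in> sets borel \<Longrightarrow> hat B (A.par z) = A.par (A.spec B z)"
  using A.unique_image[OF hat(2)[OF _ A.par_mem] A.spec_mem] by simp

lemma spec_b: "B \<in> sets borel \<Longrightarrow> A.spec B \<in> bounded_ops"
  by (rule spec_bounded_ops[OF a(1)])

definition rect :: "real set \<Rightarrow> real set \<Rightarrow> 'k bop" where
  "rect B I = tensor_op T (A.spec B) (cind I)"

definition rhat :: "real set \<Rightarrow> real set \<Rightarrow> 'k bop" where
  "rhat B I = tensor_op T (hat B) (cind I)"

lemma rect_apply: "B \<in> sets borel \<Longrightarrow> I \<in> sets borel \<Longrightarrow> g \<in> L2 \<Longrightarrow> rect B I (T \<xi> g) = T (A.spec B \<xi>) (\<lambda>t. cind I t * g t)"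
  unfolding rect_def by (rule tensor_op(2)[OF spec_b cind_borel])

lemma rhat_apply: "B \<in> sets borel \<Longrightarrow> I \<in> sets borel \<Longrightarrow> g \<in> L2 \<Longrightarrow> rhat B I (T \<xi> g) = T (hat B \<xi>) (\<lambda>t. cind I t * g t)"
  unfolding rhat_def by (rule tensor_op(2)[OF hat(1) cind_borel])

lemma rect_proj: "B \<in> sets borel \<Longrightarrow> I \<in> sets borel \<Longrightarrow> ortho_proj (rect B I)"
  unfolding rect_def by (rule tensor_proj[OF spec_b A.spec.proj])

lemma rect_N: "B \<in> sets borel \<Longrightarrow> I \<in> sets borel \<Longrightarrow> rect B I \<in> tensor_Linf T M"
  unfolding rect_def by (rule tensor_Linf_vna(2)[OF M M.affiliated_spec[OF a] cind_borel])

lemma rect_W: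
  assumes B: "B \<in> sets borel" and I: "I \<in> sets borel" and u: "(u, u') \<in> W"
  shows "(rect B I u, rhat B I u') \<in> W"
proof (rule W_map[OF _ u])
  fix \<xi> \<eta> g assume *: "(\<xi>, \<eta>) \<in> a" "g \<in> L2" "hm g \<in> L2"
  note cL = L2_mult[OF cind_borel[OF I]]
  have "(T (A.spec B \<xi>) (\<lambda>t. cind I t * g t), T (hat B \<eta>) (hm (\<lambda>t. cind I t * g t))) \<in> gens"
    unfolding gens_def mem_Collect_eq
    by (intro exI conjI, rule refl, rule hat(2)[OF B *(1)], rule cL[OF *(2)])
      (use cL[OF *(3)] in \<open>simp only: hm_mult\<close>)
  then show "(rect B I (T \<xi> g), rhat B I (T \<eta> (hm g))) \<in> W"
    using gens_W by (simp add: rect_apply[OF B I *(2)] rhat_apply[OF B I *(3)] hm_mult)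
qed

lemma hat_cinner:
  assumes B: "B \<in> sets borel" and "(x, y) \<in> a" "(v, w) \<in> a"
  shows "cinner (hat B y) w = cinner y (hat B w)"
proof -
  have r: "hat B y \<bullet> w = y \<bullet> hat B w" if xy: "(x, y) \<in> a" and vw: "(v, w) \<in> a" for x y v w
  proof -
    obtain z where z: "x = A.rt z" "y = A.par z" using xy by (rule A.memE)
    obtain z' where z': "v = A.rt z'" "w = A.par z'" using vw by (rule A.memE)
    show ?thesis unfolding z(2) z'(2) hat_par[OF B] by (rule A.par_spec_inner[OF B])
  qed
  show ?thesis
  proof (rule complex_eqI)
    show "Re (cinner (hat B y) w) = Re (cinner y (hat B w))" using r[OF assms(2,3)] by (simp add: Re_cinner)
    show "Im (cinner (hat B y) w) = Im (cinner y (hat B w))"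
      using r[OF csubspace_pairD[OF csa assms(2), of \<i>] assms(3)] by (simp add: Im_cinner bounded_opsD[OF hat(1)[OF B]])
  qed
qed

text \<open>\<open>hat B\<close> is symmetric only on the range of a, so the identity is proved for
  generators in each of the two arguments and then extended to the closed graph.\<close>

lemma rhat_sym:
  assumes B: "B \<in> sets borel" and I: "I \<in> sets borel" and u: "(u, u') \<in> W" and v: "(v, v') \<in> W"
  shows "rhat B I u' \<bullet> v' = u' \<bullet> rhat B I v'"
proof -
  let ?F = "rhat B I"
  note cL = L2_mult[OF cind_borel[OF I]]
  have 1: "?F (T \<eta> (hm g)) \<bullet> v' = T \<eta> (hm g) \<bullet> ?F v'" if g: "(\<xi>, \<eta>) \<in> a" "g \<in> L2" "hm g \<in> L2" for \<xi> \<eta> g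
  proof -
    have "(v, v') \<in> {p. ?F (T \<eta> (hm g)) \<bullet> snd p = T \<eta> (hm g) \<bullet> ?F (snd p)}"
    proof (rule W_induct[OF _ _ _ v])
      fix \<xi>' \<eta>' k assume k: "(\<xi>', \<eta>') \<in> a" "k \<in> L2" "hm k \<in> L2"
      have "ip (\<lambda>t. cind I t * hm g t) (hm k) = ip (hm g) (\<lambda>t. cind I t * hm k t)"
        unfolding ip_def by (simp add: cind_def mult_ac)
      then show "(T \<xi>' k, T \<eta>' (hm k)) \<in> {p. ?F (T \<eta> (hm g)) \<bullet> snd p = T \<eta> (hm g) \<bullet> ?F (snd p)}"
        by (simp add: rhat_apply[OF B I] g k T_inner cL hat_cinner[OF B g(1) k(1)])
    qed (auto intro!: closed_Collect_eq continuous_intros simp: subspace_def blinfun.bilinear_simps inner_add_right)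
    then show ?thesis by simp
  qed
  have "(u, u') \<in> {p. ?F (snd p) \<bullet> v' = snd p \<bullet> ?F v'}"
    by (rule W_induct[OF _ _ _ u])
      (auto intro!: closed_Collect_eq continuous_intros simp: subspace_def blinfun.bilinear_simps inner_add_left 1)
  then show ?thesis by simp
qed

text \<open>Together with |a| <= n this cuts out a part on which the tensor product is bounded; the
  parts exhaust the space.\<close>

definition In :: "nat \<Rightarrow> real set" where "In n = {t. h t \<le> real n}"

lemma In_borel [measurable]: "In n \<in> sets borel"
  unfolding In_def using h(1) by measurable

lemma In_ev: "\<forall>\<^sub>F n in sequentially. t \<in> In n"
proof -
  obtain N where "h t \<le> real N" using real_arch_simple by blast
  then show ?thesis by (intro eventually_sequentiallyI[of N]) (auto simp: In_def intro: order_trans)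
qed

abbreviation "Pn n \<equiv> rect {..real n} (In n)"
abbreviation "Qn n \<equiv> rhat {..real n} (In n)"

lemma spec_lim: "(\<lambda>n. A.spec {..real n} x) \<longlonglongrightarrow> x"
  using A.specfam_at_top[of x] by (simp add: A.spec_Iic)

lemma Pn_lim: "(\<lambda>n. Pn n k) \<longlonglongrightarrow> k"
proof -
  have "(\<lambda>n. Pn n k) \<longlonglongrightarrow> id_blinfun k"
  proof (rule strong_limit_dense[where c = 1 and S = "{T \<xi> g | \<xi> g. g \<in> L2}"])
    show "norm (Pn n k) \<le> 1 * norm k" for n k using ortho_projD(4)[OF rect_proj] by simp
    show "k \<in> closure (span {T \<xi> g | \<xi> g. g \<in> L2})" using T_dense by simp
    fix k assume "k \<in> {T \<xi> g | \<xi> g. g \<in> L2}"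
    then obtain \<xi> g where k: "k = T \<xi> g" "g \<in> L2" by blast
    show "(\<lambda>n. Pn n k) \<longlonglongrightarrow> id_blinfun k"
      unfolding k(1) using T_tendsto[OF spec_lim k(2) In_borel In_ev, of \<xi>] by (simp add: rect_apply k(2))
  qed
  then show ?thesis by simp
qed

text \<open>Restricted to the range of W because \<open>hat\<close> is determined on the range of a,
  where \<open>hat_par\<close> expresses it by spectral projections that converge to 1.\<close>

lemma Qn_lim: assumes u: "(u, u') \<in> W" shows "(\<lambda>n. Qn n u') \<longlonglongrightarrow> u'"
proof -
  have "(\<lambda>n. Qn n u') \<longlonglongrightarrow> id_blinfun u'"
  proof (rule strong_limit_dense[where c = 1 and S = "snd ` gens"])
    show "norm (Qn n k) \<le> 1 * norm k" for n k
    proof -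
      have "norm (Qn n k) \<le> norm (hat {..real n}) * 1 * norm k"
        unfolding rhat_def by (rule tensor_op(3)[OF hat(1) cind_borel]) (auto simp: cind_le)
      also have "\<dots> \<le> 1 * 1 * norm k" by (intro mult_right_mono hat(3)) auto
      finally show ?thesis by simp
    qed
    have "(u, u') \<in> {p. snd p \<in> closure (span (snd ` gens))}"
    proof (rule W_induct[OF _ _ _ u])
      have "closed (snd -` closure (span (snd ` gens)) :: ('k \<times> 'k) set)" by (intro closed_vimage closed_closure continuous_intros)
      then show "closed {p :: 'k \<times> 'k. snd p \<in> closure (span (snd ` gens))}" by (simp add: vimage_def)
      show "subspace {p :: 'k \<times> 'k. snd p \<in> closure (span (snd ` gens))}"
        using subspace_closure[OF subspace_span, of "snd ` gens"] by (simp add: subspace_def)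
      show "(T \<xi> g, T \<eta> (hm g)) \<in> {p. snd p \<in> closure (span (snd ` gens))}"
        if "(\<xi>, \<eta>) \<in> a" "g \<in> L2" "hm g \<in> L2" for \<xi> \<eta> g
      proof -
        have "(T \<xi> g, T \<eta> (hm g)) \<in> gens" using that by (auto simp: gens_def)
        then have "T \<eta> (hm g) \<in> span (snd ` gens)" by (intro span_base) force
        then show ?thesis using closure_subset by auto
      qed
    qed
    then show "u' \<in> closure (span (snd ` gens))" by simp
    fix k assume "k \<in> snd ` gens"
    then obtain \<xi> \<eta> g where k: "k = T \<eta> (hm g)" "(\<xi>, \<eta>) \<in> a" "hm g \<in> L2" unfolding gens_def by auto
    obtain z where z: "\<eta> = A.par z" using k(2) by (rule A.memE)
    have "(\<lambda>n. A.par (A.spec {..real n} z)) \<longlonglongrightarrow> A.par z" by (intro blinfun.tendsto tendsto_const spec_lim)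
    then have "(\<lambda>n. hat {..real n} \<eta>) \<longlonglongrightarrow> \<eta>" by (simp add: z hat_par)
    from T_tendsto[OF this k(3) In_borel In_ev]
    show "(\<lambda>n. Qn n k) \<longlonglongrightarrow> id_blinfun k" unfolding k(1) by (simp add: rhat_apply k(3))
  qed
  then show ?thesis by simp
qed

text \<open>Y is the tensor product of the bounded operators a chi_{[0,x]}(|a|) and h chi_I. It is W
  on the rectangle, and its factorisation through \<open>rhat\<close> lets limits of pairs in the
  graph be controlled on the range side.\<close>

lemma trunc_tensor:
  assumes x: "0 \<le> x" and I: "I \<in> sets borel" and d: "\<And>t. t \<in> I \<Longrightarrow> h t \<le> \<delta>" "0 \<le> \<delta>"
  shows "\<exists>Y\<in>tensor_Linf T M. (\<forall>k. (rect {..x} I k, Y k) \<in> W) \<and> (\<forall>k. norm (Y k) \<le> x * \<delta> * norm k) \<and>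
    (\<forall>(u, u')\<in>W. Y u = rhat {..x} I u')"
proof -
  obtain X :: "'h \<Rightarrow>\<^sub>L 'h" where X: "\<And>v. (A.spec {..x} v, X v) \<in> a" "\<And>v. norm (X v) \<le> x * norm v"
    using A.trunc_exists[OF x] by blast
  have XM: "X \<in> M" by (rule M.trunc_mem[OF a X(1)])
  then have Xb: "X \<in> bounded_ops" by (rule M.M_bounded)
  define f where "f t = complex_of_real (h t * indicator I t)" for t
  have fle: "cmod (f t) \<le> \<delta>" for t using d h(2)[of t] by (auto simp: f_def split: split_indicator)
  have fm: "f \<in> borel_measurable borel" unfolding f_def using h(1) I by measurable
  have fb: "f \<in> bounded_borel" by (rule bounded_borelI[OF fm fle])
  have B: "{..x} \<in> sets borel" by simp
  let ?Y = "tensor_op T X f"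
  note cL = L2_mult[OF cind_borel[OF I]]
  have fg: "(\<lambda>t. f t * g t) = hm (\<lambda>t. cind I t * g t)" for g by (auto simp: f_def hm_def cind_def)
  have "(rect {..x} I k, ?Y k) \<in> W" for k
  proof -
    let ?f = "\<lambda>k. (rect {..x} I k, ?Y k)"
    have "k \<in> ?f -` W"
    proof (rule dense_induct)
      show "closed (?f -` W)" by (intro closed_vimage clW continuous_intros)
      show "subspace (?f -` W)"
        unfolding subspace_def
      proof (intro conjI ballI allI)
        show "0 \<in> ?f -` W" using subspace_0[OF subW] by (simp add: zero_prod_def)
        show "x + y \<in> ?f -` W" if "x \<in> ?f -` W" "y \<in> ?f -` W" for x y
          using subspace_add[OF subW, of "?f x" "?f y"] that by (simp add: blinfun.add_right)
        show "c *\<^sub>R x \<in> ?f -` W" if "x \<in> ?f -` W" for x c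
          using subspace_scale[OF subW, of "?f x" c] that by (simp add: blinfun.scaleR_right)
      qed
      show "T \<xi> g \<in> ?f -` W" if g: "g \<in> L2" for \<xi> g
      proof -
        have "hm (\<lambda>t. cind I t * g t) \<in> L2" unfolding fg[symmetric] by (rule L2_mult[OF fb g])
        then have "(T (A.spec {..x} \<xi>) (\<lambda>t. cind I t * g t), T (X \<xi>) (hm (\<lambda>t. cind I t * g t))) \<in> gens"
          unfolding gens_def using X(1) cL[OF g] by blast
        then show ?thesis using gens_W by (simp add: rect_apply[OF B I g] tensor_op(2)[OF Xb fb g] fg)
      qed
    qed
    then show ?thesis by simp
  qed
  moreover have "norm (?Y k) \<le> x * \<delta> * norm k" for k
  proof -
    have "norm (?Y k) \<le> norm X * \<delta> * norm k" by (rule tensor_op(3)[OF Xb fb fle])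
    also have "\<dots> \<le> x * \<delta> * norm k"
      using X(2) x d by (intro mult_right_mono norm_blinfun_bound) auto
    finally show ?thesis .
  qed
  moreover have "?Y u = rhat {..x} I u'" if "(u, u') \<in> W" for u u'
  proof (rule W_eqI[OF _ that])
    fix \<xi> \<eta> g assume *: "(\<xi>, \<eta>) \<in> a" "g \<in> L2" "hm g \<in> L2"
    have "X \<xi> = hat {..x} \<eta>" using A.unique_image[OF X(1) hat(2)[OF B *(1)]] .
    then show "?Y (T \<xi> g) = rhat {..x} I (T \<eta> (hm g))"
      by (simp add: tensor_op(2)[OF Xb fb *(2)] rhat_apply[OF B I *(3)] fg hm_mult)
  qed
  moreover have "?Y \<in> tensor_Linf T M" by (rule tensor_Linf_vna(2)[OF M XM fb])
  ultimately show ?thesis by blast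
qed

lemma Yn_ex: "\<exists>Y\<in>tensor_Linf T M. (\<forall>k. (Pn n k, Y k) \<in> W) \<and> (\<forall>(u, u')\<in>W. Y u = Qn n u')"
proof -
  have "\<exists>Y\<in>tensor_Linf T M. (\<forall>k. (Pn n k, Y k) \<in> W) \<and> (\<forall>k. norm (Y k) \<le> real n * real n * norm k) \<and>
      (\<forall>(u, u')\<in>W. Y u = Qn n u')"
    by (rule trunc_tensor) (simp_all add: In_borel, simp add: In_def)
  then show ?thesis by (elim bexE conjE) (rule bexI, rule conjI)
qed

text \<open>The closure is a function: if (0, y) is in W, then \<open>Qn n y\<close> is the value of
  a bounded operator at 0, and these vectors tend to y. The domain is dense because it contains all
  \<open>Pn n k\<close>.\<close>

lemma W_cdd: "closed_densely_defined W"
  unfolding closed_densely_defined_def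
proof (intro conjI csW clW)
  have z: "y = 0" if 0: "(0, y) \<in> W" for y
  proof -
    have "Qn n y = 0" for n
    proof -
      obtain Y :: "'k bop" where "\<forall>(u, u')\<in>W. Y u = Qn n u'" using Yn_ex[of n] by (elim bexE conjE) rule
      from bspec[OF this 0] show ?thesis by simp
    qed
    then show ?thesis using Qn_lim[OF 0] by (simp add: LIMSEQ_const_iff)
  qed
  show "single_valued W"
  proof (rule single_valuedI)
    fix x y y' assume "(x, y) \<in> W" "(x, y') \<in> W"
    then have "(x - x, y - y') \<in> W" using subspace_diff[OF subW] by fastforce
    then show "y = y'" using z[of "y - y'"] by simp
  qed
  show "closure (Domain W) = UNIV"
  proof -
    have "k \<in> closure (Domain W)" for k
      unfolding closure_sequential
    proof (intro exI conjI allI)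
      show "Pn n k \<in> Domain W" for n using Yn_ex[of n] by blast
    qed (rule Pn_lim)
    then show ?thesis by blast
  qed
qed

sublocale W: closed_dense_op W using W_cdd by (simp add: closed_densely_defined_iff)

text \<open>A unitary u of the commutant commutes with \<open>Pn n\<close> and with the bounded part
  of W on its range, so it maps truncated pairs into W; closedness passes this to the limit.\<close>

lemma W_aff: "affiliated (tensor_Linf T M) W"
  unfolding affiliated_def
proof (intro ballI impI, clarify)
  fix u v v' assume u: "u \<in> commutant (tensor_Linf T M)" and v: "(v, v') \<in> W"
  have uc: "u (X k) = X (u k)" if "X \<in> tensor_Linf T M" for X k
    using u that by (auto simp: commutant_iff commute_iff)
  have m: "(u (Pn n v), u (Qn n v')) \<in> W" for n
  proof -
    obtain Y where Y: "Y \<in> tensor_Linf T M" "\<And>k. (Pn n k, Y k) \<in> W" "\<And>u u'. (u, u') \<in> W \<Longrightarrow> Y u = Qn n u'"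
      using Yn_ex[of n] by fastforce
    have "(Pn n (u v), Y (u v)) \<in> W" by (rule Y(2))
    moreover have "Pn n (u v) = u (Pn n v)" using uc[OF rect_N] by simp
    moreover have "Y (u v) = u (Qn n v')" using uc[OF Y(1), of v] Y(3)[OF v] by simp
    ultimately show ?thesis by simp
  qed
  have "(\<lambda>n. (u (Pn n v), u (Qn n v'))) \<longlonglongrightarrow> (u v, u v')"
    by (intro tendsto_Pair blinfun.tendsto tendsto_const Pn_lim Qn_lim[OF v])
  then show "(u v, u v') \<in> W" by (rule closed_sequentially[OF clW, rotated]) (rule m)
qed

lemma rect_commute:
  assumes B: "B \<in> sets borel" and I: "I \<in> sets borel" and C: "C \<in> sets borel"
  shows "rect B I (W.spec C k) = W.spec C (rect B I k)"
proof -
  have "W.res (rect B I k) = rect B I (W.res k)" for k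
    by (rule W.commute_res[of "rect B I" "rhat B I" "rect B I" "rhat B I"])
      (use rect_W[OF B I] rhat_sym[OF B I] ortho_projD(2)[OF rect_proj[OF B I]] in auto)
  then have "commute (rect B I) W.res" by (simp add: commute_iff)
  from W.spec_commute[OF this C] show ?thesis by (simp add: commute_iff)
qed

text \<open>Apply to u' the bounded operator formed from the left inverse of a above x and
  multiplication by 1/h on I; its norm is at most 1/(x \<gamma>).\<close>

lemma rect_lower:
  assumes x: "x > 0" and I: "I \<in> sets borel" and c: "\<gamma> > 0" "\<And>t. t \<in> I \<Longrightarrow> \<gamma> \<le> h t" and u: "(u, u') \<in> W"
  shows "x * \<gamma> * norm (rect {x<..} I u) \<le> norm u'"
proof -
  obtain F where F: "F \<in> bounded_ops" "\<forall>(v, w)\<in>a. F w = A.spec {x<..} v" "\<forall>y. norm (F y) \<le> (1 / x) * norm y"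
    using left_inverse_exists[OF a(1) x] by blast
  have B: "{x<..} \<in> sets borel" by simp
  define f where "f t = complex_of_real (indicator I t / h t)" for t
  have fle: "cmod (f t) \<le> 1 / \<gamma>" for t
  proof (cases "t \<in> I")
    case True
    then have "1 / h t \<le> 1 / \<gamma>" using c by (intro divide_left_mono) (auto simp: h(2))
    then show ?thesis using True h(2)[of t] by (simp add: f_def norm_divide)
  qed (use c in \<open>simp add: f_def\<close>)
  have fm: "f \<in> borel_measurable borel" unfolding f_def using h(1) I by measurable
  have fb: "f \<in> bounded_borel" by (rule bounded_borelI[OF fm fle])
  have eq: "rect {x<..} I u = tensor_op T F f u'"
  proof (rule W_eqI[OF _ u])
    fix \<xi> \<eta> g assume *: "(\<xi>, \<eta>) \<in> a" "g \<in> L2" "hm g \<in> L2"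
    have "(\<lambda>t. f t * hm g t) = (\<lambda>t. cind I t * g t)"
      using h(2) by (auto simp: f_def hm_def cind_def fun_eq_iff less_imp_neq[symmetric] split: split_indicator)
    moreover have "F \<eta> = A.spec {x<..} \<xi>" using F(2) *(1) by auto
    ultimately show "rect {x<..} I (T \<xi> g) = tensor_op T F f (T \<eta> (hm g))"
      by (simp add: rect_apply[OF B I *(2)] tensor_op(2)[OF F(1) fb *(3)])
  qed
  have "norm (tensor_op T F f u') \<le> norm F * (1 / \<gamma>) * norm u'" by (rule tensor_op(3)[OF F(1) fb fle])
  also have "\<dots> \<le> (1 / x) * (1 / \<gamma>) * norm u'"
    using F(3) x c by (intro mult_right_mono norm_blinfun_bound) auto
  finally show ?thesis unfolding eq using x c by (simp add: field_simps)
qed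

text \<open>A vector v of the rectangle below the level s of |W| has x \<gamma> |v| <= |W v| <= s
  |v|, so it is 0. Commutation of the two projections produces such a v from an arbitrary k.\<close>

lemma rect_below_spec:
  assumes x: "x > 0" and I: "I \<in> sets borel" and c: "\<gamma> > 0" "\<And>t. t \<in> I \<Longrightarrow> \<gamma> \<le> h t" and s: "0 \<le> s" "s < x * \<gamma>"
  shows "W.spec {s<..} (rect {x<..} I k) = rect {x<..} I k"
proof -
  have B: "{x<..} \<in> sets borel" "{..s} \<in> sets borel" by auto
  let ?v = "W.spec {..s} (rect {x<..} I k)"
  have Pv: "rect {x<..} I ?v = ?v"
    using rect_commute[OF B(1) I B(2)] ortho_projD(1)[OF rect_proj[OF B(1) I]] by simp
  have "W.spec {..s} ?v = ?v" using ortho_projD(1)[OF W.spec.proj[OF B(2)]] .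
  then obtain z where z: "?v = W.rt z" "norm (W.par z) \<le> s * norm ?v" using W.spec_in_domain[OF s(1)] by blast
  have "(?v, W.par z) \<in> W" using W.par_mem[of z] z by simp
  from rect_lower[OF x I c this] Pv have "x * \<gamma> * norm ?v \<le> norm (W.par z)" by simp
  then have "x * \<gamma> * norm ?v \<le> s * norm ?v" using z(2) by linarith
  then have "norm ?v = 0" using s(2) by (metis mult_right_le_imp_le not_le norm_ge_zero order_le_less)
  then have "?v = 0" by simp
  moreover have "- {..s} = {s<..}" by auto
  ultimately show ?thesis using W.spec.compl[OF B(2), of "rect {x<..} I k"] by simp
qed

text \<open>Here the vector v in both ranges has s |v| <= |W v| <= x \<delta> |v|.\<close>

lemma rect_above_spec:
  assumes x: "0 \<le> x" and I: "I \<in> sets borel" and d: "\<And>t. t \<in> I \<Longrightarrow> h t \<le> \<delta>" "0 \<le> \<delta>" and s: "x * \<delta> < s"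
  shows "W.spec {s<..} (rect {..x} I k) = 0"
proof -
  have B: "{..x} \<in> sets borel" "{s<..} \<in> sets borel" by auto
  obtain Y where Y: "\<And>k. (rect {..x} I k, blinfun_apply Y k) \<in> W" "\<And>k. norm (Y k) \<le> x * \<delta> * norm k"
    using trunc_tensor[OF x I d] by blast
  have s0: "0 \<le> s" using s mult_nonneg_nonneg[OF x d(2)] by linarith
  let ?v = "W.spec {s<..} (rect {..x} I k)"
  have Pv: "rect {..x} I ?v = ?v"
    using rect_commute[OF B(1) I B(2)] ortho_projD(1)[OF rect_proj[OF B(1) I]] by simp
  have Sv: "W.spec {s<..} ?v = ?v" using ortho_projD(1)[OF W.spec.proj[OF B(2)]] .
  have "(?v, Y ?v) \<in> W" using Y(1)[of ?v] Pv by simp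
  from W.spec_Ioi_bound[OF s0 this] Sv have "s * norm ?v \<le> norm (Y ?v)" by simp
  then have "s * norm ?v \<le> x * \<delta> * norm ?v" using Y(2)[of ?v] by linarith
  then have "norm ?v = 0" using s by (metis mult_right_le_imp_le not_le norm_ge_zero order_le_less)
  then show ?thesis by simp
qed

end

section \<open>The distribution function of \<open>a \<otimes> h\<close>\<close>

lemma borel_measurable_antimono_ennreal:
  fixes f :: "real \<Rightarrow> ennreal"
  assumes "antimono f" shows "f \<in> borel_measurable borel"
proof (rule borel_measurableI_greater)
  fix y
  have "is_interval {x. y < f x}"
    unfolding is_interval_1 using antimonoD[OF assms] less_le_trans by blast
  then show "{x \<in> space borel. y < f x} \<in> sets borel"
    by (simp add: real_interval_borel_measurable)
qed

lemma borel_measurable_mono_ennreal: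
  fixes f :: "real \<Rightarrow> ennreal"
  assumes "mono f" shows "f \<in> borel_measurable borel"
proof (rule borel_measurableI_greater)
  fix y
  have "is_interval {x. y < f x}"
    unfolding is_interval_1 using monoD[OF assms] less_le_trans by blast
  then show "{x \<in> space borel. y < f x} \<in> sets borel"
    by (simp add: real_interval_borel_measurable)
qed

lemma emeasure_Ioi_antimono: "sets \<mu> = sets borel \<Longrightarrow> antimono (\<lambda>x::real. emeasure \<mu> {x<..})"
  by (intro antimonoI emeasure_mono) auto

lemma emeasure_Ioi_SUP:
  fixes X :: "nat \<Rightarrow> real"
  assumes \<mu>: "sets \<mu> = sets borel" and X: "decseq X" "X \<longlonglongrightarrow> x" "\<And>n. x < X n"
  shows "(SUP n. emeasure \<mu> {X n<..}) = emeasure \<mu> {x<..}"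
proof -
  have "(\<Union>n. {X n<..}) = {x<..}"
  proof (intro set_eqI iffI)
    fix y assume "y \<in> (\<Union>n. {X n<..})"
    then show "y \<in> {x<..}" using X(3) by (auto intro: less_trans)
  next
    fix y assume "y \<in> {x<..}"
    then have "\<forall>\<^sub>F n in sequentially. X n < y" using order_tendstoD(2)[OF X(2)] by simp
    then obtain n where "X n < y" unfolding eventually_sequentially by blast
    then show "y \<in> (\<Union>n. {X n<..})" by auto
  qed
  moreover have "incseq (\<lambda>n. {X n<..})"
  proof (rule incseq_SucI)
    show "{X n<..} \<subseteq> {X (Suc n)<..}" for n using decseqD[OF X(1), of n "Suc n"] by auto
  qed
  ultimately show ?thesis using SUP_emeasure_incseq[of "\<lambda>n. {X n<..}" \<mu>] \<mu> by (simp add: image_subset_iff)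
qed

lemma decseq_right_approx:
  shows "decseq (\<lambda>n. x + 1 / real (Suc n))" "(\<lambda>n. x + 1 / real (Suc n)) \<longlonglongrightarrow> x" "x < x + 1 / real (Suc n)"
proof -
  show "decseq (\<lambda>n. x + 1 / real (Suc n))" by (intro decseq_SucI) (simp add: frac_le)
  show "(\<lambda>n. x + 1 / real (Suc n)) \<longlonglongrightarrow> x"
    using tendsto_add[OF tendsto_const lim_inverse_Suc, of x] by simp
qed simp

lemma psd_proj_diff:
  fixes P Q :: "'a::{real_inner,banach} \<Rightarrow>\<^sub>L 'a"
  assumes P: "ortho_proj P" and Q: "ortho_proj Q" and PQ: "\<And>x. P (Q x) = Q x"
  shows "psd (P - Q)"
proof (rule psd_diffI)
  show "self_adj Q" "self_adj P" using P Q by (auto intro: psd_imp_self_adj psd_ortho_proj)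
  fix x
  have "Q (P x) \<bullet> y = Q x \<bullet> y" for y
    by (simp add: ortho_projD(2)[OF Q] ortho_projD(2)[OF P] PQ)
  then have "Q (P x) = Q x" by (metis vector_eq_rdot)
  then have "norm (Q x) \<le> norm (P x)" using ortho_projD(4)[OF Q, of "P x"] by simp
  then show "Q x \<bullet> x \<le> P x \<bullet> x" by (simp add: ortho_projD(3)[OF Q] ortho_projD(3)[OF P] power_mono)
qed

locale tensor_weight = tensor_operator T M a h
  for T :: "'h::chilbert_space \<Rightarrow> (real \<Rightarrow> complex) \<Rightarrow> 'k::chilbert_space" and M a h +
  fixes \<tau> \<tau>A
  assumes tr: "fns_trace M \<tau>" and trA: "tensor_trace T M \<tau> \<tau>A"
begin

sublocale MT: vna_trace M \<tau> by standard (rule tr)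
sublocale NT: vna_trace "tensor_Linf T M" \<tau>A by standard (use trA in \<open>simp add: tensor_trace_def\<close>)

definition da :: "real \<Rightarrow> ennreal" where "da x = \<tau> (A.spec {x<..})"
definition dW :: "real \<Rightarrow> ennreal" where "dW s = \<tau>A (W.spec {s<..})"
definition wt :: "real set \<Rightarrow> ennreal" where "wt I = (\<integral>\<^sup>+t\<in>I. ennreal (exp (- t)) \<partial>lborel)"

lemma A_pvm: "M.pvm_in A.spec" by (rule MT.spec_pvm_in[OF a])
lemma W_pvm: "N.pvm_in W.spec" by (rule NT.spec_pvm_in[OF W_cdd W_aff])

lemma da_eq: "da x = emeasure (M.wmeas \<tau> A.spec) {x<..}"
  unfolding da_def by (rule M.emeasure_wmeas[OF A_pvm MT.tau, symmetric]) simp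

lemma dW_eq: "dW s = emeasure (N.wmeas \<tau>A W.spec) {s<..}"
  unfolding dW_def by (rule N.emeasure_wmeas[OF W_pvm NT.tau, symmetric]) simp

lemma da_antimono: "antimono da"
  using emeasure_Ioi_antimono[OF M.sets_wmeas] by (simp add: da_eq[abs_def])

lemma da_borel [measurable]: "da \<in> borel_measurable borel"
  by (rule borel_measurable_antimono_ennreal[OF da_antimono])

lemma h_borel [measurable]: "h \<in> borel_measurable borel" by (rule h(1))

lemma tau_rect:
  assumes B: "B \<in> sets borel" and I: "I \<in> sets borel"
  shows "\<tau>A (rect B I) = \<tau> (A.spec B) * wt I"
proof -
  have c: "(\<lambda>t. complex_of_real (indicator I t)) = cind I" by (simp add: cind_def[abs_def])
  have "A.spec B \<in> pos_cone M"
    using M.affiliated_spec[OF a B] psd_ortho_proj[OF A.spec.proj[OF B]] by (simp add: M.pos_cone_iff)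
  then have "\<tau>A (tensor_op T (A.spec B) (\<lambda>t. complex_of_real (indicator I t))) =
      \<tau> (A.spec B) * (\<integral>\<^sup>+ t. ennreal (indicator I t * exp (- t)) \<partial>lborel)"
    using trA cind_borel[OF I] unfolding tensor_trace_def c[symmetric] by auto
  moreover have "ennreal (indicator I t * exp (- t)) = ennreal (exp (- t)) * indicator I t" for t
    by (simp split: split_indicator)
  ultimately show ?thesis by (simp add: rect_def wt_def c)
qed

lemma rect_psd: "B \<in> sets borel \<Longrightarrow> I \<in> sets borel \<Longrightarrow> psd (rect B I)"
  by (intro psd_ortho_proj rect_proj)

lemma rect_orth:
  assumes B: "B \<in> sets borel" "B' \<in> sets borel" and I: "I \<in> sets borel" "I' \<in> sets borel" "I \<inter> I' = {}"
  shows "rect B I (rect B' I' k) = 0"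
proof -
  have z: "(\<lambda>t. cind I t * cind I' t) = (\<lambda>t. 0)" using I(3) by (auto simp: cind_def fun_eq_iff split: split_indicator)
  have "rect B I o\<^sub>L rect B' I' = 0"
  proof (rule op_eqI)
    fix \<xi> g assume g: "g \<in> L2"
    have "(\<lambda>t. cind I t * (cind I' t * g t)) = (\<lambda>t. 0)" using z by (simp add: fun_eq_iff mult.assoc[symmetric])
    then show "(rect B I o\<^sub>L rect B' I') (T \<xi> g) = blinfun_apply 0 (T \<xi> g)"
      by (simp add: rect_apply B I g L2_mult[OF cind_borel[OF I(2)] g] T_zero)
  qed
  then show ?thesis by (metis blinfun_apply_blinfun_compose zero_blinfun.rep_eq)
qed

lemma rect_add_right:
  assumes B: "B \<in> sets borel" and I: "I \<in> sets borel" "I' \<in> sets borel" "I \<inter> I' = {}"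
  shows "rect B (I \<union> I') = rect B I + rect B I'"
proof (rule op_eqI)
  fix \<xi> g assume g: "g \<in> L2"
  have "(\<lambda>t. cind (I \<union> I') t * g t) = (\<lambda>t. cind I t * g t + cind I' t * g t)"
    using I(3) by (auto simp: cind_def fun_eq_iff split: split_indicator)
  then show "rect B (I \<union> I') (T \<xi> g) = (rect B I + rect B I') (T \<xi> g)"
    by (simp add: rect_apply B I(1,2) sets.Un[OF I(1,2)] g blinfun.add_left T_add_right L2_mult[OF cind_borel])
qed

lemma rect_add_left:
  assumes B: "B \<in> sets borel" "B' \<in> sets borel" "B \<inter> B' = {}" and I: "I \<in> sets borel"
  shows "rect (B \<union> B') I = rect B I + rect B' I"
  by (rule op_eqI)
    (simp add: rect_apply B I sets.Un[OF B(1,2)] A.spec.union blinfun.add_left T_add_left L2_mult[OF cind_borel])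

text \<open>On \<open>lev q n\<close> the function \<open>h\<close> equals the constant \<open>cq q n\<close> up to the factor \<open>q\<close>; in the end \<open>q \<rightarrow> 1\<close>.\<close>

definition lev :: "real \<Rightarrow> nat \<Rightarrow> real set" where "lev q n = h -` cell q n"
definition cq :: "real \<Rightarrow> nat \<Rightarrow> real" where "cq q n = q powr of_int (int_decode n)"

lemma lev_borel [measurable]: "lev q n \<in> sets borel"
  using measurable_sets[OF h(1) cell_borel] by (simp add: lev_def)

lemma lev_disjoint: "q > 1 \<Longrightarrow> disjoint_family (lev q)"
  using cell_disjoint[of q] by (auto simp: disjoint_family_on_def lev_def)

lemma lev_Union: "q > 1 \<Longrightarrow> (\<Union>n. lev q n) = UNIV"
  using cell_Union[of q] h(2) unfolding lev_def vimage_UN[symmetric] by auto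

lemma lev_bounds: "q > 1 \<Longrightarrow> t \<in> lev q n \<Longrightarrow> cq q n < h t \<and> h t \<le> q * cq q n"
  by (auto simp: lev_def cell_def cq_def powr_add mult.commute)

lemma cq_pos: "q > 1 \<Longrightarrow> cq q n > 0" by (simp add: cq_def)

definition \<Phi> :: "real \<Rightarrow> ennreal" where
  "\<Phi> s = (\<integral>\<^sup>+t. da (s / h t) * ennreal (exp (- t)) \<partial>lborel)"

lemma Phi_cells:
  assumes "q > 1"
  shows "\<Phi> s = (\<Sum>n. \<integral>\<^sup>+t\<in>lev q n. da (s / h t) * ennreal (exp (- t)) \<partial>lborel)"
proof -
  have "\<Phi> s = (\<integral>\<^sup>+t\<in>(\<Union>n. lev q n). da (s / h t) * ennreal (exp (- t)) \<partial>lborel)"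
    by (simp add: \<Phi>_def lev_Union[OF assms])
  also have "\<dots> = (\<Sum>n. \<integral>\<^sup>+t\<in>lev q n. da (s / h t) * ennreal (exp (- t)) \<partial>lborel)"
    by (rule nn_integral_disjoint_family) (use lev_disjoint[OF assms] in auto)
  finally show ?thesis .
qed

lemma Phi_cell_const: "I \<in> sets borel \<Longrightarrow> c * wt I = (\<integral>\<^sup>+t\<in>I. c * ennreal (exp (- t)) \<partial>lborel)"
  by (simp add: wt_def nn_integral_cmult[symmetric] mult.assoc)

text \<open>A step approximation to the spectral projection of |W| above a level: on the n-th level
  set of h it keeps the part where |a| exceeds x n.\<close>

definition lam :: "real \<Rightarrow> (nat \<Rightarrow> real) \<Rightarrow> nat \<Rightarrow> 'k bop" where
  "lam q x m = (\<Sum>n<m. rect {x n<..} (lev q n))"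

lemma lam:
  assumes q: "q > 1"
  shows "ortho_proj (lam q x m)" "lam q x m \<in> tensor_Linf T M" "\<tau>A (lam q x m) = (\<Sum>n<m. da (x n) * wt (lev q n))"
proof -
  show "ortho_proj (lam q x m)" unfolding lam_def
  proof (rule ortho_proj_sum)
    fix i j :: nat and k assume "i \<noteq> j"
    then have "lev q i \<inter> lev q j = {}" using lev_disjoint[OF q] by (auto simp: disjoint_family_on_def)
    then show "rect {x i<..} (lev q i) (rect {x j<..} (lev q j) k) = 0" by (intro rect_orth) auto
  qed (auto intro: rect_proj)
  show "lam q x m \<in> tensor_Linf T M" unfolding lam_def by (rule N.M_sum) (auto intro: rect_N)
  have "\<tau>A (lam q x m) = (\<Sum>n<m. \<tau>A (rect {x n<..} (lev q n)))" unfolding lam_def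
    by (rule N.nweight_sum(2)[OF NT.tau]) (auto intro: rect_N rect_psd)
  then show "\<tau>A (lam q x m) = (\<Sum>n<m. da (x n) * wt (lev q n))" by (simp add: tau_rect da_def)
qed

lemma lam_apply: "lam q x m k = (\<Sum>n<m. rect {x n<..} (lev q n) k)"
  unfolding lam_def by (simp add: blinfun.sum_left)

lemma W_spec_N: "B \<in> sets borel \<Longrightarrow> W.spec B \<in> tensor_Linf T M"
  by (rule N.affiliated_spec[OF W_cdd W_aff])

text \<open>The thresholds s / \<open>cq q n\<close> put every rectangle above the level s, so
  \<open>lam\<close> is dominated by the spectral projection for any smaller s''. The factor q pays
  for replacing h by the left end point of its cell.\<close>

lemma Phi_le_dW:
  assumes q: "q > 1" and s: "0 \<le> s''" "s'' < s"
  shows "\<Phi> (s * q) \<le> dW s''"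
proof -
  let ?x = "\<lambda>n. s / cq q n"
  have s0: "0 < s" using s by simp
  have "(\<Sum>n<m. da (?x n) * wt (lev q n)) \<le> dW s''" for m
  proof -
    let ?L = "lam q ?x m"
    have fix_rect: "W.spec {s''<..} (rect {?x n<..} (lev q n) k) = rect {?x n<..} (lev q n) k" for n k
      by (rule rect_below_spec[of _ _ "cq q n"])
        (use s s0 cq_pos[OF q, of n] lev_bounds[OF q] in \<open>auto intro: less_imp_le\<close>)
    have "W.spec {s''<..} (?L k) = ?L k" for k
      by (simp add: lam_apply blinfun.sum_right fix_rect)
    then have "psd (W.spec {s''<..} - ?L)"
      by (intro psd_proj_diff W.spec.proj lam(1)[OF q]) auto
    then have "\<tau>A ?L \<le> dW s''" unfolding dW_def
      by (intro N.nweight_mono[OF NT.tau] lam(2)[OF q] psd_ortho_proj[OF lam(1)[OF q]] W_spec_N) auto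
    then show ?thesis by (simp add: lam(3)[OF q])
  qed
  then have "(\<Sum>n. da (?x n) * wt (lev q n)) \<le> dW s''"
    unfolding suminf_eq_SUP by (intro SUP_least) auto
  moreover have "\<Phi> (s * q) \<le> (\<Sum>n. da (?x n) * wt (lev q n))"
    unfolding Phi_cells[OF q] Phi_cell_const[OF lev_borel]
  proof (intro suminf_le nn_integral_mono allI summableI)
    fix n t
    have "da (s * q / h t) \<le> da (?x n)" if "t \<in> lev q n"
    proof (rule antimonoD[OF da_antimono])
      have "s * h t \<le> s * (q * cq q n)" using lev_bounds[OF q that] s0 by (intro mult_left_mono) auto
      then show "?x n \<le> s * q / h t" using cq_pos[OF q, of n] h(2)[of t] by (simp add: field_simps)
    qed
    then show "da (s * q / h t) * ennreal (exp (- t)) * indicator (lev q n) t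
        \<le> da (?x n) * ennreal (exp (- t)) * indicator (lev q n) t"
      by (auto split: split_indicator intro: mult_right_mono)
  qed
  ultimately show ?thesis by (rule order_trans[rotated])
qed

definition J :: "real \<Rightarrow> nat \<Rightarrow> real set" where "J q m = (\<Union>n<m. lev q n)"

lemma J_borel [measurable]: "J q m \<in> sets borel" unfolding J_def by auto

lemma J_Suc: "J q (Suc m) = J q m \<union> lev q m" by (auto simp: J_def lessThan_Suc)

lemma J_disj:
  assumes "q > 1" shows "J q m \<inter> lev q m = {}"
proof -
  have "lev q n \<inter> lev q m = {}" if "n < m" for n
    using lev_disjoint[OF assms] that by (intro disjoint_family_onD) auto
  then show ?thesis by (auto simp: J_def)
qed

lemma rect_J_Suc: "q > 1 \<Longrightarrow> rect UNIV (J q (Suc m)) = rect UNIV (J q m) + rect UNIV (lev q m)"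
  unfolding J_Suc by (intro rect_add_right J_disj) auto

lemma rect_J_lim:
  assumes q: "q > 1" shows "(\<lambda>m. rect UNIV (J q m) k) \<longlonglongrightarrow> k"
proof -
  have "(\<lambda>n. rect UNIV (J q n) k) \<longlonglongrightarrow> id_blinfun k"
  proof (rule strong_limit_dense[where c = 1 and S = "{T \<xi> g | \<xi> g. g \<in> L2}"])
    show "norm (rect UNIV (J q n) k) \<le> 1 * norm k" for n k using ortho_projD(4)[OF rect_proj] by simp
    show "k \<in> closure (span {T \<xi> g | \<xi> g. g \<in> L2})" using T_dense by simp
    fix k assume "k \<in> {T \<xi> g | \<xi> g. g \<in> L2}"
    then obtain \<xi> g where k: "k = T \<xi> g" "g \<in> L2" by blast
    have ev: "\<forall>\<^sub>F n in sequentially. t \<in> J q n" for t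
    proof -
      obtain n where "t \<in> lev q n" using lev_Union[OF q] by blast
      then show ?thesis by (intro eventually_sequentiallyI[of "Suc n"]) (auto simp: J_def)
    qed
    show "(\<lambda>n. rect UNIV (J q n) k) \<longlonglongrightarrow> id_blinfun k"
      unfolding k(1) using T_tendsto[OF tendsto_const k(2) J_borel ev, of \<xi>]
      by (simp add: rect_apply k(2) A.spec.total)
  qed
  then show ?thesis by simp
qed

text \<open>The rectangles complementary to \<open>lam\<close> are annihilated by Q, hence Q F Q = Q
  L Q for L = \<open>lam\<close> and F the projection onto the first m level sets. The trace
  property replaces Q L Q by L Q L, which is below L, and F increases to 1.\<close>

lemma dW_le_Phi:
  assumes q: "q > 1" and s: "0 < s" "s < s'"
  shows "dW s' \<le> \<Phi> (s / q)"
proof -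
  let ?x = "\<lambda>n. s / (q * cq q n)"
  let ?Q = "W.spec {s'<..}"
  let ?F = "\<lambda>m. rect UNIV (J q m)"
  have x0: "0 \<le> ?x n" for n using s q cq_pos[OF q, of n] by simp
  have Q: "ortho_proj ?Q" "?Q \<in> tensor_Linf T M" by (auto intro: W.spec.proj W_spec_N)
  have kill: "?Q (rect {..?x n} (lev q n) k) = 0" for n k
    by (rule rect_above_spec[of _ _ "q * cq q n"])
      (use s q x0 cq_pos[OF q, of n] lev_bounds[OF q] in \<open>auto\<close>)
  have QF: "?Q (?F m k) = ?Q (lam q ?x m k)" for m k
  proof (induction m)
    case 0
    have "rect UNIV (J q 0) (T \<xi> g) = 0" if "g \<in> L2" for \<xi> g
      using that by (simp add: rect_apply J_def cind_def T_zero)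
    then have "rect UNIV (J q 0) = 0" by (intro op_eqI) simp
    then show ?case by (simp add: lam_def)
  next
    case (Suc m)
    have "rect ({..?x m} \<union> {?x m<..}) (lev q m) = rect {..?x m} (lev q m) + rect {?x m<..} (lev q m)"
      by (rule rect_add_left) auto
    moreover have "{..?x m} \<union> {?x m<..} = UNIV" by auto
    ultimately have "?Q (rect UNIV (lev q m) k) = ?Q (rect {?x m<..} (lev q m) k)"
      by (simp add: blinfun.add_left blinfun.add_right kill)
    then show ?case using Suc by (simp add: rect_J_Suc[OF q] lam_apply blinfun.add_left blinfun.add_right)
  qed
  have G: "ortho_proj (lam q ?x m)" "lam q ?x m \<in> tensor_Linf T M" for m by (rule lam[OF q])+
  let ?Z = "\<lambda>m. lam q ?x m o\<^sub>L ?Q"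
  have Zadj: "radj (?Z m) = ?Q o\<^sub>L lam q ?x m" for m
    by (simp add: radj_compose NT.proj_radj[OF Q(1)] NT.proj_radj[OF G(1)])
  have QFQ: "?Q o\<^sub>L ?F m o\<^sub>L ?Q = radj (?Z m) o\<^sub>L ?Z m" for m
    unfolding Zadj by (rule blinfun_eqI) (simp add: QF ortho_projD(1)[OF G(1)])
  have "\<tau>A (radj (?Z m) o\<^sub>L ?Z m) \<le> \<Phi> (s / q)" for m
  proof -
    have ZN: "?Z m \<in> tensor_Linf T M" using G Q by (intro N.M_closed(6))
    have "\<tau>A (radj (?Z m) o\<^sub>L ?Z m) = \<tau>A (?Z m o\<^sub>L radj (?Z m))" by (rule NT.tau_tracial[OF ZN])
    also have "\<dots> \<le> \<tau>A (lam q ?x m)"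
    proof (rule N.nweight_mono[OF NT.tau _ _ G(2)])
      have e: "(?Z m o\<^sub>L radj (?Z m)) k \<bullet> k = (norm (?Q (lam q ?x m k)))\<^sup>2" for k
        unfolding Zadj
        by (simp add: ortho_projD(2)[OF G(1)] ortho_projD(1)[OF Q(1)] ortho_projD(3)[OF Q(1)])
      have sa: "self_adj (?Z m o\<^sub>L radj (?Z m))" by (simp add: self_adj_iff_radj radj_compose radj_radj)
      show "?Z m o\<^sub>L radj (?Z m) \<in> tensor_Linf T M" by (rule N.M_closed(6)[OF ZN N.M_radj[OF ZN]])
      show "psd (?Z m o\<^sub>L radj (?Z m))" using sa e by (simp add: psd_def)
      show "psd (lam q ?x m - (?Z m o\<^sub>L radj (?Z m)))"
      proof (rule psd_diffI[OF sa])
        show "self_adj (lam q ?x m)" by (intro psd_imp_self_adj psd_ortho_proj G)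
        show "(?Z m o\<^sub>L radj (?Z m)) k \<bullet> k \<le> lam q ?x m k \<bullet> k" for k
          unfolding e ortho_projD(3)[OF G(1)] using ortho_projD(4)[OF Q(1)] by (intro power_mono) auto
      qed
    qed
    also have "\<dots> = (\<Sum>n<m. da (?x n) * wt (lev q n))" by (rule lam(3)[OF q])
    also have "\<dots> \<le> (\<Sum>n. da (?x n) * wt (lev q n))" by (intro sum_le_suminf) auto
    also have "\<dots> \<le> \<Phi> (s / q)"
      unfolding Phi_cells[OF q] Phi_cell_const[OF lev_borel]
    proof (intro suminf_le nn_integral_mono allI summableI)
      fix n t
      have "da (?x n) \<le> da (s / q / h t)" if "t \<in> lev q n"
      proof (rule antimonoD[OF da_antimono])
        have "s * cq q n \<le> s * h t" using lev_bounds[OF q that] s by (intro mult_left_mono) auto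
        then show "s / q / h t \<le> ?x n" using cq_pos[OF q, of n] h(2)[of t] q by (simp add: field_simps)
      qed
      then show "da (?x n) * ennreal (exp (- t)) * indicator (lev q n) t
          \<le> da (s / q / h t) * ennreal (exp (- t)) * indicator (lev q n) t"
        by (auto split: split_indicator intro: mult_right_mono)
    qed
    finally show ?thesis .
  qed
  moreover have "\<tau>A ?Q = (SUP m. \<tau>A (?Q o\<^sub>L ?F m o\<^sub>L ?Q))"
  proof (rule N.nweight_SUP(3)[OF NT.tau])
    fix m
    have FN: "?F m \<in> tensor_Linf T M" by (intro rect_N) auto
    show "?Q o\<^sub>L ?F m o\<^sub>L ?Q \<in> tensor_Linf T M" by (intro N.M_closed(6) Q FN)
    have cp: "psd (?Q o\<^sub>L X o\<^sub>L ?Q)" if X: "psd X" for X :: "'k bop"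
      unfolding psd_def self_adj_def
    proof (intro conjI allI)
      show "(?Q o\<^sub>L X o\<^sub>L ?Q) k \<bullet> k' = k \<bullet> (?Q o\<^sub>L X o\<^sub>L ?Q) k'" for k k'
        by (simp add: ortho_projD(2)[OF Q(1)] psdD(2)[OF X])
      have "(?Q o\<^sub>L X o\<^sub>L ?Q) k \<bullet> k = X (?Q k) \<bullet> ?Q k" for k
        by (simp only: blinfun_apply_blinfun_compose ortho_projD(2)[OF Q(1)])
      then show "0 \<le> (?Q o\<^sub>L X o\<^sub>L ?Q) k \<bullet> k" for k by (simp only: psdD(1)[OF X])
    qed
    show "psd (?Q o\<^sub>L ?F m o\<^sub>L ?Q)" by (intro cp rect_psd) auto
    have "(?Q o\<^sub>L ?F (Suc m) o\<^sub>L ?Q) - (?Q o\<^sub>L ?F m o\<^sub>L ?Q) = ?Q o\<^sub>L rect UNIV (lev q m) o\<^sub>L ?Q"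
      unfolding rect_J_Suc[OF q] by (rule blinfun_eqI) (simp add: blinfun.bilinear_simps)
    then show "psd ((?Q o\<^sub>L ?F (Suc m) o\<^sub>L ?Q) - (?Q o\<^sub>L ?F m o\<^sub>L ?Q))" by (simp add: cp rect_psd)
  next
    fix k
    show "(\<lambda>m. (?Q o\<^sub>L ?F m o\<^sub>L ?Q) k) \<longlonglongrightarrow> ?Q k"
      using blinfun.tendsto[OF tendsto_const rect_J_lim[OF q, of "?Q k"], of ?Q]
      by (simp add: ortho_projD(1)[OF Q(1)])
  qed
  ultimately show ?thesis unfolding dW_def QFQ by (simp add: SUP_le_iff)
qed

text \<open>The two comparisons are shifted by a factor greater than 1. Both functions are suprema
  of their values at points decreasing to s, which removes the shift.\<close>

lemma dW_eq_Phi: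
  assumes s: "s > 0" shows "dW s = \<Phi> s"
proof (rule antisym)
  let ?s = "\<lambda>n. s + 1 / real (Suc n)"
  note X = decseq_right_approx[of s]
  \<comment> \<open>Chosen so that s q^2 is the n-th point above s: one factor q pays for the
    discretisation, the other for the strict gap.\<close>
  define q where "q n = sqrt (?s n / s)" for n
  have q: "q n > 1" "s * q n * q n = ?s n" "s < s * q n" "s * q n < ?s n" for n
  proof -
    have r: "?s n / s > 1" using X(3)[of n] s by (simp only: less_divide_eq_1_pos)
    then show q: "q n > 1" by (simp add: q_def)
    have "q n * q n = ?s n / s" unfolding q_def by (rule real_sqrt_mult_self[THEN trans]) (use r in linarith)
    then show e: "s * q n * q n = ?s n" using s by (simp add: mult.assoc)
    show "s < s * q n" using q s by simp
    then have "s * q n * 1 < s * q n * q n" using q s by (intro mult_strict_left_mono) auto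
    then show "s * q n < ?s n" using e by simp
  qed
  have "dW s = (SUP n. dW (?s n))"
    unfolding dW_eq by (rule emeasure_Ioi_SUP[OF N.sets_wmeas X, symmetric])
  also have "\<dots> \<le> \<Phi> s"
  proof (rule SUP_least)
    fix n
    show "dW (?s n) \<le> \<Phi> s" using dW_le_Phi[OF q(1), of "s * q n" "?s n" n] q[of n] s by simp
  qed
  finally show "dW s \<le> \<Phi> s" .
  have "\<Phi> s = (\<integral>\<^sup>+t. (SUP n. da (?s n / h t) * ennreal (exp (- t))) \<partial>lborel)"
    unfolding \<Phi>_def
  proof (rule nn_integral_cong)
    fix t
    have "da (s / h t) = (SUP n. da (?s n / h t))" unfolding da_eq
    proof (rule emeasure_Ioi_SUP[OF M.sets_wmeas, symmetric])
      show "decseq (\<lambda>n. ?s n / h t)" 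
        by (intro decseq_SucI divide_right_mono decseqD[OF X(1)] less_imp_le[OF h(2)]) simp
      show "(\<lambda>n. ?s n / h t) \<longlonglongrightarrow> s / h t" by (rule tendsto_divide[OF X(2) tendsto_const]) (use h(2)[of t] in simp)
      show "s / h t < ?s n / h t" for n by (rule divide_strict_right_mono[OF X(3) h(2)])
    qed
    then show "da (s / h t) * ennreal (exp (- t)) = (SUP n. da (?s n / h t) * ennreal (exp (- t)))"
      by (simp add: SUP_mult_right_ennreal)
  qed
  also have "\<dots> = (SUP n. \<Phi> (?s n))"
    unfolding \<Phi>_def
  proof (rule nn_integral_monotone_convergence_SUP)
    show "incseq (\<lambda>n t. da (?s n / h t) * ennreal (exp (- t)))"
    proof (intro incseq_SucI le_funI mult_right_mono antimonoD[OF da_antimono] divide_right_mono)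
      show "?s (Suc n) \<le> ?s n" for n using decseqD[OF X(1), of n "Suc n"] by simp
    qed (auto intro: less_imp_le[OF h(2)])
  qed measurable
  also have "\<dots> \<le> dW s"
  proof (rule SUP_least)
    fix n
    show "\<Phi> (?s n) \<le> dW s" using Phi_le_dW[OF q(1), of s "s * q n" n] q[of n] s by simp
  qed
  finally show "\<Phi> s \<le> dW s" .
qed

end

section \<open>The layer cake formula\<close>

text \<open>The substitution y = e^{-t}, which turns e^{-t} dt into Lebesgue measure on
  levels.\<close>

lemma nn_integral_exp_level:
  assumes "v < top" shows "(\<integral>\<^sup>+t. (if ennreal (exp (- t)) < v then ennreal (exp (- t)) else 0) \<partial>lborel) = v"
proof (cases v)
  case (real r)
  show ?thesis
  proof (cases "r = 0")
    case True
    then show ?thesis using real by simp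
  next
    case False
    then have r: "r > 0" using real by simp
    have iff: "exp (- t) < r \<longleftrightarrow> - ln r < t" for t
      using ln_less_cancel_iff[of "exp (- t)" r] r by auto
    have "(\<integral>\<^sup>+t. (if ennreal (exp (- t)) < v then ennreal (exp (- t)) else 0) \<partial>lborel) =
        (\<integral>\<^sup>+t. ennreal (exp (- t)) * indicator {- ln r ..} t \<partial>lborel)"
    proof (rule nn_integral_cong_AE)
      show "AE t in lborel. (if ennreal (exp (- t)) < v then ennreal (exp (- t)) else 0) =
          ennreal (exp (- t)) * indicator {- ln r ..} t"
        using AE_lborel_singleton[of "- ln r"]
        by eventually_elim (use real in \<open>auto simp: ennreal_less_iff iff split: split_indicator\<close>)
    qed
    also have "\<dots> = ennreal (0 - (- exp (- (- ln r))))"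
    proof (rule nn_integral_FTC_atLeast)
      show "DERIV (\<lambda>t. - exp (- t)) t :> exp (- t)" for t :: real
        by (auto intro!: derivative_eq_intros)
      have "((\<lambda>t::real. exp (- t)) \<longlongrightarrow> 0) at_top"
        by (rule filterlim_compose[OF exp_at_bot filterlim_uminus_at_bot_at_top])
      then show "((\<lambda>t::real. - exp (- t)) \<longlongrightarrow> 0) at_top" using tendsto_minus by fastforce
    qed auto
    also have "\<dots> = v" using real r by simp
    finally show ?thesis .
  qed
qed (use assms in simp)

lemma layer_cake_simple:
  assumes g: "simple_function \<mu> g" "\<And>x. g x < (top :: ennreal)"
  shows "(\<integral>\<^sup>+t. emeasure \<mu> {x \<in> space \<mu>. ennreal (exp (- t)) < g x} * ennreal (exp (- t)) \<partial>lborel) = (\<integral>\<^sup>+x. g x \<partial>\<mu>)"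
proof -
  let ?V = "g ` space \<mu>"
  let ?A = "\<lambda>v. g -` {v} \<inter> space \<mu>"
  have fin: "finite ?V" by (rule simple_functionD(1)[OF g(1)])
  have A: "?A v \<in> sets \<mu>" for v using simple_functionD(2)[OF g(1)] .
  have "emeasure \<mu> {x \<in> space \<mu>. c < g x} = (\<Sum>v\<in>?V. if c < v then emeasure \<mu> (?A v) else 0)" for c
  proof -
    have "emeasure \<mu> {x \<in> space \<mu>. c < g x} = emeasure \<mu> (\<Union>v\<in>{v \<in> ?V. c < v}. ?A v)"
      by (rule arg_cong[of _ _ "emeasure \<mu>"]) auto
    also have "\<dots> = (\<Sum>v\<in>{v \<in> ?V. c < v}. emeasure \<mu> (?A v))"
      by (rule sum_emeasure[symmetric]) (use fin A in \<open>auto simp: disjoint_family_on_def\<close>)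
    also have "\<dots> = (\<Sum>v\<in>?V. if c < v then emeasure \<mu> (?A v) else 0)"
      using fin by (simp add: sum.inter_filter)
    finally show ?thesis .
  qed
  then have "(\<integral>\<^sup>+t. emeasure \<mu> {x \<in> space \<mu>. ennreal (exp (- t)) < g x} * ennreal (exp (- t)) \<partial>lborel) =
      (\<integral>\<^sup>+t. (\<Sum>v\<in>?V. emeasure \<mu> (?A v) * (if ennreal (exp (- t)) < v then ennreal (exp (- t)) else 0)) \<partial>lborel)"
    by (simp add: sum_distrib_right if_distrib cong: if_cong sum.cong)
      (intro nn_integral_cong sum.cong, auto)
  also have "\<dots> = (\<Sum>v\<in>?V. emeasure \<mu> (?A v) * (\<integral>\<^sup>+t. (if ennreal (exp (- t)) < v then ennreal (exp (- t)) else 0) \<partial>lborel))"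
    by (subst nn_integral_sum) (simp_all add: nn_integral_cmult)
  also have "\<dots> = (\<Sum>v\<in>?V. v * emeasure \<mu> (?A v))"
    using g(2) by (intro sum.cong refl) (auto simp: nn_integral_exp_level mult.commute)
  also have "\<dots> = (\<integral>\<^sup>+x. g x \<partial>\<mu>)"
    by (simp add: nn_integral_eq_simple_integral[OF g(1)] simple_integral_def)
  finally show ?thesis .
qed

text \<open>Proved through simple functions instead of Fubini, because the measure in question, a
  trace composed with a spectral measure, need not be sigma-finite.\<close>

lemma layer_cake:
  assumes g: "g \<in> borel_measurable \<mu>"
  shows "(\<integral>\<^sup>+t. emeasure \<mu> {x \<in> space \<mu>. ennreal (exp (- t)) < g x} * ennreal (exp (- t)) \<partial>lborel) = (\<integral>\<^sup>+x. g x \<partial>\<mu>)"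
proof -
  obtain f where f: "\<And>i::nat. simple_function \<mu> (f i)" "incseq f" "\<And>i x. f i x < top" "\<And>x. (SUP i. f i x) = g x"
    using borel_measurable_implies_simple_function_sequence'[OF g] by metis
  let ?D = "\<lambda>g t. emeasure \<mu> {x \<in> space \<mu>. ennreal (exp (- t)) < g x} * ennreal (exp (- t))"
  have fm: "f i \<in> borel_measurable \<mu>" for i by (rule borel_measurable_simple_function[OF f(1)])
  have meas: "{x \<in> space \<mu>. c < f i x} \<in> sets \<mu>" for c i using fm[of i] by measurable
  have fle: "f i x \<le> f j x" if "i \<le> j" for i j x using incseqD[OF f(2) that] by (simp add: le_fun_def)
  have D: "?D g t = (SUP i. ?D (f i) t)" for t
  proof -
    let ?c = "ennreal (exp (- t))"
    have "{x \<in> space \<mu>. ?c < g x} = (\<Union>i. {x \<in> space \<mu>. ?c < f i x})"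
      by (auto simp: f(4)[symmetric] less_SUP_iff)
    moreover have "(SUP i. emeasure \<mu> {x \<in> space \<mu>. ?c < f i x}) = emeasure \<mu> (\<Union>i. {x \<in> space \<mu>. ?c < f i x})"
    proof (rule SUP_emeasure_incseq)
      show "range (\<lambda>i. {x \<in> space \<mu>. ?c < f i x}) \<subseteq> sets \<mu>" using meas by blast
      show "incseq (\<lambda>i. {x \<in> space \<mu>. ?c < f i x})"
      proof (rule incseq_SucI, rule subsetI)
        fix i x assume "x \<in> {x \<in> space \<mu>. ?c < f i x}"
        then show "x \<in> {x \<in> space \<mu>. ?c < f (Suc i) x}" using fle[of i "Suc i" x] by auto
      qed
    qed
    ultimately show ?thesis by (simp only: SUP_mult_right_ennreal[symmetric])
  qed
  have Dm: "?D (f i) \<in> borel_measurable lborel" for i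
  proof -
    have "mono (\<lambda>t. emeasure \<mu> {x \<in> space \<mu>. ennreal (exp (- t)) < f i x})"
    proof (intro monoI emeasure_mono subsetI)
      fix s t :: real and x assume st: "s \<le> t" and x: "x \<in> {x \<in> space \<mu>. ennreal (exp (- s)) < f i x}"
      have "ennreal (exp (- t)) \<le> ennreal (exp (- s))" using st by (intro ennreal_leI) simp
      also have "\<dots> < f i x" using x by simp
      finally show "x \<in> {x \<in> space \<mu>. ennreal (exp (- t)) < f i x}" using x by simp
    qed (rule meas)
    from borel_measurable_mono_ennreal[OF this] show ?thesis by simp
  qed
  have "(\<integral>\<^sup>+t. ?D g t \<partial>lborel) = (SUP i. \<integral>\<^sup>+t. ?D (f i) t \<partial>lborel)"
    unfolding D
  proof (rule nn_integral_monotone_convergence_SUP[OF _ Dm])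
    show "incseq (\<lambda>i. ?D (f i))"
    proof (intro incseq_SucI le_funI mult_right_mono emeasure_mono meas subsetI)
      fix i t x assume "x \<in> {x \<in> space \<mu>. ennreal (exp (- t)) < f i x}"
      then show "x \<in> {x \<in> space \<mu>. ennreal (exp (- t)) < f (Suc i) x}" using fle[of i "Suc i" x] by auto
    qed auto
  qed
  also have "\<dots> = (SUP i. \<integral>\<^sup>+x. f i x \<partial>\<mu>)" by (simp add: layer_cake_simple[OF f(1) f(3)])
  also have "\<dots> = (\<integral>\<^sup>+x. (SUP i. f i x) \<partial>\<mu>)"
    by (rule nn_integral_monotone_convergence_SUP[OF f(2) fm, symmetric])
  finally show ?thesis by (simp add: f(4))
qed

section \<open>Orlicz functions\<close>

locale orlicz =
  fixes \<psi> :: "real \<Rightarrow> ennreal"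
  assumes orlicz: "orlicz_function \<psi>"
begin

lemma convex:
  "0 \<le> u \<Longrightarrow> 0 \<le> v \<Longrightarrow> 0 \<le> r \<Longrightarrow> r \<le> 1 \<Longrightarrow> \<psi> ((1 - r) * u + r * v) \<le> ennreal (1 - r) * \<psi> u + ennreal r * \<psi> v"
  using orlicz by (simp add: orlicz_function_def)

lemma zero: "\<psi> 0 = 0" using orlicz by (simp add: orlicz_function_def)

lemma at_top: "(\<psi> \<longlongrightarrow> \<infinity>) at_top" using orlicz by (simp add: orlicz_function_def)

lemma scale: "0 \<le> u \<Longrightarrow> 0 \<le> r \<Longrightarrow> r \<le> 1 \<Longrightarrow> \<psi> (r * u) \<le> ennreal r * \<psi> u"
  using convex[of 0 u r] by (simp add: zero)

lemma mono: assumes "0 \<le> u" "u \<le> v" shows "\<psi> u \<le> \<psi> v"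
proof (cases "v = 0")
  case False
  then have "\<psi> (u / v * v) \<le> ennreal (u / v) * \<psi> v" using assms by (intro scale) auto
  also have "\<dots> \<le> ennreal 1 * \<psi> v" using assms False by (intro mult_right_mono ennreal_leI) auto
  finally show ?thesis using False by simp
qed (use assms in simp)

lemma ex_large: "\<exists>u>0. ennreal C < \<psi> u"
proof -
  have "\<forall>\<^sub>F u in at_top. ennreal C < \<psi> u" using at_top by (rule order_tendstoD) simp
  moreover have "\<forall>\<^sub>F u in at_top. (0::real) < u" by (rule eventually_gt_at_top)
  ultimately have "\<forall>\<^sub>F u in at_top. 0 < u \<and> ennreal C < \<psi> u" by eventually_elim simp
  then show ?thesis using eventually_happens[of _ "at_top :: real filter"] by auto
qed

abbreviation "oinv \<equiv> orlicz_inverse \<psi>"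

lemma level_set:
  "bdd_above {s. 0 \<le> s \<and> \<psi> s \<le> ennreal y}" "0 \<in> {s. 0 \<le> s \<and> \<psi> s \<le> ennreal y}"
proof -
  obtain u where u: "u > 0" "ennreal y < \<psi> u" using ex_large by blast
  have "s \<le> u" if "0 \<le> s" "\<psi> s \<le> ennreal y" for s
  proof (rule ccontr)
    assume "\<not> s \<le> u"
    then have "\<psi> u \<le> \<psi> s" using u by (intro mono) auto
    then show False using u that by simp
  qed
  then show "bdd_above {s. 0 \<le> s \<and> \<psi> s \<le> ennreal y}" by (intro bdd_aboveI[of _ u]) auto
qed (simp add: zero)

lemma inv_pos: assumes "y > 0" shows "oinv y > 0"
proof -
  obtain u where u: "u > 0" "\<psi> u < \<infinity>" using orlicz by (auto simp: orlicz_function_def)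
  then obtain p where p: "\<psi> u = ennreal p" "p \<ge> 0" by (cases "\<psi> u") auto
  \<comment> \<open>Gives r p <= y and r <= 1, also when p = 0.\<close>
  define r where "r = y / (p + y)"
  have r: "0 < r" "r \<le> 1" "r * p \<le> y"
    using assms p by (auto simp: r_def field_simps)
  have "\<psi> (r * u) \<le> ennreal r * ennreal p" using scale[of u r] u r p by simp
  also have "\<dots> \<le> ennreal y" using r p by (simp add: ennreal_mult[symmetric] ennreal_leI)
  finally have "r * u \<le> oinv y" unfolding orlicz_inverse_def
    using u r by (intro cSup_upper level_set) auto
  then show ?thesis using u r by (smt (verit) mult_pos_pos)
qed

lemma below_inv: assumes "0 \<le> u" "u < oinv y" shows "\<psi> u \<le> ennreal y"
proof -
  have "\<exists>s\<in>{s. 0 \<le> s \<and> \<psi> s \<le> ennreal y}. u < s"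
    using assms(2) level_set[of y] unfolding orlicz_inverse_def by (subst (asm) less_cSup_iff) blast+
  then obtain s where "0 \<le> s" "\<psi> s \<le> ennreal y" "u < s" by blast
  then show ?thesis using mono[of u s] assms(1) by simp
qed

text \<open>The supremum defining the inverse is attained. If \<psi> is finite somewhere beyond it,
  convexity bounds the value from both sides; otherwise it is the point b of the definition, where
  left continuity applies.\<close>

lemma at_inv: assumes y: "y > 0" shows "\<psi> (oinv y) \<le> ennreal y"
proof (cases "\<exists>v > oinv y. \<psi> v < \<infinity>")
  case True
  then obtain v where v: "v > oinv y" "\<psi> v < \<infinity>" by blast
  then obtain p where p: "\<psi> v = ennreal p" "p \<ge> 0" by (cases "\<psi> v") auto
  let ?b = "oinv y"
  note b = inv_pos[OF y]
  show ?thesis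
  proof (rule ennreal_le_epsilon)
    fix e :: real assume e: "e > 0"
    \<comment> \<open>The first entry keeps u nonnegative, the second makes the contribution r p of
      the far point at most e.\<close>
    define r where "r = min (?b / v) (e / (p + 1))"
    have vp: "v > 0" using v b by simp
    have r: "0 < r" "r < 1" "r * v \<le> ?b" "r * p \<le> e"
    proof -
      show "0 < r" using b e p vp by (simp add: r_def)
      have "?b / v < 1" using v b by simp
      then show "r < 1" unfolding r_def by linarith
      have "r * v \<le> ?b / v * v" using vp by (intro mult_right_mono) (auto simp: r_def)
      then show "r * v \<le> ?b" using vp by simp
      have "r * p \<le> e / (p + 1) * p" using p by (intro mult_right_mono) (auto simp: r_def)
      also have "\<dots> \<le> e" using p e by (simp add: field_simps)
      finally show "r * p \<le> e" .
    qed
    define u where "u = (?b - r * v) / (1 - r)"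
    have u: "0 \<le> u" "u < ?b"
    proof -
      show "0 \<le> u" using r by (simp add: u_def)
      have "r * ?b < r * v" using r v by simp
      then have "?b - r * v < ?b * (1 - r)" by (simp add: algebra_simps)
      then show "u < ?b" using r by (simp add: u_def pos_divide_less_eq)
    qed
    have "(1 - r) * u + r * v = ?b" using r by (simp add: u_def)
    then have "\<psi> ?b \<le> ennreal (1 - r) * \<psi> u + ennreal r * \<psi> v"
      using convex[of u v r] u vp r by simp
    also have "\<dots> \<le> ennreal 1 * ennreal y + ennreal (r * p)"
      using below_inv[OF u] r p by (intro add_mono mult_mono ennreal_leI) (auto simp: ennreal_mult)
    also have "\<dots> \<le> ennreal y + ennreal e" using r by (intro add_mono ennreal_leI) auto
    finally show "\<psi> ?b \<le> ennreal y + ennreal e" .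
  qed
next
  case False
  let ?S = "{u. 0 < u \<and> \<psi> u < \<infinity>}"
  let ?b = "oinv y"
  note b = inv_pos[OF y]
  have ub: "u \<le> ?b" if "u \<in> ?S" for u using False that by force
  have mem: "u \<in> ?S" if "0 < u" "u < ?b" for u
    using below_inv[of u y] that by (auto intro: le_less_trans)
  have "Sup ?S = ?b"
  proof (rule cSup_eq_non_empty)
    have "?b / 2 \<in> ?S" using b by (intro mem) auto
    then show "?S \<noteq> {}" by blast
    fix z assume z: "\<And>u. u \<in> ?S \<Longrightarrow> u \<le> z"
    show "?b \<le> z"
    proof (rule dense_le_bounded[OF b])
      fix w assume "0 < w" "w < ?b"
      then show "w \<le> z" using z mem by blast
    qed
  qed (rule ub)
  moreover have "bdd_above ?S" using ub by (intro bdd_aboveI)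
  ultimately have lim: "(\<psi> \<longlongrightarrow> \<psi> ?b) (at_left ?b)" using orlicz by (simp add: orlicz_function_def)
  have "\<forall>\<^sub>F u in at_left ?b. \<psi> u \<le> ennreal y"
    using eventually_at_leftI[of 0 ?b "\<lambda>u. \<psi> u \<le> ennreal y"] below_inv b by auto
  then show ?thesis by (rule tendsto_upperbound[OF lim]) simp
qed

lemma le_iff_inv: assumes "0 \<le> u" "y > 0" shows "\<psi> u \<le> ennreal y \<longleftrightarrow> u \<le> oinv y"
proof
  assume "\<psi> u \<le> ennreal y"
  then show "u \<le> oinv y" unfolding orlicz_inverse_def using assms by (intro cSup_upper level_set) auto
next
  assume "u \<le> oinv y"
  then show "\<psi> u \<le> ennreal y" using mono[OF assms(1)] at_inv[OF assms(2)] by (meson order_trans)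
qed

lemma inv_mono: assumes "0 < x" "x \<le> y" shows "oinv x \<le> oinv y"
proof -
  have "\<psi> (oinv x) \<le> ennreal y" using at_inv[OF assms(1)] assms(2) ennreal_leI order_trans by blast
  then show ?thesis using le_iff_inv[of "oinv x" y] inv_pos[of x] assms by simp
qed

abbreviation fund :: "real \<Rightarrow> real" where "fund \<equiv> (\<lambda>t. fundamental_fun \<psi> (exp t))"

lemma fund: "fund t = 1 / oinv (exp (- t))" "fund t > 0"
  by (simp_all add: fundamental_fun_def exp_minus divide_inverse inv_pos)

lemma fund_borel: "fund \<in> borel_measurable borel"
proof (rule borel_measurable_mono, rule monoI)
  fix s t :: real assume "s \<le> t"
  then have "oinv (exp (- t)) \<le> oinv (exp (- s))" by (intro inv_mono) auto
  then show "fund s \<le> fund t" unfolding fund(1) by (intro divide_left_mono) (auto simp: inv_pos)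
qed

lemma level_iff: assumes s: "s > 0" and x: "x \<ge> 0"
  shows "ennreal (exp (- t)) < \<psi> (x / s) \<longleftrightarrow> s / fund t < x"
  using le_iff_inv[of "x / s" "exp (- t)"] s x by (auto simp: fund(1) field_simps not_le[symmetric])

lemma dilate_borel: assumes "s > 0" shows "(\<lambda>x. \<psi> (x / s) * indicator {0..} x) \<in> borel_measurable borel"
  by (rule borel_measurable_mono_ennreal)
    (use assms in \<open>auto intro!: monoI mono divide_right_mono split: split_indicator\<close>)

end

section \<open>The modular, singular values and the membership conditions\<close>

locale tensor_orlicz = orlicz \<psi> + tensor_weight T M a "\<lambda>t. fundamental_fun \<psi> (exp t)" \<tau> \<tau>A
  for \<psi> and T :: "'h::chilbert_space \<Rightarrow> (real \<Rightarrow> complex) \<Rightarrow> 'k::chilbert_space" and M a \<tau> \<tau>A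
begin

text \<open>By \<open>ext_trace_ext_fun_calc\<close> this is the trace of \<psi>(|a|/s).\<close>

definition modular :: "real \<Rightarrow> ennreal" where
  "modular s = (\<integral>\<^sup>+x\<in>{0..}. \<psi> (x / s) \<partial>M.wmeas \<tau> A.spec)"

lemma modular_layers:
  assumes s: "s > 0" shows "modular s = (\<integral>\<^sup>+t. da (s / fund t) * ennreal (exp (- t)) \<partial>lborel)"
proof -
  let ?g = "\<lambda>x. \<psi> (x / s) * indicator {0..} x"
  have g: "?g \<in> borel_measurable (M.wmeas \<tau> A.spec)" using dilate_borel[OF s] by simp
  have "{x \<in> space (M.wmeas \<tau> A.spec). ennreal (exp (- t)) < ?g x} = {s / fund t<..}" for t
  proof -
    have "0 \<le> x" if "s / fund t < x" for x
      using that divide_pos_pos[OF s fund(2)[of t]] by linarith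
    then show ?thesis using level_iff[OF s, of _ t] by (auto split: split_indicator_asm simp: indicator_def)
  qed
  then show ?thesis unfolding modular_def layer_cake[OF g, symmetric] by (simp add: da_eq)
qed

lemma dW_eq_modular: "s > 0 \<Longrightarrow> dW s = modular s"
  by (simp add: dW_eq_Phi modular_layers \<Phi>_def)

lemma dW_antimono: "antimono dW"
  using emeasure_Ioi_antimono[OF N.sets_wmeas] by (simp add: dW_eq[abs_def])

lemma modular_scale:
  assumes s: "s > 0" and r: "r \<ge> 1" shows "modular (r * s) \<le> ennreal (1 / r) * modular s"
proof -
  have "modular (r * s) \<le> (\<integral>\<^sup>+x. ennreal (1 / r) * (\<psi> (x / s) * indicator {0..} x) \<partial>M.wmeas \<tau> A.spec)"
    unfolding modular_def
  proof (rule nn_integral_mono)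
    fix x
    have "\<psi> (1 / r * (x / s)) \<le> ennreal (1 / r) * \<psi> (x / s)" if "x \<ge> 0"
      using that s r by (intro scale) auto
    then show "\<psi> (x / (r * s)) * indicator {0..} x \<le> ennreal (1 / r) * (\<psi> (x / s) * indicator {0..} x)"
      by (simp split: split_indicator)
  qed
  also have "\<dots> = ennreal (1 / r) * modular s"
    unfolding modular_def by (rule nn_integral_cmult) (use dilate_borel[OF s] in simp)
  finally show ?thesis .
qed

lemma da_right: "(SUP n. da (x + 1 / real (Suc n))) = da x"
  unfolding da_eq by (rule emeasure_Ioi_SUP[OF M.sets_wmeas decseq_right_approx])

lemma dist_a: "distribution_fun \<tau> a s = da s"
  by (simp add: MT.distribution_fun_eq[OF a] da_def)

lemma dist_W: "distribution_fun \<tau>A W s = dW s"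
  by (simp add: NT.distribution_fun_eq[OF W_cdd W_aff] dW_def)

lemma luxemburg_eq: "luxemburg_norm M \<tau> \<psi> a = sing_val \<tau>A 1 W"
proof -
  have "ext_trace M \<tau> (ext_fun_calc (\<lambda>s. \<psi> (s / l)) (abs_op a)) = dW l" if "l > 0" for l
    using MT.ext_trace_ext_fun_calc[OF A_pvm spectral_measure_abs_op[OF a(1)] dilate_borel[OF that]]
    by (simp add: dW_eq_modular[OF that] modular_def)
  then have 1: "luxemburg_norm M \<tau> \<psi> a = Inf (ennreal ` {l. 0 < l \<and> dW l \<le> 1})"
    unfolding luxemburg_norm_def by (intro arg_cong[of _ _ Inf] image_cong) auto
  have 2: "sing_val \<tau>A 1 W = Inf (ennreal ` {s. 0 \<le> s \<and> dW s \<le> 1})"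
    by (simp add: sing_val_def dist_W)
  show ?thesis unfolding 1 2
  proof (rule antisym)
    show "Inf (ennreal ` {l. 0 < l \<and> dW l \<le> 1}) \<le> Inf (ennreal ` {s. 0 \<le> s \<and> dW s \<le> 1})"
    proof (rule INF_greatest)
      fix s assume s: "s \<in> {s. 0 \<le> s \<and> dW s \<le> 1}"
      show "Inf (ennreal ` {l. 0 < l \<and> dW l \<le> 1}) \<le> ennreal s"
      \<comment> \<open>The two index sets can differ only in the point 0, which is approached by
        positive s + e.\<close>
      proof (rule ennreal_le_epsilon)
        fix e :: real assume e: "e > 0"
        have "dW (s + e) \<le> dW s" using e by (intro antimonoD[OF dW_antimono]) simp
        then have "s + e \<in> {l. 0 < l \<and> dW l \<le> 1}" using s e by auto
        then have "Inf (ennreal ` {l. 0 < l \<and> dW l \<le> 1}) \<le> ennreal (s + e)" by (rule INF_lower)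
        then show "Inf (ennreal ` {l. 0 < l \<and> dW l \<le> 1}) \<le> ennreal s + ennreal e" using s e by simp
      qed
    qed
    show "Inf (ennreal ` {s. 0 \<le> s \<and> dW s \<le> 1}) \<le> Inf (ennreal ` {l. 0 < l \<and> dW l \<le> 1})"
      by (intro Inf_superset_mono image_mono) auto
  qed
qed

text \<open>Right continuity of \<open>da\<close> makes the infimum a minimum, and measurability of
  a makes it finite, so \<open>enn2real\<close> does not alter it.\<close>

lemma sing_val_le_iff:
  assumes m: "a \<in> measurable_ops M \<tau>" and t: "t > 0" and x: "x \<ge> 0"
  shows "enn2real (sing_val \<tau> t a) \<le> x \<longleftrightarrow> da x \<le> ennreal t"
proof -
  let ?S = "{s. 0 \<le> s \<and> da s \<le> ennreal t}"
  have ne: "?S \<noteq> {}" using m t unfolding MT.measurable_ops_iff[OF a] dist_a by blast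
  have bdd: "bdd_below ?S" by (intro bdd_belowI[of _ 0]) auto
  have "da (Inf ?S) \<le> ennreal t"
    unfolding da_right[of "Inf ?S", symmetric]
  proof (rule SUP_least)
    fix n
    have "\<exists>s\<in>?S. s < Inf ?S + 1 / real (Suc n)" by (subst cInf_less_iff[OF ne bdd, symmetric]) simp
    then obtain s where "s \<in> ?S" "s < Inf ?S + 1 / real (Suc n)" by blast
    then show "da (Inf ?S + 1 / real (Suc n)) \<le> ennreal t"
      using antimonoD[OF da_antimono, of s "Inf ?S + 1 / real (Suc n)"] by auto
  qed
  moreover have I0: "0 \<le> Inf ?S" using ne by (intro cInf_greatest) auto
  ultimately have mem: "Inf ?S \<in> ?S" by simp
  have "sing_val \<tau> t a = ennreal (Inf ?S)" unfolding sing_val_def dist_a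
  proof (rule antisym)
    show "Inf (ennreal ` ?S) \<le> ennreal (Inf ?S)" using mem by (rule INF_lower)
    show "ennreal (Inf ?S) \<le> Inf (ennreal ` ?S)"
      by (intro INF_greatest ennreal_leI cInf_lower bdd)
  qed
  then have e: "enn2real (sing_val \<tau> t a) = Inf ?S" using I0 by simp
  show ?thesis unfolding e
  proof
    assume "Inf ?S \<le> x"
    then have "da x \<le> da (Inf ?S)" by (rule antimonoD[OF da_antimono])
    also have "\<dots> \<le> ennreal t" using mem by simp
    finally show "da x \<le> ennreal t" .
  next
    assume "da x \<le> ennreal t"
    then show "Inf ?S \<le> x" using x bdd by (intro cInf_lower) auto
  qed
qed

lemma emeasure_Ioo_ennreal: "emeasure lborel {t. 0 < t \<and> ennreal t < D} = D"
proof (cases D)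
  case (real r)
  then have "{t. 0 < t \<and> ennreal t < D} = {0<..<r}" by (auto simp: ennreal_less_iff)
  then show ?thesis using real by simp
next
  case top
  then have "{t. 0 < t \<and> ennreal t < D} = {0<..}" by auto
  moreover have "emeasure lborel {0::real<..} = \<infinity>"
  proof (rule ccontr)
    assume "emeasure lborel {0::real<..} \<noteq> \<infinity>"
    then obtain r where r: "emeasure lborel {0::real<..} = ennreal r" "r \<ge> 0" by (cases "emeasure lborel {0::real<..}") auto
    have "emeasure lborel {0<..<r + 1} \<le> emeasure lborel {0::real<..}" by (rule emeasure_mono) auto
    then show False using r by simp
  qed
  ultimately show ?thesis using top by simp
qed

lemma sing_val_antimono:
  assumes m: "a \<in> measurable_ops M \<tau>" and t: "0 < s" "s \<le> t"
  shows "enn2real (sing_val \<tau> t a) \<le> enn2real (sing_val \<tau> s a)"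
proof -
  have "da (enn2real (sing_val \<tau> s a)) \<le> ennreal s" using sing_val_le_iff[OF m t(1) enn2real_nonneg, THEN iffD1, OF order_refl] .
  also have "\<dots> \<le> ennreal t" using t by (intro ennreal_leI)
  finally show ?thesis using sing_val_le_iff[OF m, of t] t by simp
qed

text \<open>Both sides have the same layers: by \<open>sing_val_le_iff\<close> the set of t whose
  singular value exceeds x is an initial interval of length \<open>da x\<close>.\<close>

lemma sing_val_modular:
  assumes m: "a \<in> measurable_ops M \<tau>" and al: "\<alpha> > 0"
  shows "(\<integral>\<^sup>+t\<in>{0<..}. \<psi> (\<alpha> * \<bar>enn2real (sing_val \<tau> t a)\<bar>) \<partial>lborel) = modular (1 / \<alpha>)"
proof -
  let ?m = "\<lambda>t. enn2real (sing_val \<tau> t a)"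
  let ?g = "\<lambda>t. \<psi> (\<alpha> * \<bar>?m t\<bar>) * indicator {0<..} t"
  have anti: "?g t \<le> ?g s" if "0 < s" "s \<le> t" for s t
    using sing_val_antimono[OF m that] that al by (auto intro!: mono)
  have gm: "?g \<in> borel_measurable lborel"
  proof -
    have "?g \<in> borel_measurable borel"
    proof (rule borel_measurableI_greater)
      fix y
      have "is_interval {t. y < ?g t}" unfolding is_interval_1
      proof (intro ballI allI impI)
        fix u v w assume *: "u \<in> {t. y < ?g t}" "v \<in> {t. y < ?g t}" "u \<le> w \<and> w \<le> v"
        have "0 < u" using *(1) by (auto split: split_indicator_asm)
        then have "?g v \<le> ?g w" using * by (intro anti) auto
        then show "w \<in> {t. y < ?g t}" using *(2) by auto
      qed
      then show "{t \<in> space borel. y < ?g t} \<in> sets borel" by (simp add: real_interval_borel_measurable)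
    qed
    then show ?thesis by simp
  qed
  have "{t \<in> space lborel. ennreal (exp (- r)) < ?g t} = {t. 0 < t \<and> ennreal t < da ((1 / \<alpha>) / fund r)}" for r
  proof -
    have "ennreal (exp (- r)) < \<psi> (\<alpha> * ?m t) \<longleftrightarrow> ennreal t < da ((1 / \<alpha>) / fund r)" if t: "t > 0" for t
      using level_iff[of "1 / \<alpha>" "?m t" r] al sing_val_le_iff[OF m t, of "(1 / \<alpha>) / fund r"] fund(2)[of r]
      by (simp add: mult.commute not_le[symmetric])
    then show ?thesis by (auto simp: indicator_def split: if_splits)
  qed
  then show ?thesis unfolding layer_cake[OF gm, symmetric]
    using al by (simp add: emeasure_Ioo_ennreal modular_layers)
qed

lemma sing_val_borel:
  assumes m: "a \<in> measurable_ops M \<tau>"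
  shows "(\<lambda>t. enn2real (sing_val \<tau> t a)) \<in> borel_measurable (restrict_space lborel {0<..})"
proof -
  have "mono_on {0<..} (\<lambda>t. - enn2real (sing_val \<tau> t a))"
    by (rule mono_onI) (use sing_val_antimono[OF m] in auto)
  then have "(\<lambda>t. - enn2real (sing_val \<tau> t a)) \<in> borel_measurable (restrict_space borel {0<..})"
    by (rule borel_measurable_mono_on_fnc)
  then have "(\<lambda>t. - (- enn2real (sing_val \<tau> t a))) \<in> borel_measurable (restrict_space borel {0<..})"
    by (rule borel_measurable_uminus)
  then show ?thesis
    by (simp cong: measurable_cong_sets[OF sets_restrict_space_cong[OF sets_lborel] refl])
qed

lemma markov: assumes s: "s > 0" and u: "u \<ge> 0" shows "\<psi> (u / s) * da u \<le> modular s"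
proof -
  have "\<psi> (u / s) * da u = (\<integral>\<^sup>+x. \<psi> (u / s) * indicator {u<..} x \<partial>M.wmeas \<tau> A.spec)"
    by (simp add: nn_integral_cmult_indicator da_eq)
  also have "\<dots> \<le> modular s" unfolding modular_def
  proof (rule nn_integral_mono)
    fix x
    have "\<psi> (u / s) \<le> \<psi> (x / s)" if "u < x" using that s u by (intro mono divide_right_mono) auto
    then show "\<psi> (u / s) * indicator {u<..} x \<le> \<psi> (x / s) * indicator {0..} x"
      using u by (auto split: split_indicator)
  qed
  finally show ?thesis .
qed

lemma measurable_if_modular_finite:
  assumes s: "s > 0" and fin: "modular s < \<infinity>"
  shows "a \<in> measurable_ops M \<tau>" "W \<in> measurable_ops (tensor_Linf T M) \<tau>A"
proof -
  obtain p where p: "modular s = ennreal p" "p \<ge> 0" using fin by (cases "modular s") auto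
  show "a \<in> measurable_ops M \<tau>" unfolding MT.measurable_ops_iff[OF a] dist_a
  proof (intro allI impI)
    fix \<epsilon> :: real assume e: "\<epsilon> > 0"
    \<comment> \<open>At this height the Markov bound gives \<open>da\<close> at most \<epsilon> p /
      (p + 1); adding 1 keeps the height positive when p = 0.\<close>
    obtain v where v: "v > 0" "ennreal ((p + 1) / \<epsilon>) < \<psi> v" using ex_large by blast
    have "ennreal ((p + 1) / \<epsilon>) * da (v * s) \<le> \<psi> (v * s / s) * da (v * s)"
      using v s by (intro mult_right_mono) auto
    also have "\<dots> \<le> ennreal p" unfolding p(1)[symmetric] using s v by (intro markov) auto
    finally have le: "ennreal ((p + 1) / \<epsilon>) * da (v * s) \<le> ennreal p" .
    have "da (v * s) = ennreal (\<epsilon> / (p + 1)) * (ennreal ((p + 1) / \<epsilon>) * da (v * s))"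
      using e p by (simp add: mult.assoc[symmetric] ennreal_mult[symmetric])
    also have "\<dots> \<le> ennreal (\<epsilon> / (p + 1)) * ennreal p" by (rule mult_left_mono[OF le]) simp
    also have "\<dots> \<le> ennreal \<epsilon>" using e p by (simp add: ennreal_mult[symmetric] field_simps)
    finally show "\<exists>s\<ge>0. da s \<le> ennreal \<epsilon>" using v s by (intro exI[of _ "v * s"]) auto
  qed
  show "W \<in> measurable_ops (tensor_Linf T M) \<tau>A" unfolding NT.measurable_ops_iff[OF W_cdd W_aff] dist_W
  proof (intro allI impI)
    fix \<epsilon> :: real assume e: "\<epsilon> > 0"
    \<comment> \<open>Ensures r >= 1 for \<open>modular_scale\<close> and p / r <=
      \<epsilon>.\<close>
    define r where "r = p / \<epsilon> + 1"
    have r: "r \<ge> 1" using e p by (simp add: r_def)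
    have "dW (r * s) \<le> ennreal (1 / r) * ennreal p"
      using modular_scale[OF s r] dW_eq_modular[of "r * s"] r s p(1) by simp
    also have "\<dots> \<le> ennreal \<epsilon>" using e p by (simp add: ennreal_mult[symmetric] r_def field_simps)
    finally show "\<exists>s\<ge>0. dW s \<le> ennreal \<epsilon>" using r s by (intro exI[of _ "r * s"]) auto
  qed
qed

lemma orlicz_space_iff: "a \<in> orlicz_space M \<tau> \<psi> \<longleftrightarrow> W \<in> measurable_ops (tensor_Linf T M) \<tau>A"
proof
  assume "a \<in> orlicz_space M \<tau> \<psi>"
  then obtain \<alpha> where m: "a \<in> measurable_ops M \<tau>" and al: "\<alpha> > 0"
      "(\<integral>\<^sup>+t\<in>{0<..}. \<psi> (\<alpha> * \<bar>enn2real (sing_val \<tau> t a)\<bar>) \<partial>lborel) < \<infinity>"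
    by (auto simp: orlicz_space_def classical_orlicz_def)
  then show "W \<in> measurable_ops (tensor_Linf T M) \<tau>A"
    using measurable_if_modular_finite(2)[of "1 / \<alpha>"] sing_val_modular[OF m al(1)] by simp
next
  assume "W \<in> measurable_ops (tensor_Linf T M) \<tau>A"
  then obtain s where s: "s \<ge> 0" "dW s \<le> ennreal 1"
    unfolding NT.measurable_ops_iff[OF W_cdd W_aff] dist_W using zero_less_one by blast
  \<comment> \<open>The witness s may be 0, where \<open>dW\<close> is not yet identified with the
    modular, so a positive point to its right is used.\<close>
  have "dW (s + 1) \<le> dW s" by (intro antimonoD[OF dW_antimono]) simp
  also note s(2)
  also have "ennreal 1 < \<infinity>" by simp
  finally have "dW (s + 1) < \<infinity>" .
  then have fin: "modular (s + 1) < \<infinity>" using dW_eq_modular[of "s + 1"] s(1) by simp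
  have m: "a \<in> measurable_ops M \<tau>" by (rule measurable_if_modular_finite(1)[OF _ fin]) (use s in simp)
  have "\<exists>\<alpha>>0. (\<integral>\<^sup>+t\<in>{0<..}. \<psi> (\<alpha> * \<bar>enn2real (sing_val \<tau> t a)\<bar>) \<partial>lborel) < \<infinity>"
    using sing_val_modular[OF m, of "1 / (s + 1)"] fin s(1) by (intro exI[of _ "1 / (s + 1)"]) auto
  then show "a \<in> orlicz_space M \<tau> \<psi>"
    using m sing_val_borel[OF m] by (simp add: orlicz_space_def classical_orlicz_def)
qed

end

theorem corollary2p3:
  fixes M :: "'h::chilbert_space bop set"
    and \<tau> :: "'h bop \<Rightarrow> ennreal"
    and \<psi> :: "real \<Rightarrow> ennreal"
    and T :: "'h \<Rightarrow> (real \<Rightarrow> complex) \<Rightarrow> 'k::chilbert_space"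
    and \<tau>\<^sub>A :: "'k bop \<Rightarrow> ennreal"
    and a :: "'h uop"
  assumes "von_neumann_algebra M"
    and "fns_trace M \<tau>"
    and "orlicz_function \<psi>"
    and "tensor_with_L2 T"
    and "tensor_trace T M \<tau> \<tau>\<^sub>A"
    and "closed_densely_defined a"
    and "affiliated M a"
  shows "(a \<in> orlicz_space M \<tau> \<psi> \<longleftrightarrow>
           tensor_uop T a (\<lambda>t. fundamental_fun \<psi> (exp t)) \<in> measurable_ops (tensor_Linf T M) \<tau>\<^sub>A) \<and>
         (\<forall>b \<in> orlicz_space M \<tau> \<psi>.
           luxemburg_norm M \<tau> \<psi> b =
             sing_val \<tau>\<^sub>A 1 (tensor_uop T b (\<lambda>t. fundamental_fun \<psi> (exp t))))"
proof -
  interpret orlicz \<psi> by standard (rule assms(3))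
  \<comment> \<open>The norm formula ranges over all b in the space, so the locale is instantiated
    for an arbitrary operator.\<close>
  have loc: "tensor_orlicz \<psi> T M b \<tau> \<tau>\<^sub>A" if "closed_densely_defined b" "affiliated M b" for b
    by unfold_locales (use assms that fund(2) fund_borel in auto)
  show ?thesis
  proof (intro conjI ballI)
    interpret tensor_orlicz \<psi> T M a \<tau> \<tau>\<^sub>A by (rule loc[OF assms(6,7)])
    show "a \<in> orlicz_space M \<tau> \<psi> \<longleftrightarrow>
        tensor_uop T a (\<lambda>t. fundamental_fun \<psi> (exp t)) \<in> measurable_ops (tensor_Linf T M) \<tau>\<^sub>A"
      using orlicz_space_iff unfolding W_def .
  next
    fix b assume "b \<in> orlicz_space M \<tau> \<psi>"
    then have "closed_densely_defined b" "affiliated M b" by (auto simp: orlicz_space_def measurable_ops_def)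
    then interpret tensor_orlicz \<psi> T M b \<tau> \<tau>\<^sub>A by (rule loc)
    show "luxemburg_norm M \<tau> \<psi> b = sing_val \<tau>\<^sub>A 1 (tensor_uop T b (\<lambda>t. fundamental_fun \<psi> (exp t)))"
      using luxemburg_eq unfolding W_def .
  qed
qed

end
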